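(* Let $f$ be a real-valued trigonometric polynomial on $\mathbb T^2$ and fix $k>1$. For $N=p^k$ let $\{\psi_j\}_{j=1}^N$ be an orthonormal basis of $\mathcal H_N$ consisting of Hecke eigenfunctions and put $F_j^{(N)}=\sqrt N\left(\langle\operatorname{Op}_N(f)\psi_j,\psi_j\rangle-\int_{\mathbb T^2}f\,dx\right)$. Then as $p\to\infty$ through primes, the points $F_j^{(p^k)}$ have a limiting distribution, namely that of the random variable \[Y_f=2\sum_{\nu\neq0}f^\#(\nu)\cos(\theta_\nu),\] where the $\theta_\nu$ are independently chosen from $[0,\pi)$ with respect to the probability measure $\mu(h)=\frac12 h(\frac\pi2)+\frac1{2\pi}\int_0^\pi h(\theta)\,d\theta$.
   Context: Let $A\in \mathrm{SL}(2,\mathbb Z)$ be hyperbolic, $\alpha$ an eigenvalue of $A$, $\mathfrak O=\mathbb Z[\alpha]$, $\iota:\mathfrak O\to\mathrm{Mat}(2,\mathbb Z)$, $n+m\alpha\mapsto nI+mA$; $C(N)$ is the kernel of the map $(\mathfrak O/N\mathfrak O)^*\to(\mathbb Z/N\mathbb Z)^*$ induced by the norm. $\mathcal H_N=L^2(\mathbb Z/N\mathbb Z)$ with $\langle\phi,\psi\rangle=\frac1N\sum_y\phi(y)\overline{\psi(y)}$; with $e_N(x)=e^{2\pi ix/N}$, $T_N(n)\psi(y)=e_{2N}(n_1n_2)e_N(n_2y)\psi(y+n_1)$, $\operatorname{Op}_N(f)=\sum_n\hat f(n)T_N(n)$. For odd $N$, $U_N$ is the quantum-propagator (Weil) unitary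 representation of $\mathrm{SL}(2,\mathbb Z/N\mathbb Z)$ on $\mathcal H_N$ (Hannay–Berry/Kurlberg–Rudnick quantization); Hecke eigenfunctions are joint eigenfunctions of $U_N(A)$ and all $U_N(\iota(\beta))$, $\beta\in C(N)$. With $\omega(n,m)=n_1m_2-n_2m_1$ and $Q(n)=\omega(nA,n)$, the twisted Fourier coefficients are $f^\#(\nu)=\sum_{Q(n)=\nu}(-1)^{n_1n_2}\hat f(n)$. Points $\{F_j^{(N)}\}_{j=1}^N$ have limiting distribution $Y$ if for every interval $[a,b]$, $\frac1N\#\{j: a\le F_j^{(N)}\le b\}\to\mathrm{Prob}(Y\in[a,b])$. *)

theory Defs
  imports "HOL-Probability.Probability" "HOL-Number_Theory.Cong"
begin

text \<open>
  A frequency \<open>n \<in> \<int>\<^sup>2\<close> is a row vector of type \<^typ>\<open>int ^ 2\<close>, so that \<open>nA\<close> is \<open>n v* A\<close>.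
  A function on \<open>\<int>/N\<int>\<close> is an \<open>N\<close>-periodic function on \<^typ>\<open>int\<close>.
\<close>

definition e_N :: "nat \<Rightarrow> int \<Rightarrow> complex" where
  "e_N N x = cis (2 * pi * real_of_int x / real N)"

definition H_N :: "nat \<Rightarrow> (int \<Rightarrow> complex) set" where
  "H_N N = {\<psi>. \<forall>y. \<psi> (y + int N) = \<psi> y}"

definition ip :: "nat \<Rightarrow> (int \<Rightarrow> complex) \<Rightarrow> (int \<Rightarrow> complex) \<Rightarrow> complex" where
  "ip N \<phi> \<psi> = (\<Sum>y\<in>{0..<int N}. \<phi> y * cnj (\<psi> y)) / of_nat N"

definition T_N :: "nat \<Rightarrow> int ^ 2 \<Rightarrow> (int \<Rightarrow> complex) \<Rightarrow> (int \<Rightarrow> complex)" where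
  "T_N N n \<psi> = (\<lambda>y. e_N (2 * N) (n $ 1 * n $ 2) * e_N N (n $ 2 * y) * \<psi> (y + n $ 1))"

definition torus_char :: "int ^ 2 \<Rightarrow> real ^ 2 \<Rightarrow> complex" where
  "torus_char n x = cis (2 * pi * (\<Sum>i\<in>UNIV. real_of_int (n $ i) * x $ i))"

text \<open>The unit square \<open>cbox 0 1\<close> is a fundamental domain of the torus.\<close>

definition trig_polynomial :: "(real ^ 2 \<Rightarrow> real) \<Rightarrow> bool" where
  "trig_polynomial f \<longleftrightarrow>
     (\<exists>c :: int ^ 2 \<Rightarrow> complex. finite {n. c n \<noteq> 0} \<and>
        (\<forall>x. complex_of_real (f x) = (\<Sum>n | c n \<noteq> 0. c n * torus_char n x)))"

definition fourier_coeff :: "(real ^ 2 \<Rightarrow> real) \<Rightarrow> int ^ 2 \<Rightarrow> complex" where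
  "fourier_coeff f n = integral (cbox 0 1) (\<lambda>x. complex_of_real (f x) * torus_char (- n) x)"

text \<open>For trigonometric polynomials the sums over the support of the Fourier transform are finite.\<close>

definition Op_N :: "nat \<Rightarrow> (real ^ 2 \<Rightarrow> real) \<Rightarrow> (int \<Rightarrow> complex) \<Rightarrow> (int \<Rightarrow> complex)" where
  "Op_N N f \<psi> = (\<lambda>y. \<Sum>n | fourier_coeff f n \<noteq> 0. fourier_coeff f n * T_N N n \<psi> y)"

definition unitary_on_H :: "nat \<Rightarrow> ((int \<Rightarrow> complex) \<Rightarrow> (int \<Rightarrow> complex)) \<Rightarrow> bool" where
  "unitary_on_H N V \<longleftrightarrow>
     V ` H_N N = H_N N \<and>
     (\<forall>\<phi>\<in>H_N N. \<forall>\<psi>\<in>H_N N. V (\<lambda>y. \<phi> y + \<psi> y) = (\<lambda>y. V \<phi> y + V \<psi> y)) \<and>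
     (\<forall>c. \<forall>\<psi>\<in>H_N N. V (\<lambda>y. c * \<psi> y) = (\<lambda>y. c * V \<psi> y)) \<and>
     (\<forall>\<phi>\<in>H_N N. \<forall>\<psi>\<in>H_N N. ip N (V \<phi>) (V \<psi>) = ip N \<phi> \<psi>)"

text \<open>Integer matrices representing elements of \<open>SL(2, \<int>/N\<int>)\<close>, and equality in that group.\<close>

definition SL2_mod :: "nat \<Rightarrow> (int ^ 2 ^ 2) set" where
  "SL2_mod N = {g. [det g = 1] (mod int N)}"

definition mat_cong :: "nat \<Rightarrow> int ^ 2 ^ 2 \<Rightarrow> int ^ 2 ^ 2 \<Rightarrow> bool" where
  "mat_cong N g h \<longleftrightarrow> (\<forall>i j. [g $ i $ j = h $ i $ j] (mod int N))"

text \<open>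
  For odd \<open>N\<close> the operator \<open>(-1)\<^bsup>n\<^sub>1n\<^sub>2\<^esup> T\<^sub>N(n)\<close> depends only on \<open>n\<close> modulo \<open>N\<close>.
\<close>

definition twisted_T :: "nat \<Rightarrow> int ^ 2 \<Rightarrow> (int \<Rightarrow> complex) \<Rightarrow> (int \<Rightarrow> complex)" where
  "twisted_T N n \<psi> = (\<lambda>y. (- 1) powi (n $ 1 * n $ 2) * T_N N n \<psi> y)"

text \<open>
  The quantum propagator is the unitary representation \<open>U\<close> of \<open>SL(2, \<int>/N\<int>)\<close> on \<open>H_N N\<close> with the
  exact Egorov property \<open>U(g)\<inverse> T(n) U(g) = T(ng)\<close> for the operators \<open>T(n) =\<close> \<^term>\<open>twisted_T N n\<close>.
  If \<open>g \<in> SL(2,\<int>)\<close> and \<open>g \<equiv> I (mod 2)\<close>, then the signs at \<open>n\<close> and \<open>ng\<close> agree, and this says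
  \<open>U(g)\<inverse> Op\<^sub>N(f) U(g) = Op\<^sub>N(f \<circ> g)\<close>. By irreducibility of the \<open>T(n)\<close>, the property determines each
  \<open>U(g)\<close> up to a phase, so that \<open>U\<close> is unique up to a character of \<open>SL(2, \<int>/N\<int>)\<close> and the
  eigenvectors of each \<open>U(g)\<close> do not depend on the choice.
\<close>

definition quantum_propagator ::
    "nat \<Rightarrow> (int ^ 2 ^ 2 \<Rightarrow> (int \<Rightarrow> complex) \<Rightarrow> (int \<Rightarrow> complex)) \<Rightarrow> bool" where
  "quantum_propagator N U \<longleftrightarrow>
     (\<forall>g\<in>SL2_mod N. unitary_on_H N (U g)) \<and>
     (\<forall>g\<in>SL2_mod N. \<forall>h\<in>SL2_mod N. mat_cong N g h \<longrightarrow> (\<forall>\<psi>\<in>H_N N. U g \<psi> = U h \<psi>)) \<and>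
     (\<forall>g\<in>SL2_mod N. \<forall>h\<in>SL2_mod N. \<forall>\<psi>\<in>H_N N. U (g ** h) \<psi> = U g (U h \<psi>)) \<and>
     (\<forall>g\<in>SL2_mod N. \<forall>n. \<forall>\<psi>\<in>H_N N. twisted_T N n (U g \<psi>) = U g (twisted_T N (n v* g) \<psi>))"

definition hyperbolic :: "int ^ 2 ^ 2 \<Rightarrow> bool" where
  "hyperbolic A \<longleftrightarrow> \<bar>trace A\<bar> > 2"

definition eigenvalue_of :: "int ^ 2 ^ 2 \<Rightarrow> real \<Rightarrow> bool" where
  "eigenvalue_of A \<alpha> \<longleftrightarrow> (\<exists>v. v \<noteq> 0 \<and> map_matrix real_of_int A *v v = \<alpha> *\<^sub>R v)"

text \<open>
  The order \<open>\<int>[\<alpha>]\<close>. For an eigenvalue \<open>\<alpha>\<close> of a hyperbolic \<open>A \<in> SL(2,\<int>)\<close>, the numbers \<open>1\<close>, \<open>\<alpha>\<close>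
  form a \<open>\<int>\<close>-basis of it, which makes the definite descriptions below meaningful; the algebraic
  conjugate of \<open>\<alpha>\<close> is the other eigenvalue, \<open>1/\<alpha>\<close>.
\<close>

definition order_ring :: "real \<Rightarrow> real set" where
  "order_ring \<alpha> = {real_of_int n + real_of_int m * \<alpha> | n m. True}"

definition iota :: "int ^ 2 ^ 2 \<Rightarrow> real \<Rightarrow> real \<Rightarrow> int ^ 2 ^ 2" where
  "iota A \<alpha> \<beta> =
     (THE B. \<exists>n m. \<beta> = real_of_int n + real_of_int m * \<alpha> \<and> B = mat n + mat m ** A)"

definition order_conj :: "real \<Rightarrow> real \<Rightarrow> real" where
  "order_conj \<alpha> \<beta> =
     (THE \<gamma>. \<exists>n m. \<beta> = real_of_int n + real_of_int m * \<alpha> \<and>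
                     \<gamma> = real_of_int n + real_of_int m * (1 / \<alpha>))"

definition order_norm :: "real \<Rightarrow> real \<Rightarrow> int" where
  "order_norm \<alpha> \<beta> = (THE z. real_of_int z = \<beta> * order_conj \<alpha> \<beta>)"

definition order_cong :: "real \<Rightarrow> nat \<Rightarrow> real \<Rightarrow> real \<Rightarrow> bool" where
  "order_cong \<alpha> N \<beta> \<gamma> \<longleftrightarrow> (\<exists>\<delta>\<in>order_ring \<alpha>. \<beta> - \<gamma> = real N * \<delta>)"

text \<open>
  The elements of \<open>\<int>[\<alpha>]\<close> whose classes modulo \<open>N\<close> are units in the kernel of the norm map
  to \<open>(\<int>/N\<int>)\<^sup>*\<close>.
\<close>

definition C_N :: "real \<Rightarrow> nat \<Rightarrow> real set" where
  "C_N \<alpha> N = {\<beta> \<in> order_ring \<alpha>.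
      (\<exists>\<gamma>\<in>order_ring \<alpha>. order_cong \<alpha> N (\<beta> * \<gamma>) 1) \<and> [order_norm \<alpha> \<beta> = 1] (mod int N)}"

definition eigenfunction ::
    "nat \<Rightarrow> ((int \<Rightarrow> complex) \<Rightarrow> (int \<Rightarrow> complex)) \<Rightarrow> (int \<Rightarrow> complex) \<Rightarrow> bool" where
  "eigenfunction N V \<psi> \<longleftrightarrow> \<psi> \<in> H_N N \<and> \<psi> \<noteq> (\<lambda>_. 0) \<and> (\<exists>c. V \<psi> = (\<lambda>y. c * \<psi> y))"

definition hecke_eigenfunction ::
    "int ^ 2 ^ 2 \<Rightarrow> real \<Rightarrow> nat \<Rightarrow> (int ^ 2 ^ 2 \<Rightarrow> (int \<Rightarrow> complex) \<Rightarrow> (int \<Rightarrow> complex))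
      \<Rightarrow> (int \<Rightarrow> complex) \<Rightarrow> bool" where
  "hecke_eigenfunction A \<alpha> N U \<psi> \<longleftrightarrow>
     eigenfunction N (U A) \<psi> \<and> (\<forall>\<beta>\<in>C_N \<alpha> N. eigenfunction N (U (iota A \<alpha> \<beta>)) \<psi>)"

definition orthonormal_basis_H :: "nat \<Rightarrow> (nat \<Rightarrow> int \<Rightarrow> complex) \<Rightarrow> bool" where
  "orthonormal_basis_H N \<psi> \<longleftrightarrow>
     (\<forall>j\<in>{1..N}. \<psi> j \<in> H_N N) \<and>
     (\<forall>i\<in>{1..N}. \<forall>j\<in>{1..N}. ip N (\<psi> i) (\<psi> j) = (if i = j then 1 else 0)) \<and>
     (\<forall>\<phi>\<in>H_N N. \<exists>c. \<phi> = (\<lambda>y. \<Sum>j\<in>{1..N}. c j * \<psi> j y))"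

text \<open>The matrix element is real for real \<open>f\<close>, so \<^const>\<open>Re\<close> only changes the type.\<close>

definition F_N :: "nat \<Rightarrow> (real ^ 2 \<Rightarrow> real) \<Rightarrow> (int \<Rightarrow> complex) \<Rightarrow> real" where
  "F_N N f \<psi> = sqrt (real N) * (Re (ip N (Op_N N f \<psi>) \<psi>) - integral (cbox 0 1) f)"

definition symp :: "int ^ 2 \<Rightarrow> int ^ 2 \<Rightarrow> int" where
  "symp n m = n $ 1 * m $ 2 - n $ 2 * m $ 1"

definition Q_form :: "int ^ 2 ^ 2 \<Rightarrow> int ^ 2 \<Rightarrow> int" where
  "Q_form A n = symp (n v* A) n"

text \<open>
  These are real for real \<open>f\<close>, because \<open>Q(-n) = Q(n)\<close> and the Fourier coefficients at \<open>\<plusminus>n\<close> are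
  complex conjugates.
\<close>

definition twisted_coeff :: "int ^ 2 ^ 2 \<Rightarrow> (real ^ 2 \<Rightarrow> real) \<Rightarrow> int \<Rightarrow> complex" where
  "twisted_coeff A f \<nu> =
     (\<Sum>n | fourier_coeff f n \<noteq> 0 \<and> Q_form A n = \<nu>. (- 1) powi (n $ 1 * n $ 2) * fourier_coeff f n)"

definition has_limiting_distribution ::
    "'i filter \<Rightarrow> ('i \<Rightarrow> nat) \<Rightarrow> ('i \<Rightarrow> nat \<Rightarrow> real) \<Rightarrow> 'w measure \<Rightarrow> ('w \<Rightarrow> real) \<Rightarrow> bool" where
  "has_limiting_distribution L N F M Y \<longleftrightarrow>
     (\<forall>a b. ((\<lambda>i. real (card {j \<in> {1..N i}. a \<le> F i j \<and> F i j \<le> b}) / real (N i))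
               \<longlongrightarrow> measure M {w \<in> space M. a \<le> Y w \<and> Y w \<le> b}) L)"

text \<open>
  The probability measure \<open>h \<mapsto> h(\<pi>/2)/2 + (1/2\<pi>) \<integral>\<^sub>0\<^sup>\<pi> h\<close>, given by its values on indicators \<open>h\<close>.
\<close>

definition angle_measure :: "real measure" where
  "angle_measure = measure_of UNIV (sets borel)
     (\<lambda>S. ennreal (1 / 2) * indicator S (pi / 2)
          + ennreal (1 / (2 * pi)) * emeasure lborel (S \<inter> {0..<pi}))"

lemma space_angle_measure [simp]: "space angle_measure = UNIV"
  and sets_angle_measure [simp, measurable_cong]: "sets angle_measure = sets borel"
proof -
  have eq: "sigma_sets UNIV (sets borel) = sets (borel :: real measure)"
    using sets.sigma_sets_eq[of "borel :: real measure"] by simp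
  show "space angle_measure = UNIV"
    by (simp add: angle_measure_def space_measure_of_conv)
  show "sets angle_measure = sets borel"
    by (simp add: angle_measure_def sets_measure_of_conv eq)
qed

lemma emeasure_angle_measure:
  assumes "S \<in> sets borel"
  shows "emeasure angle_measure S =
     ennreal (1 / 2) * indicator S (pi / 2)
     + ennreal (1 / (2 * pi)) * emeasure lborel (S \<inter> {0..<pi})" (is "_ = ?m S")
  unfolding angle_measure_def
proof (rule emeasure_measure_of_sigma[OF _ _ _ assms])
  show "sigma_algebra (UNIV :: real set) (sets borel)"
    using sets.sigma_algebra_axioms[of "borel :: real measure"] by simp
  show "positive (sets borel) ?m"
    by (simp add: positive_def)
  show "countably_additive (sets borel) ?m"
    unfolding countably_additive_def
  proof (intro allI impI)
    fix B :: "nat \<Rightarrow> real set"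
    assume B: "range B \<subseteq> sets borel" "disjoint_family B"
    have 1: "(\<Sum>i. indicator (B i) (pi / 2) :: ennreal) = indicator (\<Union>i. B i) (pi / 2)"
      using B(2) by (rule suminf_indicator)
    have 2: "(\<Sum>i. emeasure lborel (B i \<inter> {0..<pi})) = emeasure lborel (\<Union>i. B i \<inter> {0..<pi})"
      using B by (intro suminf_emeasure) (auto simp: disjoint_family_on_def)
    show "(\<Sum>i. ?m (B i)) = ?m (\<Union>i. B i)"
      using 1 2 by (simp add: suminf_add[symmetric] ennreal_suminf_cmult)
  qed
qed

lemma prob_space_angle_measure: "prob_space angle_measure"
proof
  have "ennreal (1 / (2 * pi)) * ennreal pi = ennreal (1 / 2)"
    by (subst ennreal_mult[symmetric]) auto
  then show "emeasure angle_measure (space angle_measure) = 1"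
    using ennreal_plus[of "1 / 2" "1 / 2"]
    by (simp add: emeasure_angle_measure del: ennreal_half ennreal_plus)
qed

end

theory Submission
 imports Defs "HOL-Number_Theory.Number_Theory" "HOL-Computational_Algebra.Polynomial_Factorial"
begin

text \<open>
 Write \<open>N = p\<^sup>k\<close> with \<open>k = 2l + e\<close>, \<open>e \<le> 1\<close>. If \<open>Q(x)\<close> is prime to \<open>p\<close>, the lattice \<open>Lat x\<close> spanned by
 \<open>p\<^bsup>l+e\<^esup>\<int>\<^sup>2\<close> and \<open>p\<^sup>l\<close> times the tangent \<open>dl A x\<close> of the conic \<open>Q = Q(x)\<close> is its own symplectic dual modulo \<open>N\<close>,
 so the operators \<open>T(n)\<close>, \<open>n \<in> Lat x\<close>, have an essentially unique joint eigenvector with the eigenvalues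
 prescribed by \<open>x\<close>, and the Hecke operators permute these vectors up to phases. Consequently all but a fraction
 \<open>O(1/p)\<close> of the Hecke eigenfunctions have a type \<open>t\<close>: they are spread evenly over the conic \<open>Q = t\<close>. The
 matrix element of \<open>T(n)\<close>, \<open>Q(n) = \<nu>\<close>, is then a sum over the points of the conic which the shift by \<open>n\<close>
 keeps on it. These come from the square roots of \<open>disc A \<cdot> \<nu>(\<nu> - 4t)\<close>: if there are none, the matrix element
 vanishes; otherwise, up to the normalisation, it is \<open>2 Re w\<close>, where \<open>w\<close> is a phase times the eigenvalue of a Hecke
 element \<open>h\<^sub>\<nu>(t)\<close>.

 The distribution is computed by moments. Stepanov's method shows that the quadratic characters of
 \<open>disc A \<cdot> \<nu>(\<nu> - 4t)\<close> are jointly equidistributed in \<open>t\<close>, which gives the independent events of probability \<open>1/2\<close>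
 in the limit. For fixed \<open>t\<close>, averaging over the eigenfunctions of type \<open>t\<close> kills a monomial in the \<open>w\<^sub>\<nu>\<close> unless the
 corresponding product of the \<open>h\<^sub>\<nu>(t)\<close> is \<open>1\<close> modulo \<open>p\<close>. The \<open>h\<^sub>\<nu>\<close> ramify at the different points \<open>t = \<nu>/4\<close>, so they are
 multiplicatively independent and this happens only for the zeros \<open>t\<close> modulo \<open>p\<close> of a fixed polynomial.
\<close>

hide_const (open) Module.smult up_ring.coeff up_ring.monom

section \<open>The operators T(n)\<close>

text \<open>The exponent \<open>k > 1\<close> gives \<open>l > 0\<close>, which leaves room for a
  self-dual lattice between \<open>p^(l+e) Z^2\<close> and \<open>p^l Z^2\<close> that varies with
  the point. Irreducibility of the operators \<open>T(n)\<close> enters only through an explicit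
  tight frame identity: vectors are identified by their overlaps with the translates of one state.
  Odd \<open>k\<close> is the obstacle in the arithmetic part. A state is located modulo
  \<open>p^l\<close>, its level is defined modulo \<open>p^(l+e)\<close>, and the translate of one
  state meets another only with size \<open>p^(-e/2)\<close>. This loss is balanced by
  \<open>sqrt N = p^l * p^(e/2)\<close>, so that the normalised matrix element is
  \<open>2 Re w\<close> times \<open>p^l\<close> over the number of points of the conic, a factor
  tending to 1. The square roots attached to different \<open>\<nu>\<close> live in residue rings
  that change with \<open>p\<close>. Elimination over the integers produces one polynomial for all
  primes, and only its being nonzero is checked over the complex numbers. The limit law has an atom
  at 0, where convergence of moments says nothing about an interval ending at 0. The missing mass is
  counted directly, from the types for which all the characters are -1.\<close>

lemma e_N_add: "e_N N (x + y) = e_N N x * e_N N y"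
 by (simp add: e_N_def cis_mult algebra_simps add_divide_distrib)

lemma e_N_0 [simp]: "e_N N 0 = 1"
 by (simp add: e_N_def)

lemma cnj_e_N [simp]: "cnj (e_N N x) = e_N N (- x)"
 by (simp add: e_N_def cis_cnj)

lemma norm_e_N [simp]: "norm (e_N N x) = 1"
 by (simp add: e_N_def)

lemma e_N_minus_mult [simp]: "e_N N (- x) * e_N N x = 1" "e_N N x * e_N N (- x) = 1"
 by (simp_all flip: e_N_add)

lemma e_N_eq_1_iff:
 assumes "N > 0"
 shows "e_N N x = 1 \<longleftrightarrow> int N dvd x"
proof -
 have "e_N N x = 1 \<longleftrightarrow> (\<exists>m::int. 2 * pi * real_of_int x / real N = 2 * pi * m)"
  by (simp add: e_N_def cis_conv_exp exp_eq_1 mult_ac)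
 also have "\<dots> \<longleftrightarrow> (\<exists>m::int. real_of_int x = real_of_int (int N * m))"
  using assms by (simp add: field_simps)
 also have "\<dots> \<longleftrightarrow> int N dvd x"
  by (simp only: of_int_eq_iff dvd_def)
 finally show ?thesis .
qed

lemma e_N_cong:
 assumes "N > 0" "int N dvd x - y"
 shows "e_N N x = e_N N y"
 using e_N_add[of N "x - y" y] assms e_N_eq_1_iff[of N "x - y"] by simp

lemma e_N_eqD:
 assumes "N > 0" "e_N N x = e_N N y"
 shows "int N dvd x - y"
proof -
 have "e_N N (x - y) = e_N N x * e_N N (- y)"
  using e_N_add[of N x "- y"] by simp
 also have "\<dots> = 1" by (simp add: assms(2))
 finally show ?thesis using e_N_eq_1_iff[OF assms(1)] by simp
qed

lemma e_N_mult_nat: "e_N N (x * int j) = e_N N x ^ j"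
 by (induction j) (simp_all add: algebra_simps e_N_add)

lemma sum_int_nat: "(\<Sum>y\<in>{0..<int N}. f y) = (\<Sum>j<N. f (int j))"
proof -
 have "{0..<int N} = int ` {..<N}"
  by (simp add: image_int_atLeastLessThan lessThan_atLeast0)
 thus ?thesis
  by (simp add: sum.reindex)
qed

lemma sum_e_N:
 assumes "N > 0"
 shows "(\<Sum>y\<in>{0..<int N}. e_N N (x * y)) = (if int N dvd x then of_nat N else 0)"
proof (cases "int N dvd x")
 case True
 hence "e_N N (x * y) = 1" for y
  using assms by (simp add: e_N_eq_1_iff)
 with True show ?thesis by simp
next
 case False
 hence "e_N N x \<noteq> 1"
  using assms by (simp add: e_N_eq_1_iff)
 moreover have "e_N N x ^ N = 1"
  using assms by (simp flip: e_N_mult_nat add: e_N_eq_1_iff)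
 ultimately show ?thesis
  using False by (simp add: sum_int_nat e_N_mult_nat sum_gp_strict)
qed

lemma periodic_mod:
 fixes g :: "int \<Rightarrow> 'a"
 assumes "\<And>y. g (y + M) = g y"
 shows "g (y + M * q) = g y" "g (y mod M) = g y"
proof -
 show *: "g (y + M * q) = g y" for y q
 proof (induction q arbitrary: y rule: int_induct[where k = 0])
  case (step1 i)
  thus ?case using assms[of "y + M * i"] by (simp add: algebra_simps)
 next
  case (step2 i)
  thus ?case using assms[of "y + M * (i - 1)"] by (simp add: algebra_simps)
 qed simp
 show "g (y mod M) = g y"
  using *[of "y mod M" "y div M"] by (simp add: mult.commute)
qed

lemma sum_periodic_shift:
 fixes g :: "int \<Rightarrow> 'a::comm_monoid_add"
 assumes "M > 0" "\<And>y. g (y + M) = g y"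
 shows "(\<Sum>y\<in>{0..<M}. g (y + m)) = (\<Sum>y\<in>{0..<M}. g y)"
proof (rule sum.reindex_bij_witness[where i = "\<lambda>y. (y - m) mod M" and j = "\<lambda>y. (y + m) mod M"])
 fix a assume "a \<in> {0..<M}"
 thus "((a + m) mod M - m) mod M = a" "((a - m) mod M + m) mod M = a"
  by (simp_all add: mod_diff_left_eq mod_add_left_eq)
 show "g ((a + m) mod M) = g (a + m)"
  using periodic_mod(2)[of g M] assms(2) by blast
qed (use assms in auto)

section \<open>Functions modulo N and their inner product\<close>

definition scl :: "complex \<Rightarrow> (int \<Rightarrow> complex) \<Rightarrow> int \<Rightarrow> complex" where
 "scl c \<phi> = (\<lambda>y. c * \<phi> y)"

lemma scl_scl [simp]: "scl a (scl b \<phi>) = scl (a * b) \<phi>"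
 by (simp add: scl_def mult.assoc)

lemma scl_1 [simp]: "scl 1 \<phi> = \<phi>"
 by (simp add: scl_def)

lemma H_N_scl: "\<phi> \<in> H_N N \<Longrightarrow> scl c \<phi> \<in> H_N N"
 by (simp add: H_N_def scl_def)

lemma H_N_sum: "(\<And>i. i \<in> I \<Longrightarrow> \<phi> i \<in> H_N N) \<Longrightarrow> (\<lambda>y. \<Sum>i\<in>I. c i * \<phi> i y) \<in> H_N N"
 by (simp add: H_N_def)

lemma H_N_diff: "\<phi> \<in> H_N N \<Longrightarrow> \<psi> \<in> H_N N \<Longrightarrow> (\<lambda>y. \<phi> y - \<psi> y) \<in> H_N N"
 by (simp add: H_N_def)

lemma cnj_ip: "cnj (ip N \<phi> \<psi>) = ip N \<psi> \<phi>"
 by (simp add: ip_def mult.commute)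

lemma ip_0_commute: "ip N \<phi> \<psi> = 0 \<longleftrightarrow> ip N \<psi> \<phi> = 0"
 by (metis cnj_ip complex_cnj_zero_iff)

lemma ip_scl_left [simp]: "ip N (scl c \<phi>) \<psi> = c * ip N \<phi> \<psi>"
 by (simp add: ip_def scl_def sum_distrib_left mult.assoc)

lemma ip_scl_right [simp]: "ip N \<phi> (scl c \<psi>) = cnj c * ip N \<phi> \<psi>"
 by (simp add: ip_def scl_def sum_distrib_left mult_ac)

lemma ip_sum_left: "ip N (\<lambda>y. \<Sum>i\<in>I. c i * \<phi> i y) \<psi> = (\<Sum>i\<in>I. c i * ip N (\<phi> i) \<psi>)"
 unfolding ip_def sum_divide_distrib sum_distrib_right sum_distrib_left times_divide_eq_right
 by (subst sum.swap) (simp add: mult.assoc)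

lemma ip_sum_right: "ip N \<phi> (\<lambda>y. \<Sum>i\<in>I. c i * \<psi> i y) = (\<Sum>i\<in>I. cnj (c i) * ip N \<phi> (\<psi> i))"
proof -
 have "ip N \<phi> (\<lambda>y. \<Sum>i\<in>I. c i * \<psi> i y) = cnj (ip N (\<lambda>y. \<Sum>i\<in>I. c i * \<psi> i y) \<phi>)"
  by (simp add: cnj_ip)
 thus ?thesis by (simp add: ip_sum_left cnj_ip)
qed

lemma ip_diff_left: "ip N (\<lambda>y. \<phi> y - \<eta> y) \<psi> = ip N \<phi> \<psi> - ip N \<eta> \<psi>"
 by (simp add: ip_def sum_subtractf diff_divide_distrib left_diff_distrib)

lemma ip_self: "ip N \<phi> \<phi> = of_real ((\<Sum>y\<in>{0..<int N}. (norm (\<phi> y))\<^sup>2) / N)"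
 by (simp add: ip_def complex_norm_square[symmetric])

lemma ip_self_eq_0:
 assumes "N > 0" "\<phi> \<in> H_N N" "ip N \<phi> \<phi> = 0"
 shows "\<phi> = (\<lambda>_. 0)"
proof
 fix y
 have "(\<Sum>y\<in>{0..<int N}. (norm (\<phi> y))\<^sup>2) = 0"
  using assms(1,3) by (simp only: ip_self of_real_eq_0_iff divide_eq_0_iff) auto
 hence "\<forall>y\<in>{0..<int N}. (norm (\<phi> y))\<^sup>2 = 0"
  by (subst (asm) sum_nonneg_eq_0_iff) auto
 moreover have "y mod int N \<in> {0..<int N}" using assms(1) by simp
 ultimately have "\<phi> (y mod int N) = 0" by fastforce
 thus "\<phi> y = 0"
  using periodic_mod(2)[of \<phi> "int N"] assms(2) by (simp add: H_N_def)
qed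

lemma exists_normalised:
 assumes "N > 0" "w \<in> H_N N" "w \<noteq> (\<lambda>_. 0)"
 obtains c where "c \<noteq> 0" "ip N (scl c w) (scl c w) = 1"
proof -
 define s where "s = (\<Sum>y\<in>{0..<int N}. (norm (w y))\<^sup>2) / N"
 have s: "ip N w w = of_real s" by (simp add: ip_self s_def)
 have "s \<noteq> 0" using ip_self_eq_0[OF assms(1,2)] assms(3) s by auto
 moreover have "s \<ge> 0" by (simp add: s_def sum_nonneg)
 ultimately have pos: "s > 0" by simp
 have "complex_of_real (1 / sqrt s) * (complex_of_real (1 / sqrt s) * complex_of_real s)
   = complex_of_real (1 / sqrt s * (1 / sqrt s * s))"
  by (simp only: of_real_mult)
 also have "1 / sqrt s * (1 / sqrt s * s) = 1" using pos by (simp add: field_simps)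
 finally have "ip N (scl (of_real (1 / sqrt s)) w) (scl (of_real (1 / sqrt s)) w) = 1"
  by (simp add: s)
 moreover have "complex_of_real (1 / sqrt s) \<noteq> 0" using pos by simp
 ultimately show ?thesis by (rule that[rotated])
qed

text \<open>For odd \<open>N\<close> this is the inverse of 2 modulo \<open>N\<close>. It turns the
  half-integral phases of \<open>T_N\<close> into \<open>N\<close>-th roots of unity.\<close>

definition half :: "nat \<Rightarrow> int" where
 "half N = (int N + 1) div 2"

lemma two_half: "odd N \<Longrightarrow> 2 * half N = int N + 1"
 by (auto elim!: oddE simp: half_def)

text \<open>The sign is \<open>cis (pi * m)\<close> for an integer \<open>m\<close>, and
  \<open>1/2 + 1/(2N) = half N / N\<close> because \<open>2 * half N = N + 1\<close>.\<close>

lemma twisted_T_eq: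
 assumes "odd N"
 shows "twisted_T N n \<psi> = (\<lambda>y. e_N N (half N * (n $ 1 * n $ 2) + n $ 2 * y) * \<psi> (y + n $ 1))"
proof -
 have N: "N > 0" using assms by (cases N) auto
 have h: "(- 1) powi m * e_N (2 * N) m = e_N N (half N * m)" for m
 proof -
  have "real_of_int (2 * half N) = real N + 1"
   using two_half[OF assms] by (metis of_int_add of_int_1 of_int_of_nat_eq)
  hence hh: "real_of_int (half N) = (real N + 1) / 2" by simp
  have "e_N N (half N * m) = cis (pi * m + 2 * pi * real_of_int m / real (2 * N))"
  proof -
   have "2 * pi * real_of_int (half N * m) / real N = pi * m + 2 * pi * real_of_int m / real (2 * N)"
    using N unfolding of_int_mult hh by (simp add: divide_simps) (simp add: algebra_simps)
   thus ?thesis by (simp only: e_N_def)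
  qed
  also have "\<dots> = cis (pi * m) * e_N (2 * N) m"
   by (simp add: e_N_def cis_mult)
  also have "cis (pi * m) = (- 1) powi m"
   using cis_power_int[of pi m] by (simp add: mult.commute)
  finally show ?thesis by simp
 qed
 show ?thesis
  by (simp add: twisted_T_def T_N_def e_N_add mult.assoc flip: h)
qed

section \<open>The symplectic form and congruences of integer vectors\<close>

lemma symp_simps:
 "symp (a + b) c = symp a c + symp b c" "symp a (b + c) = symp a b + symp a c"
 "symp (- a) b = - symp a b" "symp a (- b) = - symp a b" "symp a a = 0"
 "symp 0 a = 0" "symp a 0 = 0" "symp (a - b) c = symp a c - symp b c"
 "symp a (b - c) = symp a b - symp a c"
 by (simp_all add: symp_def algebra_simps)

lemma symp_flip: "symp a b = - symp b a"
 by (simp add: symp_def)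

definition vc :: "int \<Rightarrow> int ^ 2 \<Rightarrow> int ^ 2 \<Rightarrow> bool" where
 "vc m a b \<longleftrightarrow> m dvd a $ 1 - b $ 1 \<and> m dvd a $ 2 - b $ 2"

lemma vec2_eqI: "a $ 1 = b $ 1 \<Longrightarrow> a $ 2 = b $ 2 \<Longrightarrow> a = (b :: 'a ^ 2)"
 by (simp add: vec_eq_iff forall_2)

lemma vc_refl [simp]: "vc m a a"
 by (simp add: vc_def)

lemma vc_sym: "vc m a b \<Longrightarrow> vc m b a"
 by (simp add: vc_def dvd_diff_commute)

lemma vc_trans: "vc m a b \<Longrightarrow> vc m b c \<Longrightarrow> vc m a c"
 unfolding vc_def using dvd_add[of m "a $ 1 - b $ 1" "b $ 1 - c $ 1"]
  dvd_add[of m "a $ 2 - b $ 2" "b $ 2 - c $ 2"] by simp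

lemma vc_add: "vc m a b \<Longrightarrow> vc m c d \<Longrightarrow> vc m (a + c) (b + d)"
 unfolding vc_def by (auto simp: add_diff_add)

lemma vc_diff: "vc m a b \<Longrightarrow> vc m c d \<Longrightarrow> vc m (a - c) (b - d)"
 unfolding vc_def using dvd_diff[of m "a $ 1 - b $ 1" "c $ 1 - d $ 1"]
  dvd_diff[of m "a $ 2 - b $ 2" "c $ 2 - d $ 2"] by (simp add: algebra_simps)

lemma vc_scale: "vc m a b \<Longrightarrow> vc m (r *s a) (r *s b)"
 unfolding vc_def by (simp flip: right_diff_distrib)

lemma vc_dvd: "vc m a b \<Longrightarrow> m' dvd m \<Longrightarrow> vc m' a b"
 unfolding vc_def by (meson dvd_trans)

lemma vc_symp: "vc m a b \<Longrightarrow> vc m c d \<Longrightarrow> m dvd symp a c - symp b d"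
proof -
 assume "vc m a b" "vc m c d"
 then obtain r s t u where "a $ 1 - b $ 1 = m * r" "a $ 2 - b $ 2 = m * s"
   "c $ 1 - d $ 1 = m * t" "c $ 2 - d $ 2 = m * u"
  unfolding vc_def dvd_def by blast
 hence "a $ 1 = b $ 1 + m * r" "a $ 2 = b $ 2 + m * s" "c $ 1 = d $ 1 + m * t" "c $ 2 = d $ 2 + m * u"
  by linarith+
 hence "symp a c - symp b d = m * (r * d $ 2 + b $ 1 * u + m * r * u - s * d $ 1 - b $ 2 * t - m * s * t)"
  by (simp add: symp_def algebra_simps)
 thus ?thesis by simp
qed

lemma twisted_T_cong:
 assumes "odd N" "vc (int N) n m" "\<psi> \<in> H_N N"
 shows "twisted_T N n \<psi> = twisted_T N m \<psi>"
proof
 fix y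
 have N: "N > 0" using assms by (cases N) auto
 obtain r s where rs: "n $ 1 = m $ 1 + int N * r" "n $ 2 = m $ 2 + int N * s"
  using assms(2) unfolding vc_def dvd_def by (metis add.commute diff_add_cancel)
 have "\<psi> (y + n $ 1) = \<psi> (y + m $ 1)"
  using periodic_mod(1)[of \<psi> "int N" "y + m $ 1" r] assms(3) rs by (simp add: H_N_def algebra_simps)
 moreover have "(half N * (n $ 1 * n $ 2) + n $ 2 * y) - (half N * (m $ 1 * m $ 2) + m $ 2 * y)
   = int N * (half N * (m $ 1 * s + r * m $ 2 + int N * r * s) + s * y)"
  by (simp add: rs algebra_simps)
 hence "int N dvd (half N * (n $ 1 * n $ 2) + n $ 2 * y) - (half N * (m $ 1 * m $ 2) + m $ 2 * y)"
  by simp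
 hence "e_N N (half N * (n $ 1 * n $ 2) + n $ 2 * y) = e_N N (half N * (m $ 1 * m $ 2) + m $ 2 * y)"
  using N by (rule e_N_cong[rotated])
 ultimately show "twisted_T N n \<psi> y = twisted_T N m \<psi> y"
  by (simp add: twisted_T_eq[OF assms(1)])
qed

text \<open>The Weyl relation. The two phases differ by
  \<open>(1 - 2 * half N) * (n $ 1 * m $ 2)\<close>, a multiple of \<open>N\<close>.\<close>

lemma twisted_T_comp:
 assumes "odd N"
 shows "twisted_T N n (twisted_T N m \<psi>) = scl (e_N N (half N * symp n m)) (twisted_T N (n + m) \<psi>)"
proof
 fix y
 have N: "N > 0" using assms by (cases N) auto
 have "(half N * (n $ 1 * n $ 2) + n $ 2 * y + (half N * (m $ 1 * m $ 2) + m $ 2 * (y + n $ 1)))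
   - (half N * symp n m + (half N * ((n + m) $ 1 * (n + m) $ 2) + (n + m) $ 2 * y))
   = (1 - 2 * half N) * (n $ 1 * m $ 2)"
  by (simp add: symp_def algebra_simps)
 also have "\<dots> = int N * (- n $ 1 * m $ 2)"
  using two_half[OF assms] by simp
 finally have "e_N N (half N * (n $ 1 * n $ 2) + n $ 2 * y + (half N * (m $ 1 * m $ 2) + m $ 2 * (y + n $ 1)))
   = e_N N (half N * symp n m + (half N * ((n + m) $ 1 * (n + m) $ 2) + (n + m) $ 2 * y))"
  by (intro e_N_cong) (use N in auto)
 thus "twisted_T N n (twisted_T N m \<psi>) y = scl (e_N N (half N * symp n m)) (twisted_T N (n + m) \<psi>) y"
  unfolding twisted_T_eq[OF assms] scl_def
  by (simp add: e_N_add add.assoc mult.assoc)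
qed

lemma twisted_T_0 [simp]: "odd N \<Longrightarrow> twisted_T N 0 \<psi> = \<psi>"
 by (simp add: twisted_T_eq)

lemma twisted_T_scl: "twisted_T N n (scl c \<psi>) = scl c (twisted_T N n \<psi>)"
 by (simp add: twisted_T_def T_N_def scl_def mult_ac)

lemma twisted_T_sum:
 "twisted_T N n (\<lambda>y. \<Sum>i\<in>I. c i * \<phi> i y) = (\<lambda>y. \<Sum>i\<in>I. c i * twisted_T N n (\<phi> i) y)"
 by (simp add: twisted_T_def T_N_def sum_distrib_left sum_distrib_right mult_ac)

lemma twisted_T_H [simp]:
 assumes "odd N" "\<psi> \<in> H_N N"
 shows "twisted_T N n \<psi> \<in> H_N N"
proof -
 have N: "N > 0" using assms by (cases N) auto
 have "twisted_T N n \<psi> (y + int N) = twisted_T N n \<psi> y" for y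
 proof -
  have "\<psi> (y + int N + n $ 1) = \<psi> (y + n $ 1)"
  proof -
   have "\<And>z. \<psi> (z + int N) = \<psi> z" using assms(2) by (simp add: H_N_def)
   from this[of "y + n $ 1"] show ?thesis by (simp add: add_ac)
  qed
  moreover have "e_N N (half N * (n $ 1 * n $ 2) + n $ 2 * (y + int N)) = e_N N (half N * (n $ 1 * n $ 2) + n $ 2 * y)"
   by (rule e_N_cong[OF N]) (simp add: algebra_simps)
  ultimately show ?thesis
   by (simp add: twisted_T_eq[OF assms(1)])
 qed
 thus ?thesis by (simp add: H_N_def)
qed

lemma ip_twisted_T_adj:
 assumes "odd N" "\<phi> \<in> H_N N" "\<psi> \<in> H_N N"
 shows "ip N (twisted_T N n \<phi>) \<psi> = ip N \<phi> (twisted_T N (- n) \<psi>)"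
proof -
 have N: "int N > 0" using assms by (cases N) auto
 define g where "g = (\<lambda>y. \<phi> y * cnj (twisted_T N (- n) \<psi> y))"
 have per: "g (y + int N) = g y" for y
  using twisted_T_H[OF assms(1,3), of "- n"] assms(2) by (simp add: g_def H_N_def)
 have "(\<Sum>y\<in>{0..<int N}. twisted_T N n \<phi> y * cnj (\<psi> y)) = (\<Sum>y\<in>{0..<int N}. g (y + n $ 1))"
 proof (rule sum.cong)
  fix y
  have "e_N N (half N * (n $ 1 * n $ 2) + n $ 2 * y) = e_N N (- (half N * (n $ 1 * n $ 2) - n $ 2 * (y + n $ 1)))"
  proof (rule e_N_cong)
   have "half N * (n $ 1 * n $ 2) + n $ 2 * y + (half N * (n $ 1 * n $ 2) - n $ 2 * (y + n $ 1))
     = (2 * half N - 1) * (n $ 1 * n $ 2)"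
    by (simp add: algebra_simps)
   thus "int N dvd half N * (n $ 1 * n $ 2) + n $ 2 * y - - (half N * (n $ 1 * n $ 2) - n $ 2 * (y + n $ 1))"
    using two_half[OF assms(1)] by simp
  qed (use N in auto)
  thus "twisted_T N n \<phi> y * cnj (\<psi> y) = g (y + n $ 1)"
   by (simp add: g_def twisted_T_eq[OF assms(1)])
 qed simp
 also have "\<dots> = (\<Sum>y\<in>{0..<int N}. g y)"
  using sum_periodic_shift[of "int N" g "n $ 1"] N per by simp
 finally show ?thesis
  by (simp add: ip_def g_def)
qed

lemma ip_twisted_T_iso:
 assumes "odd N" "\<phi> \<in> H_N N" "\<psi> \<in> H_N N"
 shows "ip N (twisted_T N n \<phi>) (twisted_T N n \<psi>) = ip N \<phi> \<psi>"
 using assms by (simp add: ip_twisted_T_adj twisted_T_comp symp_simps)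

section \<open>Residue vectors modulo N and the tight frame of translates\<close>

definition grid :: "nat \<Rightarrow> (int ^ 2) set" where
 "grid N = {n. n $ 1 \<in> {0..<int N} \<and> n $ 2 \<in> {0..<int N}}"

lemma sum_grid: "(\<Sum>n\<in>grid N. g n) = (\<Sum>a\<in>{0..<int N}. \<Sum>b\<in>{0..<int N}. g (vector [a, b]))"
proof -
 have "(\<Sum>n\<in>grid N. g n) = (\<Sum>(a, b)\<in>{0..<int N} \<times> {0..<int N}. g (vector [a, b]))"
  by (rule sum.reindex_bij_witness[where i = "\<lambda>(a, b). vector [a, b]" and j = "\<lambda>n. (n $ 1, n $ 2)"])
   (auto simp: grid_def intro!: vec2_eqI arg_cong[where f = g])
 thus ?thesis by (simp add: sum.cartesian_product)
qed

lemma bij_betw_grid: "bij_betw (\<lambda>n. (n $ 1, n $ 2)) (grid N) ({0..<int N} \<times> {0..<int N})"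
 by (rule bij_betwI[where g = "\<lambda>(a, b). vector [a, b]"]) (auto simp: grid_def intro!: vec2_eqI)

lemma finite_grid [simp]: "finite (grid N)"
 using bij_betw_finite[OF bij_betw_grid] by blast

lemma card_grid: "card (grid N) = N ^ 2"
 using bij_betw_same_card[OF bij_betw_grid[of N]] by (simp add: power2_eq_square)

definition red :: "nat \<Rightarrow> int ^ 2 \<Rightarrow> int ^ 2" where
 "red N n = vector [n $ 1 mod int N, n $ 2 mod int N]"

lemma red_grid: "N > 0 \<Longrightarrow> red N n \<in> grid N"
 by (simp add: red_def grid_def)

lemma vc_red: "vc (int N) (red N n) n"
 unfolding vc_def red_def by (simp flip: mod_eq_dvd_iff)

lemma vc_grid_eq: "vc (int N) a b \<Longrightarrow> a \<in> grid N \<Longrightarrow> b \<in> grid N \<Longrightarrow> a = b"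
 by (auto simp: vc_def grid_def mod_eq_dvd_iff[symmetric] intro!: vec2_eqI)

lemma red_eq_iff: "N > 0 \<Longrightarrow> red N a = red N b \<longleftrightarrow> vc (int N) a b"
 using vc_grid_eq[of N "red N a" "red N b"] red_grid[of N] vc_red[of N] vc_sym vc_trans by metis

text \<open>The sum over the second coordinate of \<open>n\<close> is a character sum, which leaves
  only \<open>z = y mod N\<close>; the sum over the first coordinate then produces the norm of
  \<open>v\<close>. The translates of any vector thus form a tight frame, which is Schur's lemma for
  these operators in explicit form.\<close>

lemma frame_identity:
 assumes "odd N" "\<phi> \<in> H_N N" "v \<in> H_N N"
 shows "(\<lambda>y. \<Sum>n\<in>grid N. ip N \<phi> (twisted_T N n v) * twisted_T N n v y) = scl (of_nat N * ip N v v) \<phi>"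
proof
 fix y
 have N: "N > 0" using assms by (cases N) auto
 have per: "\<phi> (z mod int N) = \<phi> z" for z
  using periodic_mod(2)[of \<phi> "int N"] assms(2) by (simp add: H_N_def)
 have perv: "v (z + int N) = v z" for z
  using assms(3) by (simp add: H_N_def)
 define R where "R = {0..<int N}"
 have 1: "ip N \<phi> (twisted_T N (vector [a, b]) v) * twisted_T N (vector [a, b]) v y
   = (\<Sum>z\<in>R. \<phi> z * cnj (v (z + a)) * v (y + a) * e_N N ((y - z) * b)) / of_nat N" for a b
 proof -
  have e: "cnj (e_N N (half N * (a * b) + b * z)) * e_N N (half N * (a * b) + b * y) = e_N N ((y - z) * b)" for z
   unfolding cnj_e_N e_N_add[symmetric] by (simp add: algebra_simps)
  have *: "\<phi> z * cnj (e_N N (half N * (a * b) + b * z) * v (z + a)) * (e_N N (half N * (a * b) + b * y) * v (y + a))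
    = \<phi> z * cnj (v (z + a)) * v (y + a) * e_N N ((y - z) * b)" for z
   unfolding e[symmetric] complex_cnj_mult by (simp only: mult_ac)
  show ?thesis
   unfolding ip_def twisted_T_eq[OF assms(1)] R_def[symmetric]
   unfolding times_divide_eq_left sum_distrib_right vector_2 * ..
 qed
 have "(\<Sum>n\<in>grid N. ip N \<phi> (twisted_T N n v) * twisted_T N n v y)
   = (\<Sum>a\<in>R. \<Sum>b\<in>R. \<Sum>z\<in>R. \<phi> z * cnj (v (z + a)) * v (y + a) * e_N N ((y - z) * b)) / of_nat N"
  by (simp add: sum_grid R_def[symmetric] 1 sum_divide_distrib)
 also have "\<dots> = (\<Sum>a\<in>R. \<Sum>z\<in>R. \<phi> z * cnj (v (z + a)) * v (y + a) * (\<Sum>b\<in>R. e_N N ((y - z) * b))) / of_nat N"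
  by (subst sum.swap[of _ R R]) (simp only: sum_distrib_left)
 also have "\<dots> = (\<Sum>a\<in>R. \<Sum>z\<in>R. if z = y mod int N then of_nat N * (\<phi> y * (v (y + a) * cnj (v (y + a)))) else 0) / of_nat N"
 proof -
  have "\<phi> z * cnj (v (z + a)) * v (y + a) * (\<Sum>b\<in>R. e_N N ((y - z) * b))
   = (if z = y mod int N then of_nat N * (\<phi> y * (v (y + a) * cnj (v (y + a)))) else 0)" if "z \<in> R" for z a
  proof -
   have iff: "int N dvd y - z \<longleftrightarrow> z = y mod int N"
    using that by (auto simp: R_def mod_eq_dvd_iff[symmetric])
   have "v (y mod int N + a) = v (y + a)"
    using periodic_mod(2)[of v "int N"] perv by (metis mod_add_left_eq)
   thus ?thesis
    using sum_e_N[OF N, of "y - z"] per[of y] iff by (simp add: R_def)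
  qed
  thus ?thesis by simp
 qed
 also have "\<dots> = (\<Sum>a\<in>R. \<phi> y * (v (y + a) * cnj (v (y + a))))"
 proof -
  have "y mod int N \<in> R" using N by (simp add: R_def)
  thus ?thesis using N by (simp add: R_def sum_divide_distrib)
 qed
 also have "\<dots> = \<phi> y * (\<Sum>a\<in>R. v (a + y) * cnj (v (a + y)))"
  by (simp add: sum_distrib_left add.commute)
 also have "(\<Sum>a\<in>R. v (a + y) * cnj (v (a + y))) = (\<Sum>a\<in>R. v a * cnj (v a))"
  unfolding R_def using sum_periodic_shift[of "int N" "\<lambda>a. v a * cnj (v a)" y] N perv by simp
 finally show "(\<Sum>n\<in>grid N. ip N \<phi> (twisted_T N n v) * twisted_T N n v y) = scl (of_nat N * ip N v v) \<phi> y"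
  using N by (simp add: ip_def R_def scl_def mult.commute)
qed

lemma twisted_T_commute:
 assumes "odd N"
 shows "twisted_T N m (twisted_T N n \<phi>) = scl (e_N N (symp m n)) (twisted_T N n (twisted_T N m \<phi>))"
proof -
 have N: "N > 0" using assms by (cases N) auto
 have "half N * symp m n - (symp m n + half N * symp n m) = (2 * half N - 1) * symp m n"
  by (simp add: symp_def algebra_simps)
 hence "int N dvd half N * symp m n - (symp m n + half N * symp n m)"
  by (simp add: two_half[OF assms])
 hence "e_N N (half N * symp m n) = e_N N (symp m n) * e_N N (half N * symp n m)"
  using e_N_cong[OF N] by (simp flip: e_N_add)
 thus ?thesis
  by (simp add: twisted_T_comp[OF assms] add.commute)
qed

section \<open>Joint eigenvectors of self-dual lattices\<close>

text \<open>A character of \<open>L\<close> is written as pairing with a vector \<open>x\<close>;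
  only the class of \<open>x\<close> modulo the symplectic dual of \<open>L\<close> matters.\<close>

definition joint_eig :: "nat \<Rightarrow> (int ^ 2) set \<Rightarrow> int ^ 2 \<Rightarrow> (int \<Rightarrow> complex) \<Rightarrow> bool" where
 "joint_eig N L x \<phi> \<longleftrightarrow> \<phi> \<in> H_N N \<and> (\<forall>m\<in>L. twisted_T N m \<phi> = scl (e_N N (symp m x)) \<phi>)"

lemma joint_eig_scl: "joint_eig N L x \<phi> \<Longrightarrow> joint_eig N L x (scl c \<phi>)"
 by (simp add: joint_eig_def H_N_scl twisted_T_scl mult.commute)

lemma joint_eig_subset: "joint_eig N L x \<phi> \<Longrightarrow> L' \<subseteq> L \<Longrightarrow> joint_eig N L' x \<phi>"
 by (auto simp: joint_eig_def)

lemma joint_eig_shift: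
 assumes "odd N" "joint_eig N L x \<phi>"
 shows "joint_eig N L (x + n) (twisted_T N n \<phi>)"
 using assms unfolding joint_eig_def
 by (auto simp: twisted_T_commute[OF assms(1), of _ n] twisted_T_scl symp_simps e_N_add mult.commute)

lemma unitary_eigenvalues:
 assumes "ip N (V \<phi>) (V \<psi>) = ip N \<phi> \<psi>" "V \<phi> = scl a \<phi>" "V \<psi> = scl b \<psi>" "ip N \<phi> \<psi> \<noteq> 0"
 shows "a * cnj b = 1"
 using assms by (simp add: mult.commute)

text \<open>Each \<open>T(m)\<close> is an isometry, so two eigenvectors of it that overlap have the
  same eigenvalue.\<close>

lemma joint_eig_ip:
 assumes "odd N" "joint_eig N L x \<phi>" "joint_eig N L y \<psi>" "ip N \<phi> \<psi> \<noteq> 0" "m \<in> L"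
 shows "int N dvd symp m (x - y)"
proof -
 have N: "N > 0" using assms(1) by (cases N) auto
 have "e_N N (symp m x) * cnj (e_N N (symp m y)) = 1"
 proof (rule unitary_eigenvalues[OF ip_twisted_T_iso[OF assms(1)] _ _ assms(4)])
 qed (use assms(2,3,5) in \<open>auto simp: joint_eig_def\<close>)
 hence "e_N N (symp m (x - y)) = 1"
  by (simp add: symp_simps flip: e_N_add)
 thus ?thesis by (simp add: e_N_eq_1_iff[OF N])
qed

text \<open>Invariance under congruence modulo \<open>N\<close> makes \<open>L\<close> the preimage
  of a subgroup of the residue vectors; the last two clauses say that this subgroup equals its
  symplectic dual.\<close>

definition lagrangian :: "nat \<Rightarrow> (int ^ 2) set \<Rightarrow> bool" where
 "lagrangian N L \<longleftrightarrow> 0 \<in> L \<and> (\<forall>a\<in>L. \<forall>b\<in>L. a + b \<in> L) \<and> (\<forall>a\<in>L. - a \<in> L) \<and>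
   (\<forall>a b. vc (int N) a b \<longrightarrow> a \<in> L \<longrightarrow> b \<in> L) \<and>
   (\<forall>a\<in>L. \<forall>b\<in>L. int N dvd symp a b) \<and>
   (\<forall>n. (\<forall>a\<in>L. int N dvd symp a n) \<longrightarrow> n \<in> L)"

lemma lagrangianD:
 assumes "lagrangian N L"
 shows "0 \<in> L" "a \<in> L \<Longrightarrow> b \<in> L \<Longrightarrow> a + b \<in> L" "a \<in> L \<Longrightarrow> b \<in> L \<Longrightarrow> a - b \<in> L"
  "vc (int N) a b \<Longrightarrow> a \<in> L \<Longrightarrow> b \<in> L" "a \<in> L \<Longrightarrow> b \<in> L \<Longrightarrow> int N dvd symp a b"
  "(\<And>a. a \<in> L \<Longrightarrow> int N dvd symp a n) \<Longrightarrow> n \<in> L"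
proof -
 have *: "\<And>a b. a \<in> L \<Longrightarrow> b \<in> L \<Longrightarrow> a + b \<in> L" "\<And>a. a \<in> L \<Longrightarrow> - a \<in> L"
  "\<And>a b. vc (int N) a b \<Longrightarrow> a \<in> L \<Longrightarrow> b \<in> L" "0 \<in> L"
  "\<And>a b. a \<in> L \<Longrightarrow> b \<in> L \<Longrightarrow> int N dvd symp a b"
  "\<And>n. (\<And>a. a \<in> L \<Longrightarrow> int N dvd symp a n) \<Longrightarrow> n \<in> L"
  using assms unfolding lagrangian_def by blast+
 show "0 \<in> L" "a \<in> L \<Longrightarrow> b \<in> L \<Longrightarrow> a + b \<in> L"
  "vc (int N) a b \<Longrightarrow> a \<in> L \<Longrightarrow> b \<in> L" "a \<in> L \<Longrightarrow> b \<in> L \<Longrightarrow> int N dvd symp a b"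
  "(\<And>a. a \<in> L \<Longrightarrow> int N dvd symp a n) \<Longrightarrow> n \<in> L"
  by (fact *)+
 show "a \<in> L \<Longrightarrow> b \<in> L \<Longrightarrow> a - b \<in> L"
  using *(1)[of a "- b"] *(2)[of b] by simp
qed

lemma sum_lattice_shift:
 assumes "N > 0" "lagrangian N L" "\<mu> \<in> L" "\<And>a b. vc (int N) a b \<Longrightarrow> g a = g b"
 shows "(\<Sum>a\<in>L \<inter> grid N. g (a + \<mu>)) = (\<Sum>a\<in>L \<inter> grid N. g a)"
proof (rule sum.reindex_bij_witness[where i = "\<lambda>a. red N (a - \<mu>)" and j = "\<lambda>a. red N (a + \<mu>)"])
 fix a assume a: "a \<in> L \<inter> grid N"
 have "vc (int N) (red N (red N (a + \<mu>) - \<mu>)) (a + \<mu> - \<mu>)"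
  by (rule vc_trans[OF vc_red]) (intro vc_diff vc_red vc_refl)
 thus "red N (red N (a + \<mu>) - \<mu>) = a"
  using a red_grid[OF assms(1)] by (auto intro: vc_grid_eq)
 have "vc (int N) (red N (red N (a - \<mu>) + \<mu>)) (a - \<mu> + \<mu>)"
  by (rule vc_trans[OF vc_red]) (intro vc_add vc_red vc_refl)
 thus "red N (red N (a - \<mu>) + \<mu>) = a"
  using a red_grid[OF assms(1)] by (auto intro: vc_grid_eq)
 show "red N (a + \<mu>) \<in> L \<inter> grid N"
  using a assms(2,3) red_grid[OF assms(1)] lagrangianD(2)[OF assms(2), of a \<mu>]
  by (auto intro: lagrangianD(4)[OF assms(2) vc_sym[OF vc_red]])
 show "red N (a - \<mu>) \<in> L \<inter> grid N"
  using a assms(2,3) red_grid[OF assms(1)] lagrangianD(3)[OF assms(2), of a \<mu>]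
  by (auto intro: lagrangianD(4)[OF assms(2) vc_sym[OF vc_red]])
 show "g (red N (a + \<mu>)) = g (a + \<mu>)"
  by (rule assms(4)[OF vc_red])
qed

lemma sum_e_N_grid:
 assumes "N > 0"
 shows "(\<Sum>n\<in>grid N. e_N N (symp a n)) = (if vc (int N) a 0 then of_nat (N ^ 2) else 0)"
proof -
 have "(\<Sum>n\<in>grid N. e_N N (symp a n))
   = (\<Sum>r\<in>{0..<int N}. \<Sum>s\<in>{0..<int N}. e_N N (- a $ 2 * r) * e_N N (a $ 1 * s))"
  by (simp add: sum_grid symp_def flip: e_N_add)
 also have "\<dots> = (\<Sum>r\<in>{0..<int N}. e_N N (- a $ 2 * r)) * (\<Sum>s\<in>{0..<int N}. e_N N (a $ 1 * s))"
  by (simp only: sum_product)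
 also have "\<dots> = (if vc (int N) a 0 then of_nat (N ^ 2) else 0)"
  by (subst (1 2) sum_e_N[OF assms]) (simp add: vc_def power2_eq_square)
 finally show ?thesis .
qed

text \<open>On an isotropic \<open>L\<close> the cocycle \<open>half N * symp \<mu> a\<close>
  vanishes modulo \<open>N\<close>, so \<open>T\<close> restricts to an honest representation of
  \<open>L\<close>. Averaging it against a character projects to the eigenspace, up to a
  factor.\<close>

lemma joint_eig_average:
 assumes "odd N" "lagrangian N L" "\<phi> \<in> H_N N"
 shows "joint_eig N L x (\<lambda>y. \<Sum>a\<in>L \<inter> grid N. e_N N (- symp a x) * twisted_T N a \<phi> y)"
  (is "joint_eig N L x ?w")
 unfolding joint_eig_def
proof (intro conjI ballI)
 have N: "N > 0" using assms(1) by (cases N) auto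
 show "?w \<in> H_N N"
  by (rule H_N_sum) (simp add: assms)
 fix \<mu> assume \<mu>: "\<mu> \<in> L"
 show "twisted_T N \<mu> ?w = scl (e_N N (symp \<mu> x)) ?w"
 proof
  fix y
  define g where "g a = e_N N (- symp (a - \<mu>) x) * twisted_T N a \<phi> y" for a
  have g: "g a = g b" if "vc (int N) a b" for a b
  proof -
   have "vc (int N) (b - \<mu>) (a - \<mu>)"
    using vc_diff[OF vc_sym[OF that] vc_refl[of _ \<mu>]] .
   hence "int N dvd symp (b - \<mu>) x - symp (a - \<mu>) x"
    by (rule vc_symp) simp
   hence "e_N N (- symp (a - \<mu>) x) = e_N N (- symp (b - \<mu>) x)"
    by (intro e_N_cong[OF N]) (simp add: dvd_diff_commute)
   thus ?thesis
    using twisted_T_cong[OF assms(1) that assms(3)] by (simp add: g_def)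
  qed
  have "twisted_T N \<mu> ?w y
    = (\<Sum>a\<in>L \<inter> grid N. e_N N (- symp a x) * twisted_T N \<mu> (twisted_T N a \<phi>) y)"
   by (simp add: twisted_T_sum)
  also have "\<dots> = (\<Sum>a\<in>L \<inter> grid N. g (a + \<mu>))"
  proof (rule sum.cong)
   fix a assume "a \<in> L \<inter> grid N"
   hence "int N dvd half N * symp \<mu> a"
    using lagrangianD(5)[OF assms(2) \<mu>] by simp
   hence "e_N N (half N * symp \<mu> a) = 1"
    by (simp add: e_N_eq_1_iff[OF N])
   thus "e_N N (- symp a x) * twisted_T N \<mu> (twisted_T N a \<phi>) y = g (a + \<mu>)"
    by (simp add: g_def twisted_T_comp[OF assms(1)] add.commute)
  qed simp
  also have "\<dots> = (\<Sum>a\<in>L \<inter> grid N. g a)"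
   by (rule sum_lattice_shift[OF N assms(2) \<mu> g])
  also have "\<dots> = scl (e_N N (symp \<mu> x)) ?w y"
  proof -
   have "g a = e_N N (symp \<mu> x) * (e_N N (- symp a x) * twisted_T N a \<phi> y)" for a
   proof -
    have "- symp (a - \<mu>) x = symp \<mu> x + - symp a x"
     by (simp add: symp_simps)
    thus ?thesis unfolding g_def by (simp only: e_N_add mult.assoc)
   qed
   thus ?thesis by (simp add: scl_def sum_distrib_left)
  qed
  finally show "twisted_T N \<mu> ?w y = scl (e_N N (symp \<mu> x)) ?w y" .
 qed
qed

text \<open>The projections of a constant function to the characters \<open>x + n\<close> add up,
  over \<open>n\<close> modulo \<open>N\<close>, to \<open>N^2\<close> times that function, so one
  of them is nonzero. Translation by \<open>-n\<close> moves it back to \<open>x\<close>.\<close>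

lemma lagrangian_eigenvector:
 assumes "odd N" "lagrangian N L"
 shows "\<exists>v. joint_eig N L x v \<and> ip N v v = 1"
proof -
 have N: "N > 0" using assms(1) by (cases N) auto
 define \<psi>0 :: "int \<Rightarrow> complex" where "\<psi>0 = (\<lambda>_. 1)"
 have \<psi>0: "\<psi>0 \<in> H_N N" by (simp add: \<psi>0_def H_N_def)
 define w where "w n = (\<lambda>y. \<Sum>a\<in>L \<inter> grid N. e_N N (- symp a (x + n)) * twisted_T N a \<psi>0 y)" for n
 have wH: "w n \<in> H_N N" for n
  unfolding w_def by (rule H_N_sum) (simp add: assms(1) \<psi>0)
 have w_eig: "joint_eig N L (x + n) (w n)" for n
  unfolding w_def by (rule joint_eig_average[OF assms \<psi>0])
 have sum_w: "(\<Sum>n\<in>grid N. w n y) = of_nat (N ^ 2) * \<psi>0 y" for y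
 proof -
  have "(\<Sum>n\<in>grid N. w n y)
    = (\<Sum>a\<in>L \<inter> grid N. e_N N (- symp a x) * twisted_T N a \<psi>0 y * (\<Sum>n\<in>grid N. e_N N (symp (- a) n)))"
   unfolding w_def sum_distrib_left
   by (subst sum.swap) (simp add: symp_simps mult_ac add_ac flip: e_N_add)
  also have "\<dots> = (\<Sum>a\<in>L \<inter> grid N. if a = 0 then of_nat (N ^ 2) * \<psi>0 y else 0)"
  proof (rule sum.cong)
   fix a assume a: "a \<in> L \<inter> grid N"
   have "vc (int N) (- a) 0 \<longleftrightarrow> a = 0"
    using a N vc_grid_eq[of N a 0] by (auto simp: vc_def grid_def)
   thus "e_N N (- symp a x) * twisted_T N a \<psi>0 y * (\<Sum>n\<in>grid N. e_N N (symp (- a) n))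
     = (if a = 0 then of_nat (N ^ 2) * \<psi>0 y else 0)"
    using sum_e_N_grid[OF N, of "- a"] by (simp add: assms(1) symp_simps(6))
  qed simp
  also have "\<dots> = of_nat (N ^ 2) * \<psi>0 y"
  proof -
   have "finite (L \<inter> grid N)" by simp
   moreover have "0 \<in> L \<inter> grid N"
    using lagrangianD(1)[OF assms(2)] N by (simp add: grid_def)
   ultimately show ?thesis by simp
  qed
  finally show ?thesis .
 qed
 have "\<exists>n. w n \<noteq> (\<lambda>_. 0)"
 proof (rule ccontr)
  assume "\<not> ?thesis"
  hence "(\<Sum>n\<in>grid N. w n 0) = 0" by simp
  thus False using sum_w[of 0] N by (simp add: \<psi>0_def)
 qed
 then obtain n where "w n \<noteq> (\<lambda>_. 0)" ..
 then obtain c where c: "ip N (scl c (w n)) (scl c (w n)) = 1"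
  using exists_normalised[OF N wH] by metis
 have "joint_eig N L (x + n + - n) (twisted_T N (- n) (scl c (w n)))"
  by (intro joint_eig_shift[OF assms(1)] joint_eig_scl w_eig)
 moreover have "ip N (twisted_T N (- n) (scl c (w n))) (twisted_T N (- n) (scl c (w n))) = 1"
  using c by (subst ip_twisted_T_iso) (auto simp: assms(1) wH H_N_scl simp del: ip_scl_left ip_scl_right)
 ultimately show ?thesis by auto
qed

text \<open>A coefficient of \<open>\<phi>\<close> in the frame \<open>T(n)v\<close> vanishes unless \<open>n\<close> lies in \<open>L\<close>, by self-duality.\<close>

lemma lagrangian_unique:
 assumes "odd N" "lagrangian N L" "joint_eig N L x v" "ip N v v = 1"
 shows "card (L \<inter> grid N) = N" "joint_eig N L x \<phi> \<Longrightarrow> \<phi> = scl (ip N \<phi> v) v"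
proof -
 have N: "N > 0" using assms(1) by (cases N) auto
 have vH: "v \<in> H_N N" using assms(3) by (simp add: joint_eig_def)
 have main: "scl (of_nat N) \<phi> = scl (of_nat (card (L \<inter> grid N)) * ip N \<phi> v) v"
  if \<phi>: "joint_eig N L x \<phi>" for \<phi>
 proof
  fix y
  have term_n: "ip N \<phi> (twisted_T N n v) * twisted_T N n v y = (if n \<in> L then ip N \<phi> v * v y else 0)" for n
  proof (cases "n \<in> L")
   case True
   hence "twisted_T N n v = scl (e_N N (symp n x)) v"
    using assms(3) by (simp add: joint_eig_def)
   hence "ip N \<phi> (twisted_T N n v) * twisted_T N n v y
     = (e_N N (- symp n x) * e_N N (symp n x)) * (ip N \<phi> v * v y)"
    by (simp only: ip_scl_right cnj_e_N) (simp add: scl_def)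
   thus ?thesis using True by simp
  next
   case False
   then obtain m where m: "m \<in> L" "\<not> int N dvd symp m n"
    using lagrangianD(6)[OF assms(2)] by blast
   have "ip N \<phi> (twisted_T N n v) = 0"
   proof (rule ccontr)
    assume "ip N \<phi> (twisted_T N n v) \<noteq> 0"
    hence "int N dvd symp m (x - (x + n))"
     by (rule joint_eig_ip[OF assms(1) \<phi> joint_eig_shift[OF assms(1,3)] _ m(1)])
    thus False using m(2) by (simp add: symp_simps)
   qed
   thus ?thesis using False by simp
  qed
  have "scl (of_nat N) \<phi> y = (\<Sum>n\<in>grid N. ip N \<phi> (twisted_T N n v) * twisted_T N n v y)"
   using fun_cong[OF frame_identity[OF assms(1) _ vH, of \<phi>], of y] \<phi> assms(4) by (simp add: joint_eig_def)
  also have "\<dots> = (\<Sum>n\<in>grid N \<inter> L. ip N \<phi> v * v y)"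
   by (simp only: term_n sum.inter_restrict[OF finite_grid])
  finally show "scl (of_nat N) \<phi> y = scl (of_nat (card (L \<inter> grid N)) * ip N \<phi> v) v y"
   by (simp add: scl_def Int_commute)
 qed
 \<comment> \<open>Applied to \<open>v\<close> itself, the frame expansion counts the classes of
   \<open>L\<close> modulo \<open>N\<close>.\<close>
 have "ip N (scl (of_nat N) v) v = ip N (scl (of_nat (card (L \<inter> grid N)) * ip N v v) v) v"
  by (simp only: main[OF assms(3)])
 hence "of_nat N = (of_nat (card (L \<inter> grid N)) :: complex)"
  by (simp add: assms(4))
 thus card: "card (L \<inter> grid N) = N"
  by (simp only: of_nat_eq_iff)
 show "\<phi> = scl (ip N \<phi> v) v" if "joint_eig N L x \<phi>"
 proof -
  have "scl (1 / of_nat N) (scl (of_nat N) \<phi>) = scl (1 / of_nat N) (scl (of_nat N * ip N \<phi> v) v)"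
   using main[OF that] by (simp only: card)
  thus ?thesis using N by simp
 qed
qed

text \<open>Averaging \<open>T\<close> over \<open>L\<close> against the character of
  \<open>x\<close> is, up to the number of classes, the projection onto \<open>v\<close>. This
  expresses the size of an overlap through diagonal matrix elements of
  \<open>\<phi>\<close>.\<close>

lemma lagrangian_projection:
 assumes "odd N" "lagrangian N L" "joint_eig N L x v" "ip N v v = 1" "\<phi> \<in> H_N N"
 shows "of_nat (card (L \<inter> grid N)) * (norm (ip N \<phi> v))\<^sup>2
   = (\<Sum>a\<in>L \<inter> grid N. e_N N (- symp a x) * ip N (twisted_T N a \<phi>) \<phi>)"
proof -
 define w where "w = (\<lambda>y. \<Sum>a\<in>L \<inter> grid N. e_N N (- symp a x) * twisted_T N a \<phi> y)"
 have vH: "v \<in> H_N N" using assms(3) by (simp add: joint_eig_def)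
 have "w = scl (ip N w v) v"
  unfolding w_def by (rule lagrangian_unique(2)[OF assms(1-4) joint_eig_average[OF assms(1,2,5)]])
 hence "ip N w \<phi> = ip N w v * ip N v \<phi>"
  by (metis ip_scl_left)
 moreover have "ip N w v = of_nat (card (L \<inter> grid N)) * ip N \<phi> v"
 proof -
  have "e_N N (- symp a x) * ip N (twisted_T N a \<phi>) v = ip N \<phi> v" if "a \<in> L" for a
  proof -
   have "- a \<in> L" using assms(2) that unfolding lagrangian_def by blast
   hence "twisted_T N (- a) v = scl (e_N N (- symp a x)) v"
    using assms(3) by (simp add: joint_eig_def symp_simps)
   thus ?thesis
    by (simp add: ip_twisted_T_adj[OF assms(1,5) vH] flip: mult.assoc)
  qed
  thus ?thesis unfolding w_def by (simp add: ip_sum_left)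
 qed
 moreover have "ip N \<phi> v * ip N v \<phi> = of_real ((norm (ip N \<phi> v))\<^sup>2)"
  using complex_norm_square[of "ip N \<phi> v"] by (simp add: cnj_ip)
 ultimately show ?thesis
  unfolding w_def ip_sum_left by (simp add: mult.assoc)
qed

section \<open>The quadratic form and the Hecke matrices\<close>

text \<open>Multiplication by the trace-free matrix \<open>2 A - trace A\<close>, whose square is
  the scalar \<open>disc A\<close>. The pairing \<open>symp (dl A a) b\<close> is the polar form of
  \<open>Q_form A\<close>, so \<open>dl A x\<close> is tangent to the conic through
  \<open>x\<close>.\<close>

definition dl :: "int ^ 2 ^ 2 \<Rightarrow> int ^ 2 \<Rightarrow> int ^ 2" where
 "dl A n = 2 *s (n v* A) - trace A *s n"

definition disc :: "int ^ 2 ^ 2 \<Rightarrow> int" where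
 "disc A = (trace A)\<^sup>2 - 4 * det A"

definition act :: "int ^ 2 ^ 2 \<Rightarrow> int \<Rightarrow> int \<Rightarrow> int ^ 2 \<Rightarrow> int ^ 2" where
 "act A c d n = c *s n + d *s dl A n"

text \<open>The element \<open>c + d * sqrt (disc A)\<close> of the order, in the basis
  \<open>1\<close>, \<open>A\<close>. Such elements form a subring of index 2, which represents all
  classes modulo an odd \<open>N\<close>; their products and norms involve no trace.\<close>

definition hecke_mat :: "int ^ 2 ^ 2 \<Rightarrow> int \<Rightarrow> int \<Rightarrow> int ^ 2 ^ 2" where
 "hecke_mat A c d = mat (c - d * trace A) + mat (2 * d) ** A"

definition nrm :: "int ^ 2 ^ 2 \<Rightarrow> int \<Rightarrow> int \<Rightarrow> int" where
 "nrm A c d = c\<^sup>2 - disc A * d\<^sup>2"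

lemmas mat2_simps = vec_eq_iff forall_2 sum_2 det_2 trace_def mat_def vector_matrix_mult_def
 matrix_matrix_mult_def

lemma vec_mult_hecke_mat: "n v* hecke_mat A c d = act A c d n"
 by (simp add: hecke_mat_def act_def dl_def mat2_simps algebra_simps)

lemma det_hecke_mat: "det A = 1 \<Longrightarrow> det (hecke_mat A c d) = nrm A c d"
 by (simp add: hecke_mat_def nrm_def disc_def mat2_simps algebra_simps power2_eq_square) algebra

lemma hecke_mat_mult:
 "hecke_mat A c d ** hecke_mat A c' d' = hecke_mat A (c * c' + disc A * d * d') (c * d' + c' * d)"
 by (simp add: hecke_mat_def disc_def mat2_simps algebra_simps power2_eq_square)

lemma nrm_mult:
 "nrm A (c * c' + disc A * d * d') (c * d' + c' * d) = nrm A c d * nrm A c' d'"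
 by (simp add: nrm_def algebra_simps power2_eq_square)

lemma dl_linear: "dl A (a + b) = dl A a + dl A b" "dl A (a - b) = dl A a - dl A b"
 "dl A (c *s a) = c *s dl A a" "dl A (- a) = - dl A a" "dl A 0 = 0"
 by (simp_all add: dl_def mat2_simps algebra_simps)

lemma dl_dl: "dl A (dl A n) = disc A *s n"
 by (simp add: dl_def disc_def mat2_simps algebra_simps power2_eq_square)

lemma symp_dl: "symp (dl A a) b = - symp a (dl A b)"
 by (simp add: symp_def dl_def mat2_simps algebra_simps)

lemma symp_dl_self: "symp (dl A a) a = 2 * Q_form A a"
 by (simp add: symp_def dl_def Q_form_def mat2_simps algebra_simps)

lemma symp_smult: "symp (c *s a) b = c * symp a b" "symp a (c *s b) = c * symp a b"
 by (simp_all add: symp_def algebra_simps)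

lemma dl_act: "dl A (act A c d n) = act A c d (dl A n)"
 by (simp add: act_def dl_linear)

lemma symp_act: "symp (act A c d a) (act A c d b) = nrm A c d * symp a b"
 by (simp add: act_def nrm_def symp_simps symp_smult symp_dl[of A a] dl_dl algebra_simps power2_eq_square)

lemma Q_form_act: "Q_form A (act A c d a) = nrm A c d * Q_form A a"
 using symp_dl_self[of A "act A c d a"] symp_dl_self[of A a] by (simp add: dl_act symp_act)

lemma Q_form_add: "Q_form A (a + b) = Q_form A a + symp (dl A a) b + Q_form A b"
proof -
 have "2 * Q_form A (a + b) = 2 * (Q_form A a + symp (dl A a) b + Q_form A b)"
  using symp_flip[of "dl A b" a] symp_dl[of A a b] by (simp add: symp_dl_self[symmetric] dl_linear symp_simps)
 thus ?thesis by simp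
qed

lemma Q_form_smult: "Q_form A (c *s a) = c\<^sup>2 * Q_form A a"
 by (simp add: Q_form_def symp_def mat2_simps algebra_simps power2_eq_square)

lemma Q_form_uminus [simp]: "Q_form A (- a) = Q_form A a"
 by (simp add: Q_form_def symp_def mat2_simps algebra_simps)

text \<open>Cramer's rule in the plane. Applied to \<open>x\<close> and \<open>dl A x\<close> it
  gives coordinates adapted to the conic through \<open>x\<close>.\<close>

lemma symp_cramer: "symp u v *s m = symp m v *s u + symp u m *s v"
 by (simp add: symp_def vec_eq_iff forall_2 algebra_simps)

lemma vc_dl: "vc m a b \<Longrightarrow> vc m (dl A a) (dl A b)"
proof -
 have "vc m (a v* A) (b v* A)" if "vc m a b"
 proof -
  have "(a v* A) $ j - (b v* A) $ j = (a $ 1 - b $ 1) * A $ 1 $ j + (a $ 2 - b $ 2) * A $ 2 $ j" for j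
   by (simp add: vector_matrix_mult_def sum_2 algebra_simps)
  with that show ?thesis unfolding vc_def by auto
 qed
 thus "vc m a b \<Longrightarrow> vc m (dl A a) (dl A b)"
  unfolding dl_def by (intro vc_diff vc_scale) auto
qed

lemma vc_act: "vc m a b \<Longrightarrow> vc m (act A c d a) (act A c d b)"
 unfolding act_def by (intro vc_add vc_scale vc_dl)

lemma vc_Q_form: "vc m a b \<Longrightarrow> m dvd Q_form A a - Q_form A b"
proof -
 have "vc m (a v* A) (b v* A)" if "vc m a b"
 proof -
  have "(a v* A) $ j - (b v* A) $ j = (a $ 1 - b $ 1) * A $ 1 $ j + (a $ 2 - b $ 2) * A $ 2 $ j" for j
   by (simp add: vector_matrix_mult_def sum_2 algebra_simps)
  with that show ?thesis unfolding vc_def by auto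
 qed
 thus "vc m a b \<Longrightarrow> m dvd Q_form A a - Q_form A b"
  unfolding Q_form_def by (intro vc_symp) auto
qed

section \<open>Units and square roots modulo prime powers\<close>

lemma prime_power_inverse:
 assumes "prime p" "\<not> int p dvd a"
 obtains i where "int (p ^ j) dvd i * a - 1"
proof -
 have "coprime (int p) a"
  using assms by (simp add: prime_imp_coprime)
 hence "coprime a (int (p ^ j))"
  by (simp add: coprime_commute)
 then obtain i where "[a * i = 1] (mod int (p ^ j))"
  using cong_solve_coprime_int by blast
 thus ?thesis using that[of i] by (simp add: cong_iff_dvd_diff mult.commute)
qed

lemma prime_power_dvd_cancel:
 assumes "prime p" "\<not> int p dvd a" "int (p ^ j) dvd a * b"
 shows "int (p ^ j) dvd b"
proof -
 have "coprime (int (p ^ j)) a"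
  using assms by (simp add: coprime_power_left_iff prime_imp_coprime)
 thus ?thesis using assms(3) by (simp add: coprime_dvd_mult_right_iff)
qed

lemma norm_eq_1I:
 fixes z :: complex
 assumes "z * cnj z = 1"
 shows "norm z = 1"
proof -
 have "complex_of_real ((norm z)\<^sup>2) = of_real 1"
  using complex_norm_square[of z] by (simp add: assms)
 hence "(norm z)\<^sup>2 = 1" by (simp only: of_real_eq_iff)
 thus ?thesis using norm_ge_zero[of z] by (auto simp: power2_eq_1_iff)
qed

text \<open>Each \<open>p\<close>-th power gains a factor \<open>p\<close>: in
  \<open>x^p - 1 = (x - 1) * (1 + x + ... + x^(p-1))\<close> the second factor is a sum of
  \<open>p\<close> terms congruent to 1.\<close>

lemma one_unit_power:
 assumes "int p dvd d - 1"
 shows "int (p ^ Suc K) dvd d ^ (p ^ K) - 1"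
proof (induction K)
 case (Suc K)
 define x where "x = d ^ (p ^ K)"
 have "int p dvd (\<Sum>i<p. x ^ i) - int p"
 proof -
  have "int p dvd x ^ i - 1" for i
  proof -
   have "x - 1 dvd x ^ i - 1"
    by (metis power_diff_1_eq dvd_triv_left)
   moreover have "int p dvd x - 1"
    using Suc.IH by (simp add: x_def) (metis dvd_mult_left)
   ultimately show ?thesis by (rule dvd_trans[rotated])
  qed
  hence "int p dvd (\<Sum>i<p. x ^ i - 1)" by (intro dvd_sum) auto
  thus ?thesis by (simp add: sum_subtractf)
 qed
 hence "int p dvd (\<Sum>i<p. x ^ i)"
  using dvd_add[of "int p" "(\<Sum>i<p. x ^ i) - int p" "int p"] by simp
 hence "int (p ^ Suc K) * int p dvd (x - 1) * (\<Sum>i<p. x ^ i)"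
  using Suc.IH by (intro mult_dvd_mono) (simp_all add: x_def)
 also have "(x - 1) * (\<Sum>i<p. x ^ i) = x ^ p - 1"
  by (simp add: power_diff_1_eq)
 finally show ?case
  by (simp add: x_def mult_ac flip: power_mult)
qed (use assms in simp)

text \<open>The inverse square root is itself a power of \<open>d\<close>: the exponent
  \<open>(p^K - 1) / 2\<close> gives \<open>c^2 * d = d^(p^K)\<close>, which is 1 modulo
  \<open>p^K\<close>, and every power of \<open>d\<close> inherits the congruence to 1 modulo
  \<open>p^j\<close>.\<close>

lemma one_unit_sqrt:
 assumes "odd p" "int p dvd d - 1" "int (p ^ j) dvd d - 1"
 obtains c where "int (p ^ j) dvd c - 1" "int (p ^ K) dvd c\<^sup>2 * d - 1"
proof -
 define c where "c = d ^ ((p ^ K - 1) div 2)"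
 have "odd (p ^ K)" using assms(1) by simp
 hence "2 * ((p ^ K - 1) div 2) + 1 = p ^ K" by (auto elim!: oddE)
 hence "c\<^sup>2 * d = d ^ (p ^ K)"
  unfolding c_def by (metis power_mult mult.commute power_add power_one_right)
 moreover have "int (p ^ K) dvd d ^ (p ^ K) - 1"
  using one_unit_power[OF assms(2), of K] dvd_trans[of "int (p ^ K)" "int (p ^ Suc K)"] by simp
 moreover have "int (p ^ j) dvd c - 1"
  unfolding c_def using assms(3) by (metis power_diff_1_eq dvd_trans dvd_triv_left)
 ultimately show ?thesis using that by metis
qed

text \<open>A nonzero inner product, expanded over the tight frame, has a nonzero term; its
  translate of \<open>v\<close> meets both vectors.\<close>

lemma frame_overlap:
 assumes "odd N" "\<phi> \<in> H_N N" "v \<in> H_N N" "ip N v v = 1" "ip N \<phi> \<psi> \<noteq> 0"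
 obtains n where "ip N \<phi> (twisted_T N n v) \<noteq> 0" "ip N \<psi> (twisted_T N n v) \<noteq> 0"
proof -
 have N: "N > 0" using assms(1) by (cases N) auto
 have "of_nat N * ip N \<phi> \<psi> = ip N (scl (of_nat N * ip N v v) \<phi>) \<psi>"
  by (simp add: assms(4))
 also have "\<dots> = (\<Sum>n\<in>grid N. ip N \<phi> (twisted_T N n v) * ip N (twisted_T N n v) \<psi>)"
  by (simp add: frame_identity[OF assms(1-3), symmetric] ip_sum_left)
 finally have "(\<Sum>n\<in>grid N. ip N \<phi> (twisted_T N n v) * ip N (twisted_T N n v) \<psi>) \<noteq> 0"
  using assms(5) N by (metis mult_eq_0_iff of_nat_0_eq_iff less_irrefl)
 then obtain n where "ip N \<phi> (twisted_T N n v) * ip N (twisted_T N n v) \<psi> \<noteq> 0"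
  by (meson sum.neutral)
 thus ?thesis using that[of n] by (auto simp: ip_0_commute[of N \<psi>])
qed

section \<open>Hecke operators modulo a prime power\<close>

locale cat_map =
 fixes A :: "int ^ 2 ^ 2" and p l e :: nat
  and U :: "int ^ 2 ^ 2 \<Rightarrow> (int \<Rightarrow> complex) \<Rightarrow> (int \<Rightarrow> complex)"
 assumes prime_p: "prime p" and odd_p: "odd p" and l_pos: "l > 0" and e_le: "e \<le> 1"
  and det_A: "det A = 1" and disc_unit: "\<not> int p dvd disc A"
  and propagator: "quantum_propagator (p ^ (2 * l + e)) U"
begin

definition N :: nat where "N = p ^ (2 * l + e)"

definition P :: int where "P = int (p ^ l)"

definition P' :: int where "P' = int (p ^ (l + e))"

text \<open>This is 1 or \<open>p\<close> according to the parity of the exponent. It measures the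
  gap between the precision \<open>P\<close> of a point and the precision \<open>P'\<close> of its
  level.\<close>

definition E :: int where "E = int (p ^ e)"

lemma odd_N: "odd N" and N_pos: "N > 0"
 using odd_p prime_p by (simp_all add: N_def prime_gt_0_nat)

lemma PP: "int N = P * P'" "P' = P * E" "P' = E * P"
 by (simp_all add: N_def P_def P'_def E_def power_add power2_eq_square power_mult mult_ac
   flip: power_mult_distrib mult_2)

lemma E_dvd_P: "E dvd P"
 using e_le l_pos by (auto simp: E_def P_def intro!: le_imp_power_dvd)

lemma p_dvd_P: "int p dvd P"
 using l_pos by (simp add: P_def)

lemma P_pos: "P > 0" "P' > 0" "E > 0"
 using prime_p by (simp_all add: P_def P'_def E_def prime_gt_0_nat)

lemma P'_dvd_PP: "P' dvd P * P"
 using E_dvd_P PP(2) by simp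

lemma N_dvd_PPP: "int N dvd P * P * P"
 using P'_dvd_PP by (simp add: PP(1) mult.assoc)

lemma P'_dvd_N: "P' dvd int N" and P_dvd_P': "P dvd P'" and P_dvd_N: "P dvd int N"
 by (simp_all add: PP)

definition hecke :: "int \<Rightarrow> int \<Rightarrow> bool" where
 "hecke c d \<longleftrightarrow> int N dvd nrm A c d - 1"

definition UM :: "int \<Rightarrow> int \<Rightarrow> (int \<Rightarrow> complex) \<Rightarrow> (int \<Rightarrow> complex)" where
 "UM c d = U (hecke_mat A c d)"

lemma hecke_SL2: "hecke c d \<Longrightarrow> hecke_mat A c d \<in> SL2_mod N"
 by (simp add: hecke_def SL2_mod_def det_hecke_mat[OF det_A] cong_iff_dvd_diff)

lemma
 assumes "hecke c d" "\<phi> \<in> H_N N"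
 shows UM_H: "UM c d \<phi> \<in> H_N N"
  and UM_scl: "UM c d (scl a \<phi>) = scl a (UM c d \<phi>)"
  and UM_ip: "\<psi> \<in> H_N N \<Longrightarrow> ip N (UM c d \<phi>) (UM c d \<psi>) = ip N \<phi> \<psi>"
  and UM_T: "twisted_T N n (UM c d \<phi>) = UM c d (twisted_T N (act A c d n) \<phi>)"
proof -
 note g = hecke_SL2[OF assms(1)]
 have u: "unitary_on_H N (U (hecke_mat A c d))"
  and T: "\<And>n \<psi>. \<psi> \<in> H_N N \<Longrightarrow> twisted_T N n (U (hecke_mat A c d) \<psi>)
   = U (hecke_mat A c d) (twisted_T N (n v* hecke_mat A c d) \<psi>)"
  using propagator[folded N_def] g unfolding quantum_propagator_def by blast+
 show "UM c d \<phi> \<in> H_N N" "UM c d (scl a \<phi>) = scl a (UM c d \<phi>)"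
  "\<psi> \<in> H_N N \<Longrightarrow> ip N (UM c d \<phi>) (UM c d \<psi>) = ip N \<phi> \<psi>"
  using u assms(2) unfolding unitary_on_H_def UM_def scl_def by blast+
 show "twisted_T N n (UM c d \<phi>) = UM c d (twisted_T N (act A c d n) \<phi>)"
  using T[OF assms(2)] by (simp add: UM_def vec_mult_hecke_mat)
qed

lemma UM_comp:
 assumes "hecke c d" "hecke c' d'" "\<phi> \<in> H_N N"
 shows "UM c d (UM c' d' \<phi>) = UM (c * c' + disc A * d * d') (c * d' + c' * d) \<phi>"
 using propagator[folded N_def] hecke_SL2[OF assms(1)] hecke_SL2[OF assms(2)] assms(3)
 unfolding quantum_propagator_def UM_def
 by (metis hecke_mat_mult)

lemma hecke_mult: "hecke c d \<Longrightarrow> hecke c' d' \<Longrightarrow> hecke (c * c' + disc A * d * d') (c * d' + c' * d)"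
 unfolding hecke_def nrm_mult
proof -
 assume "int N dvd nrm A c d - 1" "int N dvd nrm A c' d' - 1"
 hence "int N dvd (nrm A c d - 1) * nrm A c' d' + (nrm A c' d' - 1)" by auto
 thus "int N dvd nrm A c d * nrm A c' d' - 1" by (simp add: algebra_simps)
qed

lemma act_act_conj: "act A c d (act A c (- d) n) = nrm A c d *s n"
 by (simp add: act_def nrm_def dl_linear dl_dl vec_eq_iff forall_2 algebra_simps power2_eq_square)

text \<open>As the norm is 1 modulo \<open>N\<close>, the conjugate pair \<open>c\<close>,
  \<open>-d\<close> acts as the inverse, and the Egorov relation can be read from the other
  side.\<close>

lemma UM_T':
 assumes "hecke c d" "\<phi> \<in> H_N N"
 shows "UM c d (twisted_T N n \<phi>) = twisted_T N (act A c (- d) n) (UM c d \<phi>)"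
proof -
 have "vc (int N) (nrm A c d *s n) n"
 proof -
  have "(nrm A c d *s n) $ i - n $ i = (nrm A c d - 1) * n $ i" for i
   by (simp add: algebra_simps)
  thus ?thesis using assms(1) unfolding hecke_def vc_def by simp
 qed
 thus ?thesis
  using UM_T[OF assms, of "act A c (- d) n"] twisted_T_cong[OF odd_N _ assms(2)]
  by (simp add: act_act_conj)
qed

definition good :: "int ^ 2 \<Rightarrow> bool" where
 "good x \<longleftrightarrow> \<not> int p dvd Q_form A x"

definition Lat :: "int ^ 2 \<Rightarrow> (int ^ 2) set" where
 "Lat x = {n. \<exists>m s. n = P' *s m + (P * s) *s dl A x}"

lemma good_cong:
 assumes "good x" "P dvd Q_form A x - Q_form A y"
 shows "good y"
 using assms p_dvd_P unfolding good_def
 by (metis dvd_add_right_iff diff_add_cancel dvd_trans)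

lemma good_vc: "good x \<Longrightarrow> vc P x y \<Longrightarrow> good y"
 using good_cong vc_Q_form by blast

text \<open>The determinant of \<open>x\<close> and \<open>dl A x\<close> is \<open>-2 Q(x)\<close>.
  Being a unit, it makes the two vectors a basis modulo every power of \<open>p\<close>.\<close>

lemma symp_dl_unit:
 assumes "good x"
 shows "\<not> int p dvd symp x (dl A x)"
proof -
 have *: "symp x (dl A x) = - 2 * Q_form A x"
  using symp_dl_self[of A x] symp_flip[of "dl A x" x] by simp
 have "\<not> int p dvd 2"
  using prime_p odd_p by (metis dvd_refl even_of_nat int_dvd_int_iff of_nat_numeral primes_dvd_imp_eq two_is_prime_nat)
 hence "\<not> int p dvd 2 * Q_form A x"
  using assms prime_p by (simp add: good_def prime_dvd_mult_iff)
 thus ?thesis unfolding * by simp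
qed

lemma P'_lattice: "P' *s m \<in> Lat x"
proof -
 have "P' *s m = P' *s m + (P * 0) *s dl A x" by simp
 thus ?thesis unfolding Lat_def by blast
qed

lemma dl_lattice: "(P * s) *s dl A x \<in> Lat x"
proof -
 have "(P * s) *s dl A x = P' *s 0 + (P * s) *s dl A x" by simp
 thus ?thesis unfolding Lat_def by blast
qed

lemma vc_iff_smult: "vc m a b \<longleftrightarrow> (\<exists>r. a = b + m *s r)"
proof
 assume "vc m a b"
 then obtain s t where "a $ 1 - b $ 1 = m * s" "a $ 2 - b $ 2 = m * t"
  unfolding vc_def dvd_def by blast
 hence "a = b + m *s vector [s, t]" by (intro vec2_eqI) auto
 thus "\<exists>r. a = b + m *s r" ..
qed (auto simp: vc_def)

lemma vc_mult: "vc m a b \<Longrightarrow> vc (r * m) (r *s a) (r *s b)"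
 unfolding vc_def vector_smult_component right_diff_distrib[symmetric] by (auto intro: mult_dvd_mono)

lemma mem_Lat_conv: "n \<in> Lat x \<longleftrightarrow> (\<exists>s. vc P' n ((P * s) *s dl A x))"
 unfolding Lat_def vc_iff_smult by (auto simp: add.commute)

text \<open>Self-duality of \<open>Lat x\<close> and the identification of its cells both come from this: a vector
 \<open>m\<close> that is orthogonal to the tangent direction \<open>x\<delta>\<close> modulo \<open>p\<^sup>e\<close> is parallel to it.\<close>

lemma parallel_mod_E:
 assumes "good x" "E dvd symp (dl A x) m"
 shows "P *s m \<in> Lat x"
proof -
 obtain i where i: "E dvd i * symp x (dl A x) - 1"
  using prime_power_inverse[OF prime_p symp_dl_unit[OF assms(1)], of e] unfolding E_def by blast
 have E': "E dvd symp m (dl A x)"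
  using assms(2) symp_flip[of m "dl A x"] by simp
 have "vc E m ((i * symp x m) *s dl A x)"
 proof -
  have "m $ j - ((i * symp x m) *s dl A x) $ j = i * symp m (dl A x) * x $ j - (i * symp x (dl A x) - 1) * m $ j" for j
  proof -
   have "(symp x (dl A x) *s m) $ j = (symp m (dl A x) *s x + symp x m *s dl A x) $ j"
    by (simp only: symp_cramer[of x "dl A x" m])
   hence "symp x (dl A x) * m $ j = symp m (dl A x) * x $ j + symp x m * dl A x $ j" by simp
   hence "i * (symp x (dl A x) * m $ j) = i * (symp m (dl A x) * x $ j + symp x m * dl A x $ j)" by simp
   thus ?thesis by (simp add: algebra_simps)
  qed
  thus ?thesis unfolding vc_def using i E' by simp
 qed
 hence "vc (P * E) (P *s m) (P *s ((i * symp x m) *s dl A x))"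
  by (rule vc_mult)
 thus ?thesis unfolding mem_Lat_conv PP(2) by (auto simp: vector_smult_assoc)
qed

text \<open>Isotropy holds because \<open>P' * P'\<close> and \<open>P * P'\<close> are multiples of
  \<open>N\<close> and the tangent vector pairs trivially with itself. For self-duality, pairing
  with \<open>P' *s m\<close> forces divisibility by \<open>P\<close>, and pairing with the tangent
  generator then gives the hypothesis of \<open>parallel_mod_E\<close>.\<close>

lemma lagrangian_Lat:
 assumes "good x"
 shows "lagrangian N (Lat x)"
 unfolding lagrangian_def
proof (intro conjI ballI allI impI)
 show "0 \<in> Lat x" using P'_lattice[of 0] by simp
next
 fix a b assume "a \<in> Lat x" "b \<in> Lat x"
 then obtain m s m' s' where ab: "a = P' *s m + (P * s) *s dl A x" "b = P' *s m' + (P * s') *s dl A x"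
  unfolding Lat_def by blast
 have "a + b = P' *s (m + m') + (P * (s + s')) *s dl A x"
  by (simp add: ab vec_eq_iff forall_2 algebra_simps)
 thus "a + b \<in> Lat x" unfolding Lat_def by blast
 have "symp a b = P * P' * (E * symp m m' + s' * symp m (dl A x) + s * symp (dl A x) m')"
  by (simp add: ab symp_simps symp_smult algebra_simps) (simp add: PP(2) algebra_simps)
 thus "int N dvd symp a b" by (simp add: PP(1))
next
 fix a assume "a \<in> Lat x"
 then obtain m s where a: "a = P' *s m + (P * s) *s dl A x"
  unfolding Lat_def by blast
 have "- a = P' *s (- m) + (P * (- s)) *s dl A x"
  by (simp add: a vec_eq_iff forall_2 algebra_simps)
 thus "- a \<in> Lat x" unfolding Lat_def by blast
next
 fix a b assume "vc (int N) a b" "a \<in> Lat x"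
 thus "b \<in> Lat x"
  unfolding mem_Lat_conv using vc_dvd[OF vc_sym P'_dvd_N] vc_trans by blast
next
 fix n assume n: "\<forall>a\<in>Lat x. int N dvd symp a n"
 have "P dvd n $ 1" "P dvd n $ 2"
 proof -
  have "int N dvd symp (P' *s vector [0, - 1]) n" "int N dvd symp (P' *s vector [1, 0]) n"
   using n P'_lattice by blast+
  hence "P' * P dvd P' * n $ 1" "P' * P dvd P' * n $ 2"
   unfolding symp_smult PP(1) by (simp_all add: symp_def mult.commute)
  thus "P dvd n $ 1" "P dvd n $ 2" using P_pos by simp_all
 qed
 hence "vc P n 0" by (simp add: vc_def)
 then obtain m where m: "n = P *s m" unfolding vc_iff_smult by auto
 have "int N dvd symp ((P * 1) *s dl A x) n" using n dl_lattice by blast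
 hence "P * P * E dvd P * P * symp (dl A x) m"
  by (simp add: m symp_smult PP(1) PP(2) mult.assoc)
 hence "E dvd symp (dl A x) m" using P_pos by simp
 thus "n \<in> Lat x" unfolding m by (rule parallel_mod_E[OF assms])
qed

text \<open>The coordinates of \<open>y\<close> in the basis \<open>x\<close>, \<open>dl A x\<close>
  give an element moving \<open>x\<close> to \<open>y\<close> modulo \<open>N\<close>; its norm is 1
  modulo \<open>p^j\<close> because the levels agree there. A scalar that is 1 modulo
  \<open>p^j\<close> corrects the norm to 1 modulo \<open>N\<close> without disturbing the image
  modulo \<open>p^j\<close>.\<close>

lemma transitive:
 assumes "good x" "int (p ^ j) dvd Q_form A x - Q_form A y" "0 < j" "j \<le> 2 * l + e"
 obtains c d where "hecke c d" "vc (int (p ^ j)) (act A c d x) y"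
proof -
 obtain i where i: "int N dvd i * symp x (dl A x) - 1"
  using prime_power_inverse[OF prime_p symp_dl_unit[OF assms(1)]] unfolding N_def by blast
 define c d where "c = i * symp y (dl A x)" and "d = i * symp x y"
 have vc1: "vc (int N) (act A c d x) y"
 proof -
  have "act A c d x $ j - y $ j = (i * symp x (dl A x) - 1) * y $ j" for j
  proof -
   have "(symp x (dl A x) *s y) $ j = (symp y (dl A x) *s x + symp x y *s dl A x) $ j"
    by (simp only: symp_cramer[of x "dl A x" y])
   hence "symp x (dl A x) * y $ j = symp y (dl A x) * x $ j + symp x y * dl A x $ j" by simp
   hence "i * (symp x (dl A x) * y $ j) = i * (symp y (dl A x) * x $ j + symp x y * dl A x $ j)" by simp
   thus ?thesis by (simp add: act_def c_def d_def algebra_simps)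
  qed
  thus ?thesis unfolding vc_def using i by simp
 qed
 have jN: "int (p ^ j) dvd int N"
  using assms(4) by (simp only: N_def int_dvd_int_iff le_imp_power_dvd)
 have "int (p ^ j) dvd (nrm A c d * Q_form A x - Q_form A y)"
  using vc_Q_form[OF vc1, of A] jN dvd_trans by (simp add: Q_form_act) blast
 hence "int (p ^ j) dvd (nrm A c d * Q_form A x - Q_form A y) - (Q_form A x - Q_form A y)"
  using assms(2) by (rule dvd_diff)
 hence "int (p ^ j) dvd Q_form A x * (nrm A c d - 1)"
  by (simp add: algebra_simps)
 hence nrm1: "int (p ^ j) dvd nrm A c d - 1"
  using prime_power_dvd_cancel[OF prime_p] assms(1) unfolding good_def by blast
 moreover have "int p dvd int (p ^ j)" using assms(3) by simp
 ultimately have "int p dvd nrm A c d - 1" by (meson dvd_trans)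
 then obtain a where a: "int (p ^ j) dvd a - 1" "int N dvd a\<^sup>2 * nrm A c d - 1"
  using one_unit_sqrt[OF odd_p _ nrm1] unfolding N_def by metis
 have "hecke (a * c) (a * d)"
  using a(2) by (simp add: hecke_def nrm_def power_mult_distrib algebra_simps)
 moreover have "vc (int (p ^ j)) (act A (a * c) (a * d) x) y"
 proof (rule vc_trans)
  show "vc (int (p ^ j)) (act A c d x) y" using vc1 jN by (rule vc_dvd)
  have "act A (a * c) (a * d) x $ i - act A c d x $ i = (a - 1) * act A c d x $ i" for i
   by (simp add: act_def algebra_simps)
  thus "vc (int (p ^ j)) (act A (a * c) (a * d) x) (act A c d x)"
   unfolding vc_def using a(1) by simp
 qed
 ultimately show ?thesis using that by blast
qed

text \<open>Pairing with \<open>dl A x\<close> and with \<open>x\<close> reads off the two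
  coordinates, up to the unit \<open>symp x (dl A x)\<close>.\<close>

lemma act_free:
 assumes "good x" "vc (int (p ^ j)) (act A c d x) x"
 shows "int (p ^ j) dvd c - 1" "int (p ^ j) dvd d"
proof -
 have "int (p ^ j) dvd symp (act A c d x) (dl A x) - symp x (dl A x)"
  "int (p ^ j) dvd symp x (act A c d x) - symp x x"
  using assms(2) by (auto intro: vc_symp)
 hence "int (p ^ j) dvd symp x (dl A x) * (c - 1)" "int (p ^ j) dvd symp x (dl A x) * d"
  by (simp_all add: act_def symp_simps symp_smult algebra_simps)
 thus "int (p ^ j) dvd c - 1" "int (p ^ j) dvd d"
  using prime_power_dvd_cancel[OF prime_p symp_dl_unit[OF assms(1)]] by blast+
qed

text \<open>Moving \<open>x\<close> by a multiple of \<open>P\<close> changes the tangent generator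
  by a multiple of \<open>P * P\<close>, hence of \<open>P'\<close>.\<close>

lemma Lat_cong:
 assumes "vc P x y"
 shows "Lat x = Lat y"
proof -
 have "Lat x \<subseteq> Lat y" if "vc P x y" for x y
 proof
  fix n assume "n \<in> Lat x"
  then obtain s where s: "vc P' n ((P * s) *s dl A x)" unfolding mem_Lat_conv ..
  have "vc (P * P) ((P * s) *s dl A x) ((P * s) *s dl A y)"
   using vc_mult[OF vc_scale[OF vc_dl[OF that, of A], of s], of P] by (simp add: vector_smult_assoc)
  thus "n \<in> Lat y"
   unfolding mem_Lat_conv using vc_trans[OF s] vc_dvd[OF _ P'_dvd_PP] by blast
 qed
 thus ?thesis using assms vc_sym by blast
qed

text \<open>The classes of this relation label the states: two points of a cell have the same
  lattice and induce the same character on it.\<close>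

definition same_cell :: "int ^ 2 \<Rightarrow> int ^ 2 \<Rightarrow> bool" where
 "same_cell x y \<longleftrightarrow> vc P x y \<and> P' dvd Q_form A x - Q_form A y"

lemma same_cell_diff:
 assumes "good x" "same_cell x y"
 shows "y - x \<in> Lat x"
proof -
 obtain m where m: "y = x + P *s m"
  using assms(2) vc_sym unfolding same_cell_def vc_iff_smult by blast
 have "P' dvd P * symp (dl A x) m + P * P * Q_form A m"
 proof -
  have "Q_form A y - Q_form A x = P * symp (dl A x) m + P * P * Q_form A m"
   by (simp add: m Q_form_add symp_smult Q_form_smult power2_eq_square)
  thus ?thesis using assms(2) unfolding same_cell_def by (metis dvd_diff_commute)
 qed
 hence "P' dvd P * symp (dl A x) m"
  using P'_dvd_PP by (metis dvd_add_left_iff dvd_mult2)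
 hence "E dvd symp (dl A x) m" using P_pos by (simp add: PP(2))
 thus ?thesis using parallel_mod_E[OF assms(1)] by (simp add: m)
qed

lemma same_cell_joint_eig:
 assumes "good x" "same_cell x y" "joint_eig N (Lat x) x \<phi>"
 shows "joint_eig N (Lat y) y \<phi>"
proof -
 have Lat: "Lat y = Lat x" using assms(2) Lat_cong unfolding same_cell_def by blast
 have "e_N N (symp m x) = e_N N (symp m y)" if "m \<in> Lat x" for m
 proof (rule e_N_cong[OF N_pos])
  have "int N dvd symp m (y - x)"
   by (rule lagrangianD(5)[OF lagrangian_Lat[OF assms(1)] that same_cell_diff[OF assms(1,2)]])
  thus "int N dvd symp m x - symp m y"
   by (simp add: symp_simps dvd_diff_commute)
 qed
 thus ?thesis using assms(3) by (simp add: joint_eig_def Lat)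
qed

section \<open>States attached to points and the Hecke action on them\<close>

definition vs :: "int ^ 2 \<Rightarrow> int \<Rightarrow> complex" where
 "vs x = (SOME v. joint_eig N (Lat x) x v \<and> ip N v v = 1)"

lemma
 assumes "good x"
 shows vs_eig: "joint_eig N (Lat x) x (vs x)" and vs_unit: "ip N (vs x) (vs x) = 1"
  and vs_H: "vs x \<in> H_N N"
 using someI_ex[OF lagrangian_eigenvector[OF odd_N lagrangian_Lat[OF assms], of x]]
 by (simp_all add: vs_def joint_eig_def)

lemma vs_unique:
 assumes "good x" "joint_eig N (Lat x) x \<phi>"
 obtains a where "\<phi> = scl a (vs x)" "a * cnj a = ip N \<phi> \<phi>"
proof -
 have "\<phi> = scl (ip N \<phi> (vs x)) (vs x)"
  using lagrangian_unique(2)[OF odd_N lagrangian_Lat vs_eig vs_unit] assms by blast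
 moreover from this have "ip N \<phi> \<phi> = ip N \<phi> (vs x) * cnj (ip N \<phi> (vs x))"
  using vs_unit[OF assms(1)] by (metis ip_scl_left ip_scl_right mult.right_neutral cnj_ip)
 ultimately show ?thesis using that by metis
qed

lemma act_Lat: "m \<in> Lat x \<Longrightarrow> act A c d m \<in> Lat (act A c d x)"
proof -
 assume "m \<in> Lat x"
 then obtain r s where m: "m = P' *s r + (P * s) *s dl A x" unfolding Lat_def by blast
 have "act A c d m = P' *s act A c d r + (P * s) *s dl A (act A c d x)"
  by (simp add: m act_def dl_linear dl_dl) (simp add: vec_eq_iff forall_2 algebra_simps)
 thus ?thesis unfolding Lat_def by blast
qed

text \<open>The Egorov relation reads \<open>U(g)^(-1) T(n) U(g) = T(ng)\<close>, so
  \<open>UM c d\<close> carries eigenvectors at the image point back to eigenvectors at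
  \<open>x\<close>. The character is preserved since the norm is 1 modulo \<open>N\<close>.\<close>

lemma UM_joint_eig:
 assumes "hecke c d" "joint_eig N (Lat (act A c d x)) (act A c d x) \<phi>"
 shows "joint_eig N (Lat x) x (UM c d \<phi>)"
 unfolding joint_eig_def
proof (intro conjI ballI)
 have \<phi>: "\<phi> \<in> H_N N" using assms(2) by (simp add: joint_eig_def)
 thus "UM c d \<phi> \<in> H_N N" by (rule UM_H[OF assms(1)])
 fix m assume "m \<in> Lat x"
 hence "twisted_T N (act A c d m) \<phi> = scl (e_N N (symp (act A c d m) (act A c d x))) \<phi>"
  using assms(2) act_Lat unfolding joint_eig_def by blast
 moreover have "e_N N (symp (act A c d m) (act A c d x)) = e_N N (symp m x)"
 proof (rule e_N_cong[OF N_pos])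
  have "symp (act A c d m) (act A c d x) - symp m x = (nrm A c d - 1) * symp m x"
   by (simp add: symp_act algebra_simps)
  thus "int N dvd symp (act A c d m) (act A c d x) - symp m x"
   using assms(1) by (simp add: hecke_def)
 qed
 ultimately show "twisted_T N m (UM c d \<phi>) = scl (e_N N (symp m x)) (UM c d \<phi>)"
  by (simp add: UM_T[OF assms(1) \<phi>] UM_scl[OF assms(1) \<phi>])
qed

lemma hecke_Q: "hecke c d \<Longrightarrow> int N dvd Q_form A (act A c d x) - Q_form A x"
proof -
 have "Q_form A (act A c d x) - Q_form A x = (nrm A c d - 1) * Q_form A x"
  by (simp add: Q_form_act algebra_simps)
 thus "hecke c d \<Longrightarrow> ?thesis" by (simp add: hecke_def)
qed

lemma hecke_good: "hecke c d \<Longrightarrow> good x \<Longrightarrow> good (act A c d x)"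
 using good_cong[of x "act A c d x"] hecke_Q[of c d x] P_dvd_N dvd_trans dvd_diff_commute by blast

lemma UM_vs:
 assumes "hecke c d" "good x" "good y" "same_cell y (act A c d x)"
 obtains a where "UM c d (vs y) = scl a (vs x)" "a * cnj a = 1"
proof -
 have "joint_eig N (Lat x) x (UM c d (vs y))"
  by (intro UM_joint_eig[OF assms(1)] same_cell_joint_eig[OF assms(3,4)] vs_eig[OF assms(3)])
 moreover have "ip N (UM c d (vs y)) (UM c d (vs y)) = 1"
  using UM_ip[OF assms(1) vs_H[OF assms(3)] vs_H[OF assms(3)]] vs_unit[OF assms(3)] by simp
 ultimately show ?thesis using vs_unique[OF assms(2)] that by metis
qed

lemma UM_vs_same:
 assumes "hecke c d" "good x" "vc P (act A c d x) x"
 obtains a where "UM c d (vs x) = scl a (vs x)" "a * cnj a = 1"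
proof (rule UM_vs[OF assms(1,2,2)])
 show "same_cell x (act A c d x)"
  using assms(3) hecke_Q[OF assms(1), of x] P'_dvd_N dvd_trans dvd_diff_commute
  unfolding same_cell_def by (blast intro: vc_sym)
qed

lemma T_vs_shift:
 assumes "good x" "m \<in> Lat x"
 shows "twisted_T N (n + m) (vs x) = scl (e_N N (symp m x - half N * symp n m)) (twisted_T N n (vs x))"
proof -
 have "twisted_T N n (twisted_T N m (vs x)) = scl (e_N N (half N * symp n m)) (twisted_T N (n + m) (vs x))"
  by (rule twisted_T_comp[OF odd_N])
 moreover have "twisted_T N m (vs x) = scl (e_N N (symp m x)) (vs x)"
  using vs_eig[OF assms(1)] assms(2) by (simp add: joint_eig_def)
 ultimately have "scl (e_N N (- (half N * symp n m))) (scl (e_N N (symp m x)) (twisted_T N n (vs x)))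
   = scl (e_N N (- (half N * symp n m))) (scl (e_N N (half N * symp n m)) (twisted_T N (n + m) (vs x)))"
  by (simp add: twisted_T_scl)
 thus ?thesis by (simp flip: e_N_add add: add.commute)
qed

section \<open>Types of Hecke eigenfunctions\<close>

definition hecke_fun :: "(int \<Rightarrow> complex) \<Rightarrow> bool" where
 "hecke_fun \<psi> \<longleftrightarrow> \<psi> \<in> H_N N \<and> ip N \<psi> \<psi> = 1 \<and> (\<forall>c d. hecke c d \<longrightarrow> (\<exists>a. UM c d \<psi> = scl a \<psi>))"

lemma eigenvalues_eq:
 assumes "hecke c d" "hecke_fun \<psi>" "\<phi>1 \<in> H_N N" "\<phi>2 \<in> H_N N" "UM c d \<phi>1 = scl a \<phi>1" "UM c d \<phi>2 = scl b \<phi>2"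
  "ip N \<psi> \<phi>1 \<noteq> 0" "ip N \<psi> \<phi>2 \<noteq> 0"
 shows "a = b"
proof -
 obtain \<kappa> where \<kappa>: "UM c d \<psi> = scl \<kappa> \<psi>" using assms(1,2) unfolding hecke_fun_def by blast
 have \<psi>: "\<psi> \<in> H_N N" using assms(2) by (simp add: hecke_fun_def)
 have "\<kappa> * cnj a = 1" "\<kappa> * cnj b = 1"
  using unitary_eigenvalues[OF UM_ip[OF assms(1) \<psi> assms(3)] \<kappa> assms(5,7)]
   unitary_eigenvalues[OF UM_ip[OF assms(1) \<psi> assms(4)] \<kappa> assms(6,8)] by auto
 hence "cnj a = cnj b" by (metis mult_cancel_left mult_zero_left zero_neq_one)
 thus ?thesis by simp
qed

text \<open>The element \<open>1 + P' * dl\<close> fixes the state at \<open>x\<close> up to a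
  phase; on its translate by \<open>n\<close> it has the additional eigenvalue \<open>e_N\<close> of
  \<open>-P' (Q(x+n) - Q(x))\<close>. An eigenfunction has one eigenvalue only, so all translates
  that meet it share \<open>Q\<close> modulo \<open>P\<close>.\<close>

lemma hecke_type_mod_P:
 assumes "good x" "hecke_fun \<psi>" "ip N \<psi> (twisted_T N n (vs x)) \<noteq> 0" "ip N \<psi> (twisted_T N n' (vs x)) \<noteq> 0"
 shows "P dvd Q_form A (x + n) - Q_form A (x + n')"
proof -
 have hk: "hecke 1 P'"
 proof -
  have "nrm A 1 P' - 1 = P * P' * (- disc A * E)"
   by (simp add: nrm_def power2_eq_square) (simp add: PP(2))
  thus ?thesis by (simp add: hecke_def PP(1))
 qed
 have "vc P (act A 1 P' x) x"
  unfolding vc_def act_def using P_dvd_P' by simp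
 then obtain a where a: "UM 1 P' (vs x) = scl a (vs x)" "a * cnj a = 1"
  using UM_vs_same[OF hk assms(1)] by metis
 have eig: "UM 1 P' (twisted_T N n (vs x))
   = scl (a * e_N N (- (P' * (Q_form A (x + n) - Q_form A x)))) (twisted_T N n (vs x))" for n
 proof -
  define m where "m = - (P' *s dl A n)"
  have m: "m \<in> Lat x" using P'_lattice[of "- dl A n"] by (simp add: m_def vec_eq_iff)
  have "UM 1 P' (twisted_T N n (vs x)) = twisted_T N (act A 1 (- P') n) (scl a (vs x))"
   by (simp add: UM_T'[OF hk vs_H[OF assms(1)]] a(1))
  also have "act A 1 (- P') n = n + m"
   by (simp add: act_def m_def vec_eq_iff)
  also have "twisted_T N (n + m) (scl a (vs x))
    = scl (a * e_N N (symp m x - half N * symp n m)) (twisted_T N n (vs x))"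
   by (simp add: twisted_T_scl T_vs_shift[OF assms(1) m])
  also have "e_N N (symp m x - half N * symp n m) = e_N N (- (P' * (Q_form A (x + n) - Q_form A x)))"
  proof (rule e_N_cong[OF N_pos])
   have "symp n m = P' * (2 * Q_form A n)"
    using symp_dl_self[of A n] symp_flip[of n "dl A n"] by (simp add: m_def symp_simps symp_smult)
   moreover have "symp m x = - (P' * symp (dl A x) n)"
    using symp_flip[of x "dl A n"] symp_dl[of A x n] by (simp add: m_def symp_simps symp_smult)
   ultimately have "symp m x - half N * symp n m - - (P' * (Q_form A (x + n) - Q_form A x))
     = (1 - 2 * half N) * (P' * Q_form A n)"
    by (simp add: Q_form_add[of A x n]) (simp add: algebra_simps)
   thus "int N dvd symp m x - half N * symp n m - - (P' * (Q_form A (x + n) - Q_form A x))"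
    by (simp add: two_half[OF odd_N])
  qed
  finally show ?thesis .
 qed
 have "a * e_N N (- (P' * (Q_form A (x + n) - Q_form A x))) = a * e_N N (- (P' * (Q_form A (x + n') - Q_form A x)))"
  by (rule eigenvalues_eq[OF hk assms(2) _ _ eig eig assms(3,4)]) (use odd_N vs_H[OF assms(1)] in auto)
 moreover have "a \<noteq> 0" using a(2) by auto
 ultimately have "e_N N (- (P' * (Q_form A (x + n) - Q_form A x))) = e_N N (- (P' * (Q_form A (x + n') - Q_form A x)))"
  by simp
 hence "int N dvd - (P' * (Q_form A (x + n) - Q_form A x)) - - (P' * (Q_form A (x + n') - Q_form A x))"
  by (rule e_N_eqD[OF N_pos])
 hence "P' * P dvd P' * (Q_form A (x + n') - Q_form A (x + n))"
  by (simp add: PP(1) algebra_simps)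
 thus ?thesis using P_pos dvd_diff_commute by (simp add: dvd_diff_commute)
qed

text \<open>The operators \<open>T(P' m)\<close> alone already locate a state modulo
  \<open>P\<close>.\<close>

lemma joint_eig_P'_ip:
 assumes "joint_eig N (range ((*s) P')) x \<phi>" "joint_eig N (range ((*s) P')) y \<psi>" "ip N \<phi> \<psi> \<noteq> 0"
 shows "vc P x y"
proof -
 have "int N dvd symp (P' *s m) (x - y)" for m
  using joint_eig_ip[OF odd_N assms] by blast
 hence "P' * P dvd P' * symp m (x - y)" for m
  by (simp add: symp_smult PP(1) mult.commute)
 hence *: "P dvd symp m (x - y)" for m
  using P_pos by simp
 show ?thesis
  using *[of "vector [1, 0]"] *[of "vector [0, 1]"] by (simp add: symp_def vc_def dvd_diff_commute)
qed

lemma P'_range: "range ((*s) P') \<subseteq> Lat x"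
 using P'_lattice by blast

lemma vs_P'_eig: "good x \<Longrightarrow> joint_eig N (range ((*s) P')) x (vs x)"
 using joint_eig_subset[OF vs_eig P'_range] .

lemma T_vs_P'_eig: "good x \<Longrightarrow> joint_eig N (range ((*s) P')) (x + n) (twisted_T N n (vs x))"
 using joint_eig_shift[OF odd_N vs_P'_eig] .

lemma UM_overlap:
 assumes "hecke c d" "hecke_fun \<psi>" "good x" "good y" "same_cell y (act A c d x)"
 shows "norm (ip N \<psi> (vs y)) = norm (ip N \<psi> (vs x))"
proof -
 obtain a where a: "UM c d (vs y) = scl a (vs x)" "a * cnj a = 1"
  using UM_vs[OF assms(1,3-5)] .
 obtain \<kappa> where \<kappa>: "UM c d \<psi> = scl \<kappa> \<psi>" using assms(1,2) unfolding hecke_fun_def by blast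
 have \<psi>: "\<psi> \<in> H_N N" "ip N \<psi> \<psi> = 1" using assms(2) by (simp_all add: hecke_fun_def)
 have \<kappa>1: "\<kappa> * cnj \<kappa> = 1"
  using UM_ip[OF assms(1) \<psi>(1) \<psi>(1)] \<psi>(2) by (simp add: \<kappa> mult.commute)
 have "ip N \<psi> (vs y) = \<kappa> * cnj a * ip N \<psi> (vs x)"
  using UM_ip[OF assms(1) \<psi>(1) vs_H[OF assms(4)]] by (simp add: \<kappa> a(1) mult_ac)
 moreover have "norm \<kappa> = 1" "norm a = 1"
  using \<kappa>1 a(2) by (simp_all add: norm_eq_1I)
 ultimately show ?thesis by (simp add: norm_mult)
qed

text \<open>The preceding congruence knows the level only modulo \<open>P\<close>. The factor
  \<open>E\<close> is detected by a Hecke element \<open>b + P * dl\<close>: once both points agree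
  modulo \<open>P\<close>, their displacement \<open>P m\<close> changes its eigenvalue by a
  character of \<open>symp (dl A z) m\<close>, the first-order change of the level.\<close>

lemma hecke_type:
 assumes "good x" "good y" "hecke_fun \<psi>" "ip N \<psi> (vs x) \<noteq> 0" "ip N \<psi> (vs y) \<noteq> 0"
 shows "P' dvd Q_form A x - Q_form A y"
proof -
 have \<psi>: "\<psi> \<in> H_N N" using assms(3) by (simp add: hecke_fun_def)
 have P: "P dvd Q_form A x - Q_form A y"
 proof -
  obtain n where n: "ip N \<psi> (twisted_T N n (vs x)) \<noteq> 0" "ip N (vs y) (twisted_T N n (vs x)) \<noteq> 0"
   using frame_overlap[OF odd_N \<psi> vs_H[OF assms(1)] vs_unit[OF assms(1)] assms(5)] .
  have "P dvd Q_form A (x + 0) - Q_form A (x + n)"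
   by (rule hecke_type_mod_P[OF assms(1,3)]) (use assms(4) n odd_N in auto)
  moreover have "vc P y (x + n)"
   by (rule joint_eig_P'_ip[OF vs_P'_eig[OF assms(2)] T_vs_P'_eig[OF assms(1)] n(2)])
  hence "P dvd Q_form A (x + n) - Q_form A y"
   using vc_Q_form[of P y "x + n" A] by (simp add: dvd_diff_commute)
  ultimately show ?thesis
   using dvd_add[of P "Q_form A x - Q_form A (x + n)" "Q_form A (x + n) - Q_form A y"] by simp
 qed
 then obtain c d where cd: "hecke c d" "vc P (act A c d x) y"
  using transitive[OF assms(1), of l y] l_pos unfolding P_def by auto
 define z where "z = act A c d x"
 have z: "good z" unfolding z_def by (rule hecke_good[OF cd(1) assms(1)])
 have "same_cell z (act A c d x)" by (simp add: z_def same_cell_def)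
 hence ipz: "ip N \<psi> (vs z) \<noteq> 0"
  using UM_overlap[OF cd(1) assms(3,1) z] assms(4) by (metis norm_eq_zero)
 obtain m where m: "y = z + P *s m"
  using vc_sym[OF cd(2)] unfolding z_def vc_iff_smult by blast
 \<comment> \<open>The first-order expansion of \<open>sqrt (1 + disc A * P^2)\<close>, with
   \<open>half N\<close> in place of \<open>1/2\<close>; the error is a multiple of
   \<open>P^4\<close> and vanishes modulo \<open>N\<close>.\<close>
 define b where "b = 1 + half N * (P * P) * disc A"
 have hk: "hecke b P"
 proof -
  have "nrm A b P - 1 = (2 * half N - 1) * (P * P * disc A) + P * P * P * (P * (half N * disc A)\<^sup>2)"
   by (simp add: nrm_def b_def power2_eq_square algebra_simps)
  thus ?thesis
   unfolding hecke_def two_half[OF odd_N] using N_dvd_PPP by (simp add: dvd_add)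
 qed
 have "vc P (act A b P z) z"
  by (simp add: vc_def act_def b_def algebra_simps)
 then obtain a where a: "UM b P (vs z) = scl a (vs z)" "a * cnj a = 1"
  using UM_vs_same[OF hk z] by metis
 define n \<mu> where "n = P *s m" and "\<mu> = - ((P * P) *s dl A m)"
 have \<mu>: "\<mu> \<in> Lat z"
 proof -
  have "\<mu> = P' *s (- ((P div E) *s dl A m))"
   using E_dvd_P PP(2) by (auto simp: \<mu>_def vec_eq_iff)
  thus ?thesis using P'_lattice by metis
 qed
 have eig: "UM b P (twisted_T N n (vs z)) = scl (a * e_N N (symp \<mu> z)) (twisted_T N n (vs z))"
 proof -
  have "UM b P (twisted_T N n (vs z)) = scl a (twisted_T N (act A b (- P) n) (vs z))"
   by (simp add: UM_T'[OF hk vs_H[OF z]] a(1) twisted_T_scl)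
  also have "twisted_T N (act A b (- P) n) (vs z) = twisted_T N (n + \<mu>) (vs z)"
  proof (rule twisted_T_cong[OF odd_N _ vs_H[OF z]])
   have "act A b (- P) n $ i - (n + \<mu>) $ i = P * P * P * (half N * disc A * m $ i)" for i
    by (simp add: act_def b_def n_def \<mu>_def dl_linear algebra_simps)
   thus "vc (int N) (act A b (- P) n) (n + \<mu>)"
    unfolding vc_def using N_dvd_PPP by simp
  qed
  also have "twisted_T N (n + \<mu>) (vs z) = scl (e_N N (symp \<mu> z - half N * symp n \<mu>)) (twisted_T N n (vs z))"
   by (rule T_vs_shift[OF z \<mu>])
  also have "e_N N (symp \<mu> z - half N * symp n \<mu>) = e_N N (symp \<mu> z)"
  proof (rule e_N_cong[OF N_pos])
   have "half N * symp n \<mu> = P * P * P * (- half N * symp m (dl A m))"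
    by (simp add: n_def \<mu>_def symp_simps symp_smult)
   thus "int N dvd symp \<mu> z - half N * symp n \<mu> - symp \<mu> z"
    using N_dvd_PPP by simp
  qed
  finally show ?thesis by simp
 qed
 have "ip N \<psi> (twisted_T N n (vs z)) \<noteq> 0"
 proof -
  have "Lat z = Lat y"
   by (rule Lat_cong) (auto simp: m vc_def)
  hence "joint_eig N (Lat y) y (twisted_T N n (vs z))"
   using joint_eig_shift[OF odd_N vs_eig[OF z], of n] by (simp add: m n_def)
  then obtain r where r: "twisted_T N n (vs z) = scl r (vs y)"
    "r * cnj r = ip N (twisted_T N n (vs z)) (twisted_T N n (vs z))"
   using vs_unique[OF assms(2)] by blast
  hence "r \<noteq> 0"
   using ip_twisted_T_iso[OF odd_N vs_H[OF z] vs_H[OF z], of n] vs_unit[OF z] by auto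
  thus ?thesis using assms(5) by (simp add: r(1))
 qed
 hence "a = a * e_N N (symp \<mu> z)"
  by (intro eigenvalues_eq[OF hk assms(3) _ _ a(1) eig ipz]) (use vs_H[OF z] odd_N in auto)
 hence "e_N N (symp \<mu> z) = 1" using a(2) by (metis mult_cancel_left mult.right_neutral mult_zero_left zero_neq_one)
 hence "int N dvd symp \<mu> z" by (simp add: e_N_eq_1_iff[OF N_pos])
 hence "P * P * E dvd P * P * (- symp (dl A m) z)"
  by (simp add: \<mu>_def symp_simps symp_smult PP(1) PP(2) mult.assoc)
 hence "E dvd - symp (dl A m) z" using P_pos by (metis dvd_mult_cancel_left less_irrefl mult_eq_0_iff)
 moreover have "symp (dl A m) z = symp (dl A z) m"
  using symp_flip[of m "dl A z"] by (simp add: symp_dl[of A m])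
 ultimately have "P' dvd P * symp (dl A z) m" by (simp add: PP(2))
 hence "P' dvd Q_form A y - Q_form A z"
  using P'_dvd_PP by (simp add: m Q_form_add symp_smult Q_form_smult power2_eq_square dvd_add)
 moreover have "P' dvd Q_form A z - Q_form A x"
  using hecke_Q[OF cd(1), of x] P'_dvd_N dvd_trans unfolding z_def by blast
 ultimately have "P' dvd Q_form A y - Q_form A x"
  using dvd_add[of P' "Q_form A y - Q_form A z" "Q_form A z - Q_form A x"] by simp
 thus ?thesis by (simp add: dvd_diff_commute)
qed

end

section \<open>Stepanov's bound for sums of Legendre symbols\<close>

lemma higher_pderiv_root_power:
 fixes G :: "int poly"
 shows "poly ((pderiv ^^ j) ([:- y, 1:] ^ j * G)) y = fact j * poly G y"
proof (induction j arbitrary: G)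
 case (Suc j)
 have "pderiv ([:- y, 1:] ^ Suc j * G)
   = [:- y, 1:] ^ j * (smult (of_nat (Suc j)) G + [:- y, 1:] * pderiv G)"
  unfolding pderiv_mult pderiv_power_Suc by (simp add: pderiv_pCons algebra_simps)
 hence "poly ((pderiv ^^ Suc j) ([:- y, 1:] ^ Suc j * G)) y
   = poly ((pderiv ^^ j) ([:- y, 1:] ^ j * (smult (of_nat (Suc j)) G + [:- y, 1:] * pderiv G))) y"
  by (simp only: funpow_Suc_right o_apply)
 also have "\<dots> = fact j * poly (smult (of_nat (Suc j)) G + [:- y, 1:] * pderiv G) y"
  by (rule Suc.IH)
 also have "\<dots> = fact (Suc j) * poly G y"
  by (simp add: algebra_simps)
 finally show ?case .
qed simp

lemma pderiv_sum': "pderiv (sum f A) = (\<Sum>x\<in>A. pderiv (f x))"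
 using higher_pderiv_sum[of 1 f A] by simp

lemma fermat_int:
 assumes "prime (p :: nat)" "\<not> int p dvd a"
 shows "[a ^ (p - 1) = 1] (mod int p)"
proof -
 define n where "n = nat (a mod int p)"
 have p: "int p > 0" using assms(1) by (simp add: prime_gt_0_nat)
 have n: "[a = int n] (mod int p)" using p by (simp add: n_def cong_def)
 hence "\<not> int p dvd int n" using assms(2) by (simp add: cong_dvd_iff)
 hence "\<not> p dvd n" by simp
 hence "[n ^ (p - 1) = 1] (mod p)" by (rule fermat_theorem[OF assms(1)])
 hence "[int (n ^ (p - 1)) = int 1] (mod int p)" by (simp only: cong_int_iff)
 hence "[int n ^ (p - 1) = 1] (mod int p)" by simp
 thus ?thesis using cong_trans[OF cong_pow[OF n]] by blast
qed

text \<open>Divisibility by the constant polynomial \<open>[:p:]\<close> stands for vanishing in the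
  polynomial ring modulo \<open>p\<close>; integer polynomials are kept throughout.\<close>

lemma const_dvd_pderiv:
 fixes F :: "int poly"
 shows "[:c:] dvd F \<Longrightarrow> [:c:] dvd pderiv F"
 by (simp add: const_poly_dvd_iff coeff_pderiv)

lemma const_dvd_higher_pderiv:
 fixes F :: "int poly"
 shows "[:c:] dvd F \<Longrightarrow> [:c:] dvd (pderiv ^^ k) F"
 by (induction k) (auto intro: const_dvd_pderiv)

lemma higher_pderiv_diff':
 fixes F G :: "int poly"
 shows "(pderiv ^^ k) (F - G) = (pderiv ^^ k) F - (pderiv ^^ k) G"
 by (induction k) (simp_all add: pderiv_diff)

lemma const_dvd_poly:
 fixes F :: "int poly"
 shows "[:c:] dvd F \<Longrightarrow> c dvd poly F x"
 by (auto elim!: dvdE)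

lemma prime_not_dvd_fact:
 assumes "prime (p :: nat)" "j < p"
 shows "\<not> int p dvd fact j"
proof
 assume "int p dvd fact j"
 hence "p dvd fact j" by (metis of_nat_fact int_dvd_int_iff)
 thus False using assms by (simp add: prime_dvd_fact_iff)
qed

text \<open>Ordinary derivatives detect multiplicities up to \<open>p\<close>, because
  \<open>j!\<close> is a unit modulo \<open>p\<close> for \<open>j < p\<close>. The roots are
  treated one at a time: the product \<open>M\<close> of the factors of the earlier roots is a unit
  at \<open>y\<close>, so the \<open>j\<close>-th derivative forces the cofactor to vanish at
  \<open>y\<close> and one more linear factor splits off.\<close>

lemma roots_mod_prime:
 fixes R :: "int poly"
 assumes p: "prime (p :: nat)" and L: "L \<le> p" and X: "finite X" "\<And>x y. x \<in> X \<Longrightarrow> y \<in> X \<Longrightarrow> int p dvd x - y \<Longrightarrow> x = y"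
  and D: "\<And>x k. x \<in> X \<Longrightarrow> k < L \<Longrightarrow> int p dvd poly ((pderiv ^^ k) R) x"
 shows "\<exists>S. [:int p:] dvd R - (\<Prod>x\<in>X. [:- x, 1:] ^ L) * S"
 using X D
proof (induction X rule: finite_induct)
 case empty
 show ?case by (rule exI[of _ R]) simp
next
 case (insert y X)
 obtain S where S: "[:int p:] dvd R - (\<Prod>x\<in>X. [:- x, 1:] ^ L) * S"
  using insert.IH insert.prems by auto
 define M where "M = (\<Prod>x\<in>X. [:- x, 1:] ^ L)"
 have My: "\<not> int p dvd poly M y"
 proof
  assume "int p dvd poly M y"
  hence "int p dvd (\<Prod>x\<in>X. (y - x) ^ L)" by (simp add: M_def poly_prod)
  then obtain x where "x \<in> X" "int p dvd (y - x) ^ L"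
   using p insert.hyps(1) prime_dvd_prod_iff[of X "int p"] by auto
  hence "int p dvd y - x" using p prime_dvd_power by (metis prime_nat_int_transfer)
  hence "y = x" using insert.prems(1) \<open>x \<in> X\<close> by blast
  thus False using insert.hyps(2) \<open>x \<in> X\<close> by blast
 qed
 have "\<exists>S'. [:int p:] dvd R - M * ([:- y, 1:] ^ j * S')" if "j \<le> L" for j
  using that
 proof (induction j)
  case 0
  thus ?case using S by (auto simp: M_def)
 next
  case (Suc j)
  then obtain S' where S': "[:int p:] dvd R - [:- y, 1:] ^ j * (M * S')"
   by (auto simp: mult_ac)
  have "int p dvd poly ((pderiv ^^ j) (R - [:- y, 1:] ^ j * (M * S'))) y"
   by (rule const_dvd_poly[OF const_dvd_higher_pderiv[OF S']])
  moreover have "int p dvd poly ((pderiv ^^ j) R) y"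
   using insert.prems(2)[of y j] Suc.prems by simp
  ultimately have "int p dvd poly ((pderiv ^^ j) R) y - poly ((pderiv ^^ j) (R - [:- y, 1:] ^ j * (M * S'))) y"
   by (intro dvd_diff)
  hence "int p dvd fact j * (poly M y * poly S' y)"
   by (simp add: higher_pderiv_diff' higher_pderiv_root_power)
  hence pS': "int p dvd poly S' y"
   using p My prime_not_dvd_fact[OF p, of j] Suc.prems L by (auto simp: prime_dvd_mult_iff)
  define lin c T where "lin = [:- y, 1:]" and "c = [:poly S' y:]" and "T = synthetic_div S' y"
  have T: "S' = lin * T + c"
   using synthetic_div_correct'[of y S'] by (simp add: lin_def c_def T_def)
  have "lin ^ j * (M * S') = M * (lin ^ Suc j * T) + lin ^ j * M * c"
   by (subst T) (simp add: algebra_simps)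
  hence "R - M * (lin ^ Suc j * T) = (R - lin ^ j * (M * S')) + lin ^ j * M * c"
   by simp
  hence "R - M * ([:- y, 1:] ^ Suc j * synthetic_div S' y)
    = (R - [:- y, 1:] ^ j * (M * S')) + [:- y, 1:] ^ j * M * [:poly S' y:]"
   unfolding lin_def c_def T_def .
  moreover have "[:int p:] dvd (R - [:- y, 1:] ^ j * (M * S')) + [:- y, 1:] ^ j * M * [:poly S' y:]"
   using pS' by (intro dvd_add[OF S'] dvd_mult) simp
  ultimately show ?case by metis
 qed
 from this[of L] show ?case
  using insert.hyps by (auto simp: M_def mult_ac)
qed

text \<open>With coefficients reduced to residues, a nonzero polynomial has a leading coefficient
  that is nonzero modulo \<open>c\<close>, so degrees can be compared as over a residue
  field.\<close>

lemma const_dvd_reduce: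
 fixes S :: "int poly"
 assumes "c > 0"
 obtains S' where "[:c:] dvd S - S'" "S' = 0 \<or> \<not> c dvd lead_coeff S'"
proof
 define S' where "S' = map_poly (\<lambda>a. a mod c) S"
 have co: "coeff S' n = coeff S n mod c" for n
  by (simp add: S'_def coeff_map_poly)
 show "[:c:] dvd S - S'"
  by (simp add: const_poly_dvd_iff co)
 show "S' = 0 \<or> \<not> c dvd lead_coeff S'"
 proof (rule ccontr)
  assume *: "\<not> (S' = 0 \<or> \<not> c dvd lead_coeff S')"
  hence "c dvd coeff S (degree S') mod c" by (simp add: co)
  hence "coeff S (degree S') mod c = 0" by (simp add: dvd_eq_mod_eq_0)
  hence "lead_coeff S' = 0" by (simp only: co)
  thus False using * by simp
 qed
qed

lemma card_roots_mod_prime: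
 fixes R :: "int poly"
 assumes "prime (p :: nat)" "L \<le> p" "finite X" "\<And>x y. x \<in> X \<Longrightarrow> y \<in> X \<Longrightarrow> int p dvd x - y \<Longrightarrow> x = y"
  and "\<And>x k. x \<in> X \<Longrightarrow> k < L \<Longrightarrow> int p dvd poly ((pderiv ^^ k) R) x"
  and "\<not> [:int p:] dvd R"
 shows "L * card X \<le> degree R"
proof -
 have p: "int p > 0" using assms(1) by (simp add: prime_gt_0_nat)
 define M where "M = (\<Prod>x\<in>X. [:- x, 1:] ^ L)"
 obtain S where S: "[:int p:] dvd R - M * S"
  using roots_mod_prime[OF assms(1-5)] unfolding M_def by blast
 obtain S' where S': "[:int p:] dvd S - S'" "S' = 0 \<or> \<not> int p dvd lead_coeff S'"
  using const_dvd_reduce[OF p] by blast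
 have "[:int p:] dvd (R - M * S) + M * (S - S')"
  by (intro dvd_add[OF S] dvd_mult[OF S'(1)])
 hence RS: "[:int p:] dvd R - M * S'" by (simp add: algebra_simps)
 hence "S' \<noteq> 0" using assms(6) by auto
 have lM: "lead_coeff M = 1" by (simp add: M_def lead_coeff_prod lead_coeff_power)
 have "degree M = (\<Sum>x\<in>X. degree ([:- x, 1:] ^ L))"
  unfolding M_def by (rule degree_prod_eq_sum_degree) simp
 also have "\<dots> = L * card X" by (simp add: degree_power_eq)
 finally have dM: "degree M = L * card X" .
 have "degree M \<le> degree R"
 proof (rule ccontr)
  assume "\<not> degree M \<le> degree R"
  hence "coeff R (degree M + degree S') = 0" by (intro coeff_eq_0) simp
  moreover have "int p dvd coeff (R - M * S') (degree M + degree S')"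
   using RS by (simp only: const_poly_dvd_iff)
  ultimately have "int p dvd lead_coeff M * lead_coeff S'"
   by (simp add: coeff_mult_degree_sum)
  thus False using S'(2) \<open>S' \<noteq> 0\<close> by (simp add: lM)
 qed
 thus ?thesis by (simp add: dM)
qed

text \<open>The polynomial factor in \<open>D^k (f^a * r) = f^(a-k) * dop f a k r\<close>. Splitting
  off the power of \<open>f\<close> keeps the degree growth at \<open>degree f\<close> per
  derivative, independently of the exponent \<open>a\<close>.\<close>

fun dop :: "int poly \<Rightarrow> int \<Rightarrow> nat \<Rightarrow> int poly \<Rightarrow> int poly" where
 "dop f a 0 r = r"
| "dop f a (Suc k) r = smult (a - int k) (pderiv f * dop f a k r) + f * pderiv (dop f a k r)"

lemma dop_diff: "dop f a k (r - s) = dop f a k r - dop f a k s"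
proof (induction k)
 case (Suc k)
 show ?case
  unfolding dop.simps Suc.IH pderiv_diff right_diff_distrib smult_diff_right by simp
qed simp

lemma degree_dop: "degree (dop f a k r) \<le> degree r + k * degree f"
proof (induction k)
 case (Suc k)
 have 1: "degree (smult (a - int k) (pderiv f * dop f a k r)) \<le> degree f + (degree r + k * degree f)"
  using Suc degree_mult_le[of "pderiv f" "dop f a k r"] degree_pderiv[of f]
  by (intro order_trans[OF degree_smult_le]) simp
 have 2: "degree (f * pderiv (dop f a k r)) \<le> degree f + (degree r + k * degree f)"
  using Suc degree_mult_le[of f "pderiv (dop f a k r)"] degree_pderiv[of "dop f a k r"] by simp
 show ?case using degree_add_le[OF 1 2] by (simp add: add_ac)
qed simp

lemma pderiv_monom_p: "[:int p:] dvd pderiv (monom 1 (j * p))"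
 by (simp add: pderiv_monom const_poly_dvd_iff)

text \<open>The powers \<open>x^(j p)\<close> have derivative 0 modulo \<open>p\<close> and behave
  like constants. Each derivative therefore uses up one factor of the prefactor \<open>f^L\<close>
  and acts on the rest through \<open>dop\<close>.\<close>

lemma dop_derivative:
 fixes f :: "int poly"
 assumes "q > 0" "k \<le> L"
 shows "[:int p:] dvd (pderiv ^^ k) (f ^ L * (\<Sum>j\<in>J. (r j + s j * f ^ q) * monom 1 (j * p)))
  - f ^ (L - k) * (\<Sum>j\<in>J. (dop f (int L) k (r j) + dop f (int (L + q)) k (s j) * f ^ q) * monom 1 (j * p))"
 using assms(2)
proof (induction k)
 case (Suc k)
 define m where "m = L - Suc k"
 have m: "L - k = Suc m" "int L - int k = int (Suc m)" "int (L + q) - int k = int (Suc m + q)"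
  using Suc.prems by (auto simp: m_def)
 define a b where "a j = dop f (int L) k (r j)" and "b j = dop f (int (L + q)) k (s j)" for j
 obtain q' where q': "q = Suc q'" using assms(1) by (cases q) auto
 have dq: "f * pderiv (f ^ q) = smult (int q) (pderiv f) * f ^ q"
  unfolding q' pderiv_power_Suc by (simp add: algebra_simps)
 have dfm: "pderiv (f ^ Suc m) = smult (int (Suc m)) (pderiv f) * f ^ m"
  unfolding pderiv_power_Suc by (simp add: algebra_simps)
 have term_j: "pderiv (f ^ Suc m * ((a j + b j * f ^ q) * monom 1 (j * p)))
   = f ^ m * ((dop f (int L) (Suc k) (r j) + dop f (int (L + q)) (Suc k) (s j) * f ^ q) * monom 1 (j * p))
    + f ^ Suc m * (a j + b j * f ^ q) * pderiv (monom 1 (j * p))" for j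
 proof -
  have 1: "dop f (int L) (Suc k) (r j) = smult (int (Suc m)) (pderiv f * a j) + f * pderiv (a j)"
   "dop f (int (L + q)) (Suc k) (s j) = smult (int (Suc m)) (pderiv f * b j) + smult (int q) (pderiv f) * b j + f * pderiv (b j)"
   unfolding dop.simps m a_def b_def by (simp_all add: smult_add_left)
  have "pderiv (f ^ Suc m * ((a j + b j * f ^ q) * monom 1 (j * p)))
    = smult (int (Suc m)) (pderiv f) * f ^ m * ((a j + b j * f ^ q) * monom 1 (j * p))
    + f ^ m * ((f * pderiv (a j) + f * pderiv (b j) * f ^ q + b j * (f * pderiv (f ^ q))) * monom 1 (j * p))
    + f ^ Suc m * (a j + b j * f ^ q) * pderiv (monom 1 (j * p))"
   unfolding pderiv_mult[of "f ^ Suc m"] pderiv_mult[of "a j + b j * f ^ q"] pderiv_add pderiv_mult[of "b j"] dfm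
   by (simp add: algebra_simps)
  also have "\<dots> = f ^ m * ((dop f (int L) (Suc k) (r j) + dop f (int (L + q)) (Suc k) (s j) * f ^ q) * monom 1 (j * p))
    + f ^ Suc m * (a j + b j * f ^ q) * pderiv (monom 1 (j * p))"
   unfolding 1 dq by (simp add: algebra_simps)
  finally show ?thesis .
 qed
 define G where "G = f ^ L * (\<Sum>j\<in>J. (r j + s j * f ^ q) * monom 1 (j * p))"
 have "[:int p:] dvd pderiv ((pderiv ^^ k) G - f ^ Suc m * (\<Sum>j\<in>J. (a j + b j * f ^ q) * monom 1 (j * p)))"
  using Suc by (intro const_dvd_pderiv) (simp add: G_def a_def b_def m)
 hence "[:int p:] dvd (pderiv ^^ Suc k) G
   - (\<Sum>j\<in>J. pderiv (f ^ Suc m * ((a j + b j * f ^ q) * monom 1 (j * p))))"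
  by (simp only: pderiv_diff sum_distrib_left pderiv_sum' funpow.simps o_apply)
 moreover have "[:int p:] dvd (\<Sum>j\<in>J. f ^ Suc m * (a j + b j * f ^ q) * pderiv (monom 1 (j * p)))"
  by (intro dvd_sum dvd_mult pderiv_monom_p)
 ultimately have "[:int p:] dvd (pderiv ^^ Suc k) G
   - (\<Sum>j\<in>J. pderiv (f ^ Suc m * ((a j + b j * f ^ q) * monom 1 (j * p))))
   + (\<Sum>j\<in>J. f ^ Suc m * (a j + b j * f ^ q) * pderiv (monom 1 (j * p)))"
  by (rule dvd_add)
 also have "(pderiv ^^ Suc k) G
   - (\<Sum>j\<in>J. pderiv (f ^ Suc m * ((a j + b j * f ^ q) * monom 1 (j * p))))
   + (\<Sum>j\<in>J. f ^ Suc m * (a j + b j * f ^ q) * pderiv (monom 1 (j * p)))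
  = (pderiv ^^ Suc k) G - f ^ m * (\<Sum>j\<in>J. (dop f (int L) (Suc k) (r j) + dop f (int (L + q)) (Suc k) (s j) * f ^ q) * monom 1 (j * p))"
  unfolding term_j sum.distrib sum_distrib_left by simp
 finally show ?case unfolding G_def m_def .
qed simp

text \<open>The term of highest degree is unique and cannot cancel. Its leading coefficient is kept
  in the conclusion so that it can be tested modulo \<open>p\<close>.\<close>

lemma sum_distinct_degrees:
 fixes t :: "'i \<Rightarrow> int poly"
 assumes "finite I" "i \<in> I" "t i \<noteq> 0"
  and "\<And>i j. i \<in> I \<Longrightarrow> j \<in> I \<Longrightarrow> t i \<noteq> 0 \<Longrightarrow> t j \<noteq> 0 \<Longrightarrow> degree (t i) = degree (t j) \<Longrightarrow> i = j"
 obtains i0 where "i0 \<in> I" "t i0 \<noteq> 0" "coeff (sum t I) (degree (t i0)) = lead_coeff (t i0)"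
proof -
 define I' where "I' = {i \<in> I. t i \<noteq> 0}"
 have "finite I'" "I' \<noteq> {}" using assms(1-3) by (auto simp: I'_def)
 then obtain i0 where i0: "i0 \<in> I'" "\<And>j. j \<in> I' \<Longrightarrow> degree (t j) \<le> degree (t i0)"
 proof -
  have "Max ((\<lambda>i. degree (t i)) ` I') \<in> (\<lambda>i. degree (t i)) ` I'"
   using \<open>finite I'\<close> \<open>I' \<noteq> {}\<close> by (intro Max_in) auto
  then obtain i0 where "i0 \<in> I'" "degree (t i0) = Max ((\<lambda>i. degree (t i)) ` I')" by auto
  moreover have "degree (t j) \<le> Max ((\<lambda>i. degree (t i)) ` I')" if "j \<in> I'" for j
   using \<open>finite I'\<close> that by (intro Max_ge) auto
  ultimately show ?thesis using that by metis
 qed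
 have "coeff (sum t I) (degree (t i0)) = (\<Sum>j\<in>I. coeff (t j) (degree (t i0)))"
  by (simp add: coeff_sum)
 also have "\<dots> = (\<Sum>j\<in>I. if j = i0 then lead_coeff (t i0) else 0)"
 proof (rule sum.cong)
  fix j assume j: "j \<in> I"
  show "coeff (t j) (degree (t i0)) = (if j = i0 then lead_coeff (t i0) else 0)"
  proof (cases "j = i0 \<or> t j = 0")
   case False
   hence "degree (t j) \<noteq> degree (t i0)" using assms(4)[of j i0] j i0(1) by (auto simp: I'_def)
   hence "degree (t j) < degree (t i0)" using i0(2)[of j] False j by (auto simp: I'_def)
   thus ?thesis using False by (simp add: coeff_eq_0)
  next
   case True
   thus ?thesis using i0(1) by (auto simp: I'_def)
  qed
 qed simp
 also have "\<dots> = lead_coeff (t i0)" using assms(1) i0(1) by (simp add: I'_def)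
 finally show ?thesis using that i0(1) by (auto simp: I'_def)
qed

text \<open>Pigeonhole: there are more assignments with entries in \<open>{0..<p}\<close> than value
  vectors modulo \<open>p\<close>, and the difference of two assignments with equal values is a
  solution. The bound on its entries ensures that a nonzero entry is nonzero modulo
  \<open>p\<close>.\<close>

lemma linear_system_mod_prime:
 fixes F :: "('i \<Rightarrow> int) \<Rightarrow> 'k \<Rightarrow> int"
 assumes "prime (p :: nat)" "finite I" "finite K" "card K < card I"
  and "\<And>u v k. k \<in> K \<Longrightarrow> F (\<lambda>i. u i - v i) k = F u k - F v k"
 obtains w where "\<And>i. i \<in> I \<Longrightarrow> \<bar>w i\<bar> < int p" "\<exists>i\<in>I. w i \<noteq> 0" "\<And>k. k \<in> K \<Longrightarrow> int p dvd F w k"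
proof -
 have p: "p > 1" using prime_gt_1_nat[OF assms(1)] .
 define A where "A = (\<Pi>\<^sub>E i\<in>I. {0..<int p})"
 define \<Phi> where "\<Phi> u = (\<lambda>k\<in>K. F u k mod int p)" for u
 have "\<Phi> ` A \<subseteq> (\<Pi>\<^sub>E k\<in>K. {0..<int p})"
  using p by (auto simp: \<Phi>_def)
 hence "card (\<Phi> ` A) \<le> card (\<Pi>\<^sub>E k\<in>K. {0..<int p})"
  by (intro card_mono finite_PiE assms) auto
 also have "\<dots> = p ^ card K" using assms(3) by (simp add: card_PiE)
 also have "\<dots> < p ^ card I" using assms(4) p by (simp add: power_strict_increasing)
 also have "\<dots> = card A" using assms(2) by (simp add: A_def card_PiE)
 finally have "\<not> inj_on \<Phi> A" by (rule pigeonhole)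
 then obtain u v where uv: "u \<in> A" "v \<in> A" "\<Phi> u = \<Phi> v" "u \<noteq> v" unfolding inj_on_def by blast
 show ?thesis
 proof (rule that[of "\<lambda>i. u i - v i"])
  fix i assume "i \<in> I"
  hence "u i \<in> {0..<int p}" "v i \<in> {0..<int p}" using uv(1,2) unfolding A_def by blast+
  thus "\<bar>u i - v i\<bar> < int p" by auto
 next
  show "\<exists>i\<in>I. u i - v i \<noteq> 0"
  proof (rule ccontr)
   assume "\<not> ?thesis"
   hence "u = v" using uv(1,2) unfolding A_def by (intro PiE_ext) auto
   thus False using uv(4) by simp
  qed
 next
  fix k assume k: "k \<in> K"
  hence "F u k mod int p = F v k mod int p" using fun_cong[OF uv(3), of k] by (simp add: \<Phi>_def)
  thus "int p dvd F (\<lambda>i. u i - v i) k" using assms(5)[OF k] by (simp add: mod_eq_dvd_iff)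
 qed
qed

text \<open>Stepanov's method: an auxiliary polynomial of small degree vanishes to order \<open>L\<close> at every \<open>x\<close>
 with \<open>f(x)\<^bsup>(p-1)/2\<^esup> = \<sigma>\<close>. As \<open>deg f\<close> is odd, the degrees of its terms are distinct, so that it does
 not vanish identically.\<close>

lemma stepanov:
 fixes f :: "int poly"
 assumes p: "prime (p :: nat)" "odd p" and f: "odd (degree f)" "\<not> int p dvd lead_coeff f"
  and r: "r = degree f" "r < p" and d: "d = (p - r) div 2" and q: "q = (p - 1) div 2"
  and L: "L \<le> p" and dim: "L * (d + L * r + J) < 2 * (J * d)"
  and X: "X \<subseteq> {0..<int p}" "\<And>x. x \<in> X \<Longrightarrow> int p dvd poly f x ^ q - \<sigma>"
 shows "L * card X \<le> L * r + J * p + r * q"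
proof -
 have p1: "p > 1" using prime_gt_1_nat[OF p(1)] .
 have q0: "q > 0" using p p1 q by (auto elim!: oddE)
 have d2: "2 * d = p - r" using p(2) f(1) r d by simp
 \<comment> \<open>\<open>c\<close> bounds the degrees of the reduced derivatives, so
   \<open>L * c\<close> congruences are imposed on the \<open>2 * J * d\<close> coefficients indexed
   by \<open>I\<close>. The Boolean separates the coefficients without and with the factor
   \<open>f^q\<close>.\<close>
 define c where "c = d + L * r + J"
 define I where "I = {False, True} \<times> {..<J} \<times> {..<d}"
 define pr where "pr w b j = (\<Sum>i<d. monom (w (b, j, i)) i)" for w :: "bool \<times> nat \<times> nat \<Rightarrow> int" and b j
 have pr_diff: "pr (\<lambda>i. u i - v i) b j = pr u b j - pr v b j" for u v b j
  by (simp add: pr_def sum_subtractf flip: diff_monom)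
 \<comment> \<open>What remains of the \<open>k\<close>-th derivative at a point of
   \<open>X\<close>, where \<open>x^p\<close> may be replaced by \<open>x\<close> and
   \<open>f(x)^q\<close> by \<open>\<sigma>\<close>.\<close>
 define EE where "EE w k = (\<Sum>j<J. (dop f (int L) k (pr w False j)
   + smult \<sigma> (dop f (int (L + q)) k (pr w True j))) * monom 1 j)" for w k
 have EE_diff: "EE (\<lambda>i. u i - v i) k = EE u k - EE v k" for u v k
  by (simp add: EE_def pr_diff dop_diff sum_subtractf smult_diff_right algebra_simps)
 have cardI: "card ({..<L} \<times> {..<c}) < card I"
  using dim by (simp add: I_def c_def card_cartesian_product)
 obtain w where w: "\<And>i. i \<in> I \<Longrightarrow> \<bar>w i\<bar> < int p" "\<exists>i\<in>I. w i \<noteq> 0"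
   "\<And>k. k \<in> {..<L} \<times> {..<c} \<Longrightarrow> int p dvd coeff (EE w (fst k)) (snd k)"
 proof (rule linear_system_mod_prime[of p I "{..<L} \<times> {..<c}" "\<lambda>w k. coeff (EE w (fst k)) (snd k)", OF p(1) _ _ cardI])
  show "finite I" "finite ({..<L} \<times> {..<c})" by (simp_all add: I_def)
 qed (simp add: EE_diff, rule that)
 have dpr: "d > 0"
  using dim by (cases "d = 0") auto
 have deg_pr: "degree (pr w b j) < d" for b j
  unfolding pr_def by (rule degree_sum_less[OF _ dpr]) (auto intro: le_less_trans[OF degree_monom_le])
 have EE0: "[:int p:] dvd EE w k" if k: "k < L" for k
 proof -
  have kr: "k * r \<le> L * r" using k by (intro mult_right_mono) auto
  have "degree (EE w k) < c"
   unfolding EE_def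
  proof (rule degree_sum_less)
   show "0 < c" using dpr by (simp add: c_def)
   fix j assume j: "j \<in> {..<J}"
   have "degree (dop f (int L) k (pr w False j)) < d + L * r"
    using degree_dop[of f "int L" k "pr w False j"] deg_pr[of False j] kr unfolding r(1)[symmetric] by linarith
   moreover have "degree (smult \<sigma> (dop f (int (L + q)) k (pr w True j))) < d + L * r"
    using degree_dop[of f "int (L + q)" k "pr w True j"] deg_pr[of True j] kr
     degree_smult_le[of \<sigma> "dop f (int (L + q)) k (pr w True j)"] unfolding r(1)[symmetric] by linarith
   ultimately have "degree (dop f (int L) k (pr w False j) + smult \<sigma> (dop f (int (L + q)) k (pr w True j))) < d + L * r"
    by (rule degree_add_less)
   thus "degree ((dop f (int L) k (pr w False j) + smult \<sigma> (dop f (int (L + q)) k (pr w True j))) * monom 1 j) < c"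
    using j by (intro le_less_trans[OF degree_mult_le]) (simp add: c_def degree_monom_eq)
  qed
  hence "int p dvd coeff (EE w k) i" for i
   using w(3)[of "(k, i)"] k coeff_eq_0[of "EE w k" i] by (cases "i < c") auto
  thus ?thesis by (simp add: const_poly_dvd_iff)
 qed
 define t where "t = (\<lambda>(b, j). (if b then pr w True j * f ^ q else pr w False j) * monom 1 (j * p))"
 define h where "h = (\<Sum>j<J. (pr w False j + pr w True j * f ^ q) * monom 1 (j * p))"
 have f0: "f \<noteq> 0" using f by auto
 have "bij_betw (\<lambda>(j, b). (b, j)) ({..<J} \<times> {False, True}) ({False, True} \<times> {..<J})"
  by (rule bij_betwI[where g = "\<lambda>(b, j). (j, b)"]) auto
 have h_sum: "h = sum t ({False, True} \<times> {..<J})"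
  unfolding h_def sum.cartesian_product' t_def by (simp add: algebra_simps sum.distrib)
 have lead_pr: "\<not> int p dvd lead_coeff (pr w b j)" if "pr w b j \<noteq> 0" "j < J" for b j
 proof -
  have co: "coeff (pr w b j) i = (if i < d then w (b, j, i) else 0)" for i
   by (simp add: pr_def coeff_sum coeff_monom)
  have "lead_coeff (pr w b j) = w (b, j, degree (pr w b j))"
   using deg_pr[of b j] by (simp add: co)
  moreover have "\<bar>w (b, j, degree (pr w b j))\<bar> < int p"
   using that(2) deg_pr[of b j] by (intro w(1)) (auto simp: I_def)
  ultimately show ?thesis using that(1) zdvd_imp_le[of "int p" "\<bar>lead_coeff (pr w b j)\<bar>"] by fastforce
 qed
 \<comment> \<open>With \<open>r = 2 r' + 1\<close>, the factor \<open>f^q\<close> contributes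
   degree \<open>r' p + d\<close>. Modulo \<open>p\<close> the terms without it have degree in
   \<open>{0..<d}\<close> and those with it in \<open>{d..<2 d}\<close>, where
   \<open>2 d = p - r < p\<close>; so the degree determines the term.\<close>
 have "\<exists>r'. r * q = r' * p + d"
 proof -
  obtain r' where r': "r = 2 * r' + 1" using f(1) r(1) by (auto elim!: oddE)
  have "2 * q + 1 = p" using p(2) q by (auto elim!: oddE)
  moreover from this have "d + r' = q" using d2 r(2) r' by linarith
  moreover have "r * q = 2 * r' * q + q" by (simp add: r' algebra_simps)
  moreover have "r' * (2 * q + 1) + d = 2 * r' * q + (d + r')" by (simp add: algebra_simps)
  ultimately show ?thesis by metis
 qed
 then obtain r' where r': "r * q = r' * p + d" by blast
 have deg_t: "degree (t (b, j)) = (if b then degree (pr w True j) + r * q else degree (pr w False j)) + j * p"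
  if "t (b, j) \<noteq> 0" for b j
 proof -
  have "pr w b j \<noteq> 0" using that by (cases b) (auto simp: t_def)
  moreover have "monom (1::int) (j * p) \<noteq> 0" by simp
  ultimately show ?thesis using f0
   by (cases b) (simp_all add: t_def degree_mult_eq degree_power_eq degree_monom_eq r(1) mult.commute[of q])
 qed
 have pr_t: "t (b, j) \<noteq> 0 \<longleftrightarrow> pr w b j \<noteq> 0" for b j
  using f0 by (cases b) (simp_all add: t_def)
 have lead_t: "\<not> int p dvd lead_coeff (t (b, j))" if "t (b, j) \<noteq> 0" "j < J" for b j
 proof -
  have "\<not> int p dvd lead_coeff (pr w b j)" using lead_pr that pr_t by blast
  moreover have "\<not> int p dvd lead_coeff f ^ q" using f(2) p(1) prime_dvd_power by (metis prime_nat_int_transfer)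
  ultimately show ?thesis using p(1)
   by (auto simp: t_def lead_coeff_mult lead_coeff_power prime_dvd_mult_iff lead_coeff_monom degree_monom_eq)
 qed
 obtain b j i where bji: "j < J" "i < d" "w (b, j, i) \<noteq> 0" using w(2) by (auto simp: I_def)
 have "coeff (pr w b j) i \<noteq> 0" using bji by (simp add: pr_def coeff_sum coeff_monom)
 hence "t (b, j) \<noteq> 0" using pr_t by auto
 obtain bj where bj: "bj \<in> {False, True} \<times> {..<J}" "t bj \<noteq> 0" "coeff (sum t ({False, True} \<times> {..<J})) (degree (t bj)) = lead_coeff (t bj)"
 proof (rule sum_distinct_degrees[of "{False, True} \<times> {..<J}" "(b, j)" t])
  fix x y assume xy: "x \<in> {False, True} \<times> {..<J}" "y \<in> {False, True} \<times> {..<J}" "t x \<noteq> 0" "t y \<noteq> 0" "degree (t x) = degree (t y)"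
  obtain b1 j1 b2 j2 where x: "x = (b1, j1)" and y: "y = (b2, j2)" by (cases x, cases y) auto
  have form: "degree (t (b, j)) = (if b then d + degree (pr w True j) else degree (pr w False j)) + (j + (if b then r' else 0)) * p"
   if "t (b, j) \<noteq> 0" for b j
   using deg_t[OF that] r' by (cases b) (simp_all add: add_mult_distrib)
  define e1 where "e1 b j = (if b then d + degree (pr w True j) else degree (pr w False j))" for b j
  have e1: "e1 b j < p" for b j using deg_pr[of b j] d2 dpr by (cases b) (auto simp: e1_def)
  have eq: "e1 b1 j1 + (j1 + (if b1 then r' else 0)) * p = e1 b2 j2 + (j2 + (if b2 then r' else 0)) * p"
   using xy(3-5) form unfolding x y e1_def by simp
  have "e1 b1 j1 = e1 b2 j2" using arg_cong[OF eq, of "\<lambda>z. z mod p"] e1 by simp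
  hence b: "b1 = b2" using deg_pr[of b1 j1] deg_pr[of b2 j2] by (auto simp: e1_def split: if_splits)
  have "j1 + (if b1 then r' else 0) = j2 + (if b2 then r' else 0)"
   using eq \<open>e1 b1 j1 = e1 b2 j2\<close> p1 by simp
  thus "x = y" using b by (simp add: x y)
 qed (use bji \<open>t (b, j) \<noteq> 0\<close> in auto)
 have "\<not> [:int p:] dvd h"
 proof
  assume "[:int p:] dvd h"
  hence "int p dvd lead_coeff (t bj)" using bj(3) unfolding h_sum const_poly_dvd_iff by metis
  thus False using lead_t bj(1,2) by (cases bj) auto
 qed
 moreover have pe: "prime_elem [:int p:]"
  using p(1) by (intro lift_prime_elem_poly) simp
 moreover have "\<not> [:int p:] dvd f" using f(2) by (auto simp: const_poly_dvd_iff)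
 ultimately have nR: "\<not> [:int p:] dvd f ^ L * h"
  using prime_elem_dvd_mult_iff prime_elem_dvd_power by metis
 have deg_R: "degree (f ^ L * h) \<le> L * r + J * p + r * q"
 proof -
  have "degree h \<le> J * p + r * q"
   unfolding h_sum
  proof (rule degree_sum_le)
   fix x assume x: "x \<in> {False, True} \<times> {..<J}"
   obtain b j where bj: "x = (b, j)" by (cases x)
   have "(j + 1) * p \<le> J * p" using x bj by (intro mult_right_mono) auto
   moreover have "degree (pr w b j) \<le> p" for b using deg_pr[of b j] d2 by simp
   ultimately show "degree (t x) \<le> J * p + r * q"
   proof (cases "t (b, j) = 0")
    case False
    have "(j + 1) * p = p + j * p" by simp
    thus ?thesis
     using deg_t[OF False] \<open>(j + 1) * p \<le> J * p\<close> \<open>\<And>b. degree (pr w b j) \<le> p\<close>[of True]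
      \<open>\<And>b. degree (pr w b j) \<le> p\<close>[of False] unfolding bj by (cases b) simp_all
   qed (simp add: bj)
  qed auto
  thus ?thesis
   using degree_mult_le[of "f ^ L" h] f0 by (simp add: degree_power_eq r(1))
 qed
 have "L * card X \<le> degree (f ^ L * h)"
 proof (rule card_roots_mod_prime[OF p(1) L _ _ _ nR])
  show "finite X" using X(1) finite_subset by blast
  show "x = y" if "x \<in> X" "y \<in> X" "int p dvd x - y" for x y
  proof -
   have "x \<in> {0..<int p}" "y \<in> {0..<int p}" using X(1) that by blast+
   thus ?thesis using that(3) by (auto simp flip: mod_eq_dvd_iff)
  qed
  fix x k assume x: "x \<in> X" and k: "k < L"
  define B where "B = (\<Sum>j<J. (dop f (int L) k (pr w False j) + dop f (int (L + q)) k (pr w True j) * f ^ q) * monom 1 (j * p))"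
  have 1: "[:int p:] dvd (pderiv ^^ k) (f ^ L * h) - f ^ (L - k) * B"
   unfolding h_def B_def by (rule dop_derivative[OF q0]) (use k in simp)
  have xp: "[x ^ (j * p) = x ^ j] (mod int p)" for j
  proof -
   have "[x ^ p = x] (mod int p)"
   proof (cases "int p dvd x")
    case True
    hence "int p dvd x ^ p" using p1 by (simp add: dvd_power_iff_le dvd_trans[OF _ dvd_power])
    thus ?thesis using True by (simp add: cong_iff_dvd_diff dvd_diff)
   next
    case False
    have "[x ^ (p - 1) = 1] (mod int p)" by (rule fermat_int[OF p(1) False])
    hence "[x * x ^ (p - 1) = x * 1] (mod int p)" by (rule cong_mult[OF cong_refl])
    thus ?thesis using p1 by (simp flip: power_Suc)
   qed
   hence "[(x ^ p) ^ j = x ^ j] (mod int p)" by (rule cong_pow)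
   thus ?thesis by (simp add: power_mult[symmetric] mult.commute)
  qed
  have fq: "[poly f x ^ q = \<sigma>] (mod int p)" using X(2)[OF x] by (simp add: cong_iff_dvd_diff)
  have "[(a + b * poly f x ^ q) * (1 * x ^ (j * p)) = (a + \<sigma> * b) * (1 * x ^ j)] (mod int p)" for a b j
  proof -
   have "[b * poly f x ^ q = \<sigma> * b] (mod int p)"
    using cong_mult[OF cong_refl[of b] fq] by (simp add: mult.commute)
   hence "[a + b * poly f x ^ q = a + \<sigma> * b] (mod int p)" by (rule cong_add[OF cong_refl])
   thus ?thesis using cong_mult[OF _ xp] by simp
  qed
  hence "[poly B x = poly (EE w k) x] (mod int p)"
   unfolding B_def EE_def poly_sum poly_mult poly_add poly_monom poly_power poly_smult
   by (intro cong_sum)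
  moreover have "[poly (EE w k) x = 0] (mod int p)"
   using const_dvd_poly[OF EE0[OF k]] by (simp add: cong_0_iff)
  ultimately have "int p dvd poly B x" using cong_trans cong_0_iff by blast
  hence "int p dvd poly (f ^ (L - k) * B) x" by simp
  moreover have "int p dvd poly ((pderiv ^^ k) (f ^ L * h) - f ^ (L - k) * B) x"
   by (rule const_dvd_poly[OF 1])
  ultimately have "int p dvd poly ((pderiv ^^ k) (f ^ L * h) - f ^ (L - k) * B) x + poly (f ^ (L - k) * B) x"
   by (intro dvd_add)
  thus "int p dvd poly ((pderiv ^^ k) (f ^ L * h)) x" by simp
 qed
 thus ?thesis using deg_R by simp
qed

section \<open>Joint distribution of Legendre symbols\<close>

lemma Legendre_range: "Legendre a p \<in> {- 1, 0, 1}"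
 by (simp add: Legendre_def)

lemma Legendre_eq_0_iff: "Legendre a p = 0 \<longleftrightarrow> p dvd a"
 by (simp add: Legendre_def cong_0_iff)

lemma Legendre_unique:
 assumes "p > 2" "u \<in> {- 1, 0, 1}" "v \<in> {- 1, 0, 1 :: int}" "[u = v] (mod p)"
 shows "u = v"
proof -
 have "p dvd u - v" using assms(4) by (simp add: cong_iff_dvd_diff)
 thus ?thesis using assms(1-3) zdvd_imp_le[of p "\<bar>u - v\<bar>"] by auto
qed

lemma Legendre_power_cong:
 assumes "prime (p :: nat)" "p > 2"
 shows "[Legendre a (int p) = a ^ ((p - 1) div 2)] (mod int p)"
 by (rule euler_criterion[OF assms])

lemma Legendre_mult:
 assumes "prime (p :: nat)" "p > 2"
 shows "Legendre (a * b) (int p) = Legendre a (int p) * Legendre b (int p)"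
proof (rule Legendre_unique[of "int p"])
 show "Legendre a (int p) * Legendre b (int p) \<in> {- 1, 0, 1}"
  using Legendre_range[of a "int p"] Legendre_range[of b "int p"] by auto
 have "[Legendre a (int p) * Legendre b (int p) = a ^ ((p - 1) div 2) * b ^ ((p - 1) div 2)] (mod int p)"
  by (intro cong_mult Legendre_power_cong assms)
 thus "[Legendre (a * b) (int p) = Legendre a (int p) * Legendre b (int p)] (mod int p)"
  using Legendre_power_cong[OF assms, of "a * b"] unfolding power_mult_distrib
  by (meson cong_sym cong_trans)
qed (use assms Legendre_range in auto)

lemma Legendre_1: "p > 1 \<Longrightarrow> Legendre 1 p = 1"
 unfolding Legendre_def QuadRes_def by (auto simp: cong_0_iff intro: exI[of _ 1])

lemma Legendre_prod:
 assumes "prime (p :: nat)" "p > 2"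
 shows "Legendre (\<Prod>i\<in>I. f i) (int p) = (\<Prod>i\<in>I. Legendre (f i) (int p))"
 using assms by (induction I rule: infinite_finite_induct) (simp_all add: Legendre_mult Legendre_1)

lemma Legendre_cong:
 assumes "[a = b] (mod p)"
 shows "Legendre a p = Legendre b p"
proof -
 have *: "[c = a] (mod p) \<longleftrightarrow> [c = b] (mod p)" for c
  using assms cong_trans cong_sym by blast
 have "[a = 0] (mod p) \<longleftrightarrow> [b = 0] (mod p)"
  using *[of 0] cong_sym_eq by metis
 thus ?thesis by (simp add: Legendre_def QuadRes_def *)
qed

lemma Legendre_square:
 assumes "prime (p :: nat)" "p > 2" "\<not> int p dvd a"
 shows "Legendre (a\<^sup>2) (int p) = 1"
 using Legendre_range[of a "int p"] Legendre_eq_0_iff[of a "int p"] assms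
 by (auto simp: power2_eq_square Legendre_mult)

definition small_sums :: "(nat \<Rightarrow> int) \<Rightarrow> bool" where
 "small_sums S \<longleftrightarrow> (\<forall>\<epsilon>>0. \<exists>p0. \<forall>p>p0. prime p \<longrightarrow> \<bar>real_of_int (S p)\<bar> \<le> \<epsilon> * real p)"

text \<open>Stepanov's bound gives about \<open>p/2\<close> for each of the classes with symbol 1
  and -1. As these classes and at most \<open>r\<close> zeros exhaust the residues, upper bounds for
  both suffice to make the difference small.\<close>

lemma odd_degree_Legendre_sum:
 fixes f :: "int poly"
 assumes f: "odd (degree f)"
 shows "small_sums (\<lambda>p. \<Sum>x\<in>{0..<int p}. Legendre (poly f x) (int p))"
 unfolding small_sums_def
proof (intro allI impI)
 fix \<epsilon> :: real assume \<epsilon>: "\<epsilon> > 0"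
 define r where "r = degree f"
 have f0: "f \<noteq> 0" using f by auto
 define K where "K = nat \<lceil>real (r + 2) / \<epsilon>\<rceil> + 1"
 have K: "K > 0" "real (r + 2) / real K \<le> \<epsilon>"
 proof -
  show "K > 0" by (simp add: K_def)
  have "real (r + 2) / \<epsilon> \<le> real K" unfolding K_def by linarith
  thus "real (r + 2) / real K \<le> \<epsilon>" using \<epsilon> \<open>K > 0\<close> by (simp add: field_simps)
 qed
 \<comment> \<open>\<open>J / L = 1/2 + 1/(2K)\<close> makes each class at most
   \<open>r + p/2 + (r+2) p/(4K)\<close>, and with this ratio the unknowns outnumber the equations
   as soon as \<open>K * (L * r + J) < d\<close>.\<close>
 define L J where "L = 2 * K" and "J = K + 1"
 define p1 where "p1 = nat \<bar>lead_coeff f\<bar> + 2 + L + 2 * (K * (L * r + J)) + 3 * r + nat \<lceil>6 * real r / \<epsilon>\<rceil>"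
 show "\<exists>p0. \<forall>p>p0. prime p \<longrightarrow> \<bar>real_of_int (\<Sum>x\<in>{0..<int p}. Legendre (poly f x) (int p))\<bar> \<le> \<epsilon> * real p"
 proof (intro exI[of _ p1] allI impI)
  fix p :: nat assume p1: "p > p1" and p: "prime p"
  have p2: "p > 2" "odd p" using p1 p prime_odd_nat[of p] by (auto simp: p1_def)
  define q d where "q = (p - 1) div 2" and "d = (p - r) div 2"
  have lc: "\<not> int p dvd lead_coeff f"
  proof
   assume "int p dvd lead_coeff f"
   hence "int p \<le> \<bar>lead_coeff f\<bar>" using f0 zdvd_imp_le[of "int p" "\<bar>lead_coeff f\<bar>"] by simp
   thus False using p1 by (simp add: p1_def)
  qed
  have rp: "r < p" using p1 by (simp add: p1_def)
  have d2: "2 * d = p - r" using p2(2) f rp by (simp add: d_def r_def)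
  have dim: "L * (d + L * r + J) < 2 * (J * d)"
  proof -
   have "K * (L * r + J) < d" using p1 d2 by (simp add: p1_def)
   hence "2 * (K * (L * r + J)) < 2 * d" by simp
   thus ?thesis by (simp add: L_def J_def algebra_simps)
  qed
  define X where "X \<sigma> = {x \<in> {0..<int p}. Legendre (poly f x) (int p) = \<sigma>}" for \<sigma>
  have finX: "finite (X \<sigma>)" for \<sigma> by (rule finite_subset[of _ "{0..<int p}"]) (auto simp: X_def)
  have bound: "real (card (X \<sigma>)) \<le> real r + real p / 2 + \<epsilon> * real p / 4" if \<sigma>: "\<sigma> \<in> {1, - 1}" for \<sigma>
  proof -
   have "L * card (X \<sigma>) \<le> L * r + J * p + r * q"
   proof (rule stepanov[OF p p2(2) f lc r_def rp d_def q_def _ dim])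
    show "L \<le> p" using p1 by (simp add: p1_def)
    fix x assume "x \<in> X \<sigma>"
    thus "int p dvd poly f x ^ q - \<sigma>"
     using Legendre_power_cong[OF p p2(1), of "poly f x"]
     by (simp add: X_def q_def cong_iff_dvd_diff dvd_diff_commute)
   qed (auto simp: X_def)
   moreover have "2 * q \<le> p" by (simp add: q_def)
   hence "2 * (r * q) \<le> r * p" by (metis mult.left_commute mult_le_mono2)
   ultimately have "2 * (L * card (X \<sigma>)) \<le> 2 * (L * r) + 2 * (J * p) + r * p" by linarith
   hence "real (2 * (L * card (X \<sigma>))) \<le> real (2 * (L * r) + 2 * (J * p) + r * p)"
    by (simp only: of_nat_le_iff)
   hence "4 * K * real (card (X \<sigma>)) \<le> 4 * K * real r + 2 * (real K + 1) * p + r * p"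
    by (simp add: L_def J_def algebra_simps)
   hence "real (card (X \<sigma>)) \<le> (4 * K * real r + 2 * (real K + 1) * p + r * p) / (4 * K)"
    using K(1) by (simp add: field_simps)
   also have "\<dots> = real r + real p / 2 + (real (r + 2) / K) * (p / 4)"
    using K(1) by (simp add: field_simps)
   also have "\<dots> \<le> real r + real p / 2 + \<epsilon> * (p / 4)"
    using K(2) by (intro add_left_mono mult_right_mono) auto
   finally show ?thesis by simp
  qed
  have zeros: "card (X 0) \<le> r"
  proof -
   have "1 * card (X 0) \<le> degree f"
   proof (rule card_roots_mod_prime[OF p _ finX])
    show "\<not> [:int p:] dvd f" using lc by (auto simp: const_poly_dvd_iff)
    show "x = y" if "x \<in> X 0" "y \<in> X 0" "int p dvd x - y" for x y
    proof -
     have "x \<in> {0..<int p}" "y \<in> {0..<int p}" using that by (simp_all add: X_def)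
     thus ?thesis using that(3) by (auto simp flip: mod_eq_dvd_iff)
    qed
   qed (use p2 in \<open>auto simp: X_def Legendre_eq_0_iff\<close>)
   thus ?thesis by (simp add: r_def)
  qed
  have split: "{0..<int p} = X 1 \<union> X (- 1) \<union> X 0"
   using Legendre_range[of _ "int p"] by (auto simp: X_def)
  have disj: "X 1 \<inter> X (- 1) = {}" "(X 1 \<union> X (- 1)) \<inter> X 0 = {}" by (auto simp: X_def)
  have "card {0..<int p} = card (X 1) + card (X (- 1)) + card (X 0)"
   unfolding split using finX disj by (simp add: card_Un_disjoint)
  hence tot: "real p = card (X 1) + card (X (- 1)) + card (X 0)" by simp
  have "(\<Sum>x\<in>{0..<int p}. Legendre (poly f x) (int p))
    = (\<Sum>x\<in>X 1. Legendre (poly f x) (int p)) + (\<Sum>x\<in>X (- 1). Legendre (poly f x) (int p))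
     + (\<Sum>x\<in>X 0. Legendre (poly f x) (int p))"
   unfolding split using finX disj by (simp add: sum.union_disjoint)
  also have "\<dots> = (\<Sum>x\<in>X 1. 1) + (\<Sum>x\<in>X (- 1). - 1) + (\<Sum>x\<in>X 0. 0)"
   by (intro arg_cong2[where f = "(+)"] sum.cong) (auto simp: X_def)
  finally have S: "real_of_int (\<Sum>x\<in>{0..<int p}. Legendre (poly f x) (int p)) = real (card (X 1)) - real (card (X (- 1)))"
   by simp
  have "6 * real r / \<epsilon> \<le> real p" using p1 unfolding p1_def by linarith
  hence "6 * real r \<le> \<epsilon> * real p" using \<epsilon> by (simp add: field_simps)
  thus "\<bar>real_of_int (\<Sum>x\<in>{0..<int p}. Legendre (poly f x) (int p))\<bar> \<le> \<epsilon> * real p"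
  proof -
   have "real (card (X 1)) \<le> real r + real p / 2 + \<epsilon> * real p / 4"
    "real (card (X (- 1))) \<le> real r + real p / 2 + \<epsilon> * real p / 4"
    by (rule bound, simp)+
   thus ?thesis
    using tot \<open>6 * real r \<le> \<epsilon> * real p\<close> zeros unfolding S by linarith
  qed
 qed
qed

lemma small_sums_bounded_diff:
 assumes "small_sums S" "\<And>p. prime p \<Longrightarrow> p > p1 \<Longrightarrow> \<bar>S' p\<bar> \<le> \<bar>S p\<bar> + C"
 shows "small_sums S'"
 unfolding small_sums_def
proof (intro allI impI)
 fix \<epsilon> :: real assume \<epsilon>: "\<epsilon> > 0"
 then obtain p0 where p0: "\<And>p. p > p0 \<Longrightarrow> prime p \<Longrightarrow> \<bar>real_of_int (S p)\<bar> \<le> \<epsilon> / 2 * real p"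
  using assms(1) unfolding small_sums_def by (meson half_gt_zero)
 show "\<exists>p0. \<forall>p>p0. prime p \<longrightarrow> \<bar>real_of_int (S' p)\<bar> \<le> \<epsilon> * real p"
 proof (intro exI[of _ "p0 + p1 + nat \<lceil>2 * real_of_int C / \<epsilon>\<rceil>"] allI impI)
  fix p :: nat assume p: "p > p0 + p1 + nat \<lceil>2 * real_of_int C / \<epsilon>\<rceil>" "prime p"
  hence "2 * real_of_int C / \<epsilon> \<le> real p" by linarith
  hence "real_of_int C \<le> \<epsilon> / 2 * real p" using \<epsilon> by (simp add: field_simps)
  moreover have "\<bar>real_of_int (S' p)\<bar> \<le> \<bar>real_of_int (S p)\<bar> + real_of_int C"
   using assms(2)[of p] p by linarith
  moreover have "\<bar>real_of_int (S p)\<bar> \<le> \<epsilon> / 2 * real p" using p0[of p] p by simp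
  ultimately show "\<bar>real_of_int (S' p)\<bar> \<le> \<epsilon> * real p" by simp
 qed
qed

text \<open>For even \<open>|R|\<close> the substitution \<open>x = \<nu> + 1/y\<close> moves the root \<open>\<nu>\<close> to infinity and makes the degree odd.\<close>

lemma product_Legendre_sum:
 fixes R :: "int set"
 assumes R: "finite R" "R \<noteq> {}"
 shows "small_sums (\<lambda>p. \<Sum>x\<in>{0..<int p}. Legendre (\<Prod>\<nu>\<in>R. x - \<nu>) (int p))"
proof (cases "odd (card R)")
 case True
 have "degree (\<Prod>\<nu>\<in>R. [:- \<nu>, 1:]) = (\<Sum>\<nu>\<in>R. degree [:- \<nu>, 1:])"
  by (rule degree_prod_eq_sum_degree) simp
 hence "odd (degree (\<Prod>\<nu>\<in>R. [:- \<nu>, 1:]))" using True by simp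
 from odd_degree_Legendre_sum[OF this] show ?thesis by (simp add: poly_prod)
next
 case False
 obtain \<nu> where \<nu>: "\<nu> \<in> R" using R(2) by blast
 define f where "f = (\<Prod>\<mu>\<in>R - {\<nu>}. [:1, \<nu> - \<mu>:])"
 have "degree f = (\<Sum>\<mu>\<in>R - {\<nu>}. degree [:1, \<nu> - \<mu>:])"
  unfolding f_def by (rule degree_prod_eq_sum_degree) simp
 also have "\<dots> = (\<Sum>\<mu>\<in>R - {\<nu>}. 1)" by (rule sum.cong) auto
 also have "\<dots> = card R - 1" using \<nu> R(1) by simp
 finally have "odd (degree f)" using False R by (simp add: card_gt_0_iff)
 from odd_degree_Legendre_sum[OF this]
 have small: "small_sums (\<lambda>p. \<Sum>x\<in>{0..<int p}. Legendre (poly f x) (int p))" .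
 show ?thesis
 proof (rule small_sums_bounded_diff[OF small, where C = 1 and ?p1.0 = 2])
  fix p :: nat assume p: "prime p" "p > 2"
  define y0 where "y0 = \<nu> mod int p"
  define mi where "mi u = u ^ (p - 2)" for u :: int
  have mi: "[u * mi u = 1] (mod int p)" if "\<not> int p dvd u" for u
  proof -
   have "p - 1 = Suc (p - 2)" using p(2) by linarith
   hence "u * mi u = u ^ (p - 1)" by (simp add: mi_def)
   thus ?thesis using fermat_int[OF p(1) that] by simp
  qed
  have mi_unit: "\<not> int p dvd mi u" if "\<not> int p dvd u" for u :: int
   using that p(1) prime_dvd_power unfolding mi_def by (metis prime_nat_int_transfer)
  have mi_cong: "[mi u = v] (mod int p)" if "[u * v = 1] (mod int p)" "\<not> int p dvd u" for u v
  proof -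
   have "[mi u * (u * v) = mi u * 1] (mod int p)" by (rule cong_mult[OF cong_refl that(1)])
   moreover have "[(u * mi u) * v = 1 * v] (mod int p)" by (rule cong_mult[OF mi[OF that(2)] cong_refl])
   ultimately show ?thesis by (metis cong_sym cong_trans mult.assoc mult.commute mult_1 mult_1_right)
  qed
  have "(\<Sum>x\<in>{0..<int p}. Legendre (\<Prod>\<mu>\<in>R. x - \<mu>) (int p)) = (\<Sum>x\<in>{0..<int p} - {y0}. Legendre (\<Prod>\<mu>\<in>R. x - \<mu>) (int p))"
  proof (rule sum.mono_neutral_right)
   show "\<forall>x\<in>{0..<int p} - ({0..<int p} - {y0}). Legendre (\<Prod>\<mu>\<in>R. x - \<mu>) (int p) = 0"
   proof
    fix x assume "x \<in> {0..<int p} - ({0..<int p} - {y0})"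
    hence "x = y0" by simp
    hence "int p dvd x - \<nu>" by (simp add: y0_def flip: mod_eq_dvd_iff)
    hence "int p dvd (\<Prod>\<mu>\<in>R. x - \<mu>)" using \<nu> R(1) by (meson dvd_prodI dvd_trans)
    thus "Legendre (\<Prod>\<mu>\<in>R. x - \<mu>) (int p) = 0" by (simp add: Legendre_eq_0_iff)
   qed
  qed auto
  also have "\<dots> = (\<Sum>y\<in>{1..<int p}. Legendre (poly f y) (int p))"
  proof (rule sum.reindex_bij_witness[where i = "\<lambda>y. (\<nu> + mi y) mod int p" and j = "\<lambda>x. mi (x - \<nu>) mod int p"])
   fix x assume x: "x \<in> {0..<int p} - {y0}"
   have u: "\<not> int p dvd x - \<nu>"
   proof
    assume "int p dvd x - \<nu>"
    hence "x mod int p = \<nu> mod int p" by (simp add: mod_eq_dvd_iff)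
    thus False using x by (simp add: y0_def)
   qed
   define y where "y = mi (x - \<nu>) mod int p"
   have yc: "[y = mi (x - \<nu>)] (mod int p)" by (simp add: y_def cong_def)
   have yu: "\<not> int p dvd y" using mi_unit[OF u] yc by (simp add: cong_dvd_iff)
   have prod1: "[y * (x - \<nu>) = 1] (mod int p)"
    using cong_trans[OF cong_mult[OF yc cong_refl[of "x - \<nu>"]]] mi[OF u] by (simp add: mult.commute)
   show "mi (x - \<nu>) mod int p \<in> {1..<int p}"
   proof -
    have "y \<noteq> 0" using yu by auto
    moreover have "y \<ge> 0" "y < int p" using p by (simp_all add: y_def)
    ultimately show ?thesis unfolding y_def[symmetric] by simp
   qed
   have "[\<nu> + mi y = \<nu> + (x - \<nu>)] (mod int p)"
    by (intro cong_add cong_refl mi_cong[OF prod1 yu])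
   thus "(\<nu> + mi (mi (x - \<nu>) mod int p)) mod int p = x"
    using x unfolding y_def[symmetric] by (simp add: cong_def)
   show "Legendre (poly f (mi (x - \<nu>) mod int p)) (int p) = Legendre (\<Prod>\<mu>\<in>R. x - \<mu>) (int p)"
    unfolding y_def[symmetric]
   proof -
    have "[(\<Prod>\<mu>\<in>R. y * (x - \<mu>)) = (\<Prod>\<mu>\<in>R. 1 + y * (\<nu> - \<mu>))] (mod int p)"
    proof (rule cong_prod)
     fix \<mu>
     have "[y * (x - \<nu>) + y * (\<nu> - \<mu>) = 1 + y * (\<nu> - \<mu>)] (mod int p)"
      by (rule cong_add[OF prod1 cong_refl])
     thus "[y * (x - \<mu>) = 1 + y * (\<nu> - \<mu>)] (mod int p)" by (simp add: algebra_simps)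
    qed
    moreover have "(\<Prod>\<mu>\<in>R. 1 + y * (\<nu> - \<mu>)) = poly f y"
     using R(1) \<nu> by (simp add: f_def poly_prod prod.remove[OF R(1) \<nu>])
    \<comment> \<open>Here the parity of \<open>card R\<close> is used: multiplying every factor by
      \<open>y\<close> multiplies the product by a square.\<close>
    moreover have "(\<Prod>\<mu>\<in>R. y * (x - \<mu>)) = (y ^ (card R div 2))\<^sup>2 * (\<Prod>\<mu>\<in>R. x - \<mu>)"
     using False by (simp add: prod.distrib power_mult[symmetric])
    ultimately have "Legendre (poly f y) (int p) = Legendre ((y ^ (card R div 2))\<^sup>2 * (\<Prod>\<mu>\<in>R. x - \<mu>)) (int p)"
     using Legendre_cong by metis
    also have "\<dots> = Legendre (\<Prod>\<mu>\<in>R. x - \<mu>) (int p)"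
    proof -
     have "\<not> int p dvd y ^ (card R div 2)" using yu p(1) prime_dvd_power by (metis prime_nat_int_transfer)
     thus ?thesis unfolding Legendre_mult[OF p] using Legendre_square[OF p] by simp
    qed
    finally show "Legendre (poly f y) (int p) = Legendre (\<Prod>\<mu>\<in>R. x - \<mu>) (int p)" .
   qed
  next
   fix y assume y: "y \<in> {1..<int p}"
   have yu: "\<not> int p dvd y" using y zdvd_imp_le[of "int p" y] by auto
   define x where "x = (\<nu> + mi y) mod int p"
   have xc: "[x = \<nu> + mi y] (mod int p)" by (simp add: x_def cong_def)
   hence xv: "[x - \<nu> = mi y] (mod int p)" using cong_diff[OF xc cong_refl[of \<nu>]] by simp
   have xu: "\<not> int p dvd x - \<nu>" using mi_unit[OF yu] xv by (simp add: cong_dvd_iff)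
   show "(\<nu> + mi y) mod int p \<in> {0..<int p} - {y0}"
   proof -
    have "x \<noteq> y0"
    proof
     assume "x = y0"
     hence "int p dvd x - \<nu>" by (simp add: y0_def flip: mod_eq_dvd_iff)
     thus False using xu by simp
    qed
    thus ?thesis unfolding x_def[symmetric] using p by (simp add: x_def)
   qed
   have "[(x - \<nu>) * y = 1] (mod int p)"
    using cong_trans[OF cong_mult[OF xv cong_refl[of y]]] mi[OF yu] by (simp add: mult.commute)
   from mi_cong[OF this xu] show "mi ((\<nu> + mi y) mod int p - \<nu>) mod int p = y"
    using y unfolding x_def[symmetric] by (simp add: cong_def)
  qed
  \<comment> \<open>The term at \<open>y = 0\<close> stands for the point \<open>x\<close> at
    infinity and equals 1.\<close>
  also have "\<dots> = (\<Sum>y\<in>{0..<int p}. Legendre (poly f y) (int p)) - 1"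
  proof -
   have "{0..<int p} = insert 0 {1..<int p}" using p by auto
   moreover have "poly f 0 = 1" by (simp add: f_def poly_prod)
   ultimately show ?thesis using p by (simp add: Legendre_1)
  qed
  finally show "\<bar>\<Sum>x\<in>{0..<int p}. Legendre (\<Prod>\<mu>\<in>R. x - \<mu>) (int p)\<bar>
    \<le> \<bar>\<Sum>y\<in>{0..<int p}. Legendre (poly f y) (int p)\<bar> + 1"
   by simp
 qed
qed

text \<open>Expand the product of \<open>1 + s * a \<nu> t\<close> over subsets of \<open>S\<close>:
  the empty subset gives \<open>p\<close>, and every other one a sum as in
  \<open>product_Legendre_sum\<close> after the substitution \<open>x = 4 t\<close>. The product is
  \<open>2^card S\<close> where all symbols equal \<open>s\<close> and 0 elsewhere, except at the
  few \<open>t\<close> where a symbol vanishes.\<close>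

lemma Legendre_patterns:
 fixes S :: "int set" and D s :: int
 assumes S: "finite S" "0 \<notin> S" and D: "D \<noteq> 0" and s: "s \<in> {1, - 1}" and \<epsilon>: "\<epsilon> > 0"
 shows "\<exists>p0. \<forall>p>p0. prime p \<longrightarrow>
  \<bar>real (card {t \<in> {0..<int p}. \<forall>\<nu>\<in>S. Legendre (D * \<nu> * (\<nu> - 4 * t)) (int p) = s}) / real p - 1 / 2 ^ card S\<bar> \<le> \<epsilon>"
proof -
 define B where "B = real (2 ^ card S)"
 define \<delta> where "\<delta> = \<epsilon> / (2 * B)"
 have B: "B \<ge> 1" by (simp add: B_def)
 have \<delta>: "\<delta> > 0" using \<epsilon> B by (simp add: \<delta>_def)
 have "\<exists>p0. \<forall>p>p0. prime p \<longrightarrow> \<bar>real_of_int (\<Sum>x\<in>{0..<int p}. Legendre (\<Prod>\<nu>\<in>R. x - \<nu>) (int p))\<bar> \<le> \<delta> * real p"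
  if "R \<in> Pow S - {{}}" for R
  using product_Legendre_sum[of R] that S(1) \<delta> finite_subset unfolding small_sums_def by blast
 then obtain P where P: "\<And>R p. R \<in> Pow S - {{}} \<Longrightarrow> p > P R \<Longrightarrow> prime p \<Longrightarrow>
   \<bar>real_of_int (\<Sum>x\<in>{0..<int p}. Legendre (\<Prod>\<nu>\<in>R. x - \<nu>) (int p))\<bar> \<le> \<delta> * real p"
  by metis
 define p1 where "p1 = (\<Sum>R\<in>Pow S. P R) + 2 + nat \<bar>D\<bar> + (\<Sum>\<nu>\<in>S. nat \<bar>\<nu>\<bar>) + nat \<lceil>2 * B * real (card S) / \<epsilon>\<rceil>"
 show ?thesis
 proof (intro exI[of _ p1] allI impI)
  fix p :: nat assume p1: "p > p1" and p: "prime p"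
  have p2: "p > 2" using p1 by (simp add: p1_def)
  have nd: "\<not> int p dvd z" if "z \<noteq> 0" "nat \<bar>z\<bar> < p" for z
   using zdvd_imp_le[of "int p" "\<bar>z\<bar>"] that by auto
  have pD: "\<not> int p dvd D" using p1 D by (intro nd) (simp_all add: p1_def)
  have pS: "\<not> int p dvd \<nu>" if "\<nu> \<in> S" for \<nu>
  proof (rule nd)
   have "nat \<bar>\<nu>\<bar> \<le> (\<Sum>\<nu>\<in>S. nat \<bar>\<nu>\<bar>)" using S(1) that by (intro member_le_sum) auto
   thus "nat \<bar>\<nu>\<bar> < p" using p1 by (simp add: p1_def)
  qed (use that S(2) in auto)
  have p4: "\<not> int p dvd 4"
  proof
   assume "int p dvd 4"
   hence "int p dvd 2 * 2" by simp
   hence "int p dvd 2" using p by (metis prime_dvd_mult_iff prime_nat_int_transfer)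
   thus False using p2 zdvd_imp_le[of "int p" 2] by simp
  qed
  define a where "a \<nu> t = Legendre (D * \<nu> * (\<nu> - 4 * t)) (int p)" for \<nu> t
  define W where "W t = (\<Prod>\<nu>\<in>S. 1 + s * a \<nu> t)" for t
  define C where "C = {t \<in> {0..<int p}. \<forall>\<nu>\<in>S. a \<nu> t = s}"
  define Z where "Z = {t \<in> {0..<int p}. \<exists>\<nu>\<in>S. a \<nu> t = 0}"
  have a_range: "a \<nu> t \<in> {- 1, 0, 1}" for \<nu> t unfolding a_def by (rule Legendre_range)
  have sum_shift: "(\<Sum>t\<in>{0..<int p}. g ((4 * t) mod int p)) = (\<Sum>x\<in>{0..<int p}. g x)" for g :: "int \<Rightarrow> int"
  proof -
   have inj: "inj_on (\<lambda>t. (4 * t) mod int p) {0..<int p}"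
   proof (rule inj_onI)
    fix t u assume tu: "t \<in> {0..<int p}" "u \<in> {0..<int p}" "(4 * t) mod int p = (4 * u) mod int p"
    hence "int p dvd 4 * (t - u)" by (simp add: mod_eq_dvd_iff algebra_simps)
    hence "int p dvd t - u" using p p4 by (metis prime_dvd_mult_iff prime_nat_int_transfer)
    hence "t mod int p = u mod int p" by (simp add: mod_eq_dvd_iff)
    thus "t = u" using tu by simp
   qed
   have "(\<lambda>t. (4 * t) mod int p) ` {0..<int p} = {0..<int p}"
    by (rule endo_inj_surj[OF _ _ inj]) (use p2 in auto)
   thus ?thesis using sum.reindex[OF inj, of g] by simp
  qed
  have term_R: "\<bar>real_of_int (\<Sum>t\<in>{0..<int p}. \<Prod>\<nu>\<in>R. s * a \<nu> t)\<bar> \<le> \<delta> * real p"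
   if R: "R \<in> Pow S - {{}}" for R
  proof -
   define u where "u = (\<Prod>\<nu>\<in>R. s * Legendre (- D * \<nu>) (int p))"
   have "(\<Prod>\<nu>\<in>R. s * a \<nu> t) = u * Legendre (\<Prod>\<nu>\<in>R. (4 * t) mod int p - \<nu>) (int p)" for t
   proof -
    have "a \<nu> t = Legendre (- D * \<nu>) (int p) * Legendre ((4 * t) mod int p - \<nu>) (int p)" for \<nu>
    proof -
     have "D * \<nu> * (\<nu> - 4 * t) = (- D * \<nu>) * (4 * t - \<nu>)" by (simp add: algebra_simps)
     hence "a \<nu> t = Legendre (- D * \<nu>) (int p) * Legendre (4 * t - \<nu>) (int p)"
      unfolding a_def by (simp only: Legendre_mult[OF p p2])
     moreover have "Legendre (4 * t - \<nu>) (int p) = Legendre ((4 * t) mod int p - \<nu>) (int p)"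
      by (rule Legendre_cong) (simp add: cong_def mod_diff_left_eq)
     ultimately show ?thesis by simp
    qed
    thus ?thesis by (simp add: u_def Legendre_prod[OF p p2] prod.distrib mult_ac)
   qed
   hence "(\<Sum>t\<in>{0..<int p}. \<Prod>\<nu>\<in>R. s * a \<nu> t) = u * (\<Sum>x\<in>{0..<int p}. Legendre (\<Prod>\<nu>\<in>R. x - \<nu>) (int p))"
    using sum_shift[of "\<lambda>x. Legendre (\<Prod>\<nu>\<in>R. x - \<nu>) (int p)"] by (simp flip: sum_distrib_left)
   moreover have "\<bar>u\<bar> \<le> 1"
    unfolding u_def abs_prod
   proof (rule prod_le_1)
    fix \<nu> show "0 \<le> \<bar>s * Legendre (- D * \<nu>) (int p)\<bar> \<and> \<bar>s * Legendre (- D * \<nu>) (int p)\<bar> \<le> 1"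
     using s Legendre_range[of "- D * \<nu>" "int p"] by auto
   qed
   moreover have "\<bar>real_of_int (\<Sum>x\<in>{0..<int p}. Legendre (\<Prod>\<nu>\<in>R. x - \<nu>) (int p))\<bar> \<le> \<delta> * real p"
   proof (rule P[OF R _ p])
    have "P R \<le> (\<Sum>R\<in>Pow S. P R)" using S(1) R by (intro member_le_sum) auto
    thus "p > P R" using p1 by (simp add: p1_def)
   qed
   moreover have "\<bar>real_of_int u\<bar> * \<bar>y\<bar> \<le> 1 * \<bar>y\<bar>" for y
    using \<open>\<bar>u\<bar> \<le> 1\<close> by (intro mult_right_mono) auto
   ultimately show ?thesis
    unfolding of_int_mult abs_mult mult_1 by (metis (no_types, lifting) abs_mult of_int_mult order_trans)
  qed
  have "(\<Sum>t\<in>{0..<int p}. W t) = (\<Sum>t\<in>{0..<int p}. \<Sum>R\<in>Pow S. \<Prod>\<nu>\<in>R. s * a \<nu> t)"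
  proof (rule sum.cong)
   fix t
   have "W t = (\<Prod>\<nu>\<in>S. s * a \<nu> t + 1)" by (simp add: W_def add.commute)
   thus "W t = (\<Sum>R\<in>Pow S. \<Prod>\<nu>\<in>R. s * a \<nu> t)" by (simp add: prod_add[OF S(1)])
  qed simp
  also have "\<dots> = (\<Sum>R\<in>Pow S. \<Sum>t\<in>{0..<int p}. \<Prod>\<nu>\<in>R. s * a \<nu> t)" by (rule sum.swap)
  also have "\<dots> = int p + (\<Sum>R\<in>Pow S - {{}}. \<Sum>t\<in>{0..<int p}. \<Prod>\<nu>\<in>R. s * a \<nu> t)"
   using S(1) by (subst sum.remove[of _ "{}"]) auto
  finally have "\<bar>real_of_int (\<Sum>t\<in>{0..<int p}. W t) - real p\<bar>
   = \<bar>\<Sum>R\<in>Pow S - {{}}. real_of_int (\<Sum>t\<in>{0..<int p}. \<Prod>\<nu>\<in>R. s * a \<nu> t)\<bar>" by simp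
  also have "\<dots> \<le> (\<Sum>R\<in>Pow S - {{}}. \<delta> * real p)"
   by (rule order_trans[OF sum_abs]) (intro sum_mono term_R)
  also have "\<dots> \<le> B * (\<delta> * real p)"
  proof -
   have "card (Pow S - {{}}) \<le> card (Pow S)" by (intro card_mono) (use S in auto)
   hence "real (card (Pow S - {{}})) \<le> B" using S(1) by (simp add: B_def card_Pow)
   thus ?thesis using \<delta> by (simp add: mult_right_mono)
  qed
  finally have W_sum: "\<bar>real_of_int (\<Sum>t\<in>{0..<int p}. W t) - real p\<bar> \<le> \<epsilon> / 2 * real p"
   using B by (simp add: \<delta>_def)
  have "\<bar>(\<Sum>t\<in>{0..<int p}. W t) - 2 ^ card S * int (card C)\<bar> \<le> 2 ^ card S * int (card Z)"
  proof -
   have Wt: "\<bar>W t - (if t \<in> C then 2 ^ card S else 0)\<bar> \<le> (if t \<in> Z then 2 ^ card S else 0)" if t: "t \<in> {0..<int p}" for t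
   proof (cases "t \<in> Z")
    case False
    hence nz: "a \<nu> t \<in> {s, - s}" if "\<nu> \<in> S" for \<nu>
     using that t a_range[of \<nu> t] s by (auto simp: Z_def)
    have "W t = (if t \<in> C then 2 ^ card S else 0)"
    proof (cases "t \<in> C")
     case True
     hence "W t = (\<Prod>\<nu>\<in>S. 2)" unfolding W_def using s by (intro prod.cong) (auto simp: C_def)
     thus ?thesis using True by simp
    next
     case False
     then obtain \<nu> where "\<nu> \<in> S" "a \<nu> t = - s" using nz t by (auto simp: C_def)
     hence "1 + s * a \<nu> t = 0" using s by auto
     hence "W t = 0" unfolding W_def using S(1) \<open>\<nu> \<in> S\<close> by (intro prod_zero) blast+
     thus ?thesis using False by simp
    qed
    thus ?thesis using False by simp
   next
    case True
    have "t \<notin> C" using True s unfolding C_def Z_def by force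
    moreover have "\<bar>W t\<bar> \<le> (\<Prod>\<nu>\<in>S. 2)"
     unfolding W_def abs_prod
    proof (rule prod_mono)
     fix \<nu> show "0 \<le> \<bar>1 + s * a \<nu> t\<bar> \<and> \<bar>1 + s * a \<nu> t\<bar> \<le> 2"
      using s a_range[of \<nu> t] by auto
    qed
    ultimately show ?thesis using True by simp
   qed
   have "(\<Sum>t\<in>{0..<int p}. W t) - 2 ^ card S * int (card C) = (\<Sum>t\<in>{0..<int p}. W t - (if t \<in> C then 2 ^ card S else 0))"
    by (simp add: sum_subtractf sum.If_cases C_def Int_def)
   also have "\<bar>\<dots>\<bar> \<le> (\<Sum>t\<in>{0..<int p}. if t \<in> Z then 2 ^ card S else 0)"
    by (rule order_trans[OF sum_abs]) (intro sum_mono Wt)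
   also have "\<dots> = 2 ^ card S * int (card Z)"
    by (simp add: sum.If_cases Z_def Int_def)
   finally show ?thesis .
  qed
  hence "\<bar>real_of_int ((\<Sum>t\<in>{0..<int p}. W t) - 2 ^ card S * int (card C))\<bar> \<le> real_of_int (2 ^ card S * int (card Z))"
   by linarith
  hence WC: "\<bar>real_of_int (\<Sum>t\<in>{0..<int p}. W t) - B * real (card C)\<bar> \<le> B * real (card Z)"
   by (simp add: B_def)
  \<comment> \<open>Each \<open>\<nu>\<close> makes its symbol vanish at a single residue
    \<open>t\<close>, so choosing such a \<open>\<nu>\<close> for every \<open>t\<close> is
    injective.\<close>
  have "card Z \<le> card S"
  proof (rule card_inj_on_le[of "\<lambda>t. SOME \<nu>. \<nu> \<in> S \<and> a \<nu> t = 0"])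
   have some: "(SOME \<nu>. \<nu> \<in> S \<and> a \<nu> t = 0) \<in> S \<and> a (SOME \<nu>. \<nu> \<in> S \<and> a \<nu> t = 0) t = 0" if "t \<in> Z" for t
    by (rule someI_ex) (use that in \<open>auto simp: Z_def\<close>)
   thus "(\<lambda>t. SOME \<nu>. \<nu> \<in> S \<and> a \<nu> t = 0) ` Z \<subseteq> S" by blast
   show "inj_on (\<lambda>t. SOME \<nu>. \<nu> \<in> S \<and> a \<nu> t = 0) Z"
   proof (rule inj_onI)
    fix t t' assume t: "t \<in> Z" "t' \<in> Z" "(SOME \<nu>. \<nu> \<in> S \<and> a \<nu> t = 0) = (SOME \<nu>. \<nu> \<in> S \<and> a \<nu> t' = 0)"
    then obtain \<nu> where \<nu>: "\<nu> \<in> S" "a \<nu> t = 0" "a \<nu> t' = 0" using some by metis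
    have "int p dvd \<nu> - 4 * t" "int p dvd \<nu> - 4 * t'"
     using \<nu> pD pS[OF \<nu>(1)] p by (auto simp: a_def Legendre_eq_0_iff prime_dvd_mult_iff)
    from dvd_diff[OF this(2,1)] have "int p dvd 4 * (t - t')" by (simp add: algebra_simps)
    hence "int p dvd t - t'" using p p4 by (metis prime_dvd_mult_iff prime_nat_int_transfer)
    hence "t mod int p = t' mod int p" by (simp add: mod_eq_dvd_iff)
    thus "t = t'" using t by (simp add: Z_def)
   qed
  qed (rule S(1))
  hence "B * real (card Z) \<le> B * real (card S)" using B by simp
  also have "\<dots> \<le> \<epsilon> / 2 * real p"
  proof -
   have "2 * B * real (card S) / \<epsilon> \<le> real p" using p1 unfolding p1_def by linarith
   thus ?thesis using \<epsilon> by (simp add: field_simps)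
  qed
  finally have "\<bar>B * real (card C) - real p\<bar> \<le> \<epsilon> * real p"
   using W_sum WC by linarith
  moreover have "(real (card C) / real p - 1 / B) * (B * real p) = B * real (card C) - real p"
   using B p2 by (simp add: field_simps)
  ultimately have "\<bar>(real (card C) / real p - 1 / B) * (B * real p)\<bar> \<le> \<epsilon> * real p"
   by (simp only:)
  hence "\<bar>real (card C) / real p - 1 / B\<bar> * B * real p \<le> \<epsilon> * real p"
   using B by (simp add: abs_mult mult.assoc)
  hence "\<bar>real (card C) / real p - 1 / B\<bar> * B \<le> \<epsilon>"
   using p2 by simp
  moreover have "\<bar>real (card C) / real p - 1 / B\<bar> * 1 \<le> \<bar>real (card C) / real p - 1 / B\<bar> * B"
   using B by (intro mult_left_mono) auto
  ultimately have "\<bar>real (card C) / real p - 1 / B\<bar> \<le> \<epsilon>" by (metis mult_1_right order_trans)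
  thus "\<bar>real (card {t \<in> {0..<int p}. \<forall>\<nu>\<in>S. Legendre (D * \<nu> * (\<nu> - 4 * t)) (int p) = s}) / real p - 1 / 2 ^ card S\<bar> \<le> \<epsilon>"
   by (simp add: C_def a_def B_def)
 qed
qed

section \<open>Multiplicative independence\<close>

text \<open>Integral polynomial expressions in \<open>t\<close> and the square roots \<open>g\<^sub>\<nu>\<close> with \<open>g\<^sub>\<nu>\<^sup>2 = \<nu>(\<nu> - 4t)\<close>.\<close>

inductive_set pexp :: "int set \<Rightarrow> (complex \<Rightarrow> (int \<Rightarrow> complex) \<Rightarrow> complex) set" for V where
 pexp_const: "(\<lambda>t g. of_int c) \<in> pexp V"
| pexp_t: "(\<lambda>t g. t) \<in> pexp V"
| pexp_g: "\<nu> \<in> V \<Longrightarrow> (\<lambda>t g. g \<nu>) \<in> pexp V"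
| pexp_add: "e \<in> pexp V \<Longrightarrow> f \<in> pexp V \<Longrightarrow> (\<lambda>t g. e t g + f t g) \<in> pexp V"
| pexp_mult: "e \<in> pexp V \<Longrightarrow> f \<in> pexp V \<Longrightarrow> (\<lambda>t g. e t g * f t g) \<in> pexp V"

definition rad :: "int \<Rightarrow> complex \<Rightarrow> complex" where
 "rad \<nu> t = of_int \<nu> * (of_int \<nu> - 4 * t)"

text \<open>In the application \<open>R\<close> is generated by a square root of an integer and
  \<open>I\<close> is \<open>p\<close> times \<open>R\<close>. Reduction modulo \<open>p\<close> is
  thus carried out inside the complex numbers, where the same expressions can also be studied
  analytically.\<close>

definition subring_ideal :: "complex set \<Rightarrow> complex set \<Rightarrow> bool" where
 "subring_ideal R I \<longleftrightarrow> (\<forall>c. of_int c \<in> R) \<and> (\<forall>x\<in>R. \<forall>y\<in>R. x + y \<in> R \<and> x * y \<in> R) \<and>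
   (\<forall>x\<in>I. \<forall>y\<in>I. x + y \<in> I) \<and> (\<forall>x\<in>R. \<forall>y\<in>I. x * y \<in> I)"

lemma pexp_mono: "e \<in> pexp V \<Longrightarrow> V \<subseteq> W \<Longrightarrow> e \<in> pexp W"
 by (induction rule: pexp.induct) (auto intro: pexp.intros)

lemma pexp_uminus: "e \<in> pexp V \<Longrightarrow> (\<lambda>t g. - e t g) \<in> pexp V"
 using pexp_mult[OF pexp_const[of "- 1"]] by fastforce

lemma pexp_diff: "e \<in> pexp V \<Longrightarrow> f \<in> pexp V \<Longrightarrow> (\<lambda>t g. e t g - f t g) \<in> pexp V"
 using pexp_add[OF _ pexp_uminus] by fastforce

lemma pexp_power: "e \<in> pexp V \<Longrightarrow> (\<lambda>t g. e t g ^ n) \<in> pexp V"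
proof (induction n)
 case 0
 thus ?case using pexp_const[of 1] by simp
next
 case (Suc n)
 thus ?case using pexp_mult[of e V "\<lambda>t g. e t g ^ n"] by simp
qed

lemma pexp_prod: "finite A \<Longrightarrow> (\<And>i. i \<in> A \<Longrightarrow> e i \<in> pexp V) \<Longrightarrow> (\<lambda>t g. \<Prod>i\<in>A. e i t g) \<in> pexp V"
proof (induction A rule: finite_induct)
 case empty
 thus ?case using pexp_const[of 1] by simp
next
 case (insert i A)
 thus ?case using pexp_mult[of "e i" V "\<lambda>t g. \<Prod>i\<in>A. e i t g"] by simp
qed

lemma pexp_rad: "(\<lambda>t g. rad \<nu> t) \<in> pexp V"
 unfolding rad_def
 using pexp_mult[OF pexp_const[of \<nu>] pexp_diff[OF pexp_const[of \<nu>] pexp_mult[OF pexp_const[of 4] pexp_t]]] by simp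

lemma pexp_indep: "e \<in> pexp V \<Longrightarrow> v \<notin> V \<Longrightarrow> e t (g(v := z)) = e t g"
 by (induction rule: pexp.induct) auto

lemma pexp_ring:
 assumes "e \<in> pexp V" "subring_ideal R I" "t \<in> R" "\<And>\<nu>. \<nu> \<in> V \<Longrightarrow> g \<nu> \<in> R"
 shows "e t g \<in> R"
 using assms by (induction rule: pexp.induct) (auto simp: subring_ideal_def)

text \<open>Division by \<open>(g v)^2 - rad v t\<close>. The cofactor \<open>c\<close> is again an
  integral expression, so the error term stays in every ideal that contains this difference.\<close>

lemma pexp_split:
 assumes "e \<in> pexp (insert v V)"
 shows "\<exists>e0\<in>pexp V. \<exists>e1\<in>pexp V. \<exists>c\<in>pexp (insert v V). \<forall>t g. e t g = e0 t g + g v * e1 t g + c t g * ((g v)\<^sup>2 - rad v t)"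
 using assms
proof (induction rule: pexp.induct)
 case (pexp_const k)
 show ?case
  by (intro bexI[of _ "\<lambda>t g. of_int k"] bexI[of _ "\<lambda>t g. of_int 0"] allI pexp.intros) simp
next
 case pexp_t
 show ?case
  by (intro bexI[of _ "\<lambda>t g. t"] bexI[of _ "\<lambda>t g. of_int 0"] allI pexp.intros) simp
next
 case (pexp_g \<nu>)
 show ?case
 proof (cases "\<nu> = v")
  case True
  show ?thesis
   by (intro bexI[of _ "\<lambda>t g. of_int 0"] bexI[of _ "\<lambda>t g. of_int 1"] bexI[of _ "\<lambda>t g. of_int 0"] allI pexp.intros)
    (simp add: True)
 next
  case False
  hence "\<nu> \<in> V" using pexp_g by simp
  thus ?thesis
   by (intro bexI[of _ "\<lambda>t g. g \<nu>"] bexI[of _ "\<lambda>t g. of_int 0"] allI pexp.intros) simp_all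
 qed
next
 case (pexp_add e f)
 then obtain e0 e1 c f0 f1 c' where *: "e0 \<in> pexp V" "e1 \<in> pexp V" "c \<in> pexp (insert v V)"
  "f0 \<in> pexp V" "f1 \<in> pexp V" "c' \<in> pexp (insert v V)"
  "\<And>t g. e t g = e0 t g + g v * e1 t g + c t g * ((g v)\<^sup>2 - rad v t)"
  "\<And>t g. f t g = f0 t g + g v * f1 t g + c' t g * ((g v)\<^sup>2 - rad v t)" by blast
 show ?case
  by (rule bexI[of _ "\<lambda>t g. e0 t g + f0 t g"], rule bexI[of _ "\<lambda>t g. e1 t g + f1 t g"],
    rule bexI[of _ "\<lambda>t g. c t g + c' t g"])
   (auto intro: pexp.intros * simp: *(7,8) algebra_simps)
next
 case (pexp_mult e f)
 then obtain e0 e1 c f0 f1 c' where *: "e0 \<in> pexp V" "e1 \<in> pexp V" "c \<in> pexp (insert v V)"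
  "f0 \<in> pexp V" "f1 \<in> pexp V" "c' \<in> pexp (insert v V)"
  "\<And>t g. e t g = e0 t g + g v * e1 t g + c t g * ((g v)\<^sup>2 - rad v t)"
  "\<And>t g. f t g = f0 t g + g v * f1 t g + c' t g * ((g v)\<^sup>2 - rad v t)" by blast
 have sub: "h \<in> pexp V \<Longrightarrow> h \<in> pexp (insert v V)" for h by (rule pexp_mono) auto
 have gv: "(\<lambda>t g. g v) \<in> pexp (insert v V)" by (rule pexp_g) simp
 define C where "C = (\<lambda>t g. e1 t g * f1 t g + c t g * f t g + (e0 t g + g v * e1 t g) * c' t g)"
 have C: "C \<in> pexp (insert v V)"
  unfolding C_def by (intro pexp.intros(4,5) sub * gv pexp_mult.hyps)
 have "e t g * f t g = (e0 t g * f0 t g + rad v t * (e1 t g * f1 t g))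
   + g v * (e0 t g * f1 t g + e1 t g * f0 t g) + C t g * ((g v)\<^sup>2 - rad v t)" for t g
  unfolding C_def *(7) *(8) by (simp add: algebra_simps power2_eq_square)
 thus ?case
  by (intro bexI[OF _ C] bexI[of _ "\<lambda>t g. e0 t g * f0 t g + rad v t * (e1 t g * f1 t g)"]
    bexI[of _ "\<lambda>t g. e0 t g * f1 t g + e1 t g * f0 t g"] allI pexp.intros(4,5) * pexp_rad) auto
qed

text \<open>\<open>e'\<close> is the norm \<open>e0^2 - rad v * e1^2\<close>, the product of the two
  conjugates of \<open>e\<close>. Modulo the relation for \<open>g v\<close> it is a multiple of
  \<open>e\<close>, and over the complex numbers a zero of the norm is a zero of \<open>e\<close>
  for one of the two values of the root.\<close>

lemma pexp_eliminate:
 assumes "e \<in> pexp (insert v V)" "v \<notin> V"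
 shows "\<exists>e'\<in>pexp V.
  (\<forall>R I t g. subring_ideal R I \<longrightarrow> t \<in> R \<longrightarrow> (\<forall>\<nu>\<in>insert v V. g \<nu> \<in> R) \<longrightarrow> (g v)\<^sup>2 - rad v t \<in> I \<longrightarrow> e t g \<in> I \<longrightarrow> e' t g \<in> I) \<and>
  (\<forall>t g. e' t g = 0 \<longrightarrow> (\<exists>z. z\<^sup>2 = rad v t \<and> e t (g(v := z)) = 0))"
proof -
 obtain e0 e1 c where e: "e0 \<in> pexp V" "e1 \<in> pexp V" "c \<in> pexp (insert v V)"
  "\<And>t g. e t g = e0 t g + g v * e1 t g + c t g * ((g v)\<^sup>2 - rad v t)"
  using pexp_split[OF assms(1)] by blast
 define e' where "e' = (\<lambda>t g. e0 t g * e0 t g - rad v t * (e1 t g * e1 t g))"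
 have e': "e' \<in> pexp V"
  unfolding e'_def by (intro pexp_diff pexp.intros(5) e pexp_rad)
 have 1: "e' t g \<in> I" if RI: "subring_ideal R I" "t \<in> R" "\<forall>\<nu>\<in>insert v V. g \<nu> \<in> R"
   "(g v)\<^sup>2 - rad v t \<in> I" "e t g \<in> I" for R I t g
 proof -
  have R: "e0 t g \<in> R" "e1 t g \<in> R" "c t g \<in> R" "g v \<in> R" "- 1 \<in> R"
   using pexp_ring[OF e(1) RI(1,2)] pexp_ring[OF e(2) RI(1,2)] pexp_ring[OF e(3) RI(1,2)] RI(3)
    RI(1)[unfolded subring_ideal_def, THEN conjunct1, rule_format, of "- 1"] by auto
  have cl: "\<And>x y. x \<in> R \<Longrightarrow> y \<in> R \<Longrightarrow> x + y \<in> R" "\<And>x y. x \<in> R \<Longrightarrow> y \<in> R \<Longrightarrow> x * y \<in> R"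
   "\<And>x y. x \<in> I \<Longrightarrow> y \<in> I \<Longrightarrow> x + y \<in> I" "\<And>x y. x \<in> R \<Longrightarrow> y \<in> I \<Longrightarrow> x * y \<in> I"
   using RI(1) unfolding subring_ideal_def by blast+
  define w where "w = (g v)\<^sup>2 - rad v t"
  have "e' t g = (e0 t g + (- 1) * (g v * e1 t g)) * (e t g + (- 1 * c t g) * w) + (e1 t g * e1 t g) * w"
   unfolding e'_def e(4) w_def by (simp add: algebra_simps power2_eq_square)
  moreover have "\<dots> \<in> I"
   using R RI(4,5) by (intro cl) (simp_all add: w_def)
  ultimately show ?thesis by simp
 qed
 have 2: "\<exists>z. z\<^sup>2 = rad v t \<and> e t (g(v := z)) = 0" if z: "e' t g = 0" for t g
 proof -
  have ind: "e0 t (g(v := z)) = e0 t g" "e1 t (g(v := z)) = e1 t g" for z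
   using pexp_indep[OF e(1) assms(2)] pexp_indep[OF e(2) assms(2)] by blast+
  have eq: "e0 t g * e0 t g = rad v t * (e1 t g * e1 t g)" using z by (simp add: e'_def)
  show ?thesis
  proof (cases "e1 t g = 0")
   case True
   thus ?thesis using eq by (intro exI[of _ "csqrt (rad v t)"]) (simp add: e(4) ind)
  next
   case False
   thus ?thesis
    using eq by (intro exI[of _ "- e0 t g / e1 t g"]) (simp add: e(4) ind field_simps power2_eq_square)
  qed
 qed
 show ?thesis using e' 1 2 by blast
qed

lemma map_poly_of_int_add: "map_poly (of_int :: int \<Rightarrow> complex) (p + q) = map_poly of_int p + map_poly of_int q"
 by (rule poly_eqI) (simp add: coeff_map_poly)

lemma map_poly_of_int_mult: "map_poly (of_int :: int \<Rightarrow> complex) (p * q) = map_poly of_int p * map_poly of_int q"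
 by (rule poly_eqI) (simp add: coeff_map_poly coeff_mult)

lemma poly_map_poly_of_int: "poly (map_poly (of_int :: int \<Rightarrow> complex) p) (of_int x) = of_int (poly p x)"
 by (induction p) (simp_all add: map_poly_pCons)

lemma pexp_empty:
 assumes "e \<in> pexp {}"
 shows "\<exists>P. \<forall>t g. e t g = poly (map_poly of_int P) t"
 using assms
proof (induction rule: pexp.induct)
 case (pexp_const c)
 show ?case by (rule exI[of _ "[:c:]"]) (simp add: map_poly_pCons)
next
 case pexp_t
 show ?case by (rule exI[of _ "[:0, 1:]"]) (simp add: map_poly_pCons)
next
 case (pexp_add e f)
 then obtain P Q where "\<forall>t g. e t g = poly (map_poly of_int P) t" "\<forall>t g. f t g = poly (map_poly of_int Q) t" by blast
 thus ?case by (intro exI[of _ "P + Q"]) (simp add: map_poly_of_int_add)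
next
 case (pexp_mult e f)
 then obtain P Q where "\<forall>t g. e t g = poly (map_poly of_int P) t" "\<forall>t g. f t g = poly (map_poly of_int Q) t" by blast
 thus ?case by (intro exI[of _ "P * Q"]) (simp add: map_poly_of_int_mult)
qed simp

text \<open>Eliminating the roots one by one leaves a polynomial in \<open>t\<close>. The ideal
  clause is what is applied modulo primes; the clause over the complex numbers serves to show that
  the polynomial is not zero.\<close>

lemma pexp_resultant:
 assumes "finite V" "e \<in> pexp V"
 shows "\<exists>P. (\<forall>R I t g. subring_ideal R I \<longrightarrow> t \<in> R \<longrightarrow> (\<forall>\<nu>\<in>V. g \<nu> \<in> R \<and> (g \<nu>)\<^sup>2 - rad \<nu> t \<in> I) \<longrightarrow> e t g \<in> I
    \<longrightarrow> poly (map_poly of_int P) t \<in> I) \<and>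
   (\<forall>t. poly (map_poly of_int P) t = 0 \<longrightarrow> (\<exists>g. (\<forall>\<nu>\<in>V. (g \<nu>)\<^sup>2 = rad \<nu> t) \<and> e t g = 0))"
 using assms
proof (induction V arbitrary: e rule: finite_induct)
 case empty
 then obtain P where "\<forall>t g. e t g = poly (map_poly of_int P) t" using pexp_empty by blast
 thus ?case by (intro exI[of _ P]) simp
next
 case (insert v V)
 obtain e' where e': "e' \<in> pexp V"
  "\<And>R I t g. subring_ideal R I \<Longrightarrow> t \<in> R \<Longrightarrow> (\<forall>\<nu>\<in>insert v V. g \<nu> \<in> R) \<Longrightarrow> (g v)\<^sup>2 - rad v t \<in> I \<Longrightarrow> e t g \<in> I \<Longrightarrow> e' t g \<in> I"
  "\<And>t g. e' t g = 0 \<Longrightarrow> \<exists>z. z\<^sup>2 = rad v t \<and> e t (g(v := z)) = 0"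
  using pexp_eliminate[OF insert.prems insert.hyps(2)] by blast
 obtain P where P: "\<And>R I t g. subring_ideal R I \<Longrightarrow> t \<in> R \<Longrightarrow> (\<forall>\<nu>\<in>V. g \<nu> \<in> R \<and> (g \<nu>)\<^sup>2 - rad \<nu> t \<in> I) \<Longrightarrow> e' t g \<in> I
    \<Longrightarrow> poly (map_poly of_int P) t \<in> I"
  "\<And>t. poly (map_poly of_int P) t = 0 \<Longrightarrow> \<exists>g. (\<forall>\<nu>\<in>V. (g \<nu>)\<^sup>2 = rad \<nu> t) \<and> e' t g = 0"
  using insert.IH[OF e'(1)] by blast
 show ?case
 proof (intro exI[of _ P] conjI allI impI)
  fix R I t g assume "subring_ideal R I" "t \<in> R" "\<forall>\<nu>\<in>insert v V. g \<nu> \<in> R \<and> (g \<nu>)\<^sup>2 - rad \<nu> t \<in> I" "e t g \<in> I"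
  thus "poly (map_poly of_int P) t \<in> I" by (intro P(1)[of R I t g] e'(2)) auto
 next
  fix t :: complex assume "poly (map_poly of_int P) t = 0"
  then obtain g where g: "\<forall>\<nu>\<in>V. (g \<nu>)\<^sup>2 = rad \<nu> t" "e' t g = 0" using P(2) by blast
  then obtain z where z: "z\<^sup>2 = rad v t" "e t (g(v := z)) = 0" using e'(3) by blast
  thus "\<exists>g. (\<forall>\<nu>\<in>insert v V. (g \<nu>)\<^sup>2 = rad \<nu> t) \<and> e t g = 0"
   using g(1) insert.hyps(2) by (intro exI[of _ "g(v := z)"]) auto
 qed
qed

lemma deriv_nonzero_eventually_neq:
 fixes f :: "complex \<Rightarrow> complex"
 assumes "(f has_field_derivative d) (at 0)" "d \<noteq> 0"
 shows "eventually (\<lambda>s. f s \<noteq> c) (at 0)"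
proof (cases "f 0 = c")
 case True
 have "((\<lambda>h. (f (0 + h) - f 0) / h) \<longlongrightarrow> d) (at 0)" using assms(1) by (simp only: DERIV_def)
 hence "eventually (\<lambda>h. (f (0 + h) - f 0) / h \<noteq> 0) (at 0)" using assms(2) by (rule tendsto_imp_eventually_ne)
 thus ?thesis by eventually_elim (use True in auto)
next
 case False
 have "isCont f 0" using assms(1) by (rule DERIV_isCont)
 hence "(f \<longlongrightarrow> f 0) (at 0)" by (simp add: isCont_def)
 thus ?thesis using False by (rule tendsto_imp_eventually_ne)
qed

lemma field_differentiable_prod:
 fixes f :: "'i \<Rightarrow> complex \<Rightarrow> complex"
 assumes "\<And>i. i \<in> A \<Longrightarrow> f i field_differentiable (at z)"
 shows "(\<lambda>x. \<Prod>i\<in>A. f i x) field_differentiable (at z)"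
 using assms by (induction A rule: infinite_finite_induct) (auto intro!: derivative_intros)

text \<open>The equation \<open>rel_exp R a b g = rel_exp R b a g\<close> says, free of
  denominators, that the product of
  \<open>((g \<nu> - \<nu>) / (g \<nu> + \<nu>))^(a \<nu> - b \<nu>)\<close> is 1.\<close>

definition rel_exp :: "int set \<Rightarrow> (int \<Rightarrow> nat) \<Rightarrow> (int \<Rightarrow> nat) \<Rightarrow> (int \<Rightarrow> complex) \<Rightarrow> complex" where
 "rel_exp R a b g = (\<Prod>\<nu>\<in>R. (g \<nu> + of_int \<nu>) ^ a \<nu> * (g \<nu> - of_int \<nu>) ^ b \<nu>)"

text \<open>Near the branch point \<open>t = \<nu>\<^sub>1/4\<close> of \<open>g\<^bsub>\<nu>\<^sub>1\<^esub> = s\<close>, all other square roots are functions of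
 \<open>s\<^sup>2\<close>; so a relation with a nontrivial exponent at \<open>\<nu>\<^sub>1\<close> has nonzero derivative in \<open>s\<close> at \<open>s = 0\<close>.\<close>

lemma no_relation_near_branch_point:
 assumes R: "finite R" "0 \<notin> R" "\<nu>1 \<in> R" "a \<nu>1 \<noteq> b \<nu>1"
 shows "\<exists>t. \<forall>g. (\<forall>\<nu>\<in>R. (g \<nu>)\<^sup>2 = rad \<nu> t) \<longrightarrow> rel_exp R a b g \<noteq> rel_exp R b a g"
proof -
 define n1 :: complex where "n1 = of_int \<nu>1"
 have n1: "n1 \<noteq> 0" using R by (auto simp: n1_def)
 \<comment> \<open>The coordinate \<open>u\<close> is the radicand at \<open>\<nu>1\<close>, so
   \<open>u = s^2\<close> when the corresponding root is \<open>s\<close>.\<close>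
 define T where "T u = (n1 - u / n1) / 4" for u
 \<comment> \<open>Branches of the other roots that are differentiable at \<open>u = 0\<close>:
   division by the value at 0 keeps the argument of \<open>csqrt\<close> near 1, away from its
   cut.\<close>
 define r where "r \<nu> u = csqrt (rad \<nu> (T 0)) * csqrt (rad \<nu> (T u) / rad \<nu> (T 0))" for \<nu> u
 have rad1: "rad \<nu>1 (T u) = u" for u using n1 by (simp add: rad_def T_def n1_def[symmetric] field_simps)
 have rad0: "rad \<nu> (T 0) \<noteq> 0" if "\<nu> \<in> R - {\<nu>1}" for \<nu>
  using that R(2) by (auto simp: rad_def T_def n1_def)
 have r2: "(r \<nu> u)\<^sup>2 = rad \<nu> (T u)" if "\<nu> \<in> R - {\<nu>1}" for \<nu> u
  using rad0[OF that] by (simp add: r_def power_mult_distrib)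
 define \<gamma> where "\<gamma> \<nu> z = (z + of_int \<nu>) / (z - of_int \<nu>)" for \<nu> and z :: complex
 define \<gamma>' where "\<gamma>' \<nu> z = (z - of_int \<nu>) / (z + of_int \<nu>)" for \<nu> and z :: complex
 define C where "C \<sigma> u = (\<Prod>\<nu>\<in>R - {\<nu>1}. \<gamma> \<nu> (\<sigma> \<nu> * r \<nu> u) ^ a \<nu> * \<gamma>' \<nu> (\<sigma> \<nu> * r \<nu> u) ^ b \<nu>)" for \<sigma> u
 define K where "K \<sigma> s = \<gamma> \<nu>1 (\<sigma> \<nu>1 * s) ^ a \<nu>1 * \<gamma>' \<nu>1 (\<sigma> \<nu>1 * s) ^ b \<nu>1 * C \<sigma> (s\<^sup>2)" for \<sigma> s
 \<comment> \<open>Any system of roots over the same \<open>t\<close> differs from the chosen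
   branches by signs. The sign patterns are finite in number, so one small \<open>s\<close> avoids
   the relation for all of them.\<close>
 define \<Sigma> where "\<Sigma> = (\<Pi>\<^sub>E \<nu>\<in>R. {1, - 1 :: complex})"
 have fin: "finite \<Sigma>" unfolding \<Sigma>_def by (rule finite_PiE[OF R(1)]) simp
 have nz: "z + of_int \<nu> \<noteq> 0" "z - of_int \<nu> \<noteq> 0" if "z\<^sup>2 = rad \<nu> t" "t \<noteq> 0" "\<nu> \<in> R" for z \<nu> t
 proof -
  have "(z + of_int \<nu>) * (z - of_int \<nu>) = z\<^sup>2 - of_int \<nu> * of_int \<nu>" by (simp add: algebra_simps power2_eq_square)
  also have "\<dots> = - 4 * of_int \<nu> * t" by (simp add: that(1) rad_def algebra_simps)
  finally have "(z + of_int \<nu>) * (z - of_int \<nu>) \<noteq> 0" using that(2,3) R(2) by auto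
  thus "z + of_int \<nu> \<noteq> 0" "z - of_int \<nu> \<noteq> 0" by auto
 qed
 have T0: "T 0 \<noteq> 0" using n1 by (simp add: T_def)
 have ev: "eventually (\<lambda>s. K \<sigma> s \<noteq> 1) (at 0)" if \<sigma>: "\<sigma> \<in> \<Sigma>" for \<sigma>
 proof -
  have \<sigma>1: "\<sigma> \<nu> = 1 \<or> \<sigma> \<nu> = - 1" if "\<nu> \<in> R" for \<nu> using \<sigma> that unfolding \<Sigma>_def by blast
  have nz0: "\<sigma> \<nu> * r \<nu> 0 + of_int \<nu> \<noteq> 0" "\<sigma> \<nu> * r \<nu> 0 - of_int \<nu> \<noteq> 0" if "\<nu> \<in> R - {\<nu>1}" for \<nu>
  proof -
   have "(\<sigma> \<nu> * r \<nu> 0)\<^sup>2 = rad \<nu> (T 0)" using r2[OF that, of 0] \<sigma>1[of \<nu>] that by (auto simp: power_mult_distrib)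
   thus "\<sigma> \<nu> * r \<nu> 0 + of_int \<nu> \<noteq> 0" "\<sigma> \<nu> * r \<nu> 0 - of_int \<nu> \<noteq> 0" using nz T0 that by blast+
  qed
  have "r \<nu> field_differentiable (at 0)" if "\<nu> \<in> R - {\<nu>1}" for \<nu>
  proof -
   have "\<nu> \<noteq> 0" "n1 \<noteq> of_int \<nu>" using that R(2) by (auto simp: n1_def)
   hence "(\<lambda>u. rad \<nu> (T u) / rad \<nu> (T 0)) field_differentiable (at 0)"
    unfolding rad_def T_def using n1 by (intro derivative_intros) auto
   moreover have "csqrt field_differentiable (at (rad \<nu> (T 0) / rad \<nu> (T 0)))"
    using rad0[OF that] by (intro field_differentiable_at_csqrt) (simp add: complex_nonpos_Reals_iff)
   ultimately have "(csqrt \<circ> (\<lambda>u. rad \<nu> (T u) / rad \<nu> (T 0))) field_differentiable (at 0)"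
    by (rule field_differentiable_compose)
   thus ?thesis unfolding r_def o_def by (intro derivative_intros)
  qed
  hence "C \<sigma> field_differentiable (at 0)"
   unfolding C_def \<gamma>_def \<gamma>'_def
   by (intro field_differentiable_prod derivative_intros) (use nz0 in \<open>auto simp: right_minus_eq\<close>)
  then obtain c where c: "(C \<sigma> has_field_derivative c) (at 0)" unfolding field_differentiable_def by blast
  \<comment> \<open>Functions of \<open>s^2\<close> have derivative 0 at \<open>s = 0\<close>, so
    only the factor at \<open>\<nu>1\<close> contributes to the derivative of
    \<open>K\<close>.\<close>
  have sq: "((\<lambda>s :: complex. s\<^sup>2) has_field_derivative 0) (at 0)"
   by (auto intro!: derivative_eq_intros)
  have "((\<lambda>s. C \<sigma> (s\<^sup>2)) has_field_derivative c * 0) (at 0)"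
   using DERIV_chain2[of "C \<sigma>" c "\<lambda>s. s\<^sup>2" 0 0] c sq by simp
  hence dC: "((\<lambda>s. C \<sigma> (s\<^sup>2)) has_field_derivative 0) (at 0)" by simp
  have d\<gamma>: "((\<lambda>s. \<gamma> \<nu>1 (\<sigma> \<nu>1 * s)) has_field_derivative - 2 * \<sigma> \<nu>1 / n1) (at 0)"
   unfolding \<gamma>_def n1_def[symmetric] using n1
   by (auto intro!: derivative_eq_intros simp: field_simps)
  have d\<gamma>': "((\<lambda>s. \<gamma>' \<nu>1 (\<sigma> \<nu>1 * s)) has_field_derivative 2 * \<sigma> \<nu>1 / n1) (at 0)"
   unfolding \<gamma>'_def n1_def[symmetric] using n1
   by (auto intro!: derivative_eq_intros simp: field_simps)
  have g0: "\<gamma> \<nu>1 (\<sigma> \<nu>1 * 0) = - 1" "\<gamma>' \<nu>1 (\<sigma> \<nu>1 * 0) = - 1"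
   using n1 by (simp_all add: \<gamma>_def \<gamma>'_def n1_def)
  define X where "X = 2 * \<sigma> \<nu>1 / n1"
  have da: "((\<lambda>s. \<gamma> \<nu>1 (\<sigma> \<nu>1 * s) ^ a \<nu>1) has_field_derivative of_nat (a \<nu>1) * (- 1) ^ (a \<nu>1) * X) (at 0)"
   using DERIV_power[OF d\<gamma>, of "a \<nu>1"] unfolding g0 by (cases "a \<nu>1") (simp_all add: X_def mult_ac)
  have db: "((\<lambda>s. \<gamma>' \<nu>1 (\<sigma> \<nu>1 * s) ^ b \<nu>1) has_field_derivative - of_nat (b \<nu>1) * (- 1) ^ (b \<nu>1) * X) (at 0)"
   using DERIV_power[OF d\<gamma>', of "b \<nu>1"] unfolding g0 by (cases "b \<nu>1") (simp_all add: X_def algebra_simps add_divide_distrib)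
  define d where "d = (of_nat (a \<nu>1) - of_nat (b \<nu>1)) * ((- 1) ^ a \<nu>1 * (- 1) ^ b \<nu>1) * X * C \<sigma> 0"
  have "(K \<sigma> has_field_derivative d) (at 0)"
   unfolding K_def using DERIV_mult[OF DERIV_mult[OF da db] dC] unfolding g0 d_def
   by (simp add: algebra_simps)
  moreover have "d \<noteq> 0"
  proof -
   have "C \<sigma> 0 \<noteq> 0" unfolding C_def \<gamma>_def \<gamma>'_def using R(1) nz0 by (auto simp: prod_zero_iff)
   moreover have "X \<noteq> 0" using n1 \<sigma>1[OF R(3)] by (auto simp: X_def)
   moreover have "of_nat (a \<nu>1) - of_nat (b \<nu>1) \<noteq> (0 :: complex)" using R(4) by simp
   ultimately show ?thesis by (simp add: d_def)
  qed
  ultimately show ?thesis by (rule deriv_nonzero_eventually_neq)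
 qed
 have "eventually (\<lambda>s. \<forall>\<sigma>\<in>\<Sigma>. K \<sigma> s \<noteq> 1) (at 0)"
  using fin ev by (intro eventually_ball_finite) auto
 moreover have "eventually (\<lambda>s. T (s\<^sup>2) \<noteq> 0) (at 0)"
 proof -
  have "((\<lambda>s. T (s\<^sup>2)) \<longlongrightarrow> T (0\<^sup>2)) (at 0)" unfolding T_def using n1 by (intro tendsto_intros) auto
  thus ?thesis using T0 by (intro tendsto_imp_eventually_ne) auto
 qed
 ultimately have "eventually (\<lambda>s. (\<forall>\<sigma>\<in>\<Sigma>. K \<sigma> s \<noteq> 1) \<and> T (s\<^sup>2) \<noteq> 0) (at (0 :: complex))"
  by (rule eventually_conj)
 then obtain s where s: "\<forall>\<sigma>\<in>\<Sigma>. K \<sigma> s \<noteq> 1" "T (s\<^sup>2) \<noteq> 0"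
  using eventually_happens[of _ "at (0 :: complex)"] by (auto simp: trivial_limit_at)
 show ?thesis
 proof (intro exI[of _ "T (s\<^sup>2)"] allI impI notI)
  fix g assume g: "\<forall>\<nu>\<in>R. (g \<nu>)\<^sup>2 = rad \<nu> (T (s\<^sup>2))" and eq: "rel_exp R a b g = rel_exp R b a g"
  define r1 where "r1 \<nu> = (if \<nu> = \<nu>1 then s else r \<nu> (s\<^sup>2))" for \<nu>
  define \<sigma> where "\<sigma> = (\<lambda>\<nu>\<in>R. if g \<nu> = r1 \<nu> then 1 else - 1 :: complex)"
  have \<sigma>: "\<sigma> \<in> \<Sigma>" by (auto simp: \<sigma>_def \<Sigma>_def)
  have g\<sigma>: "g \<nu> = \<sigma> \<nu> * r1 \<nu>" if \<nu>: "\<nu> \<in> R" for \<nu>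
  proof -
   have "(g \<nu>)\<^sup>2 = (r1 \<nu>)\<^sup>2" using g \<nu> rad1 r2[of \<nu> "s\<^sup>2"] by (simp add: r1_def)
   hence "g \<nu> = r1 \<nu> \<or> g \<nu> = - r1 \<nu>" by (simp add: power2_eq_iff)
   thus ?thesis using \<nu> by (auto simp: \<sigma>_def)
  qed
  have gnz: "g \<nu> + of_int \<nu> \<noteq> 0" "g \<nu> - of_int \<nu> \<noteq> 0" if "\<nu> \<in> R" for \<nu>
   using nz[of "g \<nu>" \<nu> "T (s\<^sup>2)"] g s(2) that by auto
  have "rel_exp R b a g \<noteq> 0" using R(1) gnz by (auto simp: rel_exp_def prod_zero_iff)
  hence "1 = rel_exp R a b g / rel_exp R b a g" by (simp add: eq)
  also have "\<dots> = (\<Prod>\<nu>\<in>R. \<gamma> \<nu> (g \<nu>) ^ a \<nu> * \<gamma>' \<nu> (g \<nu>) ^ b \<nu>)"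
   unfolding rel_exp_def prod_dividef[symmetric] \<gamma>_def \<gamma>'_def
   by (rule prod.cong) (simp_all add: power_divide mult.commute)
  also have "\<dots> = K \<sigma> s"
  proof -
   have "(\<Prod>\<nu>\<in>R - {\<nu>1}. \<gamma> \<nu> (g \<nu>) ^ a \<nu> * \<gamma>' \<nu> (g \<nu>) ^ b \<nu>) = C \<sigma> (s\<^sup>2)"
    unfolding C_def by (rule prod.cong) (auto simp: g\<sigma> r1_def)
   thus ?thesis
    by (simp add: K_def prod.remove[OF R(1,3)] g\<sigma>[OF R(3)] r1_def)
  qed
  finally show False using s(1) \<sigma> by auto
 qed
qed

lemma square_root_irrational:
 fixes D :: int
 assumes "\<And>z. z\<^sup>2 \<noteq> D" "a\<^sup>2 * D = b\<^sup>2"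
 shows "a = 0"
proof (rule ccontr)
 assume a: "a \<noteq> 0"
 have "a\<^sup>2 dvd b\<^sup>2" using assms(2) by (metis dvd_triv_left)
 hence "a dvd b" by (simp add: pow_divides_pow_iff)
 then obtain z where "b = a * z" by blast
 hence "D = z\<^sup>2" using assms(2) a by (simp add: power_mult_distrib)
 thus False using assms(1)[of z] by simp
qed

text \<open>With \<open>g = s \<nu> * \<delta>\<close>, the last two congruences for
  \<open>\<nu>\<close> are the components of
  \<open>(c \<nu> + d \<nu> * \<delta>) * (g + \<nu>) = g - \<nu>\<close>, the equation of the Hecke
  elements in the matrix elements. \<open>P\<close> must detect every \<open>t\<close> at which a
  product of them is 1 modulo \<open>p\<close>, uniformly in \<open>p\<close> and
  \<open>D\<close>.\<close>

definition relation_poly :: "int set \<Rightarrow> (int \<Rightarrow> nat) \<Rightarrow> (int \<Rightarrow> nat) \<Rightarrow> int poly \<Rightarrow> bool" where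
 "relation_poly R a b P \<longleftrightarrow> (\<forall>p D \<delta> t c d s x y.
   (\<forall>z. z\<^sup>2 \<noteq> D) \<longrightarrow> p \<noteq> 0 \<longrightarrow> \<delta>\<^sup>2 = of_int D \<longrightarrow>
   (\<forall>\<nu>\<in>R. p dvd D * (s \<nu>)\<^sup>2 - \<nu> * (\<nu> - 4 * t) \<and> p dvd c \<nu> * \<nu> + D * d \<nu> * s \<nu> + \<nu>
    \<and> p dvd c \<nu> * s \<nu> + d \<nu> * \<nu> - s \<nu>) \<longrightarrow>
   (\<Prod>\<nu>\<in>R. (of_int (c \<nu>) + of_int (d \<nu>) * \<delta>) ^ a \<nu> * (of_int (c \<nu>) - of_int (d \<nu>) * \<delta>) ^ b \<nu>)
    = (of_int x + of_int y * \<delta> :: complex) \<longrightarrow> p dvd x - 1 \<longrightarrow> p dvd y \<longrightarrow> p dvd poly P t)"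

theorem multiplicative_relation:
 fixes R :: "int set"
 assumes R: "finite R" "0 \<notin> R" "\<exists>\<nu>\<in>R. a \<nu> \<noteq> b \<nu>"
 obtains P :: "int poly" where "P \<noteq> 0" "relation_poly R a b P"
proof -
 define e where "e = (\<lambda>(t :: complex) g. rel_exp R a b g - rel_exp R b a g)"
 have "(\<lambda>(t :: complex) g. rel_exp R a b g) \<in> pexp R" for a b
 proof -
  have "(\<lambda>(t :: complex) g. (g \<nu> + of_int \<nu>) ^ a \<nu> * (g \<nu> - of_int \<nu>) ^ b \<nu>) \<in> pexp R" if "\<nu> \<in> R" for \<nu>
   using pexp_mult[OF pexp_power[OF pexp_add[OF pexp_g[OF that] pexp_const[of \<nu>]]]
     pexp_power[OF pexp_diff[OF pexp_g[OF that] pexp_const[of \<nu>]]]] .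
  from pexp_prod[OF R(1) this] show ?thesis unfolding rel_exp_def .
 qed
 hence "e \<in> pexp R" unfolding e_def by (intro pexp_diff)
 then obtain P where P1: "\<And>S I t g. subring_ideal S I \<Longrightarrow> t \<in> S \<Longrightarrow> (\<forall>\<nu>\<in>R. g \<nu> \<in> S \<and> (g \<nu>)\<^sup>2 - rad \<nu> t \<in> I) \<Longrightarrow> e t g \<in> I
    \<Longrightarrow> poly (map_poly of_int P) t \<in> I"
  and P2: "\<And>t. poly (map_poly of_int P) t = 0 \<Longrightarrow> \<exists>g. (\<forall>\<nu>\<in>R. (g \<nu>)\<^sup>2 = rad \<nu> t) \<and> e t g = 0"
  using pexp_resultant[OF R(1)] by metis
 show ?thesis
 proof (rule that)
  show "P \<noteq> 0"
  proof
   assume "P = 0"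
   obtain \<nu>1 where "\<nu>1 \<in> R" "a \<nu>1 \<noteq> b \<nu>1" using R(3) by blast
   then obtain t where "\<forall>g. (\<forall>\<nu>\<in>R. (g \<nu>)\<^sup>2 = rad \<nu> t) \<longrightarrow> rel_exp R a b g \<noteq> rel_exp R b a g"
    using no_relation_near_branch_point[OF R(1,2)] by blast
   moreover have "poly (map_poly of_int P) t = 0" by (simp add: \<open>P = 0\<close>)
   ultimately show False using P2[of t] by (auto simp: e_def)
  qed
  show "relation_poly R a b P"
   unfolding relation_poly_def
  proof (intro allI impI)
  fix p D \<delta> t c d s x y
  assume D0: "\<forall>z. z\<^sup>2 \<noteq> (D :: int)" and p: "p \<noteq> 0" and \<delta>: "\<delta>\<^sup>2 = (of_int D :: complex)"
   and rel0: "\<forall>\<nu>\<in>R. p dvd D * (s \<nu>)\<^sup>2 - \<nu> * (\<nu> - 4 * t) \<and> p dvd c \<nu> * \<nu> + D * d \<nu> * s \<nu> + \<nu>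
     \<and> p dvd c \<nu> * s \<nu> + d \<nu> * \<nu> - s \<nu>"
   and prod: "(\<Prod>\<nu>\<in>R. (of_int (c \<nu>) + of_int (d \<nu>) * \<delta>) ^ a \<nu> * (of_int (c \<nu>) - of_int (d \<nu>) * \<delta>) ^ b \<nu>)
     = of_int x + of_int y * \<delta>"
   and xy: "p dvd x - 1" "p dvd y"
  have D: "\<And>z. z\<^sup>2 \<noteq> D" using D0 by blast
  note rel = rel0[rule_format]
  \<comment> \<open>The order generated by \<open>\<delta>\<close>, and \<open>p\<close> times it:
    congruence modulo \<open>p\<close> becomes membership of the difference in
    \<open>I\<close>.\<close>
  define S where "S = {of_int m + of_int n * \<delta> | m n. True}"
  define I where "I = {of_int p * z | z. z \<in> S}"
  have S_I: "of_int m + of_int n * \<delta> \<in> S" for m n by (auto simp: S_def)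
  have S_add: "u + v \<in> S" if "u \<in> S" "v \<in> S" for u v
  proof -
   obtain m n m' n' where "u = of_int m + of_int n * \<delta>" "v = of_int m' + of_int n' * \<delta>" using \<open>u \<in> S\<close> \<open>v \<in> S\<close> unfolding S_def by blast
   hence "u + v = of_int (m + m') + of_int (n + n') * \<delta>" by (simp add: algebra_simps)
   thus ?thesis using S_I by metis
  qed
  have S_mult: "u * v \<in> S" if "u \<in> S" "v \<in> S" for u v
  proof -
   obtain m n m' n' where "u = of_int m + of_int n * \<delta>" "v = of_int m' + of_int n' * \<delta>" using \<open>u \<in> S\<close> \<open>v \<in> S\<close> unfolding S_def by blast
   hence "u * v = of_int (m * m') + of_int (n * n') * \<delta>\<^sup>2 + of_int (m * n' + m' * n) * \<delta>"
    by (simp add: algebra_simps power2_eq_square)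
   hence "u * v = of_int (m * m' + n * n' * D) + of_int (m * n' + m' * n) * \<delta>" by (simp add: \<delta>)
   thus ?thesis using S_I by metis
  qed
  have I_add: "u + v \<in> I" if "u \<in> I" "v \<in> I" for u v
   using that S_add unfolding I_def by (auto simp flip: distrib_left)
  have I_mult: "u * v \<in> I" if "u \<in> S" "v \<in> I" for u v
   using that S_mult unfolding I_def by (auto simp: mult.left_commute)
  have ints: "of_int m \<in> S" for m using S_I[of m 0] by simp
  have SI: "subring_ideal S I" unfolding subring_ideal_def using ints S_add S_mult I_add I_mult by blast
  have I_I: "of_int m + of_int n * \<delta> \<in> I" if dvds: "p dvd m" "p dvd n" for m n
  proof -
   obtain m' n' where "m = p * m'" "n = p * n'" using dvds unfolding dvd_def by blast
   hence "of_int m + of_int n * \<delta> = of_int p * (of_int m' + of_int n' * \<delta>)" by (simp add: algebra_simps)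
   thus ?thesis unfolding I_def using S_I by blast
  qed
  define cng where "cng u v \<longleftrightarrow> u - v \<in> I" for u v
  have I_neg: "- u \<in> I" if "u \<in> I" for u using I_mult[OF ints[of "- 1"] that] by simp
  have cng_refl: "cng u u" for u using I_I[of 0 0] by (simp add: cng_def)
  have cng_sym: "cng u v \<Longrightarrow> cng v u" for u v using I_neg by (fastforce simp: cng_def)
  have cng_trans: "cng u v \<Longrightarrow> cng v w \<Longrightarrow> cng u w" for u v w
   using I_add[of "u - v" "v - w"] by (simp add: cng_def)
  have cng_mult: "cng (u * u') (v * v')" if "cng u v" "cng u' v'" "u' \<in> S" "v \<in> S" for u v u' v'
  proof -
   have "u * u' - v * v' = u' * (u - v) + v * (u' - v')" by (simp add: algebra_simps)
   thus ?thesis using that I_add I_mult unfolding cng_def by metis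
  qed
  have S_pow: "u ^ k \<in> S" if "u \<in> S" for u k
   using that S_mult ints[of 1] by (induction k) auto
  have cng_pow: "cng (u ^ k) (v ^ k)" if "cng u v" "u \<in> S" "v \<in> S" for u v k
   by (induction k) (auto intro!: cng_refl cng_mult that S_pow)
  have S_prod: "(\<Prod>\<nu>\<in>R. f \<nu>) \<in> S" if "\<And>\<nu>. \<nu> \<in> R \<Longrightarrow> f \<nu> \<in> S" for f
   using R(1) that S_mult ints[of 1] by (induction R rule: finite_induct) auto
  have cng_prod: "cng (\<Prod>\<nu>\<in>R. f \<nu>) (\<Prod>\<nu>\<in>R. h \<nu>)"
   if "\<And>\<nu>. \<nu> \<in> R \<Longrightarrow> cng (f \<nu>) (h \<nu>) \<and> f \<nu> \<in> S \<and> h \<nu> \<in> S" for f h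
  proof -
   have "cng (\<Prod>\<nu>\<in>R. f \<nu>) (\<Prod>\<nu>\<in>R. h \<nu>) \<and> (\<Prod>\<nu>\<in>R. f \<nu>) \<in> S \<and> (\<Prod>\<nu>\<in>R. h \<nu>) \<in> S"
    using R(1) that
   proof (induction R rule: finite_induct)
    case empty
    thus ?case using cng_refl ints[of 1] by simp
   next
    case (insert \<nu> F)
    thus ?case using cng_mult[of "f \<nu>" "h \<nu>"] S_mult by simp
   qed
   thus ?thesis by blast
  qed
  define g where "g \<nu> = of_int (s \<nu>) * \<delta>" for \<nu>
  define u v where "u \<nu> = of_int (c \<nu>) + of_int (d \<nu>) * \<delta>" and "v \<nu> = of_int (c \<nu>) - of_int (d \<nu>) * \<delta>" for \<nu>
  have gS: "g \<nu> \<in> S" for \<nu> using S_I[of 0 "s \<nu>"] by (simp add: g_def)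
  have uS: "u \<nu> \<in> S" for \<nu> using S_I[of "c \<nu>" "d \<nu>"] by (simp add: u_def)
  have vS: "v \<nu> \<in> S" for \<nu> using S_I[of "c \<nu>" "- d \<nu>"] by (simp add: v_def)
  have pS: "g \<nu> + of_int \<nu> \<in> S" for \<nu> using S_add[OF gS ints] .
  have mS: "g \<nu> - of_int \<nu> \<in> S" for \<nu> using S_add[OF gS ints[of "- \<nu>"]] by simp
  have ru: "cng (u \<nu> * (g \<nu> + of_int \<nu>)) (g \<nu> - of_int \<nu>)" if "\<nu> \<in> R" for \<nu>
  proof -
   have "u \<nu> * (g \<nu> + of_int \<nu>) - (g \<nu> - of_int \<nu>)
    = of_int (c \<nu> * \<nu> + \<nu>) + of_int (d \<nu> * s \<nu>) * \<delta>\<^sup>2 + of_int (c \<nu> * s \<nu> + d \<nu> * \<nu> - s \<nu>) * \<delta>"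
    by (simp add: u_def g_def algebra_simps power2_eq_square)
   also have "\<dots> = of_int (c \<nu> * \<nu> + D * d \<nu> * s \<nu> + \<nu>) + of_int (c \<nu> * s \<nu> + d \<nu> * \<nu> - s \<nu>) * \<delta>"
    by (simp add: \<delta> algebra_simps)
   finally have eq: "u \<nu> * (g \<nu> + of_int \<nu>) - (g \<nu> - of_int \<nu>) = \<dots>" .
   show ?thesis unfolding cng_def eq by (rule I_I) (use rel[OF that] in auto)
  qed
  have rv: "cng (v \<nu> * (g \<nu> - of_int \<nu>)) (g \<nu> + of_int \<nu>)" if "\<nu> \<in> R" for \<nu>
  proof -
   have "v \<nu> * (g \<nu> - of_int \<nu>) - (g \<nu> + of_int \<nu>)
    = of_int (- (c \<nu> * \<nu>) - \<nu>) - of_int (d \<nu> * s \<nu>) * \<delta>\<^sup>2 + of_int (c \<nu> * s \<nu> + d \<nu> * \<nu> - s \<nu>) * \<delta>"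
    by (simp add: v_def g_def algebra_simps power2_eq_square)
   also have "\<dots> = of_int (- (c \<nu> * \<nu> + D * d \<nu> * s \<nu> + \<nu>)) + of_int (c \<nu> * s \<nu> + d \<nu> * \<nu> - s \<nu>) * \<delta>"
    by (simp add: \<delta> algebra_simps)
   finally have eq: "v \<nu> * (g \<nu> - of_int \<nu>) - (g \<nu> + of_int \<nu>) = \<dots>" .
   show ?thesis unfolding cng_def eq by (rule I_I) (use rel[OF that] in \<open>simp_all only: dvd_minus_iff\<close>)
  qed
  have c1: "cng (\<Prod>\<nu>\<in>R. (u \<nu> * (g \<nu> + of_int \<nu>)) ^ a \<nu> * (v \<nu> * (g \<nu> - of_int \<nu>)) ^ b \<nu>) (rel_exp R b a g)"
  proof -
   have "rel_exp R b a g = (\<Prod>\<nu>\<in>R. (g \<nu> - of_int \<nu>) ^ a \<nu> * (g \<nu> + of_int \<nu>) ^ b \<nu>)"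
    by (simp add: rel_exp_def mult.commute)
   moreover have "cng (\<Prod>\<nu>\<in>R. (u \<nu> * (g \<nu> + of_int \<nu>)) ^ a \<nu> * (v \<nu> * (g \<nu> - of_int \<nu>)) ^ b \<nu>)
     (\<Prod>\<nu>\<in>R. (g \<nu> - of_int \<nu>) ^ a \<nu> * (g \<nu> + of_int \<nu>) ^ b \<nu>)"
    by (intro cng_prod conjI cng_mult cng_pow ru rv S_mult S_pow uS vS pS mS)
   ultimately show ?thesis by simp
  qed
  have c2: "(\<Prod>\<nu>\<in>R. (u \<nu> * (g \<nu> + of_int \<nu>)) ^ a \<nu> * (v \<nu> * (g \<nu> - of_int \<nu>)) ^ b \<nu>)
    = (of_int x + of_int y * \<delta>) * rel_exp R a b g"
   unfolding prod[symmetric] rel_exp_def u_def v_def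
   by (simp add: power_mult_distrib prod.distrib mult_ac)
  have c3: "cng ((of_int x + of_int y * \<delta>) * rel_exp R a b g) (1 * rel_exp R a b g)"
  proof (rule cng_mult)
   have "(of_int x + of_int y * \<delta>) - 1 = of_int (x - 1) + of_int y * \<delta>" by simp
   thus "cng (of_int x + of_int y * \<delta>) 1" unfolding cng_def using I_I[OF xy] by (simp only:)
   show "rel_exp R a b g \<in> S" unfolding rel_exp_def by (intro S_prod S_mult S_pow pS mS)
   show "1 \<in> S" using ints[of 1] by simp
  qed (rule cng_refl)
  have "e (of_int t) g \<in> I"
   using cng_trans[OF cng_sym[OF c3] c1[unfolded c2]] unfolding e_def cng_def by simp
  moreover have "(g \<nu>)\<^sup>2 - rad \<nu> (of_int t) \<in> I" if "\<nu> \<in> R" for \<nu>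
  proof -
   have "(g \<nu>)\<^sup>2 - rad \<nu> (of_int t) = of_int (D * (s \<nu>)\<^sup>2 - \<nu> * (\<nu> - 4 * t)) + of_int 0 * \<delta>"
    by (simp add: g_def rad_def power_mult_distrib \<delta>)
   thus ?thesis using I_I[of "D * (s \<nu>)\<^sup>2 - \<nu> * (\<nu> - 4 * t)" 0] rel[OF that] by (simp only: dvd_0_right)
  qed
  ultimately have "poly (map_poly of_int P) (of_int t) \<in> I"
   using P1[OF SI ints] gS by blast
  hence "of_int (poly P t) \<in> I" by (simp add: poly_map_poly_of_int)
  then obtain m n where mn: "of_int (poly P t) = of_int p * (of_int m + of_int n * \<delta>)"
   unfolding I_def S_def by blast
  \<comment> \<open>An integer of the form \<open>p * (m + n * \<delta>)\<close> has
    \<open>n = 0\<close>, because \<open>D\<close> is not a square; so it is divisible by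
    \<open>p\<close>.\<close>
  hence "of_int (p * n) * \<delta> = (of_int (poly P t - p * m) :: complex)"
   by (simp add: algebra_simps)
  hence "(of_int (p * n) * \<delta>)\<^sup>2 = (of_int (poly P t - p * m) :: complex)\<^sup>2" by simp
  hence "(of_int ((p * n)\<^sup>2 * D) :: complex) = of_int ((poly P t - p * m)\<^sup>2)"
   by (simp add: power_mult_distrib \<delta>)
  hence eq: "(p * n)\<^sup>2 * D = (poly P t - p * m)\<^sup>2" by (simp only: of_int_eq_iff)
  hence "p * n = 0" by (rule square_root_irrational[OF D])
  hence "(poly P t - p * m)\<^sup>2 = 0" using eq by (metis mult_zero_left zero_power2)
  hence "poly P t = p * m" by simp
  thus "p dvd poly P t" by simp
  qed
 qed
qed

section \<open>Matrix elements of Hecke eigenfunctions\<close>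

context cat_map
begin

definition conic :: "int \<Rightarrow> (int ^ 2) set" where
 "conic t = {a \<in> grid (p ^ l). P dvd Q_form A a - t}"

text \<open>Cells of level \<open>t\<close> modulo \<open>P'\<close> correspond to the points of the
  conic modulo \<open>P\<close>; this fixes one representative of each cell.\<close>

definition lift :: "int \<Rightarrow> int ^ 2 \<Rightarrow> int ^ 2" where
 "lift t a = (SOME x. vc P x a \<and> P' dvd Q_form A x - t)"

lemma finite_conic [simp]: "finite (conic t)"
 by (simp add: conic_def)

lemma good_of_level:
 assumes "\<not> int p dvd t" "P dvd Q_form A x - t"
 shows "good x"
 unfolding good_def
proof
 assume "int p dvd Q_form A x"
 hence "int p dvd Q_form A x - (Q_form A x - t)"
  using dvd_trans[OF p_dvd_P assms(2)] by (rule dvd_diff)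
 thus False using assms(1) by simp
qed

text \<open>Scaling \<open>a\<close> by an inverse square root of the one-unit
  \<open>Q(a) / t\<close> corrects the level and leaves the class modulo \<open>P\<close>
  unchanged.\<close>

lemma lift_exists:
 assumes "\<not> int p dvd t" "P dvd Q_form A a - t"
 shows "\<exists>x. vc P x a \<and> P' dvd Q_form A x - t"
proof -
 obtain i where i: "int (p ^ (l + e)) dvd i * t - 1"
  using prime_power_inverse[OF prime_p assms(1)] by metis
 have it: "P' dvd i * t - 1" using i by (simp add: P'_def)
 define d where "d = Q_form A a * i"
 have "d - 1 = (Q_form A a - t) * i + (i * t - 1)" by (simp add: d_def algebra_simps)
 hence d1: "P dvd d - 1"
  using assms(2) it P_dvd_P' by (metis dvd_add dvd_mult2 dvd_trans)
 then obtain c where c: "P dvd c - 1" "P' dvd c\<^sup>2 * d - 1"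
  using one_unit_sqrt[OF odd_p, of d l "l + e"] p_dvd_P dvd_trans unfolding P_def P'_def by metis
 have "vc P (c *s a) a"
 proof -
  have "(c *s a) $ j - a $ j = (c - 1) * a $ j" for j by (simp add: algebra_simps)
  thus ?thesis unfolding vc_def using c(1) by simp
 qed
 moreover have "P' dvd Q_form A (c *s a) - t"
 proof -
  have "Q_form A (c *s a) - t = (c\<^sup>2 * d - 1) * t - (i * t - 1) * (c\<^sup>2 * Q_form A a)"
   by (simp add: Q_form_smult d_def algebra_simps)
  thus ?thesis using c(2) it by (simp add: dvd_diff)
 qed
 ultimately show ?thesis by blast
qed

lemma
 assumes "\<not> int p dvd t" "a \<in> conic t"
 shows lift_vc: "vc P (lift t a) a" and lift_Q: "P' dvd Q_form A (lift t a) - t"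
  and good_lift: "good (lift t a)"
proof -
 show *: "vc P (lift t a) a" "P' dvd Q_form A (lift t a) - t"
  using someI_ex[OF lift_exists[OF assms(1), of a]] assms(2) by (simp_all add: lift_def conic_def)
 show "good (lift t a)"
  using good_of_level[OF assms(1)] *(2) P_dvd_P' dvd_trans by blast
qed

lemma level_dvd: "m dvd x - t \<Longrightarrow> m dvd y - t \<Longrightarrow> m dvd x - (y :: int)"
 using dvd_diff[of m "x - t" "y - t"] by simp

definition has_type :: "(int \<Rightarrow> complex) \<Rightarrow> int \<Rightarrow> bool" where
 "has_type \<psi> t \<longleftrightarrow> hecke_fun \<psi> \<and> (\<exists>x. good x \<and> ip N \<psi> (vs x) \<noteq> 0 \<and> P' dvd Q_form A x - t)"

lemma has_type_level:
 assumes "has_type \<psi> t" "good x" "ip N \<psi> (vs x) \<noteq> 0"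
 shows "P' dvd Q_form A x - t"
proof -
 obtain y where y: "hecke_fun \<psi>" "good y" "ip N \<psi> (vs y) \<noteq> 0" "P' dvd Q_form A y - t"
  using assms(1) unfolding has_type_def by blast
 hence "P' dvd Q_form A x - Q_form A y"
  using hecke_type assms(2,3) by blast
 thus ?thesis using y(4) dvd_add[of P' "Q_form A x - Q_form A y" "Q_form A y - t"] by simp
qed

lemma has_type_unique:
 assumes "has_type \<psi> t" "has_type \<psi> t'"
 shows "P' dvd t - t'"
proof -
 obtain x where "good x" "ip N \<psi> (vs x) \<noteq> 0" "P' dvd Q_form A x - t'"
  using assms(2) unfolding has_type_def by blast
 moreover from this have "P' dvd Q_form A x - t"
  using has_type_level[OF assms(1)] by blast
 ultimately show ?thesis
  using dvd_diff[of P' "Q_form A x - t'" "Q_form A x - t"] by simp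
qed

text \<open>Both sides are compared through the translates \<open>w\<close> of one state. Each
  \<open>w\<close> sits at one point modulo \<open>P\<close>. Off the conic both overlaps vanish; on
  it, only the state at that point contributes to the sum, and a second frame expansion, in
  translates of this state, shows that \<open>\<psi>\<close> meets \<open>w\<close> only through
  it.\<close>

lemma hecke_expansion:
 assumes "has_type \<psi> t" "\<not> int p dvd t"
 shows "\<psi> = (\<lambda>y. \<Sum>a\<in>conic t. ip N \<psi> (vs (lift t a)) * vs (lift t a) y)" (is "\<psi> = ?\<phi>")
proof (rule ccontr)
 assume neq: "\<psi> \<noteq> ?\<phi>"
 obtain x where hk: "hecke_fun \<psi>" and x: "good x" "ip N \<psi> (vs x) \<noteq> 0" "P' dvd Q_form A x - t"
  using assms(1) unfolding has_type_def by blast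
 have \<psi>: "\<psi> \<in> H_N N" using hk by (simp add: hecke_fun_def)
 have \<phi>: "?\<phi> \<in> H_N N" by (rule H_N_sum) (simp add: vs_H good_lift assms(2))
 define \<eta> where "\<eta> = (\<lambda>y. \<psi> y - ?\<phi> y)"
 have \<eta>: "\<eta> \<in> H_N N" unfolding \<eta>_def by (rule H_N_diff[OF \<psi> \<phi>])
 have "\<eta> \<noteq> (\<lambda>_. 0)" using neq by (auto simp: \<eta>_def fun_eq_iff)
 hence "ip N \<eta> \<eta> \<noteq> 0" using ip_self_eq_0[OF N_pos \<eta>] by blast
 then obtain n where n: "ip N \<eta> (twisted_T N n (vs x)) \<noteq> 0"
  using frame_overlap[OF odd_N \<eta> vs_H[OF x(1)] vs_unit[OF x(1)]] by metis
 define w where "w = twisted_T N n (vs x)"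
 have wH: "w \<in> H_N N" using vs_H[OF x(1)] by (simp add: w_def odd_N)
 have w_eig: "joint_eig N (range ((*s) P')) (x + n) w"
  unfolding w_def by (rule T_vs_P'_eig[OF x(1)])
 have ip\<phi>: "ip N ?\<phi> w = (\<Sum>a\<in>conic t. ip N \<psi> (vs (lift t a)) * ip N (vs (lift t a)) w)"
  by (rule ip_sum_left)
 have near: "vc P a (x + n)" if "a \<in> conic t" "ip N (vs (lift t a)) w \<noteq> 0" for a
  using joint_eig_P'_ip[OF vs_P'_eig[OF good_lift[OF assms(2) that(1)]] w_eig that(2)]
   lift_vc[OF assms(2) that(1)] vc_sym vc_trans by blast
 have "ip N \<psi> w = ip N ?\<phi> w"
 proof (cases "P dvd Q_form A (x + n) - t")
  case False
  have "ip N \<psi> w = 0"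
  proof (rule ccontr)
   assume "ip N \<psi> w \<noteq> 0"
   hence "P dvd Q_form A (x + n) - Q_form A (x + 0)"
    using hecke_type_mod_P[OF x(1) hk, of n 0] x(2) by (simp add: w_def odd_N)
   moreover have "P dvd Q_form A x - t" using x(3) P_dvd_P' dvd_trans by blast
   ultimately show False
    using False dvd_add[of P "Q_form A (x + n) - Q_form A x" "Q_form A x - t"] by simp
  qed
  moreover have "ip N (vs (lift t a)) w = 0" if a: "a \<in> conic t" for a
  proof (rule ccontr)
   assume "ip N (vs (lift t a)) w \<noteq> 0"
   hence "P dvd Q_form A a - Q_form A (x + n)"
    using near[OF a] vc_Q_form by blast
   moreover have "P dvd Q_form A a - t" using a by (simp add: conic_def)
   ultimately show False
    using False dvd_diff[of P "Q_form A a - t" "Q_form A a - Q_form A (x + n)"] by simp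
  qed
  ultimately show ?thesis unfolding ip\<phi> by simp
 next
  case True
  define a where "a = red (p ^ l) (x + n)"
  have av: "vc P a (x + n)" unfolding a_def P_def by (rule vc_red)
  have pl: "p ^ l > 0" using prime_p by (simp add: prime_gt_0_nat)
  have a: "a \<in> conic t"
   unfolding conic_def
  proof (intro CollectI conjI)
   show "a \<in> grid (p ^ l)" unfolding a_def by (rule red_grid[OF pl])
   show "P dvd Q_form A a - t"
    using dvd_add[OF vc_Q_form[OF av, of A] True] by simp
  qed
  define y where "y = lift t a"
  note y = lift_vc[OF assms(2) a, folded y_def] lift_Q[OF assms(2) a, folded y_def]
   good_lift[OF assms(2) a, folded y_def]
  have "ip N ?\<phi> w = ip N \<psi> (vs y) * ip N (vs y) w"
  proof -
   have "ip N ?\<phi> w = (\<Sum>b\<in>{a}. ip N \<psi> (vs (lift t b)) * ip N (vs (lift t b)) w)"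
    unfolding ip\<phi>
   proof (rule sum.mono_neutral_right)
    show "\<forall>b\<in>conic t - {a}. ip N \<psi> (vs (lift t b)) * ip N (vs (lift t b)) w = 0"
    proof
     fix b assume b: "b \<in> conic t - {a}"
     have "ip N (vs (lift t b)) w = 0"
     proof (rule ccontr)
      assume "ip N (vs (lift t b)) w \<noteq> 0"
      hence "vc P b a" using near[of b] b vc_sym[OF av] vc_trans by blast
      hence "b = a"
       using a b vc_grid_eq[of "p ^ l" b a] by (simp add: conic_def P_def)
      thus False using b by simp
     qed
     thus "ip N \<psi> (vs (lift t b)) * ip N (vs (lift t b)) w = 0" by simp
    qed
   qed (use a in auto)
   thus ?thesis by (simp add: y_def)
  qed
  moreover have "ip N \<psi> w = ip N \<psi> (vs y) * ip N (vs y) w"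
  proof -
   \<comment> \<open>A translate of the state at \<open>y\<close> that meets both \<open>w\<close>
     and \<open>\<psi>\<close> sits at \<open>y\<close> modulo \<open>P\<close> and, by the type of
     \<open>\<psi>\<close>, at the same level modulo \<open>P'\<close>. So its displacement lies in
     \<open>Lat y\<close>, and it is the state itself up to a phase.\<close>
   have term_m: "cnj (ip N w (twisted_T N m (vs y))) * ip N \<psi> (twisted_T N m (vs y))
     = (if m \<in> Lat y then ip N \<psi> (vs y) * ip N (vs y) w else 0)" for m
   proof (cases "m \<in> Lat y")
    case True
    hence *: "twisted_T N m (vs y) = scl (e_N N (symp m y)) (vs y)"
     using vs_eig[OF y(3)] by (simp add: joint_eig_def)
    have "cnj (ip N w (twisted_T N m (vs y))) * ip N \<psi> (twisted_T N m (vs y))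
     = (e_N N (symp m y) * e_N N (- symp m y)) * (ip N \<psi> (vs y) * ip N (vs y) w)"
     unfolding * ip_scl_right complex_cnj_mult cnj_ip by simp
    thus ?thesis using True by simp
   next
    case False
    have "ip N \<psi> (twisted_T N m (vs y)) = 0" if nz: "ip N w (twisted_T N m (vs y)) \<noteq> 0"
    proof (rule ccontr)
     assume nz2: "ip N \<psi> (twisted_T N m (vs y)) \<noteq> 0"
     have "vc P (x + n) (y + m)"
      by (rule joint_eig_P'_ip[OF w_eig T_vs_P'_eig[OF y(3)] nz])
     moreover have "vc P (x + n) y" using vc_sym[OF av] vc_sym[OF y(1)] vc_trans by blast
     ultimately have vc: "vc P y (y + m)" using vc_sym vc_trans by blast
     have g: "good (y + m)" by (rule good_vc[OF y(3) vc])
     have "joint_eig N (Lat (y + m)) (y + m) (twisted_T N m (vs y))"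
      using joint_eig_shift[OF odd_N vs_eig[OF y(3)], of m] Lat_cong[OF vc] by simp
     then obtain r where r: "twisted_T N m (vs y) = scl r (vs (y + m))"
      using vs_unique[OF g] by blast
     hence "ip N \<psi> (vs (y + m)) \<noteq> 0" using nz2 by auto
     hence "P' dvd Q_form A (y + m) - t" by (rule has_type_level[OF assms(1) g])
     hence "same_cell y (y + m)"
      using vc level_dvd[OF y(2)] by (simp add: same_cell_def)
     hence "y + m - y \<in> Lat y" by (rule same_cell_diff[OF y(3)])
     thus False using False by simp
    qed
    thus ?thesis using False by auto
   qed
   have "of_nat N * ip N w \<psi> = ip N (scl (of_nat N * ip N (vs y) (vs y)) w) \<psi>"
    by (simp add: vs_unit[OF y(3)])
   also have "\<dots> = (\<Sum>m\<in>grid N. ip N w (twisted_T N m (vs y)) * ip N (twisted_T N m (vs y)) \<psi>)"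
    by (simp add: frame_identity[OF odd_N wH vs_H[OF y(3)], symmetric] ip_sum_left)
   finally have "cnj (of_nat N * ip N w \<psi>)
    = cnj (\<Sum>m\<in>grid N. ip N w (twisted_T N m (vs y)) * ip N (twisted_T N m (vs y)) \<psi>)"
    by (rule arg_cong)
   hence "of_nat N * ip N \<psi> w
    = (\<Sum>m\<in>grid N. cnj (ip N w (twisted_T N m (vs y))) * ip N \<psi> (twisted_T N m (vs y)))"
    by (simp only: complex_cnj_mult cnj_sum cnj_ip complex_cnj_of_nat)
   also have "\<dots> = (\<Sum>m\<in>grid N \<inter> Lat y. ip N \<psi> (vs y) * ip N (vs y) w)"
    by (simp only: term_m sum.inter_restrict[OF finite_grid])
   also have "\<dots> = of_nat N * (ip N \<psi> (vs y) * ip N (vs y) w)"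
    using lagrangian_unique(1)[OF odd_N lagrangian_Lat[OF y(3)] vs_eig[OF y(3)] vs_unit[OF y(3)]]
    by (simp add: Int_commute)
   finally show ?thesis using N_pos by simp
  qed
  ultimately show ?thesis by simp
 qed
 hence "ip N \<eta> w = 0" unfolding \<eta>_def ip_diff_left by simp
 thus False using n by (simp add: w_def)
qed

lemma lift_transitive:
 assumes "\<not> int p dvd t" "good x" "good y" "P' dvd Q_form A x - t" "P' dvd Q_form A y - t"
 obtains c d where "hecke c d" "vc P' (act A c d x) y" "same_cell y (act A c d x)"
proof -
 obtain c d where cd: "hecke c d" "vc P' (act A c d x) y"
  using transitive[OF assms(2), of "l + e" y] level_dvd[OF assms(4,5)] l_pos
  unfolding P'_def by auto
 have "P' dvd Q_form A (act A c d x) - Q_form A x"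
  using hecke_Q[OF cd(1), of x] P'_dvd_N dvd_trans by blast
 hence "P' dvd Q_form A (act A c d x) - t"
  using dvd_add[OF _ assms(4)] by fastforce
 hence "same_cell y (act A c d x)"
  using vc_dvd[OF vc_sym[OF cd(2)] P_dvd_P'] level_dvd[OF assms(5)] by (simp add: same_cell_def)
 thus ?thesis using that cd by blast
qed

text \<open>Hecke operators act transitively on the cells of one level, so all coefficients have the
  same absolute value, and \<open>ip N \<psi> \<psi> = 1\<close> determines it.\<close>

lemma hecke_coeff:
 assumes "has_type \<psi> t" "\<not> int p dvd t" "good x" "P' dvd Q_form A x - t"
 shows "(norm (ip N \<psi> (vs x)))\<^sup>2 = 1 / card (conic t)" "conic t \<noteq> {}"
proof -
 have hk: "hecke_fun \<psi>" using assms(1) by (simp add: has_type_def)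
 have eq: "norm (ip N \<psi> (vs y)) = norm (ip N \<psi> (vs x))" if y: "good y" "P' dvd Q_form A y - t" for y
 proof -
  obtain c d where cd: "hecke c d" "same_cell y (act A c d x)"
   using lift_transitive[OF assms(2,3) y(1) assms(4) y(2)] by blast
  thus ?thesis using UM_overlap[OF cd(1) hk assms(3) y(1) cd(2)] by simp
 qed
 have "ip N \<psi> \<psi> = (\<Sum>a\<in>conic t. ip N \<psi> (vs (lift t a)) * ip N (vs (lift t a)) \<psi>)"
  using arg_cong[OF hecke_expansion[OF assms(1,2)], of "\<lambda>\<phi>. ip N \<phi> \<psi>"] by (simp only: ip_sum_left)
 also have "\<dots> = (\<Sum>a\<in>conic t. of_real ((norm (ip N \<psi> (vs x)))\<^sup>2))"
 proof (rule sum.cong)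
  fix a assume a: "a \<in> conic t"
  have "ip N \<psi> (vs (lift t a)) * ip N (vs (lift t a)) \<psi> = of_real ((norm (ip N \<psi> (vs (lift t a))))\<^sup>2)"
   using complex_norm_square[of "ip N \<psi> (vs (lift t a))"] by (simp add: cnj_ip)
  thus "ip N \<psi> (vs (lift t a)) * ip N (vs (lift t a)) \<psi> = of_real ((norm (ip N \<psi> (vs x)))\<^sup>2)"
   by (simp only: eq[OF good_lift[OF assms(2) a] lift_Q[OF assms(2) a]])
 qed simp
 finally have "complex_of_real 1 = of_real (card (conic t) * (norm (ip N \<psi> (vs x)))\<^sup>2)"
  using hk by (simp add: hecke_fun_def)
 hence *: "card (conic t) * (norm (ip N \<psi> (vs x)))\<^sup>2 = 1"
  by (simp only: of_real_eq_iff)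
 hence "card (conic t) \<noteq> 0" by (metis mult_zero_left of_nat_0 zero_neq_one)
 with * show "(norm (ip N \<psi> (vs x)))\<^sup>2 = 1 / card (conic t)" "conic t \<noteq> {}"
  by (auto simp: field_simps)
qed

definition pair_term :: "int ^ 2 \<Rightarrow> (int \<Rightarrow> complex) \<Rightarrow> int ^ 2 \<Rightarrow> int ^ 2 \<Rightarrow> complex" where
 "pair_term n \<psi> x y = ip N \<psi> (vs x) * cnj (ip N \<psi> (vs y)) * ip N (twisted_T N n (vs x)) (vs y)"

text \<open>\<open>T(n)\<close> moves a state at \<open>a\<close> to \<open>a + n\<close> modulo
  \<open>P\<close>. In the double sum over states only the pairs \<open>a\<close>,
  \<open>a + n\<close> with both points on the conic survive.\<close>

lemma matrix_element_sum:
 assumes "has_type \<psi> t" "\<not> int p dvd t"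
 shows "ip N (twisted_T N n \<psi>) \<psi>
  = (\<Sum>a | a \<in> conic t \<and> P dvd Q_form A (a + n) - t. pair_term n \<psi> (lift t a) (lift t (red (p ^ l) (a + n))))"
proof -
 define v where "v a = vs (lift t a)" for a
 define c where "c a = ip N \<psi> (v a)" for a
 have \<psi>: "\<psi> = (\<lambda>y. \<Sum>a\<in>conic t. c a * v a y)"
  unfolding c_def v_def by (rule hecke_expansion[OF assms])
 have pl: "p ^ l > 0" using prime_p by (simp add: prime_gt_0_nat)
 have near: "b = red (p ^ l) (a + n)"
  if ab: "a \<in> conic t" "b \<in> conic t" "ip N (twisted_T N n (v a)) (v b) \<noteq> 0" for a b
 proof -
  have "vc P (lift t a + n) (lift t b)"
   by (rule joint_eig_P'_ip[OF T_vs_P'_eig vs_P'_eig ab(3)[unfolded v_def]])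
    (simp_all add: good_lift assms ab)
  hence "vc P (a + n) b"
   using vc_add[OF vc_sym[OF lift_vc[OF assms(2) ab(1)]] vc_refl[of _ n]] lift_vc[OF assms(2) ab(2)]
    vc_trans by blast
  hence "vc P b (red (p ^ l) (a + n))"
   using vc_sym[OF vc_red[of "p ^ l" "a + n"]] vc_sym vc_trans unfolding P_def by blast
  thus ?thesis
   using ab(2) red_grid[OF pl] vc_grid_eq[of "p ^ l" b] by (simp add: conic_def P_def)
 qed
 have red_conic: "red (p ^ l) (a + n) \<in> conic t \<longleftrightarrow> P dvd Q_form A (a + n) - t" for a
 proof -
  have "P dvd Q_form A (red (p ^ l) (a + n)) - Q_form A (a + n)"
   unfolding P_def by (rule vc_Q_form[OF vc_red])
  hence "P dvd Q_form A (red (p ^ l) (a + n)) - t \<longleftrightarrow> P dvd Q_form A (a + n) - t"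
   using dvd_add_right_iff[of P "Q_form A (red (p ^ l) (a + n)) - Q_form A (a + n)" "Q_form A (a + n) - t"]
   by simp
  thus ?thesis using red_grid[OF pl] by (simp add: conic_def)
 qed
 have "ip N (twisted_T N n \<psi>) \<psi> = ip N (twisted_T N n (\<lambda>y. \<Sum>a\<in>conic t. c a * v a y)) (\<lambda>y. \<Sum>a\<in>conic t. c a * v a y)"
  by (simp flip: \<psi>)
 also have "\<dots> = (\<Sum>a\<in>conic t. c a * (\<Sum>b\<in>conic t. cnj (c b) * ip N (twisted_T N n (v a)) (v b)))"
  by (simp add: twisted_T_sum ip_sum_left ip_sum_right)
 also have "\<dots> = (\<Sum>a\<in>conic t. if P dvd Q_form A (a + n) - t
   then pair_term n \<psi> (lift t a) (lift t (red (p ^ l) (a + n))) else 0)"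
 proof (rule sum.cong)
  fix a assume a: "a \<in> conic t"
  define b0 where "b0 = red (p ^ l) (a + n)"
  have "(\<Sum>b\<in>conic t. cnj (c b) * ip N (twisted_T N n (v a)) (v b))
    = (\<Sum>b\<in>conic t. if b = b0 then cnj (c b0) * ip N (twisted_T N n (v a)) (v b0) else 0)"
   using near[OF a] by (intro sum.cong) (auto simp: b0_def)
  also have "\<dots> = (if P dvd Q_form A (a + n) - t then cnj (c b0) * ip N (twisted_T N n (v a)) (v b0) else 0)"
   using red_conic[of a] by (simp add: b0_def)
  finally show "c a * (\<Sum>b\<in>conic t. cnj (c b) * ip N (twisted_T N n (v a)) (v b))
   = (if P dvd Q_form A (a + n) - t then pair_term n \<psi> (lift t a) (lift t (red (p ^ l) (a + n))) else 0)"
   by (simp add: pair_term_def b0_def c_def v_def)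
 qed simp
 also have "\<dots> = (\<Sum>a | a \<in> conic t \<and> P dvd Q_form A (a + n) - t. pair_term n \<psi> (lift t a) (lift t (red (p ^ l) (a + n))))"
  by (simp add: sum.If_cases Int_def)
 finally show ?thesis .
qed

text \<open>The coefficients of \<open>\<psi>\<close> at \<open>x\<close> and \<open>y\<close>
  differ by its eigenvalue and the phase \<open>a\<close>. The last factor depends neither on
  \<open>\<psi>\<close> nor on the phases chosen for the two states.\<close>

lemma pair_term_hecke:
 assumes "has_type \<psi> t" "\<not> int p dvd t" "good x" "good y" "P' dvd Q_form A x - t"
  and "hecke c d" "same_cell y (act A c d x)" "UM c d \<psi> = scl \<kappa> \<psi>" "UM c d (vs y) = scl a (vs x)"
 shows "pair_term n \<psi> x y = of_real (1 / card (conic t)) * cnj \<kappa> * (a * ip N (twisted_T N n (vs x)) (vs y))"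
proof -
 have \<psi>: "\<psi> \<in> H_N N" using assms(1) by (simp add: has_type_def hecke_fun_def)
 have "ip N \<psi> (vs y) = \<kappa> * cnj a * ip N \<psi> (vs x)"
  using UM_ip[OF assms(6) \<psi> vs_H[OF assms(4)]] by (simp add: assms(8,9) mult_ac)
 hence "pair_term n \<psi> x y = (ip N \<psi> (vs x) * cnj (ip N \<psi> (vs x))) * cnj \<kappa> * (a * ip N (twisted_T N n (vs x)) (vs y))"
  by (simp add: pair_term_def mult_ac)
 also have "ip N \<psi> (vs x) * cnj (ip N \<psi> (vs x)) = of_real (1 / card (conic t))"
  using complex_norm_square[of "ip N \<psi> (vs x)"] hecke_coeff(1)[OF assms(1-3,5)]
  by (metis of_real_power)
 finally show ?thesis .
qed

lemma ip_vs_not_Lat: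
 assumes "good x" "m \<notin> Lat x"
 shows "ip N (twisted_T N m (vs x)) (vs x) = 0"
proof (rule ccontr)
 assume nz: "ip N (twisted_T N m (vs x)) (vs x) \<noteq> 0"
 have "int N dvd symp a m" if a: "a \<in> Lat x" for a
  using joint_eig_ip[OF odd_N joint_eig_shift[OF odd_N vs_eig[OF assms(1)]] vs_eig[OF assms(1)] nz a]
  by simp
 thus False using lagrangianD(6)[OF lagrangian_Lat[OF assms(1)]] assms(2) by blast
qed

lemma card_P'_grid: "card {a \<in> grid N. vc P' a 0} = nat (P * P)"
proof -
 have bij: "bij_betw ((*s) P') (grid (p ^ l)) {a \<in> grid N. vc P' a 0}"
 proof (rule bij_betwI[where g = "\<lambda>a. vector [a $ 1 div P', a $ 2 div P']"])
  show "(*s) P' \<in> grid (p ^ l) \<rightarrow> {a \<in> grid N. vc P' a 0}"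
  proof
   fix a assume a: "a \<in> grid (p ^ l)"
   have "P' * a $ j < int N" if "a $ j < P" for j
    using that P_pos unfolding PP(1) by (simp add: mult.commute[of P])
   thus "P' *s a \<in> {a \<in> grid N. vc P' a 0}"
    using a P_pos by (simp add: grid_def vc_def P_def)
  qed
  show "(\<lambda>a. vector [a $ 1 div P', a $ 2 div P']) \<in> {a \<in> grid N. vc P' a 0} \<rightarrow> grid (p ^ l)"
  proof
   fix a assume a: "a \<in> {a \<in> grid N. vc P' a 0}"
   have "a $ j div P' < P" if "a $ j < int N" for j
   proof (rule ccontr)
    assume "\<not> a $ j div P' < P"
    hence "P * P' \<le> a $ j div P' * P'" using P_pos by (intro mult_right_mono) auto
    also have "\<dots> \<le> a $ j"
     using P_pos pos_mod_sign[of P' "a $ j"] by (simp flip: minus_mod_eq_div_mult)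
    finally show False using that by (simp add: PP(1))
   qed
   thus "vector [a $ 1 div P', a $ 2 div P'] \<in> grid (p ^ l)"
    using a P_pos by (simp add: grid_def P_def pos_imp_zdiv_nonneg_iff)
  qed
 qed (use P_pos in \<open>auto simp: vc_def intro!: vec2_eqI\<close>)
 have "card {a \<in> grid N. vc P' a 0} = (p ^ l) ^ 2"
  using bij_betw_same_card[OF bij] by (simp add: card_grid)
 also have "\<dots> = nat (int ((p ^ l) ^ 2))" by (simp only: nat_int)
 also have "int ((p ^ l) ^ 2) = P * P" by (simp add: P_def power2_eq_square)
 finally show ?thesis .
qed

text \<open>For \<open>e = 1\<close> the polarisations at \<open>x\<close> and \<open>y\<close> are transversal, whence the factor \<open>p\<^bsup>-e\<^esup>\<close>.\<close>

lemma transversal_overlap: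
 assumes "good x" "good y" "vc P y (x + n)" "\<not> int p dvd symp x y"
 shows "(norm (ip N (twisted_T N n (vs x)) (vs y)))\<^sup>2 = 1 / real_of_int E"
proof -
 define \<phi> where "\<phi> = twisted_T N n (vs x)"
 have \<phi>: "\<phi> \<in> H_N N" using vs_H[OF assms(1)] by (simp add: \<phi>_def odd_N)
 note L = lagrangian_Lat[OF assms(2)]
 have term_a: "e_N N (- symp a y) * ip N (twisted_T N a \<phi>) \<phi> = (if vc P' a 0 then 1 else 0)"
  if a: "a \<in> Lat y" for a
 proof -
  have "twisted_T N a \<phi> = scl (e_N N (symp a n)) (twisted_T N n (twisted_T N a (vs x)))"
   unfolding \<phi>_def by (rule twisted_T_commute[OF odd_N])
  hence *: "ip N (twisted_T N a \<phi>) \<phi> = e_N N (symp a n) * ip N (twisted_T N a (vs x)) (vs x)"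
   using ip_twisted_T_iso[OF odd_N twisted_T_H[OF odd_N vs_H[OF assms(1)]] vs_H[OF assms(1)]]
   by (simp add: \<phi>_def)
  show ?thesis
  proof (cases "vc P' a 0")
   case True
   then obtain m where m: "a = P' *s m" unfolding vc_iff_smult by auto
   hence "twisted_T N a (vs x) = scl (e_N N (symp a x)) (vs x)"
    using vs_eig[OF assms(1)] P'_lattice by (simp add: joint_eig_def)
   hence "e_N N (- symp a y) * ip N (twisted_T N a \<phi>) \<phi> = e_N N (symp a (x + n - y))"
    by (simp add: * vs_unit[OF assms(1)] symp_simps algebra_simps flip: e_N_add)
   also have "\<dots> = 1"
   proof -
    have "P dvd symp m (x + n - y) - symp m 0"
     by (rule vc_symp[OF vc_refl]) (use vc_diff[OF vc_sym[OF assms(3)] vc_refl[of P y]] in simp)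
    hence "int N dvd symp a (x + n - y)"
     by (simp add: m symp_smult PP(1) symp_simps(7) mult.commute)
    thus ?thesis by (simp add: e_N_eq_1_iff[OF N_pos])
   qed
   finally show ?thesis using True by simp
  next
   case False
   \<comment> \<open>The tangent generators pair to \<open>- disc A * symp x y\<close>, up to powers
     of \<open>P\<close>, and this is a unit; so the two lattices meet only in the multiples of
     \<open>P'\<close>.\<close>
   have "a \<notin> Lat x"
   proof
    assume ax: "a \<in> Lat x"
    obtain m s where ms: "a = P' *s m + (P * s) *s dl A y" using a unfolding Lat_def by blast
    have "int N dvd symp ((P * 1) *s dl A x) a"
     by (rule lagrangianD(5)[OF lagrangian_Lat[OF assms(1)] dl_lattice ax])
    hence "int N dvd P * (P' * symp (dl A x) m + P * s * symp (dl A x) (dl A y))"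
     by (simp add: ms symp_simps symp_smult algebra_simps)
    hence "P' dvd P' * symp (dl A x) m + P * s * symp (dl A x) (dl A y)"
     using P_pos by (simp add: PP(1))
    hence "P' dvd P * s * symp (dl A x) (dl A y)"
     by (simp add: dvd_add_right_iff)
    hence "E dvd s * symp (dl A x) (dl A y)"
     using P_pos by (simp add: PP(2) mult.assoc)
    moreover have "symp (dl A x) (dl A y) = - (disc A * symp x y)"
     by (simp add: symp_dl[of A x] dl_dl symp_smult)
    ultimately have "E dvd (disc A * symp x y) * s" by (simp add: mult_ac)
    moreover have "\<not> int p dvd disc A * symp x y"
     using disc_unit assms(4) prime_p by (simp add: prime_dvd_mult_iff)
    ultimately have "E dvd s"
     using prime_power_dvd_cancel[OF prime_p] unfolding E_def by blast
    hence "vc P' ((P * s) *s dl A y) 0"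
     by (simp add: vc_def PP(2) mult_dvd_mono)
    hence "vc P' a (P' *s m + 0)" unfolding ms by (intro vc_add vc_refl)
    moreover have "vc P' (P' *s m + 0) 0" by (simp add: vc_def)
    ultimately show False using False vc_trans by blast
   qed
   thus ?thesis using False by (simp add: * ip_vs_not_Lat[OF assms(1)])
  qed
 qed
 have "of_nat N * complex_of_real ((norm (ip N \<phi> (vs y)))\<^sup>2)
   = (\<Sum>a\<in>Lat y \<inter> grid N. e_N N (- symp a y) * ip N (twisted_T N a \<phi>) \<phi>)"
  using lagrangian_projection[OF odd_N L vs_eig[OF assms(2)] vs_unit[OF assms(2)] \<phi>]
   lagrangian_unique(1)[OF odd_N L vs_eig[OF assms(2)] vs_unit[OF assms(2)]] by simp
 also have "\<dots> = (\<Sum>a\<in>Lat y \<inter> grid N. if vc P' a 0 then 1 else 0)"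
  by (rule sum.cong) (simp_all add: term_a)
 also have "\<dots> = of_nat (card {a \<in> Lat y \<inter> grid N. vc P' a 0})"
  by (simp add: sum.If_cases Int_def)
 also have "{a \<in> Lat y \<inter> grid N. vc P' a 0} = {a \<in> grid N. vc P' a 0}"
  using P'_lattice by (auto simp: vc_iff_smult)
 finally have "complex_of_real (real N * (norm (ip N \<phi> (vs y)))\<^sup>2) = complex_of_real (real_of_int (P * P))"
  using P_pos by (simp add: card_P'_grid)
 hence "real N * (norm (ip N \<phi> (vs y)))\<^sup>2 = real_of_int (P * P)"
  by (simp only: of_real_eq_iff)
 moreover have "real N = real_of_int (P * P) * real_of_int E"
  using PP by (metis mult.assoc of_int_mult of_int_of_nat_eq)
 ultimately show ?thesis
  using P_pos unfolding \<phi>_def by (simp add: field_simps)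
qed

end

context cat_map
begin

lemma dvd_shift: "m dvd u - v \<Longrightarrow> m dvd u - t \<longleftrightarrow> m dvd v - (t :: int)"
 using dvd_add_right_iff[of m "u - v" "v - t"] by simp

lemma pl_pos: "p ^ l > 0"
 using prime_p by (simp add: prime_gt_0_nat)

lemma vc_red_P: "vc P (red (p ^ l) a) a"
 unfolding P_def by (rule vc_red)

lemma red_conic: "red (p ^ l) a \<in> conic t \<longleftrightarrow> P dvd Q_form A a - t"
 using dvd_shift[OF vc_Q_form[OF vc_red_P, of A a]] red_grid[OF pl_pos] by (simp add: conic_def)

lemma p_not_dvd_2: "\<not> int p dvd 2"
 using prime_p odd_p by (metis dvd_refl even_of_nat int_dvd_int_iff of_nat_numeral primes_dvd_imp_eq two_is_prime_nat)

lemma symp_self_dl: "symp n (dl A n) = - 2 * Q_form A n"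
 using symp_dl_self[of A n] symp_flip[of "dl A n" n] by simp

text \<open>The solution of \<open>Q(a) = Q(a + n)\<close> in the basis \<open>n\<close>,
  \<open>dl A n\<close>: the equation fixes the coefficient \<open>-1/2\<close> of \<open>n\<close>,
  and \<open>s = symp n a\<close> determines the other one. The parameter \<open>i\<close> stands
  for the inverse of \<open>2 \<nu>\<close> modulo \<open>P\<close>.\<close>

definition sol :: "int ^ 2 \<Rightarrow> int \<Rightarrow> int \<Rightarrow> int ^ 2" where
 "sol n i s = i *s act A (- Q_form A n) (- s) n"

context
 fixes n :: "int ^ 2" and i \<nu> t :: int
 assumes \<nu>: "\<nu> = Q_form A n" "\<not> int p dvd \<nu>" and i: "P dvd i * (2 * \<nu>) - 1"
begin

text \<open>The vanishing of \<open>Q(a + n) - Q(a)\<close>, called \<open>y\<close> in the proof,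
  yields the coordinates of \<open>a\<close>; evaluating \<open>Q\<close> on them and comparing with
  \<open>t\<close> gives the quadratic equation for \<open>symp n a\<close>.\<close>

lemma sol_complete:
 assumes "P dvd Q_form A a - t" "P dvd Q_form A (a + n) - t"
 shows "P dvd disc A * (symp n a)\<^sup>2 - \<nu> * (\<nu> - 4 * t)" "vc P a (sol n i (symp n a))"
proof -
 define s y where "s = symp n a" and "y = symp (dl A a) n + \<nu>"
 have y: "P dvd y"
  using level_dvd[OF assms(2,1)] by (simp add: y_def Q_form_add \<nu>(1))
 have "symp n (dl A n) *s a = symp a (dl A n) *s n + symp n a *s dl A n"
  by (rule symp_cramer)
 moreover have "symp a (dl A n) = \<nu> - y"
  by (simp add: y_def symp_dl[of A a])
 ultimately have *: "(- 2 * \<nu>) *s a = (\<nu> - y) *s n + s *s dl A n"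
  by (simp add: symp_self_dl \<nu>(1) s_def)
 have comp: "2 * \<nu> * a $ j = - \<nu> * n $ j - s * dl A n $ j + y * n $ j" for j
  using arg_cong[OF *, of "\<lambda>v. v $ j"] by (simp add: algebra_simps)
 have "a $ j - sol n i s $ j = (i * y) * n $ j - (i * (2 * \<nu>) - 1) * a $ j" for j
 proof -
  have "i * (2 * \<nu> * a $ j) = i * (- \<nu> * n $ j - s * dl A n $ j + y * n $ j)" using comp by simp
  thus ?thesis by (simp add: sol_def act_def \<nu>(1) algebra_simps)
 qed
 thus "vc P a (sol n i (symp n a))"
  unfolding vc_def s_def[symmetric] using i y by simp
 have "vc P ((2 * \<nu>) *s a) (act A (- \<nu>) (- s) n)"
  unfolding vc_def act_def using y by (simp add: comp)
 hence "P dvd (2 * \<nu>)\<^sup>2 * Q_form A a - (\<nu>\<^sup>2 - disc A * s\<^sup>2) * \<nu>"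
  using vc_Q_form[of P _ _ A] by (fastforce simp: Q_form_smult Q_form_act nrm_def \<nu>(1))
 moreover have "P dvd (2 * \<nu>)\<^sup>2 * (Q_form A a - t)" using assms(1) by simp
 ultimately have "P dvd ((2 * \<nu>)\<^sup>2 * Q_form A a - (\<nu>\<^sup>2 - disc A * s\<^sup>2) * \<nu>) - (2 * \<nu>)\<^sup>2 * (Q_form A a - t)"
  by (rule dvd_diff)
 hence "P dvd \<nu> * (disc A * s\<^sup>2 - \<nu> * (\<nu> - 4 * t))"
  by (simp add: algebra_simps power2_eq_square)
 thus "P dvd disc A * (symp n a)\<^sup>2 - \<nu> * (\<nu> - 4 * t)"
  using prime_power_dvd_cancel[OF prime_p \<nu>(2)] unfolding P_def s_def by blast
qed

text \<open>Adding \<open>n\<close> turns the coefficient \<open>-1/2\<close> of \<open>n\<close>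
  into \<open>1/2\<close>. So the translate of one solution is the negative of the solution for
  \<open>-s\<close>, which is the symmetry that pairs the two terms of a matrix element.\<close>

lemma sol_shift: "vc P (sol n i s + n) (i *s act A \<nu> (- s) n)"
proof -
 have "(sol n i s + n) $ j - (i *s act A \<nu> (- s) n) $ j = (i * (2 * \<nu>) - 1) * (- n $ j)" for j
  by (simp add: sol_def act_def \<nu>(1) algebra_simps)
 thus ?thesis unfolding vc_def using i by (metis dvd_mult2)
qed

lemma sol_sound:
 assumes "P dvd disc A * s\<^sup>2 - \<nu> * (\<nu> - 4 * t)"
 shows "P dvd Q_form A (sol n i s) - t" "P dvd Q_form A (sol n i s + n) - t"
  "P dvd symp n (sol n i s) - s"
proof -
 define u where "u = i * (2 * \<nu>) - 1"
 have "i\<^sup>2 * ((\<nu>\<^sup>2 - disc A * s\<^sup>2) * \<nu>) - t = t * (u * (u + 2)) - i\<^sup>2 * \<nu> * (disc A * s\<^sup>2 - \<nu> * (\<nu> - 4 * t))"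
  by (simp add: u_def algebra_simps power2_eq_square)
 moreover have "P dvd t * (u * (u + 2)) - i\<^sup>2 * \<nu> * (disc A * s\<^sup>2 - \<nu> * (\<nu> - 4 * t))"
  using assms i by (simp add: u_def)
 ultimately have *: "P dvd i\<^sup>2 * ((\<nu>\<^sup>2 - disc A * s\<^sup>2) * \<nu>) - t" by simp
 thus "P dvd Q_form A (sol n i s) - t"
  by (simp add: sol_def Q_form_smult Q_form_act nrm_def \<nu>(1))
 have "P dvd Q_form A (i *s act A \<nu> (- s) n) - t"
  using * by (simp add: Q_form_smult Q_form_act nrm_def \<nu>(1))
 thus "P dvd Q_form A (sol n i s + n) - t"
  using dvd_shift[OF vc_Q_form[OF sol_shift]] by blast
 have "symp n (sol n i s) - s = s * u"
  by (simp add: sol_def act_def symp_simps symp_smult symp_self_dl u_def \<nu>(1) algebra_simps)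
 thus "P dvd symp n (sol n i s) - s" using i by (simp add: u_def)
qed

lemma sol_cong: "P dvd s - s' \<Longrightarrow> vc P (sol n i s) (sol n i s')"
proof -
 have "sol n i s $ j - sol n i s' $ j = (s - s') * (- i * dl A n $ j)" for j
  by (simp add: sol_def act_def algebra_simps)
 thus "P dvd s - s' \<Longrightarrow> ?thesis" unfolding vc_def by simp
qed

end

text \<open>The Hecke element \<open>-1\<close> replaces \<open>n\<close> by \<open>-n\<close> and
  the points by their negatives; passing to the adjoint of \<open>T(-n)\<close> exchanges the two
  points.\<close>

lemma pair_term_conj:
 assumes "hecke_fun \<psi>" "good x" "good y" "good x'" "good y'" "same_cell x' (- y)" "same_cell y' (- x)"
 shows "pair_term n \<psi> x' y' = cnj (pair_term n \<psi> x y)"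
proof -
 have hk: "hecke (- 1) 0" by (simp add: hecke_def nrm_def)
 have act: "act A (- 1) 0 z = - z" for z by (simp add: act_def vec_eq_iff)
 obtain \<alpha> where \<alpha>: "UM (- 1) 0 (vs x') = scl \<alpha> (vs y)" "\<alpha> * cnj \<alpha> = 1"
  using UM_vs[OF hk assms(3,4)] assms(6) unfolding act by blast
 obtain \<beta> where \<beta>: "UM (- 1) 0 (vs y') = scl \<beta> (vs x)" "\<beta> * cnj \<beta> = 1"
  using UM_vs[OF hk assms(2,5)] assms(7) unfolding act by blast
 obtain \<kappa> where \<kappa>: "UM (- 1) 0 \<psi> = scl \<kappa> \<psi>" using assms(1) hk unfolding hecke_fun_def by blast
 have \<psi>: "\<psi> \<in> H_N N" "ip N \<psi> \<psi> = 1" using assms(1) by (simp_all add: hecke_fun_def)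
 have \<kappa>1: "\<kappa> * cnj \<kappa> = 1"
  using UM_ip[OF hk \<psi>(1) \<psi>(1)] \<psi>(2) by (simp add: \<kappa> mult.commute)
 note H = vs_H[OF assms(2)] vs_H[OF assms(3)] vs_H[OF assms(4)] vs_H[OF assms(5)]
 have 1: "ip N \<psi> (vs x') = \<kappa> * cnj \<alpha> * ip N \<psi> (vs y)"
  using UM_ip[OF hk \<psi>(1) H(3)] by (simp add: \<kappa> \<alpha>(1) mult_ac)
 have 2: "ip N \<psi> (vs y') = \<kappa> * cnj \<beta> * ip N \<psi> (vs x)"
  using UM_ip[OF hk \<psi>(1) H(4)] by (simp add: \<kappa> \<beta>(1) mult_ac)
 have "ip N (twisted_T N n (vs x')) (vs y') = ip N (UM (- 1) 0 (twisted_T N n (vs x'))) (UM (- 1) 0 (vs y'))"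
  using UM_ip[OF hk twisted_T_H[OF odd_N H(3)] H(4)] by simp
 also have "\<dots> = \<alpha> * cnj \<beta> * ip N (twisted_T N (- n) (vs y)) (vs x)"
  by (simp add: UM_T'[OF hk H(3)] \<alpha>(1) \<beta>(1) act twisted_T_scl mult_ac)
 also have "ip N (twisted_T N (- n) (vs y)) (vs x) = cnj (ip N (twisted_T N n (vs x)) (vs y))"
  using ip_twisted_T_adj[OF odd_N H(2) H(1), of "- n"] by (simp add: cnj_ip)
 finally have 3: "ip N (twisted_T N n (vs x')) (vs y') = \<alpha> * cnj \<beta> * cnj (ip N (twisted_T N n (vs x)) (vs y))" .
 have "pair_term n \<psi> x' y' = (\<kappa> * cnj \<kappa>) * (\<alpha> * cnj \<alpha>) * (\<beta> * cnj \<beta>) * cnj (pair_term n \<psi> x y)"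
  unfolding pair_term_def 1 2 3 by (simp add: mult_ac)
 thus ?thesis by (simp add: \<kappa>1 \<alpha>(2) \<beta>(2))
qed

lemma matrix_element_zero:
 assumes "has_type \<psi> t" "\<not> int p dvd t" "\<nu> = Q_form A n" "\<not> int p dvd \<nu>"
  and "\<nexists>s. int p dvd disc A * s\<^sup>2 - \<nu> * (\<nu> - 4 * t)"
 shows "ip N (twisted_T N n \<psi>) \<psi> = 0"
proof -
 have "\<not> int p dvd 2 * \<nu>" using assms(4) p_not_dvd_2 prime_p by (simp add: prime_dvd_mult_iff)
 then obtain i where i: "P dvd i * (2 * \<nu>) - 1"
  using prime_power_inverse[OF prime_p] unfolding P_def by metis
 have "{a. a \<in> conic t \<and> P dvd Q_form A (a + n) - t} = {}"
  using sol_complete(1)[OF assms(3,4) i, of _ t] assms(5) dvd_trans[OF p_dvd_P] by (fastforce simp: conic_def)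
 thus ?thesis unfolding matrix_element_sum[OF assms(1,2)] by (simp only: sum.empty)
qed

lemma act_comp: "act A c d (act A c' d' n) = act A (c * c' + disc A * d * d') (c * d' + c' * d) n"
 by (simp add: act_def dl_linear dl_dl) (simp add: vec_eq_iff forall_2 algebra_simps)

lemma act_smult: "act A c d (i *s n) = i *s act A c d n"
 by (simp add: act_def dl_linear vec_eq_iff forall_2 algebra_simps)

text \<open>Exactly two points of the conic are kept on it, belonging to \<open>s\<close> and
  \<open>-s\<close>, and their terms are conjugate. The Hecke element carries the first point to its
  translate, so its eigenvalue contains all the dependence on \<open>\<psi>\<close>.\<close>

theorem matrix_element:
 assumes "\<not> int p dvd t" "\<nu> = Q_form A n" "\<not> int p dvd \<nu>" "\<not> int p dvd \<nu> - 4 * t"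
  and "int p dvd disc A * s0\<^sup>2 - \<nu> * (\<nu> - 4 * t)"
 obtains c d s Z where "hecke c d" "norm Z = 1" "int p dvd disc A * s\<^sup>2 - \<nu> * (\<nu> - 4 * t)"
  "int p dvd c * \<nu> + disc A * d * s + \<nu>" "int p dvd c * s + d * \<nu> - s"
  "\<And>\<psi> \<kappa>. has_type \<psi> t \<Longrightarrow> UM c d \<psi> = scl \<kappa> \<psi> \<Longrightarrow>
    ip N (twisted_T N n \<psi>) \<psi> = of_real (2 / (card (conic t) * sqrt (real_of_int E)) * Re (Z * cnj \<kappa>))"
proof -
 have "\<not> int p dvd 2 * \<nu>" using assms(3) p_not_dvd_2 prime_p by (simp add: prime_dvd_mult_iff)
 then obtain i where i: "P dvd i * (2 * \<nu>) - 1"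
  using prime_power_inverse[OF prime_p] unfolding P_def by metis
 define c0 where "c0 = \<nu> * (\<nu> - 4 * t)"
 have c0: "\<not> int p dvd c0" using assms(3,4) prime_p by (simp add: c0_def prime_dvd_mult_iff)
 obtain i0 where i0: "P dvd i0 * c0 - 1" using prime_power_inverse[OF prime_p c0] unfolding P_def by metis
 have "disc A * s0\<^sup>2 * i0 - 1 = (disc A * s0\<^sup>2 - c0) * i0 + (i0 * c0 - 1)" by (simp add: algebra_simps)
 moreover have "int p dvd (disc A * s0\<^sup>2 - c0) * i0 + (i0 * c0 - 1)"
  by (rule dvd_add[OF dvd_mult2[OF assms(5)[folded c0_def]] dvd_trans[OF p_dvd_P i0]])
 ultimately have "int p dvd disc A * s0\<^sup>2 * i0 - 1" by (simp only:)
 \<comment> \<open>The root \<open>s0\<close> modulo \<open>p\<close> is rescaled to a root modulo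
   \<open>P\<close>: the quotient of \<open>disc A * s0^2\<close> by the required value is 1 modulo
   \<open>p\<close> and thus has an inverse square root.\<close>
 then obtain r where r: "P dvd r\<^sup>2 * (disc A * s0\<^sup>2 * i0) - 1"
  using one_unit_sqrt[OF odd_p, of _ 0 l] unfolding P_def by (metis one_dvd power_0 of_nat_1)
 define s where "s = r * s0"
 have s: "P dvd disc A * s\<^sup>2 - \<nu> * (\<nu> - 4 * t)"
 proof -
  have "disc A * s\<^sup>2 - c0 = (r\<^sup>2 * (disc A * s0\<^sup>2 * i0) - 1) * c0 - (i0 * c0 - 1) * (disc A * s\<^sup>2)"
   by (simp add: s_def power_mult_distrib algebra_simps)
  thus ?thesis using r i0 by (simp add: c0_def)
 qed
 hence s': "P dvd disc A * (- s)\<^sup>2 - \<nu> * (\<nu> - 4 * t)" by simp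
 have ps: "\<not> int p dvd s"
 proof
  assume "int p dvd s"
  hence "int p dvd disc A * s\<^sup>2" by (simp add: power2_eq_square)
  from dvd_diff[OF this dvd_trans[OF p_dvd_P s]] show False using c0 by (simp add: c0_def)
 qed
 define a1 a2 where "a1 = red (p ^ l) (sol n i s)" and "a2 = red (p ^ l) (sol n i (- s))"
 note sols = sol_sound[OF assms(2,3) i]
 have a1v: "vc P a1 (sol n i s)" and a2v: "vc P a2 (sol n i (- s))"
  unfolding a1_def a2_def by (rule vc_red_P)+
 have a1: "a1 \<in> conic t" and a2: "a2 \<in> conic t"
  unfolding a1_def a2_def red_conic using sols(1)[OF s] sols(1)[OF s'] by auto
 have b1: "P dvd Q_form A (a1 + n) - t"
  using sols(2)[OF s] dvd_shift[OF vc_Q_form[OF vc_add[OF a1v vc_refl[of P n]], of A]] by blast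
 have b2: "P dvd Q_form A (a2 + n) - t"
  using sols(2)[OF s'] dvd_shift[OF vc_Q_form[OF vc_add[OF a2v vc_refl[of P n]], of A]] by blast
 have sn1: "P dvd symp n a1 - s"
  using sols(3)[OF s] dvd_shift[OF vc_symp[OF vc_refl a1v, of n]] by blast
 have sn2: "P dvd symp n a2 + s"
  using sols(3)[OF s'] dvd_shift[OF vc_symp[OF vc_refl a2v, of n], of "- s"] by simp
 have p2s: "\<not> int p dvd 2 * s" using ps p_not_dvd_2 prime_p by (simp add: prime_dvd_mult_iff)
 have neq: "a1 \<noteq> a2"
 proof
  assume "a1 = a2"
  hence "P dvd symp n a1 + s" using sn2 by simp
  from dvd_diff[OF this sn1] have "P dvd 2 * s" by simp
  thus False using p2s dvd_trans[OF p_dvd_P] by blast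
 qed
 \<comment> \<open>The equation for \<open>symp n a\<close> has the roots \<open>s\<close> and
   \<open>-s\<close>, distinct modulo \<open>p\<close>, and each determines the point.\<close>
 have set_eq: "{a. a \<in> conic t \<and> P dvd Q_form A (a + n) - t} = {a1, a2}"
 proof (intro equalityI subsetI)
  fix a assume a: "a \<in> {a. a \<in> conic t \<and> P dvd Q_form A (a + n) - t}"
  hence Qa: "P dvd Q_form A a - t" "P dvd Q_form A (a + n) - t" by (auto simp: conic_def)
  define r where "r = symp n a"
  note sc = sol_complete[OF assms(2,3) i Qa, folded r_def]
  have "P dvd disc A * ((r - s) * (r + s))"
   using level_dvd[OF sc(1) s] by (simp add: algebra_simps power2_eq_square)
  hence dvd: "P dvd (r - s) * (r + s)"
   using prime_power_dvd_cancel[OF prime_p disc_unit] unfolding P_def by blast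
  have eqI: "a = red (p ^ l) (sol n i q)" if "P dvd r - q" for q
  proof -
   have "vc P a (red (p ^ l) (sol n i q))"
    using vc_trans[OF vc_trans[OF sc(2) sol_cong[OF assms(2,3) i that]] vc_sym[OF vc_red_P]] .
   thus ?thesis
    using a red_grid[OF pl_pos] vc_grid_eq[of "p ^ l" a] by (simp add: conic_def P_def)
  qed
  show "a \<in> {a1, a2}"
  proof (cases "int p dvd r - s")
   case False
   hence "P dvd r + s" using prime_power_dvd_cancel[OF prime_p _ dvd[unfolded P_def]] by (simp add: P_def)
   thus ?thesis using eqI[of "- s"] by (simp add: a2_def)
  next
   case True
   have "\<not> int p dvd r + s"
   proof
    assume "int p dvd r + s"
    hence "int p dvd (r + s) - (r - s)" using True by (rule dvd_diff)
    thus False using p2s by simp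
   qed
   hence "P dvd r - s"
    using prime_power_dvd_cancel[OF prime_p, of "r + s" l "r - s"] dvd by (simp add: P_def mult.commute)
   thus ?thesis using eqI[of s] by (simp add: a1_def)
  qed
 qed (use a1 a2 b1 b2 in auto)
 define x1 y1 x2 y2 where "x1 = lift t a1" and "y1 = lift t (red (p ^ l) (a1 + n))"
  and "x2 = lift t a2" and "y2 = lift t (red (p ^ l) (a2 + n))"
 have r1: "red (p ^ l) (a1 + n) \<in> conic t" and r2: "red (p ^ l) (a2 + n) \<in> conic t"
  unfolding red_conic by (fact b1 b2)+
 note g = good_lift[OF assms(1) a1, folded x1_def] good_lift[OF assms(1) r1, folded y1_def]
  good_lift[OF assms(1) a2, folded x2_def] good_lift[OF assms(1) r2, folded y2_def]
 note Q = lift_Q[OF assms(1) a1, folded x1_def] lift_Q[OF assms(1) r1, folded y1_def]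
  lift_Q[OF assms(1) a2, folded x2_def] lift_Q[OF assms(1) r2, folded y2_def]
 have v1: "vc P x1 (sol n i s)" using lift_vc[OF assms(1) a1] a1v vc_trans unfolding x1_def by blast
 have v2: "vc P x2 (sol n i (- s))" using lift_vc[OF assms(1) a2] a2v vc_trans unfolding x2_def by blast
 have w1: "vc P y1 (i *s act A \<nu> (- s) n)"
  using lift_vc[OF assms(1) r1] vc_red_P vc_add[OF a1v vc_refl[of P n]] sol_shift[OF assms(2,3) i, of s] vc_trans
  unfolding y1_def by blast
 have w2: "vc P y2 (i *s act A \<nu> s n)"
  using vc_trans[OF vc_trans[OF vc_trans[OF lift_vc[OF assms(1) r2] vc_red_P] vc_add[OF a2v vc_refl[of P n]]]
    sol_shift[OF assms(2,3) i, of "- s"]]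
  unfolding y2_def by simp
 have neg1: "- (i *s act A \<nu> (- s) n) = sol n i (- s)" and neg2: "- (i *s act A \<nu> s n) = sol n i s"
  by (simp_all add: sol_def act_def assms(2) vec_eq_iff algebra_simps)
 have vc_neg: "vc P u v \<Longrightarrow> vc P (- u) (- v)" for u v
  using vc_diff[OF vc_refl[of P 0]] by fastforce
 have cell1: "same_cell x2 (- y1)"
  using vc_trans[OF v2 vc_sym[OF vc_neg[OF w1, unfolded neg1]]] level_dvd[OF Q(3) Q(2)]
  by (simp add: same_cell_def)
 have cell2: "same_cell y2 (- x1)"
 proof -
  have "vc P (- y2) x1" using vc_trans[OF vc_neg[OF w2, unfolded neg2] vc_sym[OF v1]] .
  hence "vc P y2 (- x1)" using vc_neg by fastforce
  thus ?thesis using level_dvd[OF Q(4) Q(1)] by (simp add: same_cell_def)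
 qed
 obtain c d where cd: "hecke c d" "vc P' (act A c d x1) y1" "same_cell y1 (act A c d x1)"
  using lift_transitive[OF assms(1) g(1,2) Q(1,2)] .
 obtain a where a: "UM c d (vs y1) = scl a (vs x1)" "a * cnj a = 1"
  using UM_vs[OF cd(1) g(1,2) cd(3)] .
 \<comment> \<open>\<open>sqrt E\<close> undoes the size of the overlap, and \<open>a\<close>
   cancels the arbitrary phases of the two states.\<close>
 define Z where "Z = of_real (sqrt (real_of_int E)) * (a * ip N (twisted_T N n (vs x1)) (vs y1))"
 have "norm Z = 1"
 proof -
  have near: "vc P y1 (x1 + n)"
  proof -
   have "vc P (i *s act A \<nu> (- s) n) (sol n i s + n)" by (rule vc_sym[OF sol_shift[OF assms(2,3) i]])
   thus ?thesis using w1 vc_sym[OF vc_add[OF v1 vc_refl[of P n]]] vc_trans by blast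
  qed
  have "\<not> int p dvd symp x1 y1"
  proof
   assume p: "int p dvd symp x1 y1"
   have "P dvd symp x1 y1 - symp x1 (x1 + n)" by (rule vc_symp[OF vc_refl near])
   moreover have "P dvd symp n x1 - symp n (sol n i s)" by (rule vc_symp[OF vc_refl v1])
   ultimately have "P dvd (symp x1 y1 - symp x1 (x1 + n)) - (symp n x1 - symp n (sol n i s)) - (symp n (sol n i s) - s)"
    using dvd_diff[OF dvd_diff sols(3)[OF s]] by blast
   hence "P dvd symp x1 y1 + s"
    using symp_flip[of x1 n] by (simp add: symp_simps algebra_simps)
   hence "int p dvd symp x1 y1 + s" using dvd_trans[OF p_dvd_P] by blast
   thus False using p ps by (simp add: dvd_add_right_iff)
  qed
  hence "(norm (ip N (twisted_T N n (vs x1)) (vs y1)))\<^sup>2 = 1 / real_of_int E"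
   by (rule transversal_overlap[OF g(1,2) near])
  hence "norm (ip N (twisted_T N n (vs x1)) (vs y1)) = sqrt (1 / real_of_int E)"
   by (metis norm_ge_zero real_sqrt_unique)
  thus ?thesis
   using norm_eq_1I[OF a(2)] P_pos by (simp add: Z_def norm_mult real_sqrt_divide)
 qed
 moreover have "int p dvd disc A * s\<^sup>2 - \<nu> * (\<nu> - 4 * t)"
  using dvd_trans[OF p_dvd_P s] .
 \<comment> \<open>The element carries the first solution to its translate by \<open>n\<close>. In
   the basis \<open>n\<close>, \<open>dl A n\<close> this says
   \<open>(c + d \<delta>) (s \<delta> + \<nu>) = s \<delta> - \<nu>\<close>, read off in two
   components.\<close>
 moreover have "int p dvd c * \<nu> + disc A * d * s + \<nu>" "int p dvd c * s + d * \<nu> - s"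
 proof -
  have "vc P (act A c d x1) (act A c d (sol n i s))" by (rule vc_act[OF v1])
  hence "vc P (act A c d (sol n i s)) (i *s act A \<nu> (- s) n)"
   using vc_dvd[OF cd(2) P_dvd_P'] w1 vc_sym vc_trans by blast
  hence 1: "vc P (i *s act A (- (c * \<nu>) - disc A * d * s) (- (c * s) - d * \<nu>) n) (i *s act A \<nu> (- s) n)"
   unfolding sol_def act_smult act_comp by (simp add: assms(2)[symmetric] mult.commute)
  have "symp (i *s act A u v n) n = i * v * (2 * \<nu>)" "symp (i *s act A u v n) (dl A n) = - i * u * (2 * \<nu>)" for u v
   by (simp_all add: symp_smult act_def symp_simps symp_dl_self symp_self_dl assms(2))
  note s12 = this
  have "P dvd i * (- (c * s) - d * \<nu>) * (2 * \<nu>) - i * (- s) * (2 * \<nu>)"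
   using vc_symp[OF 1 vc_refl[of P n]] unfolding s12 .
  also have "i * (- (c * s) - d * \<nu>) * (2 * \<nu>) - i * (- s) * (2 * \<nu>) = - ((i * (2 * \<nu>)) * (c * s + d * \<nu> - s))"
   by (simp add: algebra_simps)
  finally have 2: "P dvd (i * (2 * \<nu>)) * (c * s + d * \<nu> - s)" by (simp only: dvd_minus_iff)
  have "P dvd - i * (- (c * \<nu>) - disc A * d * s) * (2 * \<nu>) - (- i * \<nu> * (2 * \<nu>))"
   using vc_symp[OF 1 vc_refl[of P "dl A n"]] unfolding s12 .
  also have "- i * (- (c * \<nu>) - disc A * d * s) * (2 * \<nu>) - (- i * \<nu> * (2 * \<nu>))
    = (i * (2 * \<nu>)) * (c * \<nu> + disc A * d * s + \<nu>)"
   by (simp add: algebra_simps)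
  finally have 3: "P dvd (i * (2 * \<nu>)) * (c * \<nu> + disc A * d * s + \<nu>)" .
  have cancel: "P dvd z" if "P dvd (i * (2 * \<nu>)) * z" for z
  proof -
   have "P dvd (i * (2 * \<nu>)) * z - (i * (2 * \<nu>) - 1) * z"
    by (rule dvd_diff[OF that dvd_mult2[OF i]])
   thus ?thesis by (simp add: left_diff_distrib)
  qed
  show "int p dvd c * \<nu> + disc A * d * s + \<nu>" "int p dvd c * s + d * \<nu> - s"
   using dvd_trans[OF p_dvd_P cancel[OF 3]] dvd_trans[OF p_dvd_P cancel[OF 2]] .
 qed
 moreover have "ip N (twisted_T N n \<psi>) \<psi> = of_real (2 / (card (conic t) * sqrt (real_of_int E)) * Re (Z * cnj \<kappa>))"
  if "has_type \<psi> t" "UM c d \<psi> = scl \<kappa> \<psi>" for \<psi> \<kappa>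
 proof -
  have hk: "hecke_fun \<psi>" using that(1) by (simp add: has_type_def)
  have "ip N (twisted_T N n \<psi>) \<psi> = pair_term n \<psi> x1 y1 + pair_term n \<psi> x2 y2"
   unfolding matrix_element_sum[OF that(1) assms(1)] set_eq using neq
   by (simp add: x1_def y1_def x2_def y2_def)
  also have "\<dots> = of_real (2 * Re (pair_term n \<psi> x1 y1))"
   by (simp add: pair_term_conj[OF hk g cell1 cell2] complex_add_cnj)
  also have "pair_term n \<psi> x1 y1 = of_real (1 / (card (conic t) * sqrt (real_of_int E))) * (Z * cnj \<kappa>)"
  proof -
   have "a * ip N (twisted_T N n (vs x1)) (vs y1) = of_real (1 / sqrt (real_of_int E)) * Z"
    using P_pos by (simp add: Z_def)
   thus ?thesis
    using pair_term_hecke[OF that(1) assms(1) g(1,2) Q(1) cd(1,3) that(2) a(1), of n] by (simp add: mult_ac)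
  qed
  also have "Re \<dots> = 1 / (card (conic t) * sqrt (real_of_int E)) * Re (Z * cnj \<kappa>)"
   by (simp only: Re_complex_of_real Im_complex_of_real times_complex.sel mult_zero_left diff_zero)
  finally show ?thesis by simp
 qed
 ultimately show ?thesis using that cd(1) by blast
qed

section \<open>Traces of Hecke operators over the eigenfunctions of one type\<close>

lemma parseval:
 assumes "orthonormal_basis_H N \<psi>" "\<phi> \<in> H_N N" "\<eta> \<in> H_N N"
 shows "(\<Sum>j\<in>{1..N}. ip N \<phi> (\<psi> j) * ip N (\<psi> j) \<eta>) = ip N \<phi> \<eta>"
proof -
 obtain c where c: "\<phi> = (\<lambda>y. \<Sum>j\<in>{1..N}. c j * \<psi> j y)"
  using assms(1,2) unfolding orthonormal_basis_H_def by blast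
 have "ip N \<phi> (\<psi> j) = c j" if j: "j \<in> {1..N}" for j
 proof -
  have "ip N \<phi> (\<psi> j) = (\<Sum>i\<in>{1..N}. if i = j then c j else 0)"
   unfolding c ip_sum_left using assms(1) j by (intro sum.cong) (auto simp: orthonormal_basis_H_def)
  thus ?thesis using j by simp
 qed
 hence "(\<Sum>j\<in>{1..N}. ip N \<phi> (\<psi> j) * ip N (\<psi> j) \<eta>) = (\<Sum>j\<in>{1..N}. c j * ip N (\<psi> j) \<eta>)"
  by simp
 thus ?thesis unfolding c ip_sum_left .
qed

context
 fixes \<psi> :: "nat \<Rightarrow> int \<Rightarrow> complex" and t :: int
 assumes onb: "orthonormal_basis_H N \<psi>" and hk: "\<And>j. j \<in> {1..N} \<Longrightarrow> hecke_fun (\<psi> j)"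
  and t: "\<not> int p dvd t"
begin

text \<open>For an eigenfunction of type \<open>t\<close> the squared overlaps with the states of
  the conic add up to 1; for every other one they vanish. Interchanging the sums gives the trace on
  the span of these states.\<close>

lemma trace_type:
 assumes "hecke c d" "\<And>j. j \<in> {1..N} \<Longrightarrow> UM c d (\<psi> j) = scl (\<kappa> j) (\<psi> j)"
 shows "(\<Sum>j | j \<in> {1..N} \<and> has_type (\<psi> j) t. \<kappa> j) = (\<Sum>a\<in>conic t. ip N (UM c d (vs (lift t a))) (vs (lift t a)))"
proof -
 define J where "J = {j. j \<in> {1..N} \<and> has_type (\<psi> j) t}"
 have sum1: "(\<Sum>a\<in>conic t. of_real ((norm (ip N (\<psi> j) (vs (lift t a))))\<^sup>2)) = (1::complex)" if "j \<in> J" for j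
 proof -
  have ht: "has_type (\<psi> j) t" using that by (simp add: J_def)
  have ne: "conic t \<noteq> {}"
   using ht hecke_coeff(2)[OF ht t] unfolding has_type_def by blast
  have "(\<Sum>a\<in>conic t. complex_of_real ((norm (ip N (\<psi> j) (vs (lift t a))))\<^sup>2)) = (\<Sum>a\<in>conic t. of_real (1 / card (conic t)))"
   by (rule sum.cong) (simp_all only: hecke_coeff(1)[OF ht t good_lift[OF t] lift_Q[OF t]])
  thus ?thesis using ne by simp
 qed
 have term_a: "(\<Sum>j\<in>J. \<kappa> j * of_real ((norm (ip N (\<psi> j) (vs (lift t a))))\<^sup>2)) = ip N (UM c d (vs (lift t a))) (vs (lift t a))"
  if a: "a \<in> conic t" for a
 proof -
  define v where "v = vs (lift t a)"
  have v: "v \<in> H_N N" unfolding v_def by (rule vs_H[OF good_lift[OF t a]])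
  have "ip N (UM c d v) (\<psi> j) * ip N (\<psi> j) v = \<kappa> j * of_real ((norm (ip N (\<psi> j) v))\<^sup>2)"
   if j: "j \<in> {1..N}" for j
  proof -
   have \<psi>: "\<psi> j \<in> H_N N" "ip N (\<psi> j) (\<psi> j) = 1" using hk[OF j] by (simp_all add: hecke_fun_def)
   have "\<kappa> j * cnj (\<kappa> j) = 1"
    using UM_ip[OF assms(1) \<psi>(1) \<psi>(1)] \<psi>(2) by (simp add: assms(2)[OF j] mult.commute)
   moreover have "cnj (\<kappa> j) * ip N (UM c d v) (\<psi> j) = ip N v (\<psi> j)"
    using UM_ip[OF assms(1) v \<psi>(1)] by (simp add: assms(2)[OF j])
   ultimately have "ip N (UM c d v) (\<psi> j) = \<kappa> j * ip N v (\<psi> j)"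
    by (metis mult.assoc mult.commute mult.left_neutral)
   moreover have "ip N v (\<psi> j) * ip N (\<psi> j) v = of_real ((norm (ip N (\<psi> j) v))\<^sup>2)"
    using complex_norm_square[of "ip N (\<psi> j) v"] by (simp add: cnj_ip mult.commute)
   ultimately show ?thesis by (simp add: mult.assoc)
  qed
  hence "ip N (UM c d v) v = (\<Sum>j\<in>{1..N}. \<kappa> j * of_real ((norm (ip N (\<psi> j) v))\<^sup>2))"
   using parseval[OF onb UM_H[OF assms(1) v] v] by simp
  also have "\<dots> = (\<Sum>j\<in>J. \<kappa> j * of_real ((norm (ip N (\<psi> j) v))\<^sup>2))"
  proof (rule sum.mono_neutral_right)
   show "\<forall>j\<in>{1..N} - J. \<kappa> j * of_real ((norm (ip N (\<psi> j) v))\<^sup>2) = 0"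
   proof
    fix j assume j: "j \<in> {1..N} - J"
    have "ip N (\<psi> j) v = 0"
     using j hk[of j] good_lift[OF t a] lift_Q[OF t a] unfolding J_def has_type_def v_def by blast
    thus "\<kappa> j * of_real ((norm (ip N (\<psi> j) v))\<^sup>2) = 0" by simp
   qed
  qed (auto simp: J_def)
  finally show ?thesis by (simp add: v_def)
 qed
 have "(\<Sum>j\<in>J. \<kappa> j) = (\<Sum>j\<in>J. \<Sum>a\<in>conic t. \<kappa> j * of_real ((norm (ip N (\<psi> j) (vs (lift t a))))\<^sup>2))"
  by (rule sum.cong) (simp_all only: sum_distrib_left[symmetric] sum1 mult_1_right)
 also have "\<dots> = (\<Sum>a\<in>conic t. \<Sum>j\<in>J. \<kappa> j * of_real ((norm (ip N (\<psi> j) (vs (lift t a))))\<^sup>2))"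
  by (rule sum.swap)
 also have "\<dots> = (\<Sum>a\<in>conic t. ip N (UM c d (vs (lift t a))) (vs (lift t a)))"
  by (rule sum.cong) (simp_all only: term_a)
 finally show ?thesis unfolding J_def .
qed

text \<open>A Hecke operator permutes the states up to phases, so only states fixed modulo
  \<open>P\<close> contribute to the trace. By freeness of the action there are none unless the
  element is 1 modulo \<open>p\<close>.\<close>

lemma trace_type_zero:
 assumes "hecke c d" "\<And>j. j \<in> {1..N} \<Longrightarrow> UM c d (\<psi> j) = scl (\<kappa> j) (\<psi> j)"
  and "\<not> (int p dvd c - 1 \<and> int p dvd d)"
 shows "(\<Sum>j | j \<in> {1..N} \<and> has_type (\<psi> j) t. \<kappa> j) = 0"
proof -
 have "ip N (UM c d (vs (lift t a))) (vs (lift t a)) = 0" if a: "a \<in> conic t" for a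
 proof (rule ccontr)
 assume nz: "ip N (UM c d (vs (lift t a))) (vs (lift t a)) \<noteq> 0"
 define x where "x = lift t a"
 have x: "good x" unfolding x_def by (rule good_lift[OF t a])
 define z where "z = act A c (- d) x"
 have hk': "hecke c (- d)" using assms(1) by (simp add: hecke_def nrm_def)
 have z: "good z" unfolding z_def by (rule hecke_good[OF hk' x])
 have az: "act A c d z = nrm A c d *s x" unfolding z_def by (rule act_act_conj)
 have "vc (int N) (act A c d z) x"
 proof -
  have "act A c d z $ j - x $ j = (nrm A c d - 1) * x $ j" for j
   by (simp add: az algebra_simps)
  thus ?thesis using assms(1) unfolding hecke_def vc_def by simp
 qed
 hence "same_cell x (act A c d z)"
  unfolding same_cell_def using vc_dvd[OF vc_sym P_dvd_N] dvd_trans[OF P'_dvd_N vc_Q_form[OF vc_sym]] by blast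
 then obtain \<alpha> where \<alpha>: "UM c d (vs x) = scl \<alpha> (vs z)"
  using UM_vs[OF assms(1) z x] by blast
 hence "ip N (vs z) (vs x) \<noteq> 0" using nz by (auto simp: x_def)
 hence "vc P z x" by (rule joint_eig_P'_ip[OF vs_P'_eig[OF z] vs_P'_eig[OF x]])
 hence "vc (int (p ^ 1)) (act A c (- d) x) x"
  using vc_dvd[OF _ p_dvd_P] by (simp add: z_def)
 hence "int (p ^ 1) dvd c - 1" "int (p ^ 1) dvd - d"
  using act_free[OF x] by blast+
 thus False using assms(3) by simp
 qed
 thus ?thesis using trace_type[of c d \<kappa>, OF assms(1,2)] by simp
qed

lemma card_type: "card {j. j \<in> {1..N} \<and> has_type (\<psi> j) t} = card (conic t)"
proof -
 have hk1: "hecke 1 0" by (simp add: hecke_def nrm_def)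
 have "\<forall>j\<in>{1..N}. \<exists>a. UM 1 0 (\<psi> j) = scl a (\<psi> j)"
  using hk hk1 unfolding hecke_fun_def by blast
 hence "\<exists>\<kappa>. \<forall>j\<in>{1..N}. UM 1 0 (\<psi> j) = scl (\<kappa> j) (\<psi> j)" by (rule bchoice)
 then obtain \<kappa> where \<kappa>: "\<And>j. j \<in> {1..N} \<Longrightarrow> UM 1 0 (\<psi> j) = scl (\<kappa> j) (\<psi> j)" by blast
 \<comment> \<open>The operator of the unit element is idempotent by multiplicativity and onto by
   unitarity, hence the identity.\<close>
 have id: "UM 1 0 \<phi> = \<phi>" if \<phi>: "\<phi> \<in> H_N N" for \<phi>
 proof -
  have u: "unitary_on_H N (U (hecke_mat A 1 0))"
   using propagator[folded N_def] hecke_SL2[OF hk1] unfolding quantum_propagator_def by blast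
  hence "U (hecke_mat A 1 0) ` H_N N = H_N N" unfolding unitary_on_H_def by blast
  hence "\<phi> \<in> U (hecke_mat A 1 0) ` H_N N" using \<phi> by simp
  then obtain \<phi>' where "\<phi>' \<in> H_N N" "\<phi> = UM 1 0 \<phi>'" unfolding UM_def by blast
  thus ?thesis using UM_comp[OF hk1 hk1] by simp
 qed
 have "\<kappa> j = 1" if j: "j \<in> {1..N}" for j
 proof -
  have \<psi>: "\<psi> j \<in> H_N N" "ip N (\<psi> j) (\<psi> j) = 1" using hk[OF j] by (simp_all add: hecke_fun_def)
  have "ip N (scl (\<kappa> j) (\<psi> j)) (\<psi> j) = 1" using id[OF \<psi>(1)] \<kappa>[OF j] \<psi>(2) by simp
  thus ?thesis by (simp add: \<psi>(2))
 qed
 hence "of_nat (card {j. j \<in> {1..N} \<and> has_type (\<psi> j) t}) = (\<Sum>j | j \<in> {1..N} \<and> has_type (\<psi> j) t. \<kappa> j)"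
  by simp
 also have "\<dots> = of_nat (card (conic t))"
  using trace_type[of 1 0 \<kappa>, OF hk1 \<kappa>] vs_unit[OF good_lift[OF t]] id[OF vs_H[OF good_lift[OF t]]] by simp
 finally show ?thesis by (simp only: of_nat_eq_iff)
qed

end

end

section \<open>Counting points on conics\<close>

text \<open>The residues \<open>c^2\<close> and \<open>u + D * d^2\<close> fill two sets of
  \<open>(p + 1) / 2\<close> elements each, which must meet.\<close>

lemma norm_form_represents:
 assumes "prime p" "odd p" "\<not> int p dvd D"
 obtains c d where "int p dvd c\<^sup>2 - D * d\<^sup>2 - u"
proof -
 define q :: int where "q = (int p - 1) div 2"
 have q: "2 * q + 1 = int p" using assms(2) by (auto elim!: oddE simp: q_def)
 have p: "int p > 0" using assms(1) by (simp add: prime_gt_0_nat)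
 have inj0: "c = c'" if "c \<in> {0..q}" "c' \<in> {0..q}" "int p dvd c\<^sup>2 - c'\<^sup>2" for c c'
 proof -
  have "int p dvd (c - c') * (c + c')" using that(3) by (simp add: algebra_simps power2_eq_square)
  hence "int p dvd c - c' \<or> int p dvd c + c'" using assms(1) by (simp add: prime_dvd_mult_iff)
  thus ?thesis
  proof
   assume "int p dvd c - c'"
   thus ?thesis using zdvd_imp_le[of "int p" "\<bar>c - c'\<bar>"] that q by (cases "c = c'") auto
  next
   assume "int p dvd c + c'"
   thus ?thesis using zdvd_imp_le[of "int p" "c + c'"] that q by (cases "c + c' = 0") auto
  qed
 qed
 define X where "X = (\<lambda>c. c\<^sup>2 mod int p) ` {0..q}"
 define Y where "Y = (\<lambda>d. (u + D * d\<^sup>2) mod int p) ` {0..q}"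
 have "inj_on (\<lambda>c. c\<^sup>2 mod int p) {0..q}"
  by (rule inj_onI) (auto intro!: inj0 simp: mod_eq_dvd_iff)
 hence cX: "card X = nat (q + 1)" by (simp add: X_def card_image)
 have "inj_on (\<lambda>d. (u + D * d\<^sup>2) mod int p) {0..q}"
 proof (rule inj_onI)
  fix d d' assume d: "d \<in> {0..q}" "d' \<in> {0..q}" "(u + D * d\<^sup>2) mod int p = (u + D * d'\<^sup>2) mod int p"
  hence "int p dvd D * (d\<^sup>2 - d'\<^sup>2)" by (simp add: mod_eq_dvd_iff algebra_simps)
  hence "int p dvd d\<^sup>2 - d'\<^sup>2" using assms(1,3) by (simp add: prime_dvd_mult_iff)
  thus "d = d'" using inj0 d by blast
 qed
 hence cY: "card Y = nat (q + 1)" by (simp add: Y_def card_image)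
 have "X \<inter> Y \<noteq> {}"
 proof
  assume "X \<inter> Y = {}"
  hence "card (X \<union> Y) = nat (q + 1) + nat (q + 1)"
   using cX cY by (subst card_Un_disjoint) (auto simp: X_def Y_def)
  moreover have "X \<union> Y \<subseteq> {0..<int p}" using p by (auto simp: X_def Y_def)
  hence "card (X \<union> Y) \<le> card {0..<int p}" by (intro card_mono) auto
  ultimately have "nat (q + 1) + nat (q + 1) \<le> p" by simp
  thus False using q by linarith
 qed
 then obtain c d where "c\<^sup>2 mod int p = (u + D * d\<^sup>2) mod int p"
  unfolding X_def Y_def by auto
 hence "int p dvd c\<^sup>2 - D * d\<^sup>2 - u" by (simp add: mod_eq_dvd_iff algebra_simps)
 thus ?thesis by (rule that)
qed

lemma card_residue_class:
 assumes "p > 0" "l > 0"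
 shows "card {x \<in> {0..<int (p ^ l)}. int p dvd x - r} = p ^ (l - 1)"
proof -
 have pl: "int (p ^ l) = int p * int (p ^ (l - 1))"
  using assms(2) by (metis Suc_pred' of_nat_mult power_Suc)
 have p: "int p > 0" using assms(1) by simp
 have "bij_betw (\<lambda>y. int p * y + r mod int p) {0..<int (p ^ (l - 1))} {x \<in> {0..<int (p ^ l)}. int p dvd x - r}"
 proof (rule bij_betwI[where g = "\<lambda>x. x div int p"])
  show "(\<lambda>y. int p * y + r mod int p) \<in> {0..<int (p ^ (l - 1))} \<rightarrow> {x \<in> {0..<int (p ^ l)}. int p dvd x - r}"
  proof
   fix y assume y: "y \<in> {0..<int (p ^ (l - 1))}"
   have "r mod int p < int p" "r mod int p \<ge> 0" using p by simp_all
   moreover have "int p * y \<le> int p * (int (p ^ (l - 1)) - 1)" using y p by (intro mult_left_mono) auto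
   ultimately have "int p * y + r mod int p < int (p ^ l)" unfolding pl by (simp add: algebra_simps)
   moreover have "int p dvd int p * y + r mod int p - r"
    by (simp add: mod_eq_dvd_iff[symmetric])
   ultimately show "int p * y + r mod int p \<in> {x \<in> {0..<int (p ^ l)}. int p dvd x - r}"
    using y p by simp
  qed
  show "(\<lambda>x. x div int p) \<in> {x \<in> {0..<int (p ^ l)}. int p dvd x - r} \<rightarrow> {0..<int (p ^ (l - 1))}"
  proof
   fix x assume x: "x \<in> {x \<in> {0..<int (p ^ l)}. int p dvd x - r}"
   have "int p * (x div int p) \<le> x" using p pos_mod_sign[of "int p" x] by (simp flip: minus_mod_eq_mult_div)
   moreover have "x < int (p ^ l)" using x by simp
   ultimately have "int p * (x div int p) < int p * int (p ^ (l - 1))" unfolding pl by linarith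
   thus "x div int p \<in> {0..<int (p ^ (l - 1))}"
    using x p by (simp add: pos_imp_zdiv_nonneg_iff)
  qed
  fix x assume "x \<in> {x \<in> {0..<int (p ^ l)}. int p dvd x - r}"
  hence "x mod int p = r mod int p" by (simp add: mod_eq_dvd_iff)
  thus "int p * (x div int p) + r mod int p = x" by (metis mult_div_mod_eq)
 qed (use p in auto)
 from bij_betw_same_card[OF this] show ?thesis by (simp add: nat_power_eq)
qed

lemma sum_grid_shift:
 fixes g :: "int ^ 2 \<Rightarrow> 'a::comm_monoid_add"
 assumes "M > 0" "\<And>a b. vc (int M) a b \<Longrightarrow> g a = g b"
 shows "(\<Sum>a\<in>grid M. g (a + m)) = (\<Sum>a\<in>grid M. g a)"
proof -
 have M: "int M > 0" using assms(1) by simp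
 have v: "vector [r, s] + m = vector [r + m $ 1, s + m $ 2]" for r s
  by (intro vec2_eqI) auto
 have "(\<Sum>a\<in>grid M. g (a + m)) = (\<Sum>r\<in>{0..<int M}. \<Sum>s\<in>{0..<int M}. g (vector [r + m $ 1, s + m $ 2]))"
  by (simp add: sum_grid v)
 also have "\<dots> = (\<Sum>r\<in>{0..<int M}. \<Sum>s\<in>{0..<int M}. g (vector [r + m $ 1, s]))"
  by (intro sum.cong refl sum_periodic_shift[OF M, of "\<lambda>s. g (vector [_, s])"] assms(2)) (simp add: vc_def)
 also have "\<dots> = (\<Sum>r\<in>{0..<int M}. \<Sum>s\<in>{0..<int M}. g (vector [r, s]))"
  by (intro sum_periodic_shift[OF M, of "\<lambda>r. \<Sum>s\<in>{0..<int M}. g (vector [r, s])"] sum.cong refl assms(2))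
   (simp add: vc_def)
 finally show ?thesis by (simp add: sum_grid)
qed

context cat_map
begin

definition norm_one :: "(int ^ 2) set" where
 "norm_one = {n \<in> grid (p ^ l). P dvd nrm A (n $ 1) (n $ 2) - 1}"

text \<open>The norm form represents \<open>t / Q(n)\<close> modulo \<open>p\<close>; scaling by an
  inverse square root of a one-unit makes the level exact modulo \<open>P\<close>.\<close>

lemma conic_nonempty:
 assumes "good n" "\<not> int p dvd t"
 shows "conic t \<noteq> {}"
proof -
 define \<nu> where "\<nu> = Q_form A n"
 have \<nu>: "\<not> int p dvd \<nu>" using assms(1) by (simp add: good_def \<nu>_def)
 obtain i where i: "P dvd i * \<nu> - 1" using prime_power_inverse[OF prime_p \<nu>] unfolding P_def by metis
 obtain j where j: "P dvd j * t - 1" using prime_power_inverse[OF prime_p assms(2)] unfolding P_def by metis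
 obtain c d where "int p dvd c\<^sup>2 - disc A * d\<^sup>2 - i * t"
  by (rule norm_form_represents[OF prime_p odd_p disc_unit])
 hence cd: "int p dvd nrm A c d - i * t" by (simp add: nrm_def)
 define w where "w = nrm A c d * \<nu> * j"
 have "w - 1 = (nrm A c d - i * t) * (\<nu> * j) + (i * \<nu> - 1) * (t * j) + (j * t - 1)"
  by (simp add: w_def algebra_simps)
 moreover have "int p dvd (nrm A c d - i * t) * (\<nu> * j) + (i * \<nu> - 1) * (t * j) + (j * t - 1)"
  by (intro dvd_add dvd_mult2[OF cd] dvd_mult2[OF dvd_trans[OF p_dvd_P i]] dvd_trans[OF p_dvd_P j])
 ultimately have "int p dvd w - 1" by (simp only:)
 then obtain r where r: "P dvd r\<^sup>2 * w - 1"
  using one_unit_sqrt[OF odd_p, of w 0 l] unfolding P_def by (metis one_dvd power_0 of_nat_1)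
 have "Q_form A (r *s act A c d n) - t = (r\<^sup>2 * w - 1) * t - (j * t - 1) * (r\<^sup>2 * nrm A c d * \<nu>)"
  by (simp add: Q_form_smult Q_form_act w_def \<nu>_def algebra_simps)
 moreover have "P dvd (r\<^sup>2 * w - 1) * t - (j * t - 1) * (r\<^sup>2 * nrm A c d * \<nu>)"
  by (rule dvd_diff[OF dvd_mult2[OF r] dvd_mult2[OF j]])
 ultimately have "P dvd Q_form A (r *s act A c d n) - t" by (simp only:)
 hence "red (p ^ l) (r *s act A c d n) \<in> conic t" by (simp add: red_conic)
 thus ?thesis by blast
qed

lemma nrm_cong: "m dvd c - c' \<Longrightarrow> m dvd d - d' \<Longrightarrow> m dvd nrm A c d - nrm A c' d'"
proof -
 assume *: "m dvd c - c'" "m dvd d - d'"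
 have "nrm A c d - nrm A c' d' = (c - c') * (c + c') - (d - d') * (disc A * (d + d'))"
  by (simp add: nrm_def algebra_simps power2_eq_square)
 moreover have "m dvd (c - c') * (c + c') - (d - d') * (disc A * (d + d'))"
  by (rule dvd_diff[OF dvd_mult2[OF *(1)] dvd_mult2[OF *(2)]])
 ultimately show ?thesis by (simp only:)
qed

text \<open>The norm-one elements modulo \<open>P\<close> act simply transitively on the
  conic.\<close>

lemma card_conic:
 assumes "good n" "\<not> int p dvd t"
 shows "card (conic t) = card norm_one"
proof -
 obtain a where a: "a \<in> conic t" using conic_nonempty[OF assms] by blast
 hence Qa: "P dvd Q_form A a - t" by (simp add: conic_def)
 have ga: "good a" by (rule good_of_level[OF assms(2) Qa])
 define F :: "int ^ 2 \<Rightarrow> int ^ 2" where "F m = red (p ^ l) (act A (m $ 1) (m $ 2) a)" for m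
 have "bij_betw F norm_one (conic t)"
  unfolding bij_betw_def
 proof
  show "inj_on F norm_one"
  proof (rule inj_onI)
   fix m m' assume m: "m \<in> norm_one" "m' \<in> norm_one" "F m = F m'"
   have "vc (int (p ^ l)) (act A (m $ 1) (m $ 2) a) (act A (m' $ 1) (m' $ 2) a)"
    using m(3) by (simp only: F_def red_eq_iff[OF pl_pos])
   hence "vc (int (p ^ l)) (act A (m $ 1) (m $ 2) a - act A (m' $ 1) (m' $ 2) a + a)
     (act A (m' $ 1) (m' $ 2) a - act A (m' $ 1) (m' $ 2) a + a)"
    by (intro vc_add vc_diff vc_refl)
   moreover have "act A (m $ 1) (m $ 2) a - act A (m' $ 1) (m' $ 2) a + a = act A (m $ 1 - m' $ 1 + 1) (m $ 2 - m' $ 2) a"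
    by (simp add: act_def vec_eq_iff algebra_simps)
   ultimately have "vc (int (p ^ l)) (act A (m $ 1 - m' $ 1 + 1) (m $ 2 - m' $ 2) a) a" by simp
   from act_free[OF ga this] have "vc (int (p ^ l)) m m'" by (simp add: vc_def)
   thus "m = m'"
    by (rule vc_grid_eq) (use m in \<open>simp_all add: norm_one_def\<close>)
  qed
  show "F ` norm_one = conic t"
  proof (intro equalityI subsetI)
   fix b assume "b \<in> F ` norm_one"
   then obtain m where m: "m \<in> norm_one" "b = F m" by blast
   have "Q_form A (act A (m $ 1) (m $ 2) a) - t = (nrm A (m $ 1) (m $ 2) - 1) * Q_form A a + (Q_form A a - t)"
    by (simp add: Q_form_act algebra_simps)
   moreover have "P dvd (nrm A (m $ 1) (m $ 2) - 1) * Q_form A a + (Q_form A a - t)"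
    using m(1) Qa by (intro dvd_add dvd_mult2) (auto simp: norm_one_def)
   ultimately show "b \<in> conic t" unfolding m(2) F_def red_conic by (simp only:)
  next
   fix b assume b: "b \<in> conic t"
   hence Qb: "P dvd Q_form A b - t" by (simp add: conic_def)
   obtain c d where cd: "hecke c d" "vc P (act A c d a) b"
    using transitive[OF ga, of l b] level_dvd[OF Qa Qb] l_pos unfolding P_def by auto
   define m where "m = red (p ^ l) (vector [c, d])"
   have mv: "vc P m (vector [c, d])" unfolding m_def by (rule vc_red_P)
   hence m12: "P dvd m $ 1 - c" "P dvd m $ 2 - d" by (simp_all add: vc_def)
   have "P dvd nrm A c d - 1" using cd(1) P_dvd_N dvd_trans unfolding hecke_def by blast
   hence "P dvd nrm A (m $ 1) (m $ 2) - 1"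
    using dvd_shift[OF nrm_cong[OF m12]] by blast
   hence "m \<in> norm_one" using red_grid[OF pl_pos] by (simp add: norm_one_def m_def)
   moreover have "F m = b"
   proof -
    have "act A (m $ 1) (m $ 2) a $ k - act A c d a $ k = (m $ 1 - c) * a $ k + (m $ 2 - d) * dl A a $ k" for k
     by (simp add: act_def algebra_simps)
    hence "vc P (act A (m $ 1) (m $ 2) a) (act A c d a)"
     unfolding vc_def using m12 by simp
    hence "vc P (F m) b" unfolding F_def using vc_red_P cd(2) vc_trans by blast
    thus ?thesis
     using b red_grid[OF pl_pos] vc_grid_eq[of "p ^ l" "F m" b] by (simp add: conic_def P_def F_def)
   qed
   ultimately show "b \<in> F ` norm_one" by blast
  qed
 qed
 from bij_betw_same_card[OF this] show ?thesis by simp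
qed

lemma card_quadratic_roots:
 assumes "\<not> int p dvd \<alpha>"
 shows "card {x \<in> {0..<int (p ^ l)}. int p dvd \<alpha> * x\<^sup>2 + \<beta> * x + \<gamma>} \<le> 2 * p ^ (l - 1)" (is "card ?R \<le> _")
proof (cases "?R = {}")
 case True
 thus ?thesis by (simp only: card.empty)
next
 case False
 then obtain x0 where x0: "int p dvd \<alpha> * x0\<^sup>2 + \<beta> * x0 + \<gamma>" by blast
 obtain i where i: "int p dvd i * \<alpha> - 1" using prime_power_inverse[OF prime_p assms, of 1] by auto
 define x1 where "x1 = - x0 - i * \<beta>"
 define C where "C r = {x \<in> {0..<int (p ^ l)}. int p dvd x - r}" for r
 have p: "p > 0" using prime_p by (simp add: prime_gt_0_nat)
 have "?R \<subseteq> C x0 \<union> C x1"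
 proof
  fix x assume x: "x \<in> ?R"
  hence "int p dvd (\<alpha> * x\<^sup>2 + \<beta> * x + \<gamma>) - (\<alpha> * x0\<^sup>2 + \<beta> * x0 + \<gamma>)" using x0 by (intro dvd_diff) auto
  moreover have "(\<alpha> * x\<^sup>2 + \<beta> * x + \<gamma>) - (\<alpha> * x0\<^sup>2 + \<beta> * x0 + \<gamma>) = (x - x0) * (\<alpha> * (x + x0) + \<beta>)"
   by (simp add: algebra_simps power2_eq_square)
  ultimately have "int p dvd x - x0 \<or> int p dvd \<alpha> * (x + x0) + \<beta>"
   using prime_p by (simp add: prime_dvd_mult_iff)
  moreover have "int p dvd x - x1" if "int p dvd \<alpha> * (x + x0) + \<beta>"
  proof -
   have "x - x1 = i * (\<alpha> * (x + x0) + \<beta>) - (i * \<alpha> - 1) * (x + x0)"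
    by (simp add: x1_def algebra_simps)
   thus ?thesis using dvd_diff[OF dvd_mult[OF that] dvd_mult2[OF i]] by (simp only:)
  qed
  ultimately show "x \<in> C x0 \<union> C x1" using x by (auto simp: C_def)
 qed
 moreover have "finite (C r)" for r
  by (rule finite_subset[of _ "{0..<int (p ^ l)}"]) (auto simp: C_def)
 ultimately have "card ?R \<le> card (C x0 \<union> C x1)" by (intro card_mono finite_UnI)
 also have "\<dots> \<le> card (C x0) + card (C x1)" by (rule card_Un_le)
 also have "\<dots> = 2 * p ^ (l - 1)" unfolding C_def card_residue_class[OF p l_pos] by simp
 finally show ?thesis .
qed

text \<open>Count along the lines parallel to \<open>n\<close>. On such a line \<open>Q\<close> is a
  quadratic polynomial whose leading coefficient is the unit \<open>Q(n)\<close>, so at most two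
  residue classes modulo \<open>p\<close> are bad; averaging over the shifts gives the
  bound.\<close>

lemma card_bad:
 assumes "good n"
 shows "card {a \<in> grid (p ^ l). \<not> good a} \<le> 2 * p ^ (l - 1) * p ^ l"
proof -
 define g :: "int ^ 2 \<Rightarrow> nat" where "g a = (if good a then 0 else 1)" for a
 have g: "g a = g b" if "vc (int (p ^ l)) a b" for a b
  using good_vc[of a b] good_vc[of b a] that vc_sym[of P a b] by (auto simp: g_def P_def)
 have "p ^ l * card {a \<in> grid (p ^ l). \<not> good a} = (\<Sum>x\<in>{0..<int (p ^ l)}. \<Sum>a\<in>grid (p ^ l). g (a + x *s n))"
 proof -
  have "(\<Sum>a\<in>grid (p ^ l). g (a + x *s n)) = card {a \<in> grid (p ^ l). \<not> good a}" for x
   using sum_grid_shift[of "p ^ l" g "x *s n", OF pl_pos g] by (simp add: g_def sum.If_cases Int_def)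
  thus ?thesis by (simp add: nat_power_eq)
 qed
 also have "\<dots> = (\<Sum>a\<in>grid (p ^ l). \<Sum>x\<in>{0..<int (p ^ l)}. g (a + x *s n))"
  by (rule sum.swap)
 also have "\<dots> \<le> (\<Sum>a\<in>grid (p ^ l). 2 * p ^ (l - 1))"
 proof (rule sum_mono)
  fix a
  have "(\<Sum>x\<in>{0..<int (p ^ l)}. g (a + x *s n)) = card {x \<in> {0..<int (p ^ l)}. \<not> good (a + x *s n)}"
   by (simp add: g_def sum.If_cases Int_def)
  also have "{x \<in> {0..<int (p ^ l)}. \<not> good (a + x *s n)}
    = {x \<in> {0..<int (p ^ l)}. int p dvd Q_form A n * x\<^sup>2 + symp (dl A a) n * x + Q_form A a}"
   by (simp add: good_def Q_form_add Q_form_smult symp_smult algebra_simps)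
  also have "card \<dots> \<le> 2 * p ^ (l - 1)"
   using assms by (intro card_quadratic_roots) (simp add: good_def)
  finally show "(\<Sum>x\<in>{0..<int (p ^ l)}. g (a + x *s n)) \<le> 2 * p ^ (l - 1)" .
 qed
 also have "\<dots> = p ^ l * (2 * p ^ (l - 1) * p ^ l)"
  by (simp add: card_grid power2_eq_square)
 finally show ?thesis using pl_pos by (simp only: nat_mult_le_cancel1)
qed

text \<open>The good points are partitioned into the conics of the \<open>p^l - p^(l-1)\<close> unit
  levels, all of the same size. With \<open>card_bad\<close> this yields the size up to a factor
  \<open>1 + O(1/p)\<close>.\<close>

lemma card_norm_one:
 assumes "good n"
 shows "card norm_one * (p ^ l - p ^ (l - 1)) + card {a \<in> grid (p ^ l). \<not> good a} = (p ^ l)\<^sup>2"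
proof -
 define T where "T = {t \<in> {0..<int (p ^ l)}. \<not> int p dvd t}"
 have p: "p > 0" using prime_p by (simp add: prime_gt_0_nat)
 have T: "T = {0..<int (p ^ l)} - {t \<in> {0..<int (p ^ l)}. int p dvd t - 0}" by (auto simp: T_def)
 have cT: "card T = p ^ l - p ^ (l - 1)"
 proof -
  have "finite {t \<in> {0..<int (p ^ l)}. int p dvd t - 0}"
   by (rule finite_subset[of _ "{0..<int (p ^ l)}"]) auto
  hence "card T = card {0..<int (p ^ l)} - card {t \<in> {0..<int (p ^ l)}. int p dvd t - 0}"
   unfolding T by (rule card_Diff_subset) auto
  thus ?thesis unfolding card_residue_class[OF p l_pos] by (simp add: nat_power_eq)
 qed
 have finT: "finite T"
  by (rule finite_subset[of _ "{0..<int (p ^ l)}"]) (auto simp: T_def)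
 have "{a \<in> grid (p ^ l). good a} = (\<Union>t\<in>T. conic t)"
 proof (intro equalityI subsetI)
  fix a assume a: "a \<in> {a \<in> grid (p ^ l). good a}"
  define t where "t = Q_form A a mod P"
  have "P dvd Q_form A a - t" by (simp add: t_def mod_eq_dvd_iff[symmetric])
  moreover have "\<not> int p dvd t"
  proof
   assume "int p dvd t"
   hence "int p dvd Q_form A a" using p_dvd_P by (simp add: t_def dvd_mod_iff)
   thus False using a by (simp add: good_def)
  qed
  moreover have "t \<in> {0..<int (p ^ l)}" using P_pos by (simp add: t_def P_def)
  ultimately show "a \<in> (\<Union>t\<in>T. conic t)" using a by (auto simp: T_def conic_def)
 next
  fix a assume "a \<in> (\<Union>t\<in>T. conic t)"
  thus "a \<in> {a \<in> grid (p ^ l). good a}" by (auto simp: T_def conic_def intro: good_of_level)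
 qed
 moreover have "card (\<Union>t\<in>T. conic t) = (\<Sum>t\<in>T. card (conic t))"
 proof (rule card_UN_disjoint)
  show "\<forall>t\<in>T. \<forall>t'\<in>T. t \<noteq> t' \<longrightarrow> conic t \<inter> conic t' = {}"
  proof (intro ballI impI)
   fix t t' assume t: "t \<in> T" "t' \<in> T" "t \<noteq> t'"
   show "conic t \<inter> conic t' = {}"
   proof (rule ccontr)
    assume "conic t \<inter> conic t' \<noteq> {}"
    then obtain a where "P dvd Q_form A a - t" "P dvd Q_form A a - t'" by (auto simp: conic_def)
    hence "P dvd t - t'" using dvd_diff[of P "Q_form A a - t'" "Q_form A a - t"] by simp
    hence "t mod P = t' mod P" by (simp add: mod_eq_dvd_iff)
    thus False using t by (simp add: T_def P_def)
   qed
  qed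
 qed (auto simp: finT)
 moreover have "(\<Sum>t\<in>T. card (conic t)) = card norm_one * (p ^ l - p ^ (l - 1))"
 proof -
  have "(\<Sum>t\<in>T. card (conic t)) = (\<Sum>t\<in>T. card norm_one)"
   by (rule sum.cong) (auto simp: T_def card_conic[OF assms])
  thus ?thesis by (simp add: cT)
 qed
 ultimately have "card {a \<in> grid (p ^ l). good a} = card norm_one * (p ^ l - p ^ (l - 1))" by simp
 moreover have "card {a \<in> grid (p ^ l). good a} + card {a \<in> grid (p ^ l). \<not> good a} = card (grid (p ^ l))"
  by (subst card_Un_disjoint[symmetric]) (auto intro!: arg_cong[where f = card])
 ultimately show ?thesis by (simp add: card_grid)
qed

end

section \<open>Eigenvalues of products of Hecke elements and the resulting spectral data\<close>

context cat_map
begin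

lemma hecke_conj: "hecke c d \<Longrightarrow> hecke c (- d)"
 by (simp add: hecke_def nrm_def)

definition ev :: "(int \<Rightarrow> complex) \<Rightarrow> int \<Rightarrow> int \<Rightarrow> complex" where
 "ev \<psi> c d = ip N (UM c d \<psi>) \<psi>"

lemma ev_eq:
 assumes "hecke_fun \<psi>" "hecke c d"
 shows "UM c d \<psi> = scl (ev \<psi> c d) \<psi>" "ev \<psi> c d * cnj (ev \<psi> c d) = 1"
proof -
 obtain a where a: "UM c d \<psi> = scl a \<psi>" using assms unfolding hecke_fun_def by blast
 have \<psi>: "\<psi> \<in> H_N N" "ip N \<psi> \<psi> = 1" using assms(1) by (simp_all add: hecke_fun_def)
 have "ev \<psi> c d = a" by (simp add: ev_def a \<psi>(2))
 thus "UM c d \<psi> = scl (ev \<psi> c d) \<psi>" by (simp add: a)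
 show "ev \<psi> c d * cnj (ev \<psi> c d) = 1"
  using UM_ip[OF assms(2) \<psi>(1) \<psi>(1)] \<psi>(2) \<open>ev \<psi> c d = a\<close> by (simp add: a mult.commute)
qed

lemma ev_unique: "hecke_fun \<psi> \<Longrightarrow> UM c d \<psi> = scl a \<psi> \<Longrightarrow> ev \<psi> c d = a"
 by (simp add: ev_def hecke_fun_def)

lemma ev_comp:
 assumes "hecke_fun \<psi>" "hecke c d" "hecke c' d'"
 shows "ev \<psi> (c * c' + disc A * d * d') (c * d' + c' * d) = ev \<psi> c d * ev \<psi> c' d'"
proof (rule ev_unique[OF assms(1)])
 have \<psi>: "\<psi> \<in> H_N N" using assms(1) by (simp add: hecke_fun_def)
 have "UM (c * c' + disc A * d * d') (c * d' + c' * d) \<psi> = UM c d (UM c' d' \<psi>)"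
  by (simp add: UM_comp[OF assms(2,3) \<psi>])
 also have "\<dots> = scl (ev \<psi> c d * ev \<psi> c' d') \<psi>"
  using ev_eq(1)[OF assms(1,2)] ev_eq(1)[OF assms(1,3)] UM_scl[OF assms(2) \<psi>] by (simp add: mult.commute)
 finally show "UM (c * c' + disc A * d * d') (c * d' + c' * d) \<psi> = scl (ev \<psi> c d * ev \<psi> c' d') \<psi>" .
qed

lemma hecke_one: "hecke 1 0"
 by (simp add: hecke_def nrm_def)

lemma ev_one: "hecke_fun \<psi> \<Longrightarrow> ev \<psi> 1 0 = 1"
 using ev_comp[of \<psi> 1 0 1 0] ev_eq(2)[of \<psi> 1 0] hecke_one by auto

text \<open>The pairs \<open>c\<close>, \<open>d\<close> and \<open>c\<close>, \<open>-d\<close> are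
  inverse modulo \<open>N\<close>, and eigenvalues have absolute value 1.\<close>

lemma ev_conj: "hecke_fun \<psi> \<Longrightarrow> hecke c d \<Longrightarrow> ev \<psi> c (- d) = cnj (ev \<psi> c d)"
proof -
 assume \<psi>: "hecke_fun \<psi>" and cd: "hecke c d"
 have "\<psi> \<in> H_N N" using \<psi> by (simp add: hecke_fun_def)
 define x where "x = c * c - disc A * d * d"
 have "hecke x 0"
  using hecke_mult[OF cd hecke_conj[OF cd]] by (simp add: x_def)
 have x1: "int N dvd x - 1" using cd by (simp add: hecke_def nrm_def x_def power2_eq_square mult.assoc)
 have "mat_cong N (hecke_mat A x 0) (hecke_mat A 1 0)"
  using x1 by (simp add: mat_cong_def hecke_mat_def mat_def matrix_matrix_mult_def cong_iff_dvd_diff forall_2 sum_2)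
 hence "UM x 0 \<psi> = UM 1 0 \<psi>"
  using propagator[folded N_def] hecke_SL2[OF \<open>hecke x 0\<close>] hecke_SL2[OF hecke_one] \<open>\<psi> \<in> H_N N\<close>
  unfolding quantum_propagator_def UM_def by blast
 hence "ev \<psi> c d * ev \<psi> c (- d) = 1"
  using ev_comp[OF \<psi> cd hecke_conj[OF cd]] ev_one[OF \<psi>] by (simp add: ev_def x_def)
 hence "cnj (ev \<psi> c d) = (ev \<psi> c d * cnj (ev \<psi> c d)) * ev \<psi> c (- d)"
  by (simp add: mult_ac)
 thus ?thesis using ev_eq(2)[OF \<psi> cd] by simp
qed

text \<open>A complex square root \<open>\<delta>\<close> of the discriminant lets products of Hecke
  elements be written as complex numbers, the form used in \<open>relation_poly\<close>, while the
  eigenvalues multiply along.\<close>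

lemma hecke_monoid_power:
 fixes \<delta> :: complex
 assumes \<delta>: "\<delta>\<^sup>2 = of_int (disc A)" and cd: "hecke c d"
 shows "\<exists>x y. hecke x y \<and> (of_int c + of_int d * \<delta>) ^ k = of_int x + of_int y * \<delta> \<and>
  (\<forall>\<psi>. hecke_fun \<psi> \<longrightarrow> ev \<psi> x y = ev \<psi> c d ^ k)"
proof (induction k)
 case 0
 show ?case by (intro exI[of _ 1] exI[of _ 0]) (simp add: hecke_one ev_one)
next
 case (Suc k)
 then obtain x y where xy: "hecke x y" "(of_int c + of_int d * \<delta>) ^ k = of_int x + of_int y * \<delta>"
  "\<And>\<psi>. hecke_fun \<psi> \<Longrightarrow> ev \<psi> x y = ev \<psi> c d ^ k" by blast
 have "(of_int c + of_int d * \<delta>) * (of_int x + of_int y * \<delta>)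
   = of_int (c * x + disc A * d * y) + of_int (c * y + x * d) * \<delta>"
  using \<delta> by (simp add: algebra_simps power2_eq_square)
 thus ?case
  using hecke_mult[OF cd xy(1)] ev_comp[OF _ cd xy(1)] xy(2,3) by (intro exI conjI) auto
qed

lemma hecke_monoid_prod:
 fixes \<delta> :: complex
 assumes \<delta>: "\<delta>\<^sup>2 = of_int (disc A)" and "finite R" and cd: "\<And>\<nu>. \<nu> \<in> R \<Longrightarrow> hecke (c \<nu>) (d \<nu>)"
 shows "\<exists>x y. hecke x y \<and>
  (\<Prod>\<nu>\<in>R. (of_int (c \<nu>) + of_int (d \<nu>) * \<delta>) ^ a \<nu> * (of_int (c \<nu>) - of_int (d \<nu>) * \<delta>) ^ b \<nu>) = of_int x + of_int y * \<delta> \<and>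
  (\<forall>\<psi>. hecke_fun \<psi> \<longrightarrow> ev \<psi> x y = (\<Prod>\<nu>\<in>R. ev \<psi> (c \<nu>) (d \<nu>) ^ a \<nu> * cnj (ev \<psi> (c \<nu>) (d \<nu>)) ^ b \<nu>))"
 using assms(2) cd
proof (induction R rule: finite_induct)
 case empty
 show ?case by (intro exI[of _ 1] exI[of _ 0]) (simp add: hecke_one ev_one)
next
 case (insert \<nu> R)
 have mult: "(of_int x + of_int y * \<delta>) * (of_int x' + of_int y' * \<delta>)
   = of_int (x * x' + disc A * y * y') + of_int (x * y' + x' * y) * \<delta>" for x y x' y'
  using \<delta> by (simp add: algebra_simps power2_eq_square)
 obtain x y where xy: "hecke x y"
  "(\<Prod>\<nu>\<in>R. (of_int (c \<nu>) + of_int (d \<nu>) * \<delta>) ^ a \<nu> * (of_int (c \<nu>) - of_int (d \<nu>) * \<delta>) ^ b \<nu>) = of_int x + of_int y * \<delta>"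
  "\<And>\<psi>. hecke_fun \<psi> \<Longrightarrow> ev \<psi> x y = (\<Prod>\<nu>\<in>R. ev \<psi> (c \<nu>) (d \<nu>) ^ a \<nu> * cnj (ev \<psi> (c \<nu>) (d \<nu>)) ^ b \<nu>)"
  using insert.IH insert.prems by auto
 have hk: "hecke (c \<nu>) (d \<nu>)" "hecke (c \<nu>) (- d \<nu>)" using insert.prems hecke_conj by auto
 obtain x1 y1 where 1: "hecke x1 y1" "(of_int (c \<nu>) + of_int (d \<nu>) * \<delta>) ^ a \<nu> = of_int x1 + of_int y1 * \<delta>"
  "\<And>\<psi>. hecke_fun \<psi> \<Longrightarrow> ev \<psi> x1 y1 = ev \<psi> (c \<nu>) (d \<nu>) ^ a \<nu>"
  using hecke_monoid_power[OF \<delta> hk(1)] by blast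
 obtain x2 y2 where 2: "hecke x2 y2" "(of_int (c \<nu>) - of_int (d \<nu>) * \<delta>) ^ b \<nu> = of_int x2 + of_int y2 * \<delta>"
  "\<And>\<psi>. hecke_fun \<psi> \<Longrightarrow> ev \<psi> x2 y2 = cnj (ev \<psi> (c \<nu>) (d \<nu>)) ^ b \<nu>"
  using hecke_monoid_power[OF \<delta> hk(2), of "b \<nu>"] ev_conj[OF _ hk(1)] by auto
 note h12 = hecke_mult[OF 1(1) 2(1)]
 have "(\<Prod>\<nu>\<in>insert \<nu> R. (of_int (c \<nu>) + of_int (d \<nu>) * \<delta>) ^ a \<nu> * (of_int (c \<nu>) - of_int (d \<nu>) * \<delta>) ^ b \<nu>)
   = (of_int x1 + of_int y1 * \<delta>) * (of_int x2 + of_int y2 * \<delta>) * (of_int x + of_int y * \<delta>)"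
  using insert.hyps by (simp add: 1(2) 2(2) xy(2))
 note prod = this[unfolded mult]
 show ?case
  by (rule exI, rule exI, rule conjI[OF hecke_mult[OF h12 xy(1)]], rule conjI[OF prod])
   (use insert.hyps in \<open>simp add: ev_comp[OF _ h12 xy(1)] ev_comp[OF _ 1(1) 2(1)] 1(3) 2(3) xy(3)\<close>)
qed

lemma Legendre_disc:
 assumes "\<not> int p dvd \<nu> * (\<nu> - 4 * t)"
 shows "Legendre (disc A * \<nu> * (\<nu> - 4 * t)) (int p) = 1 \<longleftrightarrow> (\<exists>s. int p dvd disc A * s\<^sup>2 - \<nu> * (\<nu> - 4 * t))"
proof -
 have n0: "\<not> int p dvd disc A * \<nu> * (\<nu> - 4 * t)"
  using assms disc_unit prime_p by (simp add: prime_dvd_mult_iff)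
 have "Legendre (disc A * \<nu> * (\<nu> - 4 * t)) (int p) = 1 \<longleftrightarrow> (\<exists>y. int p dvd y\<^sup>2 - disc A * \<nu> * (\<nu> - 4 * t))"
  using n0 by (simp add: Legendre_def QuadRes_def cong_0_iff cong_iff_dvd_diff)
 also have "\<dots> \<longleftrightarrow> (\<exists>s. int p dvd disc A * s\<^sup>2 - \<nu> * (\<nu> - 4 * t))"
 proof
  assume "\<exists>s. int p dvd disc A * s\<^sup>2 - \<nu> * (\<nu> - 4 * t)"
  then obtain s where "int p dvd disc A * s\<^sup>2 - \<nu> * (\<nu> - 4 * t)" ..
  hence "int p dvd disc A * (disc A * s\<^sup>2 - \<nu> * (\<nu> - 4 * t))" by (rule dvd_mult)
  hence "int p dvd (disc A * s)\<^sup>2 - disc A * \<nu> * (\<nu> - 4 * t)"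
   by (simp add: algebra_simps power2_eq_square)
  thus "\<exists>y. int p dvd y\<^sup>2 - disc A * \<nu> * (\<nu> - 4 * t)" ..
 next
  assume "\<exists>y. int p dvd y\<^sup>2 - disc A * \<nu> * (\<nu> - 4 * t)"
  then obtain y where y: "int p dvd y\<^sup>2 - disc A * \<nu> * (\<nu> - 4 * t)" ..
  obtain i where i: "int p dvd i * disc A - 1"
   using prime_power_inverse[OF prime_p disc_unit, of 1] by auto
  have "disc A * (i * y)\<^sup>2 - \<nu> * (\<nu> - 4 * t)
    = (i * disc A - 1) * (i * y\<^sup>2 + \<nu> * (\<nu> - 4 * t)) + i * (y\<^sup>2 - disc A * \<nu> * (\<nu> - 4 * t))"
   by (simp add: algebra_simps power2_eq_square)
  moreover have "int p dvd (i * disc A - 1) * (i * y\<^sup>2 + \<nu> * (\<nu> - 4 * t)) + i * (y\<^sup>2 - disc A * \<nu> * (\<nu> - 4 * t))"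
   by (rule dvd_add[OF dvd_mult2[OF i] dvd_mult[OF y]])
  ultimately show "\<exists>s. int p dvd disc A * s\<^sup>2 - \<nu> * (\<nu> - 4 * t)" by metis
 qed
 finally show ?thesis .
qed

text \<open>Types live modulo \<open>P'\<close>, but the Legendre symbols and the relation
  polynomials see them only modulo \<open>p\<close>. Eigenfunctions are therefore collected by
  \<open>\<tau>\<close>, the type modulo \<open>p\<close>, whereas the Hecke elements and phases
  behind \<open>w\<close> are chosen for each full type. \<open>G\<close> omits the functions
  without a type and those with a type in the residues excluded by \<open>T\<close>.\<close>

theorem spectral_data:
 fixes \<psi> :: "nat \<Rightarrow> int \<Rightarrow> complex" and S :: "int set" and n :: "int \<Rightarrow> int ^ 2"
 assumes onb: "orthonormal_basis_H N \<psi>" and hk: "\<And>j. j \<in> {1..N} \<Longrightarrow> hecke_fun (\<psi> j)"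
  and S: "finite S" "S \<noteq> {}" "\<And>\<nu>. \<nu> \<in> S \<Longrightarrow> Q_form A (n \<nu>) = \<nu> \<and> \<not> int p dvd \<nu>"
  and disc: "\<forall>z. z\<^sup>2 \<noteq> disc A"
  and T_def: "T = {t \<in> {0..<int p}. \<not> int p dvd t \<and> (\<forall>\<nu>\<in>S. \<not> int p dvd \<nu> - 4 * t)}"
  and L_def: "L = (\<lambda>\<nu> t. Legendre (disc A * \<nu> * (\<nu> - 4 * t)) (int p))"
 obtains G \<tau> w where "G \<subseteq> {1..N}" "\<And>j. j \<in> G \<Longrightarrow> \<tau> j \<in> T"
  "\<And>t. t \<in> T \<Longrightarrow> card {j \<in> G. \<tau> j = t} = p ^ (l + e - 1) * card norm_one"
  "\<And>\<nu> j. \<nu> \<in> S \<Longrightarrow> j \<in> G \<Longrightarrow> L \<nu> (\<tau> j) \<noteq> 1 \<Longrightarrow> ip N (twisted_T N (n \<nu>) (\<psi> j)) (\<psi> j) = 0"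
  "\<And>\<nu> j. \<nu> \<in> S \<Longrightarrow> j \<in> G \<Longrightarrow> L \<nu> (\<tau> j) = 1 \<Longrightarrow> norm (w \<nu> j) = 1 \<and>
    ip N (twisted_T N (n \<nu>) (\<psi> j)) (\<psi> j) = of_real (2 / (card norm_one * sqrt (real (p ^ e))) * Re (w \<nu> j))"
  "\<And>R a b Pl t. R \<subseteq> S \<Longrightarrow> relation_poly R a b Pl \<Longrightarrow> t \<in> T \<Longrightarrow> (\<And>\<nu>. \<nu> \<in> R \<Longrightarrow> L \<nu> t = 1) \<Longrightarrow>
    \<not> int p dvd poly Pl t \<Longrightarrow> (\<Sum>j | j \<in> G \<and> \<tau> j = t. \<Prod>\<nu>\<in>R. w \<nu> j ^ a \<nu> * cnj (w \<nu> j) ^ b \<nu>) = 0"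
proof -
 define B where "B t = {j \<in> {1..N}. has_type (\<psi> j) t}" for t
 define TT where "TT = {t \<in> {0..<P'}. t mod int p \<in> T}"
 have p0: "int p > 0" using prime_p by (simp add: prime_gt_0_nat)
 have modp: "int p dvd t mod int p - t" for t by (simp flip: mod_eq_dvd_iff)
 have T_unit: "\<not> int p dvd t" "\<nu> \<in> S \<Longrightarrow> \<not> int p dvd \<nu> - 4 * t" if "t mod int p \<in> T" for t \<nu>
 proof -
  show "\<not> int p dvd t" using that by (simp add: T_def dvd_mod_iff)
  assume "\<nu> \<in> S"
  have "int p dvd (\<nu> - 4 * (t mod int p)) - (\<nu> - 4 * t)"
   using dvd_mult[OF modp[of t], of "- 4"] by (simp add: algebra_simps)
  thus "\<not> int p dvd \<nu> - 4 * t"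
   using that \<open>\<nu> \<in> S\<close> dvd_add[of "int p" "(\<nu> - 4 * (t mod int p)) - (\<nu> - 4 * t)" "\<nu> - 4 * t"] by (auto simp: T_def)
 qed
 have L_mod: "L \<nu> (t mod int p) = L \<nu> t" for \<nu> t
  unfolding L_def
 proof (rule Legendre_cong)
  have "int p dvd disc A * \<nu> * (- 4) * (t mod int p - t)" by (rule dvd_mult[OF modp])
  thus "[disc A * \<nu> * (\<nu> - 4 * (t mod int p)) = disc A * \<nu> * (\<nu> - 4 * t)] (mod int p)"
   by (simp add: cong_iff_dvd_diff algebra_simps)
 qed
 obtain \<nu>0 where "\<nu>0 \<in> S" using S(2) by blast
 hence good0: "good (n \<nu>0)" using S(3) by (simp add: good_def)
 have B_disj: "t = t'" if "t \<in> TT" "t' \<in> TT" "j \<in> B t" "j \<in> B t'" for t t' j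
 proof -
  have "P' dvd t - t'" using that(3,4) has_type_unique unfolding B_def by blast
  hence "t mod P' = t' mod P'" by (simp add: mod_eq_dvd_iff)
  thus ?thesis using that(1,2) by (simp add: TT_def)
 qed
 define G where "G = (\<Union>t\<in>TT. B t)"
 define ty where "ty j = (THE t. t \<in> TT \<and> j \<in> B t)" for j
 have ty: "ty j = t" if "t \<in> TT" "j \<in> B t" for t j
  unfolding ty_def by (rule the_equality) (use that B_disj in blast)+
 have ty_G: "ty j \<in> TT" "j \<in> B (ty j)" if "j \<in> G" for j
  using that ty by (auto simp: G_def)
 define \<tau> where "\<tau> j = ty j mod int p" for j
 have fibre: "{j. j \<in> G \<and> \<tau> j = t} = (\<Union>u\<in>{u \<in> {0..<P'}. u mod int p = t}. B u)" if t: "t \<in> T" for t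
 proof (intro equalityI subsetI)
  fix j assume "j \<in> {j. j \<in> G \<and> \<tau> j = t}"
  thus "j \<in> (\<Union>u\<in>{u \<in> {0..<P'}. u mod int p = t}. B u)"
   using ty_G[of j] by (auto simp: \<tau>_def TT_def)
 next
  fix j assume "j \<in> (\<Union>u\<in>{u \<in> {0..<P'}. u mod int p = t}. B u)"
  then obtain u where u: "u \<in> {0..<P'}" "u mod int p = t" "j \<in> B u" by blast
  hence "u \<in> TT" using t by (simp add: TT_def)
  thus "j \<in> {j. j \<in> G \<and> \<tau> j = t}" using u ty[OF _ u(3)] by (auto simp: G_def \<tau>_def)
 qed
 define U where "U t = {u \<in> {0..<P'}. u mod int p = t}" for t
 have finU: "finite (U t)" for t unfolding U_def by (rule finite_subset[of _ "{0..<P'}"]) auto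
 have U_TT: "U t \<subseteq> TT" if "t \<in> T" for t using that by (auto simp: U_def TT_def)
 have finB: "finite (B t)" for t by (simp add: B_def)
 have cardU: "card (U t) = p ^ (l + e - 1)" if t: "t \<in> T" for t
 proof -
  have "t \<in> {0..<int p}" using t by (simp add: T_def)
  hence "U t = {x \<in> {0..<int (p ^ (l + e))}. int p dvd x - t}"
   by (auto simp: U_def P'_def mod_eq_dvd_iff[symmetric])
  thus ?thesis using card_residue_class[of p "l + e" t] p0 l_pos by simp
 qed
 have cardB: "card (B u) = card norm_one" if "u \<in> TT" for u
  using card_type[OF onb hk, of u] card_conic[OF good0, of u] T_unit(1)[of u] that
  by (simp add: B_def TT_def)
 have sum_fibre: "(\<Sum>j | j \<in> G \<and> \<tau> j = t. f j) = (\<Sum>u\<in>U t. \<Sum>j\<in>B u. f j)" if t: "t \<in> T" for t and f :: "nat \<Rightarrow> complex"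
  unfolding fibre[OF t] U_def[symmetric]
  by (rule sum.UNION_disjoint) (use finU finB U_TT[OF t] B_disj in blast)+
 have card_fibre: "card {j \<in> G. \<tau> j = t} = p ^ (l + e - 1) * card norm_one" if t: "t \<in> T" for t
 proof -
  have "card {j \<in> G. \<tau> j = t} = (\<Sum>u\<in>U t. card (B u))"
   unfolding fibre[OF t] U_def[symmetric]
   by (rule card_UN_disjoint) (use finU finB U_TT[OF t] B_disj in blast)+
  also have "\<dots> = (\<Sum>u\<in>U t. card norm_one)"
   by (rule sum.cong) (use U_TT[OF t] cardB in auto)
  finally show ?thesis by (simp add: cardU[OF t])
 qed
 define ok where "ok \<nu> u c d s Z \<longleftrightarrow> hecke c d \<and> norm Z = 1 \<and> int p dvd disc A * s\<^sup>2 - \<nu> * (\<nu> - 4 * u) \<and>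
  int p dvd c * \<nu> + disc A * d * s + \<nu> \<and> int p dvd c * s + d * \<nu> - s \<and>
  (\<forall>\<phi> \<kappa>. has_type \<phi> u \<longrightarrow> UM c d \<phi> = scl \<kappa> \<phi> \<longrightarrow>
    ip N (twisted_T N (n \<nu>) \<phi>) \<phi> = of_real (2 / (card (conic u) * sqrt (real_of_int E)) * Re (Z * cnj \<kappa>)))"
  for \<nu> u c d s and Z :: complex
 have ex_ok: "\<exists>c d s Z. ok \<nu> u c d s Z" if h: "\<nu> \<in> S" "u \<in> TT" "L \<nu> u = 1" for \<nu> u
 proof -
  note un = T_unit[of u] and TTu = h(2)[unfolded TT_def, simplified]
  have nd: "\<not> int p dvd \<nu> * (\<nu> - 4 * u)"
   using S(3)[OF h(1)] un(2)[OF _ h(1)] TTu prime_p by (simp add: prime_dvd_mult_iff)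
  obtain s0 where s0: "int p dvd disc A * s0\<^sup>2 - \<nu> * (\<nu> - 4 * u)"
   using h(3) Legendre_disc[OF nd] unfolding L_def by blast
  have p1: "\<not> int p dvd u" "\<not> int p dvd \<nu> - 4 * u" using un(1) un(2)[OF _ h(1)] TTu by blast+
  have p2: "\<nu> = Q_form A (n \<nu>)" "\<not> int p dvd \<nu>" using S(3)[OF h(1)] by auto
  show ?thesis
  proof (rule matrix_element[OF p1(1) p2 p1(2) s0])
   fix c d s and Z :: complex
   assume a: "hecke c d" "norm Z = 1" "int p dvd disc A * s\<^sup>2 - \<nu> * (\<nu> - 4 * u)"
    "int p dvd c * \<nu> + disc A * d * s + \<nu>" "int p dvd c * s + d * \<nu> - s"
    "\<And>\<phi> \<kappa>. has_type \<phi> u \<Longrightarrow> UM c d \<phi> = scl \<kappa> \<phi> \<Longrightarrow>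
     ip N (twisted_T N (n \<nu>) \<phi>) \<phi> = of_real (2 / (card (conic u) * sqrt (real_of_int E)) * Re (Z * cnj \<kappa>))"
   have "ok \<nu> u c d s Z" unfolding ok_def using a by blast
   thus ?thesis by blast
  qed
 qed
 define cc where "cc \<nu> u = (SOME (c, d, s, Z). ok \<nu> u c d s Z)" for \<nu> u
 define c where "c \<nu> u = fst (cc \<nu> u)" for \<nu> u
 define d where "d \<nu> u = fst (snd (cc \<nu> u))" for \<nu> u
 define s where "s \<nu> u = fst (snd (snd (cc \<nu> u)))" for \<nu> u
 define Z where "Z \<nu> u = snd (snd (snd (cc \<nu> u)))" for \<nu> u
 have ok: "ok \<nu> u (c \<nu> u) (d \<nu> u) (s \<nu> u) (Z \<nu> u)" if h: "\<nu> \<in> S" "u \<in> TT" "L \<nu> u = 1" for \<nu> u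
 proof -
  obtain c' d' s' Z' where "ok \<nu> u c' d' s' Z'" using ex_ok[OF h] by blast
  hence "case (c', d', s', Z') of (c, d, s, Z) \<Rightarrow> ok \<nu> u c d s Z" by simp
  hence "case cc \<nu> u of (c, d, s, Z) \<Rightarrow> ok \<nu> u c d s Z" unfolding cc_def by (rule someI)
  thus ?thesis by (simp add: c_def d_def s_def Z_def case_prod_unfold)
 qed
 define w where "w \<nu> j = Z \<nu> (ty j) * cnj (ev (\<psi> j) (c \<nu> (ty j)) (d \<nu> (ty j)))" for \<nu> j
 show ?thesis
 proof (rule that[of G \<tau> w])
  show "G \<subseteq> {1..N}" by (auto simp: G_def B_def)
  show "\<tau> j \<in> T" if "j \<in> G" for j using ty_G(1)[OF that] by (simp add: TT_def \<tau>_def)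
  show "card {j \<in> G. \<tau> j = t} = p ^ (l + e - 1) * card norm_one" if "t \<in> T" for t
   by (rule card_fibre[OF that])
  show "ip N (twisted_T N (n \<nu>) (\<psi> j)) (\<psi> j) = 0" if "\<nu> \<in> S" "j \<in> G" "L \<nu> (\<tau> j) \<noteq> 1" for \<nu> j
  proof -
   define u where "u = ty j"
   have u: "u \<in> TT" "j \<in> B u" using ty_G[OF that(2)] by (simp_all add: u_def)
   have un: "\<not> int p dvd u" "\<not> int p dvd \<nu> - 4 * u"
    using T_unit[of u] u(1) that(1) by (auto simp: TT_def)
   have nd: "\<not> int p dvd \<nu> * (\<nu> - 4 * u)"
    using S(3)[OF that(1)] un prime_p by (simp add: prime_dvd_mult_iff)
   have "L \<nu> u \<noteq> 1" using that(3) by (simp add: \<tau>_def u_def L_mod)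
   thus ?thesis
    using matrix_element_zero[of "\<psi> j" u \<nu> "n \<nu>"] u(2) un(1) S(3)[OF that(1)] Legendre_disc[OF nd]
    by (simp add: B_def L_def)
  qed
  show "norm (w \<nu> j) = 1 \<and> ip N (twisted_T N (n \<nu>) (\<psi> j)) (\<psi> j)
    = of_real (2 / (card norm_one * sqrt (real (p ^ e))) * Re (w \<nu> j))" if "\<nu> \<in> S" "j \<in> G" "L \<nu> (\<tau> j) = 1" for \<nu> j
  proof -
   define u where "u = ty j"
   have u: "u \<in> TT" "j \<in> B u" using ty_G[OF that(2)] by (simp_all add: u_def)
   have "L \<nu> u = 1" using that(3) by (simp add: \<tau>_def u_def L_mod)
   note ok = ok[OF that(1) u(1) this, unfolded ok_def]
   have j: "j \<in> {1..N}" "has_type (\<psi> j) u" using u(2) by (simp_all add: B_def)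
   have hc: "hecke (c \<nu> u) (d \<nu> u)" using ok by blast
   note e = ev_eq[OF hk[OF j(1)] hc]
   have "norm (w \<nu> j) = 1" using ok norm_eq_1I[OF e(2)] by (simp add: w_def u_def norm_mult)
   moreover have "ip N (twisted_T N (n \<nu>) (\<psi> j)) (\<psi> j)
     = of_real (2 / (card (conic u) * sqrt (real_of_int E)) * Re (w \<nu> j))"
    using ok j(2) e(1) unfolding w_def u_def by blast
   moreover have "card (conic u) = card norm_one"
    using card_conic[OF good0] T_unit(1)[of u] u(1) by (simp add: TT_def)
   ultimately show ?thesis by (simp add: E_def)
  qed
  show "(\<Sum>j | j \<in> G \<and> \<tau> j = t. \<Prod>\<nu>\<in>R. w \<nu> j ^ a \<nu> * cnj (w \<nu> j) ^ b \<nu>) = 0"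
   if R: "R \<subseteq> S" and rel: "relation_poly R a b Pl" and t: "t \<in> T" and L1: "\<And>\<nu>. \<nu> \<in> R \<Longrightarrow> L \<nu> t = 1"
    and np: "\<not> int p dvd poly Pl t" for R a b Pl t
  proof -
   have "(\<Sum>j\<in>B u. \<Prod>\<nu>\<in>R. w \<nu> j ^ a \<nu> * cnj (w \<nu> j) ^ b \<nu>) = 0" if u: "u \<in> U t" for u
   proof -
    have uTT: "u \<in> TT" using u U_TT[OF t] by blast
    have umod: "u mod int p = t" using u by (simp add: U_def)
    have Lu: "L \<nu> u = 1" if "\<nu> \<in> R" for \<nu> using L1[OF that] L_mod[of \<nu> u] umod by simp
    have okR: "ok \<nu> u (c \<nu> u) (d \<nu> u) (s \<nu> u) (Z \<nu> u)" if "\<nu> \<in> R" for \<nu>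
     using ok[OF _ uTT Lu[OF that]] R that by blast
    have hc: "hecke (c \<nu> u) (d \<nu> u)" if "\<nu> \<in> R" for \<nu> using okR[OF that] by (simp add: ok_def)
    define \<delta> where "\<delta> = csqrt (of_int (disc A))"
    have \<delta>: "\<delta>\<^sup>2 = of_int (disc A)" by (simp add: \<delta>_def)
    have finR: "finite R" using R S(1) finite_subset by blast
    obtain x y where xy: "hecke x y"
     "(\<Prod>\<nu>\<in>R. (of_int (c \<nu> u) + of_int (d \<nu> u) * \<delta>) ^ a \<nu> * (of_int (c \<nu> u) - of_int (d \<nu> u) * \<delta>) ^ b \<nu>) = of_int x + of_int y * \<delta>"
     "\<And>\<phi>. hecke_fun \<phi> \<Longrightarrow> ev \<phi> x y = (\<Prod>\<nu>\<in>R. ev \<phi> (c \<nu> u) (d \<nu> u) ^ a \<nu> * cnj (ev \<phi> (c \<nu> u) (d \<nu> u)) ^ b \<nu>)"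
     using hecke_monoid_prod[OF \<delta> finR, of "\<lambda>\<nu>. c \<nu> u" "\<lambda>\<nu>. d \<nu> u" a b] hc by blast
    \<comment> \<open>Otherwise the product of the Hecke elements would be 1 modulo
      \<open>p\<close>, and the relation polynomial would vanish at \<open>u\<close>, hence at
      \<open>t\<close>.\<close>
    have "\<not> (int p dvd x - 1 \<and> int p dvd y)"
    proof
     assume xy1: "int p dvd x - 1 \<and> int p dvd y"
     have "int p dvd poly Pl u"
      using rel[unfolded relation_poly_def, rule_format, of "disc A" "int p" \<delta> "\<lambda>\<nu>. s \<nu> u" u "\<lambda>\<nu>. c \<nu> u" "\<lambda>\<nu>. d \<nu> u" x y]
       disc p0 \<delta> okR xy(2) xy1 unfolding ok_def by auto
     moreover have "[t = u] (mod int p)" by (simp add: cong_def flip: umod)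
     hence "[poly Pl t = poly Pl u] (mod int p)"
      unfolding poly_altdef by (intro cong_sum cong_mult cong_pow cong_refl)
     ultimately show False using np by (simp add: cong_dvd_iff)
    qed
    hence "(\<Sum>j | j \<in> {1..N} \<and> has_type (\<psi> j) u. ev (\<psi> j) x y) = 0"
     using trace_type_zero[OF onb hk _ xy(1), of u "\<lambda>j. ev (\<psi> j) x y"] ev_eq(1)[OF hk xy(1)]
      T_unit(1)[of u] uTT by (simp add: TT_def)
    hence tr: "(\<Sum>j\<in>B u. ev (\<psi> j) x y) = 0" by (simp only: B_def)
    have "(\<Prod>\<nu>\<in>R. w \<nu> j ^ a \<nu> * cnj (w \<nu> j) ^ b \<nu>)
     = (\<Prod>\<nu>\<in>R. Z \<nu> u ^ a \<nu> * cnj (Z \<nu> u) ^ b \<nu>) * cnj (ev (\<psi> j) x y)" if j: "j \<in> B u" for j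
    proof -
     have "ty j = u" by (rule ty[OF uTT j])
     moreover have "hecke_fun (\<psi> j)" using hk j by (simp add: B_def)
     ultimately show ?thesis
      by (simp add: w_def xy(3) power_mult_distrib prod.distrib mult_ac)
    qed
    hence "(\<Sum>j\<in>B u. \<Prod>\<nu>\<in>R. w \<nu> j ^ a \<nu> * cnj (w \<nu> j) ^ b \<nu>)
     = (\<Prod>\<nu>\<in>R. Z \<nu> u ^ a \<nu> * cnj (Z \<nu> u) ^ b \<nu>) * cnj (\<Sum>j\<in>B u. ev (\<psi> j) x y)"
     by (simp add: sum_distrib_left)
    thus ?thesis by (simp add: tr)
   qed
   thus ?thesis unfolding sum_fibre[OF t] by simp
  qed
 qed
qed

end

section \<open>The order generated by the eigenvalue\<close>

lemma square_ratio:
 fixes x y D :: int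
 assumes "x\<^sup>2 = D * y\<^sup>2" "y \<noteq> 0"
 shows "\<exists>z. z\<^sup>2 = D"
proof -
 have "y\<^sup>2 dvd x\<^sup>2" using assms(1) by simp
 hence "y dvd x" by simp
 then obtain z where "x = y * z" ..
 hence "y\<^sup>2 * z\<^sup>2 = y\<^sup>2 * D" using assms(1) by (simp add: power_mult_distrib)
 thus ?thesis using assms(2) by auto
qed

text \<open>For \<open>|trace A| \<ge> 3\<close> the number \<open>(trace A)^2 - 4\<close> lies
  strictly between the consecutive squares of \<open>|trace A| - 1\<close> and
  \<open>|trace A|\<close>.\<close>

lemma hyperbolic_disc:
 assumes "det A = 1" "hyperbolic A"
 shows "z\<^sup>2 \<noteq> disc A"
proof
 assume z: "z\<^sup>2 = disc A"
 hence eq: "z\<^sup>2 = (trace A)\<^sup>2 - 4" using assms(1) by (simp add: disc_def)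
 hence "z\<^sup>2 < (trace A)\<^sup>2" by simp
 hence "\<bar>z\<bar> < \<bar>trace A\<bar>" by (metis abs_ge_zero power2_abs power_less_imp_less_base)
 hence "\<bar>z\<bar>\<^sup>2 \<le> (\<bar>trace A\<bar> - 1)\<^sup>2" by (intro power_mono) auto
 moreover have "(\<bar>trace A\<bar> - 1)\<^sup>2 = (trace A)\<^sup>2 - 2 * \<bar>trace A\<bar> + 1"
  by (simp add: power2_diff)
 ultimately show False using eq assms(2) by (simp add: hyperbolic_def)
qed

text \<open>Completing the square: \<open>disc A * (n $ 2)^2 - 4 * b * Q(n)\<close> is a square, so
  a nonzero isotropic vector would make \<open>disc A\<close> a square.\<close>

lemma Q_form_eq_0:
 assumes "\<And>z. z\<^sup>2 \<noteq> disc A" "Q_form A n = 0"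
 shows "n = 0"
proof -
 define a b c d where "a = A $ 1 $ 1" "b = A $ 1 $ 2" "c = A $ 2 $ 1" "d = A $ 2 $ 2"
 have disc: "disc A = (a - d)\<^sup>2 + 4 * b * c"
  by (simp add: disc_def mat2_simps a_b_c_d_def power2_eq_square algebra_simps)
 have Q: "Q_form A n = - b * (n $ 1)\<^sup>2 + (a - d) * (n $ 1 * n $ 2) + c * (n $ 2)\<^sup>2"
  by (simp add: Q_form_def symp_def mat2_simps a_b_c_d_def power2_eq_square algebra_simps)
 have "(- 2 * b * n $ 1 + (a - d) * n $ 2)\<^sup>2 = disc A * (n $ 2)\<^sup>2 - 4 * b * Q_form A n"
  unfolding disc Q by (simp add: power2_eq_square algebra_simps)
 hence "n $ 2 = 0" using square_ratio[of _ "disc A" "n $ 2"] assms by fastforce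
 moreover have "b \<noteq> 0" using disc assms(1)[of "a - d"] by auto
 hence "n $ 1 = 0" using Q assms(2) \<open>n $ 2 = 0\<close> by simp
 ultimately show ?thesis by (simp add: vec_eq_iff forall_2)
qed

lemma eigenvalue_char_poly:
 assumes "det A = 1" "eigenvalue_of A \<alpha>"
 shows "\<alpha>\<^sup>2 = real_of_int (trace A) * \<alpha> - 1"
proof -
 define a b c d where "a = real_of_int (A $ 1 $ 1)" "b = real_of_int (A $ 1 $ 2)" "c = real_of_int (A $ 2 $ 1)" "d = real_of_int (A $ 2 $ 2)"
 obtain v where v: "v \<noteq> 0" "map_matrix real_of_int A *v v = \<alpha> *\<^sub>R v"
  using assms(2) unfolding eigenvalue_of_def by blast
 have v1: "a * v $ 1 + b * v $ 2 = \<alpha> * v $ 1" and v2: "c * v $ 1 + d * v $ 2 = \<alpha> * v $ 2"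
  using v(2) by (simp_all add: vec_eq_iff forall_2 matrix_vector_mult_def sum_2 map_matrix_def a_b_c_d_def)
 define q where "q = (a - \<alpha>) * (d - \<alpha>) - b * c"
 have "q * v $ 1 = (d - \<alpha>) * (a * v $ 1 + b * v $ 2 - \<alpha> * v $ 1) - b * (c * v $ 1 + d * v $ 2 - \<alpha> * v $ 2)"
  "q * v $ 2 = (a - \<alpha>) * (c * v $ 1 + d * v $ 2 - \<alpha> * v $ 2) - c * (a * v $ 1 + b * v $ 2 - \<alpha> * v $ 1)"
  by (simp_all add: q_def algebra_simps)
 hence "q * v $ 1 = 0" "q * v $ 2 = 0" using v1 v2 by simp_all
 moreover have "v $ 1 \<noteq> 0 \<or> v $ 2 \<noteq> 0" using v(1) by (auto simp: vec_eq_iff forall_2)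
 ultimately have q0: "q = 0" by auto
 have "a * d - b * c = real_of_int (det A)" by (simp add: det_2 a_b_c_d_def)
 hence "a * d - b * c = 1" using assms(1) by simp
 moreover have "real_of_int (trace A) = a + d" by (simp add: trace_def sum_2 a_b_c_d_def)
 ultimately show ?thesis using q0 by (simp add: q_def power2_eq_square algebra_simps)
qed

context
 fixes A :: "int ^ 2 ^ 2" and \<alpha> :: real
 assumes A: "det A = 1" "hyperbolic A" "eigenvalue_of A \<alpha>"
begin

lemma order_unique:
 assumes "real_of_int n + real_of_int m * \<alpha> = real_of_int n' + real_of_int m' * \<alpha>"
 shows "n = n' \<and> m = m'"
proof -
 have char: "(2 * \<alpha> - trace A)\<^sup>2 = disc A"
  using eigenvalue_char_poly[OF A(1,3)] A(1) by (simp add: disc_def power2_eq_square algebra_simps)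
 have "m = m'"
 proof (rule ccontr)
  assume "m \<noteq> m'"
  hence y: "m - m' \<noteq> 0" by simp
  have "real_of_int (n' - n) = (m - m') * \<alpha>" using assms by (simp add: algebra_simps)
  hence "real_of_int (2 * (n' - n) - trace A * (m - m')) = (2 * \<alpha> - trace A) * (m - m')"
   by (simp add: algebra_simps)
  hence "real_of_int ((2 * (n' - n) - trace A * (m - m'))\<^sup>2) = real_of_int (disc A * (m - m')\<^sup>2)"
   by (simp only: of_int_power of_int_mult power_mult_distrib char)
  hence "(2 * (n' - n) - trace A * (m - m'))\<^sup>2 = disc A * (m - m')\<^sup>2" by linarith
  thus False using square_ratio[OF _ y] hyperbolic_disc[OF A(1,2)] by blast
 qed
 thus ?thesis using assms by simp
qed

lemma iota_eq: "iota A \<alpha> (real_of_int n + real_of_int m * \<alpha>) = mat n + mat m ** A"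
 unfolding iota_def by (rule the_equality) (use order_unique in blast)+

lemma order_conj_eq:
 "order_conj \<alpha> (real_of_int n + real_of_int m * \<alpha>) = real_of_int n + real_of_int m * (trace A - \<alpha>)"
proof -
 have "\<alpha> * (trace A - \<alpha>) = 1"
  using eigenvalue_char_poly[OF A(1,3)] by (simp add: power2_eq_square algebra_simps)
 hence inv: "1 / \<alpha> = trace A - \<alpha>" by (metis mult_cancel_left1 mult_zero_left nonzero_eq_divide_eq mult.commute zero_neq_one)
 show ?thesis unfolding order_conj_def inv by (rule the_equality) (use order_unique in blast)+
qed

lemma order_norm_eq:
 "order_norm \<alpha> (real_of_int n + real_of_int m * \<alpha>) = n\<^sup>2 + n * m * trace A + m\<^sup>2"
 "(real_of_int n + real_of_int m * \<alpha>) * (real_of_int n + real_of_int m * (trace A - \<alpha>)) = real_of_int (n\<^sup>2 + n * m * trace A + m\<^sup>2)"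
proof -
 have "(real_of_int n + real_of_int m * \<alpha>) * (real_of_int n + real_of_int m * (trace A - \<alpha>))
  = (real_of_int n)\<^sup>2 + n * m * trace A + (real_of_int m)\<^sup>2 * (trace A * \<alpha> - \<alpha>\<^sup>2)"
  by (simp add: power2_eq_square algebra_simps)
 thus 1: "(real_of_int n + real_of_int m * \<alpha>) * (real_of_int n + real_of_int m * (trace A - \<alpha>))
  = real_of_int (n\<^sup>2 + n * m * trace A + m\<^sup>2)"
  by (simp add: eigenvalue_char_poly[OF A(1,3)])
 show "order_norm \<alpha> (real_of_int n + real_of_int m * \<alpha>) = n\<^sup>2 + n * m * trace A + m\<^sup>2"
  unfolding order_norm_def order_conj_eq 1 by (rule the_equality) (rule refl, simp only: of_int_eq_iff)
qed

text \<open>In these coordinates the norm of the order is \<open>nrm\<close>, and the algebraic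
  conjugate supplies the inverse modulo \<open>N\<close>.\<close>

lemma hecke_mat_iota:
 assumes "int N dvd nrm A c d - 1"
 shows "\<exists>\<beta>\<in>C_N \<alpha> N. iota A \<alpha> \<beta> = hecke_mat A c d"
proof -
 define n m where "n = c - d * trace A" and "m = 2 * d"
 define \<beta> where "\<beta> = real_of_int n + real_of_int m * \<alpha>"
 have nrm: "n\<^sup>2 + n * m * trace A + m\<^sup>2 = nrm A c d"
  using A(1) by (simp add: n_def m_def nrm_def disc_def power2_eq_square algebra_simps)
 obtain r where r: "nrm A c d - 1 = int N * r" using assms by blast
 have "order_cong \<alpha> N (\<beta> * (real_of_int n + real_of_int m * (trace A - \<alpha>))) 1"
 proof -
  have "real_of_int r \<in> order_ring \<alpha>"
   unfolding order_ring_def by (intro CollectI exI[of _ r] exI[of _ 0]) simp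
  moreover have "real_of_int (nrm A c d) - 1 = real_of_int (int N * r)" using r by linarith
  ultimately show ?thesis unfolding order_cong_def \<beta>_def order_norm_eq(2) nrm by auto
 qed
 moreover have "real_of_int n + real_of_int m * (trace A - \<alpha>) \<in> order_ring \<alpha>"
  unfolding order_ring_def by (intro CollectI exI[of _ "n + m * trace A"] exI[of _ "- m"]) (simp add: algebra_simps)
 moreover have "\<beta> \<in> order_ring \<alpha>" unfolding order_ring_def \<beta>_def by blast
 moreover have "[order_norm \<alpha> \<beta> = 1] (mod int N)"
  unfolding \<beta>_def order_norm_eq(1) nrm using assms by (simp add: cong_iff_dvd_diff)
 ultimately have "\<beta> \<in> C_N \<alpha> N" unfolding C_N_def by blast
 moreover have "iota A \<alpha> \<beta> = hecke_mat A c d"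
  unfolding \<beta>_def iota_eq n_def m_def hecke_mat_def ..
 ultimately show ?thesis by blast
qed

end

section \<open>Hecke symmetry of the matrix elements\<close>

context cat_map
begin

lemma hecke_funI:
 assumes "hyperbolic A" "eigenvalue_of A \<alpha>" "hecke_eigenfunction A \<alpha> N U \<psi>" "ip N \<psi> \<psi> = 1"
 shows "hecke_fun \<psi>"
 unfolding hecke_fun_def
proof (intro conjI allI impI)
 show "\<psi> \<in> H_N N" using assms(3) by (simp add: hecke_eigenfunction_def eigenfunction_def)
 show "\<exists>a. UM c d \<psi> = scl a \<psi>" if "hecke c d" for c d
 proof -
  obtain \<beta> where "\<beta> \<in> C_N \<alpha> N" "iota A \<alpha> \<beta> = hecke_mat A c d"
   using hecke_mat_iota[OF det_A assms(1,2)] \<open>hecke c d\<close> unfolding hecke_def by blast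
  thus ?thesis using assms(3) unfolding hecke_eigenfunction_def eigenfunction_def UM_def scl_def by metis
 qed
qed fact

lemma matrix_element_act:
 assumes "hecke_fun \<psi>" "hecke c d"
 shows "ip N (twisted_T N (act A c d n) \<psi>) \<psi> = ip N (twisted_T N n \<psi>) \<psi>"
proof -
 have H: "\<psi> \<in> H_N N" using assms(1) by (simp add: hecke_fun_def)
 note ev = ev_eq[OF assms]
 have "ip N (twisted_T N (act A c d n) \<psi>) \<psi> = ip N (UM c d (twisted_T N (act A c d n) \<psi>)) (UM c d \<psi>)"
  using H odd_N by (simp add: UM_ip[OF assms(2)])
 also have "\<dots> = ip N (twisted_T N n (UM c d \<psi>)) (UM c d \<psi>)"
  by (simp only: UM_T[OF assms(2) H])
 also have "\<dots> = ev \<psi> c d * cnj (ev \<psi> c d) * ip N (twisted_T N n \<psi>) \<psi>"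
  unfolding ev(1) by (simp add: twisted_T_scl)
 finally show ?thesis using ev(2) by simp
qed

lemma matrix_element_real:
 assumes "hecke_fun \<psi>"
 shows "cnj (ip N (twisted_T N n \<psi>) \<psi>) = ip N (twisted_T N n \<psi>) \<psi>"
proof -
 have H: "\<psi> \<in> H_N N" using assms(1) by (simp add: hecke_fun_def)
 have "cnj (ip N (twisted_T N n \<psi>) \<psi>) = ip N \<psi> (twisted_T N n \<psi>)" by (rule cnj_ip)
 also have "\<dots> = ip N (twisted_T N (- n) \<psi>) \<psi>"
  using ip_twisted_T_adj[OF odd_N H H, of "- n"] by simp
 also have "- n = act A (- 1) 0 n" by (simp add: act_def vec_eq_iff)
 also have "ip N (twisted_T N (act A (- 1) 0 n) \<psi>) \<psi> = ip N (twisted_T N n \<psi>) \<psi>"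
  by (rule matrix_element_act[OF assms]) (simp add: hecke_def nrm_def)
 finally show ?thesis .
qed

text \<open>Hecke elements act transitively on the vectors of one level prime to \<open>p\<close>
  and leave the matrix elements unchanged. This is why \<open>f\<close> enters only through its
  twisted coefficients.\<close>

lemma matrix_element_level:
 assumes "hecke_fun \<psi>" "\<not> int p dvd Q_form A n" "Q_form A n = Q_form A n'"
 shows "ip N (twisted_T N n \<psi>) \<psi> = ip N (twisted_T N n' \<psi>) \<psi>"
proof -
 have H: "\<psi> \<in> H_N N" using assms(1) by (simp add: hecke_fun_def)
 obtain c d where cd: "hecke c d" "vc (int N) (act A c d n) n'"
  using transitive[of n "2 * l + e" n'] assms(2,3) l_pos unfolding good_def N_def by auto
 show ?thesis
  using matrix_element_act[OF assms(1) cd(1), of n] twisted_T_cong[OF odd_N cd(2) H] by simp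
qed

end

section \<open>Fourier coefficients\<close>

lemma integral_cis_period:
 fixes m :: int
 shows "(\<integral>t. indicator {0..1} t *\<^sub>R cis (2 * pi * (real_of_int m * t)) \<partial>lborel) = (if m = 0 then 1 else 0)"
  and "integrable lborel (\<lambda>t. indicator {0..1} t *\<^sub>R cis (2 * pi * (real_of_int m * t)))"
proof -
 have cont: "continuous_on {0..1} (\<lambda>t. cis (2 * pi * (real_of_int m * t)))"
  by (intro continuous_intros)
 show int: "integrable lborel (\<lambda>t. indicator {0..1} t *\<^sub>R cis (2 * pi * (real_of_int m * t)))"
  by (rule borel_integrable_compact[OF _ cont]) simp
 have "(\<integral>t. indicator {0..1} t *\<^sub>R cis (2 * pi * (real_of_int m * t)) \<partial>lborel)
  = integral {0..1} (\<lambda>t. cis (2 * pi * (real_of_int m * t)))"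
  using set_borel_integral_eq_integral(2)[of "{0..1}" "\<lambda>t. cis (2 * pi * (real_of_int m * t))"] int
  by (simp add: set_integrable_def set_lebesgue_integral_def)
 also have "\<dots> = (if m = 0 then 1 else 0)"
 proof (cases "m = 0")
  case False
  define c where "c = \<i> * complex_of_real (2 * pi * real_of_int m)"
  have c: "c \<noteq> 0" using False by (simp add: c_def)
  have cis: "cis (2 * pi * (real_of_int m * t)) = exp (c * complex_of_real t)" for t
   unfolding cis_conv_exp c_def by (simp add: mult_ac)
  have "((\<lambda>t. exp (c * complex_of_real t)) has_integral (exp (c * complex_of_real 1) / c - exp (c * complex_of_real 0) / c)) {0..1}"
  proof (rule fundamental_theorem_of_calculus)
   fix t :: real
   have "((\<lambda>z. exp (c * z) / c) has_field_derivative exp (c * complex_of_real t)) (at (complex_of_real t))"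
    using c by (auto intro!: derivative_eq_intros)
   thus "((\<lambda>t. exp (c * complex_of_real t) / c) has_vector_derivative exp (c * complex_of_real t)) (at t within {0..1})"
    by (rule has_vector_derivative_real_field)
  qed simp
  moreover have "exp (c * complex_of_real 1) = cis (2 * pi * real_of_int m)" using cis[of 1] by simp
  hence "exp (c * complex_of_real 1) = 1" by (simp add: cis_multiple_2pi)
  ultimately show ?thesis using False unfolding cis by (simp add: integral_unique)
 qed simp
 finally show "(\<integral>t. indicator {0..1} t *\<^sub>R cis (2 * pi * (real_of_int m * t)) \<partial>lborel) = (if m = 0 then 1 else 0)" .
qed

lemma Basis_vec2: "(Basis :: (real ^ 2) set) = {axis 1 1, axis 2 1}"
 by (auto simp: Basis_vec_def) (metis exhaust_2)+

lemma torus_char_0 [simp]: "torus_char 0 x = 1"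
 and torus_char_add: "torus_char n x * torus_char m x = torus_char (n + m) x"
 by (simp_all add: torus_char_def cis_mult sum.distrib algebra_simps)

lemma continuous_torus_char: "continuous_on S (torus_char n)"
 unfolding torus_char_def[abs_def] by (intro continuous_intros)

lemma integrable_torus_char: "torus_char n integrable_on cbox 0 1"
 using continuous_torus_char by (rule integrable_continuous)

lemma integral_torus_char: "integral (cbox 0 1) (torus_char n) = (if n = 0 then 1 else 0)"
proof -
 interpret product_sigma_finite "\<lambda>_ :: real ^ 2. lborel :: real measure" by standard
 define h where "h b t = indicator {0..1} t *\<^sub>R cis (2 * pi * (real_of_int (n $ (if b = axis 1 1 then 1 else 2)) * t))"
  for b :: "real ^ 2" and t :: real
 define e1 e2 where "e1 = (axis 1 1 :: real ^ 2)" and "e2 = (axis 2 1 :: real ^ 2)"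
 have e: "e1 \<noteq> e2" "e1 $ 1 = 1" "e1 $ 2 = 0" "e2 $ 1 = 0" "e2 $ 2 = 1" "Basis = {e1, e2}"
  by (auto simp: e1_def e2_def axis_def vec_eq_iff Basis_vec2)
 have int: "integrable lborel (\<lambda>x. indicator (cbox 0 1) x *\<^sub>R torus_char n x)"
  by (rule borel_integrable_compact) (auto intro: continuous_torus_char)
 have "integral (cbox 0 1) (torus_char n) = (\<integral>x. indicator (cbox 0 1) x *\<^sub>R torus_char n x \<partial>lborel)"
  using set_borel_integral_eq_integral(2)[of "cbox 0 1" "torus_char n"] int
  by (simp add: set_integrable_def set_lebesgue_integral_def)
 also have "\<dots> = (\<integral>g. indicator (cbox 0 1) (\<Sum>b\<in>Basis. g b *\<^sub>R b) *\<^sub>R torus_char n (\<Sum>b\<in>Basis. g b *\<^sub>R b)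
   \<partial>(\<Pi>\<^sub>M b\<in>(Basis :: (real ^ 2) set). lborel))"
  by (subst lborel_eq, subst integral_distr) (use int in auto)
 also have "\<dots> = (\<integral>g. (\<Prod>b\<in>Basis. h b (g b)) \<partial>(\<Pi>\<^sub>M b\<in>(Basis :: (real ^ 2) set). lborel))"
 proof (rule Bochner_Integration.integral_cong[OF refl])
  fix g :: "real ^ 2 \<Rightarrow> real"
  have x: "(\<Sum>b\<in>Basis. g b *\<^sub>R b) $ 1 = g e1" "(\<Sum>b\<in>Basis. g b *\<^sub>R b) $ 2 = g e2"
   unfolding e(6) using e(1-5) by simp_all
  have box: "x \<in> cbox 0 1 \<longleftrightarrow> x $ 1 \<in> {0..1} \<and> x $ 2 \<in> {0..1}" for x :: "real ^ 2"
   by (auto simp: mem_box_cart forall_2)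
  have "(\<Prod>b\<in>Basis. h b (g b)) = h e1 (g e1) * h e2 (g e2)" unfolding e(6) using e(1) by simp
  also have "\<dots> = indicator (cbox 0 1) (\<Sum>b\<in>Basis. g b *\<^sub>R b) *\<^sub>R torus_char n (\<Sum>b\<in>Basis. g b *\<^sub>R b)"
  proof -
   have "h e1 (g e1) = indicator {0..1} (g e1) *\<^sub>R cis (2 * pi * (real_of_int (n $ 1) * g e1))"
    "h e2 (g e2) = indicator {0..1} (g e2) *\<^sub>R cis (2 * pi * (real_of_int (n $ 2) * g e2))"
    using e(1) by (auto simp: h_def e1_def e2_def)
   moreover have "torus_char n (\<Sum>b\<in>Basis. g b *\<^sub>R b)
    = cis (2 * pi * (real_of_int (n $ 1) * g e1)) * cis (2 * pi * (real_of_int (n $ 2) * g e2))"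
    unfolding torus_char_def sum_2 x by (simp add: cis_mult algebra_simps)
   moreover have "indicator (cbox 0 1) (\<Sum>b\<in>Basis. g b *\<^sub>R b) = (indicator {0..1} (g e1) * indicator {0..1} (g e2) :: real)"
    unfolding indicator_def box x by auto
   ultimately show ?thesis by simp
  qed
  finally show "indicator (cbox 0 1) (\<Sum>b\<in>Basis. g b *\<^sub>R b) *\<^sub>R torus_char n (\<Sum>b\<in>Basis. g b *\<^sub>R b) = (\<Prod>b\<in>Basis. h b (g b))" ..
 qed
 also have "\<dots> = (\<Prod>b\<in>Basis. integral\<^sup>L lborel (h b))"
  by (rule product_integral_prod) (simp_all add: h_def[abs_def] integral_cis_period(2))
 also have "\<dots> = integral\<^sup>L lborel (h e1) * integral\<^sup>L lborel (h e2)" unfolding e(6) using e(1) by simp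
 also have "integral\<^sup>L lborel (h e1) = (if n $ 1 = 0 then 1 else 0)"
  unfolding h_def[abs_def] integral_cis_period(1) by (simp add: e1_def e2_def)
 also have "integral\<^sup>L lborel (h e2) = (if n $ 2 = 0 then 1 else 0)"
  unfolding h_def[abs_def] integral_cis_period(1) using e(1) by (simp add: e1_def e2_def)
 finally show ?thesis by (auto simp: vec_eq_iff forall_2)
qed

lemma trig_polynomial_fourier:
 assumes "trig_polynomial f"
 shows "finite {n. fourier_coeff f n \<noteq> 0}" "fourier_coeff f 0 = of_real (integral (cbox 0 1) f)"
proof -
 obtain c where c: "finite {n. c n \<noteq> 0}" "\<And>x. complex_of_real (f x) = (\<Sum>n | c n \<noteq> 0. c n * torus_char n x)"
  using assms unfolding trig_polynomial_def by blast
 have fc: "fourier_coeff f m = c m" for m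
 proof -
  have "fourier_coeff f m = integral (cbox 0 1) (\<lambda>x. \<Sum>n | c n \<noteq> 0. c n * torus_char (n - m) x)"
   unfolding fourier_coeff_def c(2)
   by (rule arg_cong[where f = "integral (cbox 0 1)"]) (simp add: fun_eq_iff sum_distrib_right mult.assoc torus_char_add)
  also have "\<dots> = (\<Sum>n | c n \<noteq> 0. integral (cbox 0 1) (\<lambda>x. c n * torus_char (n - m) x))"
   by (rule integral_sum[OF c(1)]) (intro integrable_on_mult_right integrable_torus_char)
  also have "\<dots> = (\<Sum>n | c n \<noteq> 0. if n = m then c n else 0)"
   by (rule sum.cong) (simp_all add: integral_torus_char)
  also have "\<dots> = c m" using c(1) by (simp add: sum.delta)
  finally show ?thesis .
 qed
 show "finite {n. fourier_coeff f n \<noteq> 0}" using c(1) by (simp add: fc)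
 have "continuous_on (cbox 0 1) (\<lambda>x. Re (complex_of_real (f x)))"
  unfolding c(2) by (intro continuous_intros continuous_torus_char)
 hence "f integrable_on cbox 0 1" by (intro integrable_continuous) simp
 hence "((\<lambda>x. complex_of_real (f x)) has_integral of_real (integral (cbox 0 1) f)) (cbox 0 1)"
  by (intro has_integral_of_real integrable_integral)
 thus "fourier_coeff f 0 = of_real (integral (cbox 0 1) f)"
  unfolding fourier_coeff_def by (simp add: integral_unique)
qed

lemma T_N_eq_twisted: "T_N N n \<psi> = scl ((- 1) powi (n $ 1 * n $ 2)) (twisted_T N n \<psi>)"
 by (simp add: twisted_T_def scl_def fun_eq_iff power_int_minus_one_mult_self mult.assoc[symmetric] flip: power_int_mult_distrib)

context cat_map
begin

text \<open>The frequency 0 produces the integral of \<open>f\<close>; the other frequencies are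
  grouped by level, on which alone the matrix element depends.\<close>

lemma F_N_hecke:
 assumes f: "trig_polynomial f" and \<psi>: "hecke_fun \<psi>" and disc: "\<And>z. z\<^sup>2 \<noteq> disc A"
  and S: "finite S" "Q_form A ` ({n. fourier_coeff f n \<noteq> 0} - {0}) \<subseteq> S"
   "\<And>\<nu>. \<nu> \<in> S \<Longrightarrow> Q_form A (r \<nu>) = \<nu> \<and> \<not> int p dvd \<nu>"
 shows "F_N N f \<psi> = sqrt N * (\<Sum>\<nu>\<in>S. Re (twisted_coeff A f \<nu>) * Re (ip N (twisted_T N (r \<nu>) \<psi>) \<psi>))"
proof -
 define K where "K = {n. fourier_coeff f n \<noteq> 0}"
 have K: "finite K" using trig_polynomial_fourier(1)[OF f] by (simp add: K_def)
 define g where "g n = fourier_coeff f n * ((- 1) powi (n $ 1 * n $ 2) * ip N (twisted_T N n \<psi>) \<psi>)" for n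
 have "ip N (Op_N N f \<psi>) \<psi> = (\<Sum>n\<in>K. fourier_coeff f n * ip N (T_N N n \<psi>) \<psi>)"
  unfolding Op_N_def ip_sum_left K_def ..
 hence "ip N (Op_N N f \<psi>) \<psi> = (\<Sum>n\<in>K. g n)" by (simp add: T_N_eq_twisted g_def)
 also have "\<dots> = (\<Sum>n\<in>K - {0}. g n) + g 0"
 proof (cases "0 \<in> K")
  case True
  thus ?thesis using K by (simp add: sum.remove[of K 0])
 next
  case False
  hence "g 0 = 0" by (simp add: K_def g_def)
  thus ?thesis using False by simp
 qed
 also have "g 0 = of_real (integral (cbox 0 1) f)"
  using \<psi> trig_polynomial_fourier(2)[OF f] odd_N by (simp add: g_def hecke_fun_def)
 finally have "Re (ip N (Op_N N f \<psi>) \<psi>) - integral (cbox 0 1) f = Re (\<Sum>n\<in>K - {0}. g n)" by simp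
 also have "(\<Sum>n\<in>K - {0}. g n) = (\<Sum>\<nu>\<in>S. \<Sum>n | n \<in> K - {0} \<and> Q_form A n = \<nu>. g n)"
  using sum.group[of "K - {0}" S "Q_form A" g] K S(1,2) by (simp add: K_def)
 also have "\<dots> = (\<Sum>\<nu>\<in>S. twisted_coeff A f \<nu> * ip N (twisted_T N (r \<nu>) \<psi>) \<psi>)"
 proof (rule sum.cong[OF refl])
  fix \<nu> assume \<nu>: "\<nu> \<in> S"
  have "\<nu> \<noteq> 0" using S(3)[OF \<nu>] by auto
  hence eq: "{n. n \<in> K - {0} \<and> Q_form A n = \<nu>} = {n. fourier_coeff f n \<noteq> 0 \<and> Q_form A n = \<nu>}"
   by (auto simp: K_def Q_form_def symp_def)
  have "g n = (- 1) powi (n $ 1 * n $ 2) * fourier_coeff f n * ip N (twisted_T N (r \<nu>) \<psi>) \<psi>" if "Q_form A n = \<nu>" for n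
   using matrix_element_level[OF \<psi>, of n "r \<nu>"] S(3)[OF \<nu>] that by (simp add: g_def)
  thus "(\<Sum>n | n \<in> K - {0} \<and> Q_form A n = \<nu>. g n) = twisted_coeff A f \<nu> * ip N (twisted_T N (r \<nu>) \<psi>) \<psi>"
   unfolding eq twisted_coeff_def sum_distrib_right by (intro sum.cong) auto
 qed
 also have "Re \<dots> = (\<Sum>\<nu>\<in>S. Re (twisted_coeff A f \<nu>) * Re (ip N (twisted_T N (r \<nu>) \<psi>) \<psi>))"
 proof -
  have "Im (ip N (twisted_T N n \<psi>) \<psi>) = 0" for n
   using matrix_element_real[OF \<psi>, of n] by (metis Im_complex_of_real Reals_cnj_iff Reals_cases)
  thus ?thesis by simp
 qed
 finally show ?thesis by (simp add: F_N_def)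
qed

end

section \<open>The angle measure and the method of moments\<close>

lemma nn_integral_angle_measure:
 assumes "f \<in> borel_measurable borel"
 shows "(\<integral>\<^sup>+x. f x \<partial>angle_measure) = ennreal (1 / 2) * f (pi / 2)
   + ennreal (1 / (2 * pi)) * (\<integral>\<^sup>+x. f x * indicator {0..<pi} x \<partial>lborel)"
 using assms
proof (induction rule: borel_measurable_induct)
 case (cong f g)
 hence "f = g" by auto
 thus ?case using cong by simp
next
 case (set A)
 have "(\<lambda>x. indicator A x * indicator {0..<pi} x :: ennreal) = indicator (A \<inter> {0..<pi})"
  by (auto simp: indicator_def)
 thus ?case using set by (simp add: emeasure_angle_measure)
next
 case (mult u c)
 thus ?case
  by (simp add: nn_integral_cmult distrib_left mult_ac)
next
 case (add u v)
 thus ?case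
  by (simp add: nn_integral_add distrib_left distrib_right add_ac)
next
 case (seq U)
 have inc: "incseq (\<lambda>i. U i x)" for x using seq(3) by (auto simp: incseq_def le_fun_def)
 have m: "U i \<in> borel_measurable borel" for i by fact
 have mu: "(\<lambda>x. U i x * indicator {0..<pi} x) \<in> borel_measurable lborel" for i using m by simp
 have incu: "incseq (\<lambda>i x. U i x * indicator {0..<pi} x)"
  using seq(3) by (auto simp: incseq_def le_fun_def intro!: mult_right_mono)
 have sup: "(SUP i. U i) = (\<lambda>x. SUP i. U i x)" by (rule ext, rule SUP_apply)
 have ma: "U i \<in> borel_measurable angle_measure" for i
  using m[of i] measurable_cong_sets[OF sets_angle_measure refl] by blast
 have "(\<integral>\<^sup>+x. (SUP i. U i x) \<partial>angle_measure) = (SUP i. \<integral>\<^sup>+x. U i x \<partial>angle_measure)"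
  by (rule nn_integral_monotone_convergence_SUP[OF seq(3) ma])
 also have "\<dots> = (SUP i. ennreal (1 / 2) * U i (pi / 2) + ennreal (1 / (2 * pi)) * (\<integral>\<^sup>+x. U i x * indicator {0..<pi} x \<partial>lborel))"
  by (simp add: seq.IH)
 also have "\<dots> = (SUP i. ennreal (1 / 2) * U i (pi / 2)) + (SUP i. ennreal (1 / (2 * pi)) * (\<integral>\<^sup>+x. U i x * indicator {0..<pi} x \<partial>lborel))"
 proof (rule ennreal_SUP_add)
  show "incseq (\<lambda>i. ennreal (1 / 2) * U i (pi / 2))"
   using inc by (auto simp: incseq_def intro!: mult_left_mono)
  show "incseq (\<lambda>i. ennreal (1 / (2 * pi)) * (\<integral>\<^sup>+x. U i x * indicator {0..<pi} x \<partial>lborel))"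
   using incu by (auto simp: incseq_def le_fun_def intro!: mult_left_mono nn_integral_mono)
 qed
 also have "\<dots> = ennreal (1 / 2) * (SUP i. U i (pi / 2)) + ennreal (1 / (2 * pi)) * (SUP i. \<integral>\<^sup>+x. U i x * indicator {0..<pi} x \<partial>lborel)"
  by (simp only: SUP_mult_left_ennreal)
 also have "(SUP i. \<integral>\<^sup>+x. U i x * indicator {0..<pi} x \<partial>lborel) = (\<integral>\<^sup>+x. (SUP i. U i x * indicator {0..<pi} x) \<partial>lborel)"
  by (rule nn_integral_monotone_convergence_SUP[symmetric, OF incu mu])
 also have "\<dots> = (\<integral>\<^sup>+x. (SUP i. U i x) * indicator {0..<pi} x \<partial>lborel)"
  by (simp only: SUP_mult_right_ennreal)
 finally show ?case unfolding sup .
qed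

text \<open>The middle binomial coefficient for even \<open>k\<close> and 0 for odd
  \<open>k\<close>: the \<open>k\<close>-th moment of \<open>2 * cos x\<close> for uniform
  \<open>x\<close>. The form as a sum matches the binomial expansion from which it arises.\<close>

definition central :: "nat \<Rightarrow> real" where
 "central k = (\<Sum>a\<le>k. if 2 * a = k then real (k choose a) else 0)"

lemma power_2cos: "(2 * cos x) ^ k = (\<Sum>a\<le>k. real (k choose a) * cos ((2 * real a - real k) * x))"
proof -
 have "complex_of_real ((2 * cos x) ^ k) = (cis x + cis (- x)) ^ k"
 proof -
  have "cis x + cis (- x) = complex_of_real (2 * cos x)" by (simp add: complex_eq_iff)
  thus ?thesis by simp
 qed
 also have "\<dots> = (\<Sum>a\<le>k. of_nat (k choose a) * cis x ^ a * cis (- x) ^ (k - a))"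
  by (rule binomial_ring)
 also have "\<dots> = (\<Sum>a\<le>k. of_nat (k choose a) * cis ((2 * real a - real k) * x))"
 proof (rule sum.cong)
  fix a assume "a \<in> {..k}"
  hence "real (k - a) = real k - real a" by (simp add: of_nat_diff)
  hence "cis x ^ a * cis (- x) ^ (k - a) = cis ((2 * real a - real k) * x)"
   by (simp only: Complex.DeMoivre cis_mult) (simp add: algebra_simps)
  thus "of_nat (k choose a) * cis x ^ a * cis (- x) ^ (k - a) = of_nat (k choose a) * cis ((2 * real a - real k) * x)"
   by (simp add: mult.assoc)
 qed simp
 finally have "Re (complex_of_real ((2 * cos x) ^ k)) = Re (\<Sum>a\<le>k. of_nat (k choose a) * cis ((2 * real a - real k) * x))"
  by simp
 thus ?thesis by simp
qed

lemma angle_moment: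
 "integral\<^sup>L angle_measure (\<lambda>x. (2 * cos x) ^ k) = (0 ^ k + central k) / 2"
proof -
 interpret prob_space angle_measure by (rule prob_space_angle_measure)
 \<comment> \<open>The constant \<open>2^k\<close> makes the integrand nonnegative, so that the
   integral can be computed in \<open>ennreal\<close>; it is subtracted at the end.\<close>
 define g where "g x = (2 * cos x) ^ k + 2 ^ k" for x :: real
 have abs_le: "\<bar>(2 * cos x) ^ k\<bar> \<le> 2 ^ k" for x :: real
  unfolding power_abs by (intro power_mono) (auto simp: abs_mult)
 have g0: "g x \<ge> 0" for x using abs_le[of x] unfolding g_def by linarith
 have gm: "g \<in> borel_measurable borel" unfolding g_def by measurable
 \<comment> \<open>An antiderivative of the trigonometric expansion. Of the binomial terms only the
   one of frequency 0, \<open>2 * a = k\<close>, contributes over \<open>[0, \<pi>]\<close>.\<close>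
 define F where "F x = (\<Sum>a\<le>k. real (k choose a) * (if 2 * a = k then x else sin ((2 * real a - real k) * x) / (2 * real a - real k))) + 2 ^ k * x" for x
 have DF: "DERIV F x :> g x" for x
 proof -
  have "((\<lambda>x. if 2 * a = k then x else sin ((2 * real a - real k) * x) / (2 * real a - real k))
    has_real_derivative cos ((2 * real a - real k) * x)) (at x)" for a
  proof (cases "2 * a = k")
   case True
   hence "2 * real a - real k = 0" by auto
   hence "(\<lambda>x. if 2 * a = k then x else sin ((2 * real a - real k) * x) / (2 * real a - real k)) = (\<lambda>x. x)"
    "cos ((2 * real a - real k) * x) = 1" using True by (simp_all only: if_True refl mult_zero_left cos_zero)
   thus ?thesis by (simp only: DERIV_ident)
  next
   case False
   hence "2 * real a - real k \<noteq> 0" by (metis (mono_tags, lifting) eq_iff_diff_eq_0 of_nat_eq_iff of_nat_mult of_nat_numeral)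
   thus ?thesis using False by (auto intro!: derivative_eq_intros)
  qed
  hence "((\<lambda>x. (\<Sum>a\<le>k. real (k choose a) * (if 2 * a = k then x else sin ((2 * real a - real k) * x) / (2 * real a - real k))) + 2 ^ k * x)
    has_real_derivative (\<Sum>a\<le>k. real (k choose a) * cos ((2 * real a - real k) * x)) + 2 ^ k * 1) (at x)"
   by (intro DERIV_add DERIV_sum DERIV_cmult DERIV_ident)
  thus ?thesis unfolding F_def[abs_def] g_def power_2cos by (simp only: mult_1_right)
 qed
 have "F pi - F 0 = pi * (central k + 2 ^ k)"
 proof -
  have "sin ((2 * real a - real k) * pi) = 0" for a
  proof -
   have "(2 * real a - real k) = real_of_int (2 * int a - int k)" by simp
   thus ?thesis by (metis mult.commute sin_zero_iff_int2)
  qed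
  hence "F pi = (\<Sum>a\<le>k. real (k choose a) * (if 2 * a = k then pi else 0)) + 2 ^ k * pi"
   by (simp add: F_def if_distrib cong: if_cong)
  also have "(\<Sum>a\<le>k. real (k choose a) * (if 2 * a = k then pi else 0)) = pi * central k"
   by (simp add: central_def sum_distrib_left if_distrib mult.commute cong: if_cong)
  finally have "F pi = pi * (central k + 2 ^ k)" by (simp add: algebra_simps)
  moreover have "F 0 = 0" unfolding F_def by (simp add: sum.neutral)
  ultimately show ?thesis by simp
 qed
 moreover have "(\<integral>\<^sup>+x. ennreal (g x) * indicator {0..pi} x \<partial>lborel) = ennreal (F pi - F 0)"
  by (rule nn_integral_FTC_Icc) (use gm DF g0 in auto)
 moreover have "(\<integral>\<^sup>+x. ennreal (g x) * indicator {0..<pi} x \<partial>lborel) = (\<integral>\<^sup>+x. ennreal (g x) * indicator {0..pi} x \<partial>lborel)"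
 proof (rule nn_integral_cong_AE)
  show "AE x in lborel. ennreal (g x) * indicator {0..<pi} x = ennreal (g x) * indicator {0..pi} x"
   using AE_lborel_singleton[of pi] by eventually_elim (auto simp: indicator_def)
 qed
 ultimately have "(\<integral>\<^sup>+x. ennreal (g x) \<partial>angle_measure)
   = ennreal (1 / 2) * ennreal (g (pi / 2)) + ennreal (1 / (2 * pi)) * ennreal (pi * (central k + 2 ^ k))"
  using nn_integral_angle_measure[of "\<lambda>x. ennreal (g x)"] gm by simp
 also have "\<dots> = ennreal (1 / 2 * g (pi / 2) + 1 / (2 * pi) * (pi * (central k + 2 ^ k)))"
 proof -
  have "central k \<ge> 0" unfolding central_def by (intro sum_nonneg) auto
  thus ?thesis using g0[of "pi / 2"] ennreal_mult[of "1 / 2" "g (pi / 2)"]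
    ennreal_mult[of "1 / (2 * pi)" "pi * (central k + 2 ^ k)"]
    ennreal_plus[of "1 / 2 * g (pi / 2)" "1 / (2 * pi) * (pi * (central k + 2 ^ k))"] by (simp del: ennreal_plus ennreal_half)
 qed
 also have "1 / 2 * g (pi / 2) + 1 / (2 * pi) * (pi * (central k + 2 ^ k)) = (0 ^ k + central k) / 2 + 2 ^ k"
  by (simp add: g_def field_simps)
 finally have nn: "(\<integral>\<^sup>+x. ennreal (g x) \<partial>angle_measure) = ennreal ((0 ^ k + central k) / 2 + 2 ^ k)" .
 have gma: "g \<in> borel_measurable angle_measure" using gm measurable_cong_sets[OF sets_angle_measure refl] by blast
 have "central k \<ge> 0" unfolding central_def by (intro sum_nonneg) auto
 hence "integral\<^sup>L angle_measure g = (0 ^ k + central k) / 2 + 2 ^ k"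
  using integral_eq_nn_integral[OF gma] g0 nn by (simp del: ennreal_plus)
 moreover have "integrable angle_measure (\<lambda>x. (2 * cos x) ^ k)"
 proof (rule integrable_const_bound[where B = "2 ^ k"])
  have "(\<lambda>x :: real. (2 * cos x) ^ k) \<in> borel_measurable borel" by measurable
  thus "(\<lambda>x. (2 * cos x) ^ k) \<in> borel_measurable angle_measure"
   using measurable_cong_sets[OF sets_angle_measure refl] by blast
 qed (use abs_le in auto)
 hence "integral\<^sup>L angle_measure g = integral\<^sup>L angle_measure (\<lambda>x. (2 * cos x) ^ k) + 2 ^ k"
  unfolding g_def using prob_space by (subst Bochner_Integration.integral_add) auto
 ultimately show ?thesis by simp
qed

lemma angle_cos_zero: "emeasure angle_measure {x. cos x = 0} = ennreal (1 / 2)"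
proof -
 have m: "{x :: real. cos x = 0} \<in> sets borel" by measurable
 have "{x. cos x = 0} \<inter> {0..<pi} \<subseteq> {pi / 2}"
 proof
  fix x :: real assume x: "x \<in> {x. cos x = 0} \<inter> {0..<pi}"
  hence "cos x = cos (pi / 2)" by simp
  thus "x \<in> {pi / 2}" using x cos_inj_pi[of x "pi / 2"] by auto
 qed
 hence "emeasure lborel ({x. cos x = 0} \<inter> {0..<pi}) \<le> emeasure lborel {pi / 2}"
  by (intro emeasure_mono) auto
 thus ?thesis by (simp add: emeasure_angle_measure[OF m])
qed

text \<open>The atom at \<open>\<pi>/2\<close> has cosine 0 and is missed, and \<open>cos\<close> is
  injective on \<open>[0, \<pi>)\<close>, so at most one point of Lebesgue measure 0 is
  left.\<close>

lemma angle_cos_nonzero: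
 assumes "y \<noteq> 0"
 shows "emeasure angle_measure {x. c * cos x = y} = 0"
proof (cases "c = 0")
 case True
 thus ?thesis using assms by simp
next
 case False
 have m: "{x :: real. c * cos x = y} \<in> sets borel" by measurable
 have "\<exists>z. {x. c * cos x = y} \<inter> {0..<pi} \<subseteq> {z}"
 proof (cases "{x. c * cos x = y} \<inter> {0..<pi} = {}")
  case False
  then obtain z where z: "c * cos z = y" "z \<in> {0..<pi}" by blast
  have "x = z" if "c * cos x = y" "x \<in> {0..<pi}" for x
  proof -
   have "cos x = cos z" using that z \<open>c \<noteq> 0\<close> by (metis mult_left_cancel)
   thus ?thesis using that z cos_inj_pi[of x z] by auto
  qed
  thus ?thesis by blast
 qed blast
 then obtain z where "{x. c * cos x = y} \<inter> {0..<pi} \<subseteq> {z}" ..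
 hence "emeasure lborel ({x. c * cos x = y} \<inter> {0..<pi}) \<le> emeasure lborel {z}"
  by (intro emeasure_mono) auto
 thus ?thesis using assms by (simp add: emeasure_angle_measure[OF m])
qed

text \<open>Fubini for the joint law of \<open>X \<nu>\<close> and the sum \<open>W\<close> of the
  other variables: for a fixed value \<open>u\<close> of \<open>W\<close> the event requires
  \<open>X \<nu> = y - u \<noteq> 0\<close>, which has probability 0.\<close>

lemma (in prob_space) atomless_sum:
 assumes S: "finite S" "indep_vars (\<lambda>_. borel) X S" and \<nu>: "\<nu> \<in> S"
  and X: "\<And>x. x \<noteq> 0 \<Longrightarrow> measure M {w \<in> space M. X \<nu> w = x} = 0"
 shows "measure M {w \<in> space M. (\<Sum>\<mu>\<in>S. X \<mu> w) = y \<and> X \<nu> w \<noteq> (0 :: real)} = 0"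
proof -
 define W where "W w = (\<Sum>\<mu>\<in>S - {\<nu>}. X \<mu> w)" for w
 have mX: "X \<mu> \<in> borel_measurable M" if "\<mu> \<in> S" for \<mu>
  using S(2) that by (auto simp: indep_vars_def)
 have mW: "W \<in> borel_measurable M" unfolding W_def by (intro borel_measurable_sum mX) auto
 have "insert \<nu> (S - {\<nu>}) = S" using \<nu> by blast
 hence ind: "indep_var borel (X \<nu>) borel W"
  using indep_vars_sum[of "S - {\<nu>}" \<nu> X] S unfolding W_def by simp
 interpret PX: prob_space "distr M borel (X \<nu>)" by (rule prob_space_distr[OF mX[OF \<nu>]])
 interpret PW: prob_space "distr M borel W" by (rule prob_space_distr[OF mW])
 interpret P: pair_prob_space "distr M borel (X \<nu>)" "distr M borel W" ..
 have joint: "distr M borel (X \<nu>) \<Otimes>\<^sub>M distr M borel W = distr M (borel \<Otimes>\<^sub>M borel) (\<lambda>w. (X \<nu> w, W w))"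
  using indep_var_distribution_eq[of borel "X \<nu>" borel W] ind by blast
 define A where "A = {z :: real \<times> real. fst z + snd z = y \<and> fst z \<noteq> 0}"
 have A: "A \<in> sets (borel \<Otimes>\<^sub>M borel)"
 proof -
  have "{z \<in> space (borel \<Otimes>\<^sub>M borel :: (real \<times> real) measure). fst z + snd z = y \<and> fst z \<noteq> 0} \<in> sets (borel \<Otimes>\<^sub>M borel)"
   by measurable
  thus ?thesis by (simp add: A_def space_pair_measure)
 qed
 have "emeasure (distr M borel (X \<nu>)) ((\<lambda>x. (x, u)) -` A) = 0" for u
 proof -
  have sub: "(\<lambda>x. (x, u)) -` A \<subseteq> (if y - u = 0 then {} else {y - u})" by (auto simp: A_def)
  show ?thesis
  proof (cases "y - u = 0")
   case False
   have "emeasure (distr M borel (X \<nu>)) ((\<lambda>x. (x, u)) -` A) \<le> emeasure (distr M borel (X \<nu>)) {y - u}"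
    using sub False by (intro emeasure_mono) auto
   also have "\<dots> = emeasure M {w \<in> space M. X \<nu> w = y - u}"
    using mX[OF \<nu>] by (subst emeasure_distr) (auto intro!: arg_cong[where f = "emeasure M"])
   also have "\<dots> = 0" using X[OF False] by (simp add: emeasure_eq_measure)
   finally show ?thesis by simp
  qed (use sub in auto)
 qed
 hence "emeasure (distr M borel (X \<nu>) \<Otimes>\<^sub>M distr M borel W) A = 0"
  using A by (subst P.emeasure_pair_measure_alt2) simp_all
 hence "emeasure M ((\<lambda>w. (X \<nu> w, W w)) -` A \<inter> space M) = 0"
  unfolding joint using A mX[OF \<nu>] mW by (subst (asm) emeasure_distr) auto
 moreover have "(\<lambda>w. (X \<nu> w, W w)) -` A \<inter> space M = {w \<in> space M. (\<Sum>\<mu>\<in>S. X \<mu> w) = y \<and> X \<nu> w \<noteq> 0}"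
  using S(1) \<nu> by (auto simp: A_def W_def sum.remove[of S \<nu>])
 ultimately show ?thesis by (simp add: measure_def)
qed

text \<open>Convergence of moments gives convergence of the distribution functions at the continuity points
 of the limit. At the only possible atom \<open>0\<close>, the mass is supplied by the points where all \<open>X\<close> vanish.\<close>

lemma moments_imp_limiting_distribution:
 fixes X :: "'i \<Rightarrow> 'k \<Rightarrow> nat \<Rightarrow> real" and Z :: "'k \<Rightarrow> 'w \<Rightarrow> real"
 assumes "prob_space M" and S: "finite S"
  and Zm: "\<And>\<nu>. \<nu> \<in> S \<Longrightarrow> Z \<nu> \<in> borel_measurable M" and Zb: "\<And>\<nu> w. \<nu> \<in> S \<Longrightarrow> \<bar>Z \<nu> w\<bar> \<le> C"
  and N: "eventually (\<lambda>i. N i > 0) L" and G: "eventually (\<lambda>i. G i \<subseteq> {1..N i}) L"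
  and Xb: "eventually (\<lambda>i. \<forall>\<nu>\<in>S. \<forall>j\<in>G i. \<bar>X i \<nu> j\<bar> \<le> C) L"
  and mom: "\<And>k. ((\<lambda>i. (\<Sum>j\<in>G i. \<Prod>\<nu>\<in>S. X i \<nu> j ^ k \<nu>) / real (N i)) \<longlongrightarrow> integral\<^sup>L M (\<lambda>w. \<Prod>\<nu>\<in>S. Z \<nu> w ^ k \<nu>)) L"
  and F: "eventually (\<lambda>i. \<forall>j\<in>G i. F i j = (\<Sum>\<nu>\<in>S. c \<nu> * X i \<nu> j)) L"
  and Y: "Y = (\<lambda>w. \<Sum>\<nu>\<in>S. c \<nu> * Z \<nu> w)"
  and atom: "\<And>y. y \<noteq> 0 \<Longrightarrow> measure M {w \<in> space M. Y w = y} = 0"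
  and G0: "eventually (\<lambda>i. G0 i \<subseteq> {j \<in> G i. \<forall>\<nu>\<in>S. X i \<nu> j = 0}) L"
  and zero: "((\<lambda>i. real (card (G0 i)) / real (N i)) \<longlongrightarrow> z) L" "measure M {w \<in> space M. Y w = 0} \<le> z"
 shows "has_limiting_distribution L N F M Y"
proof -
 interpret prob_space M by fact
 define F' where "F' i j = (\<Sum>\<nu>\<in>S. c \<nu> * X i \<nu> j)" for i j
 define \<Lambda> where "\<Lambda> i g = (\<Sum>j\<in>G i. g (F' i j)) / real (N i)" for i and g :: "real \<Rightarrow> real"
 have Ym: "Y \<in> borel_measurable M" unfolding Y by (intro borel_measurable_sum borel_measurable_times Zm) auto
 define B where "B = (\<Sum>\<nu>\<in>S. \<bar>c \<nu>\<bar> * C)"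
 have Yb: "\<bar>Y w\<bar> \<le> B" for w
  unfolding Y B_def by (rule order_trans[OF sum_abs]) (auto simp: abs_mult intro!: sum_mono mult_left_mono Zb)
 have Fb: "eventually (\<lambda>i. \<forall>j\<in>G i. \<bar>F' i j\<bar> \<le> B) L"
  using Xb by eventually_elim
   (auto simp: F'_def B_def abs_mult intro!: order_trans[OF sum_abs] sum_mono mult_left_mono)
 have int_prod: "integrable M (\<lambda>w. Y w ^ n * (\<Prod>\<nu>\<in>S. Z \<nu> w ^ k \<nu>))" for n k
 proof (rule integrable_const_bound[where B = "B ^ n * (\<Prod>\<nu>\<in>S. C ^ k \<nu>)"])
  show "(\<lambda>w. Y w ^ n * (\<Prod>\<nu>\<in>S. Z \<nu> w ^ k \<nu>)) \<in> borel_measurable M"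
   by (intro borel_measurable_times borel_measurable_power Ym borel_measurable_prod Zm) auto
  have "\<bar>Y w ^ n * (\<Prod>\<nu>\<in>S. Z \<nu> w ^ k \<nu>)\<bar> \<le> B ^ n * (\<Prod>\<nu>\<in>S. C ^ k \<nu>)" for w
   unfolding abs_mult abs_prod power_abs
   by (intro mult_mono power_mono prod_mono Yb conjI) (auto intro!: Zb prod_nonneg power_mono
     order_trans[OF abs_ge_zero Yb] zero_le_power)
  thus "AE w in M. norm (Y w ^ n * (\<Prod>\<nu>\<in>S. Z \<nu> w ^ k \<nu>)) \<le> B ^ n * (\<Prod>\<nu>\<in>S. C ^ k \<nu>)" by simp
 qed
 \<comment> \<open>The induction takes one factor off the power of \<open>F'\<close> and expands it,
   which raises one exponent \<open>k \<nu>\<close>; hence the mixed monomials in the claim.\<close>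
 have step1: "((\<lambda>i. (\<Sum>j\<in>G i. F' i j ^ n * (\<Prod>\<nu>\<in>S. X i \<nu> j ^ k \<nu>)) / real (N i))
   \<longlongrightarrow> integral\<^sup>L M (\<lambda>w. Y w ^ n * (\<Prod>\<nu>\<in>S. Z \<nu> w ^ k \<nu>))) L" for n k
 proof (induction n arbitrary: k)
  case 0
  thus ?case using mom[of k] by simp
 next
  case (Suc n)
  have shift: "x \<nu> * (\<Prod>\<mu>\<in>S. x \<mu> ^ k \<mu>) = (\<Prod>\<mu>\<in>S. x \<mu> ^ (k(\<nu> := Suc (k \<nu>))) \<mu>)" if "\<nu> \<in> S" for x :: "'k \<Rightarrow> real" and \<nu>
  proof -
   have "(\<Prod>\<mu>\<in>S - {\<nu>}. x \<mu> ^ (k(\<nu> := Suc (k \<nu>))) \<mu>) = (\<Prod>\<mu>\<in>S - {\<nu>}. x \<mu> ^ k \<mu>)"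
    by (rule prod.cong) auto
   thus ?thesis using S that by (simp add: prod.remove[of S \<nu>])
  qed
  have expand: "u ^ Suc n * v = (\<Sum>\<nu>\<in>S. c \<nu> * (u ^ n * (\<Prod>\<mu>\<in>S. x \<mu> ^ (k(\<nu> := Suc (k \<nu>))) \<mu>)))"
   if "u = (\<Sum>\<nu>\<in>S. c \<nu> * x \<nu>)" "v = (\<Prod>\<mu>\<in>S. x \<mu> ^ k \<mu>)" for u v and x :: "'k \<Rightarrow> real"
  proof -
   have "u ^ Suc n * v = (\<Sum>\<nu>\<in>S. c \<nu> * x \<nu>) * (u ^ n * v)" using that(1) by simp
   also have "\<dots> = (\<Sum>\<nu>\<in>S. c \<nu> * (u ^ n * (x \<nu> * v)))" by (simp add: sum_distrib_left sum_distrib_right mult_ac)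
   also have "\<dots> = (\<Sum>\<nu>\<in>S. c \<nu> * (u ^ n * (\<Prod>\<mu>\<in>S. x \<mu> ^ (k(\<nu> := Suc (k \<nu>))) \<mu>)))"
    unfolding that(2) by (rule sum.cong) (simp_all only: shift)
   finally show ?thesis .
  qed
  have lhs: "(\<Sum>j\<in>G i. F' i j ^ Suc n * (\<Prod>\<nu>\<in>S. X i \<nu> j ^ k \<nu>)) / real (N i)
   = (\<Sum>\<nu>\<in>S. c \<nu> * ((\<Sum>j\<in>G i. F' i j ^ n * (\<Prod>\<mu>\<in>S. X i \<mu> j ^ (k(\<nu> := Suc (k \<nu>))) \<mu>)) / real (N i)))" for i
  proof -
   have "(\<Sum>j\<in>G i. F' i j ^ Suc n * (\<Prod>\<nu>\<in>S. X i \<nu> j ^ k \<nu>))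
    = (\<Sum>j\<in>G i. \<Sum>\<nu>\<in>S. c \<nu> * (F' i j ^ n * (\<Prod>\<mu>\<in>S. X i \<mu> j ^ (k(\<nu> := Suc (k \<nu>))) \<mu>)))"
    by (intro sum.cong refl expand) (simp_all add: F'_def)
   also have "\<dots> = (\<Sum>\<nu>\<in>S. c \<nu> * (\<Sum>j\<in>G i. F' i j ^ n * (\<Prod>\<mu>\<in>S. X i \<mu> j ^ (k(\<nu> := Suc (k \<nu>))) \<mu>)))"
    by (subst sum.swap) (simp only: sum_distrib_left)
   finally show ?thesis by (simp only: sum_divide_distrib[of _ S] times_divide_eq_right)
  qed
  have "integral\<^sup>L M (\<lambda>w. Y w ^ Suc n * (\<Prod>\<nu>\<in>S. Z \<nu> w ^ k \<nu>))
   = integral\<^sup>L M (\<lambda>w. \<Sum>\<nu>\<in>S. c \<nu> * (Y w ^ n * (\<Prod>\<mu>\<in>S. Z \<mu> w ^ (k(\<nu> := Suc (k \<nu>))) \<mu>)))"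
   by (rule Bochner_Integration.integral_cong[OF refl], rule expand) (simp_all add: Y)
  also have "\<dots> = (\<Sum>\<nu>\<in>S. c \<nu> * integral\<^sup>L M (\<lambda>w. Y w ^ n * (\<Prod>\<mu>\<in>S. Z \<mu> w ^ (k(\<nu> := Suc (k \<nu>))) \<mu>)))"
   by (subst Bochner_Integration.integral_sum) (auto intro!: integrable_mult_right int_prod simp del: fun_upd_apply)
  finally show ?case unfolding lhs by (simp only: tendsto_sum tendsto_mult_left Suc.IH)
 qed
 \<comment> \<open>All values lie in \<open>[-B, B]\<close>, where a continuous function is
   uniformly close to a polynomial.\<close>
 have cont: "((\<lambda>i. \<Lambda> i g) \<longlongrightarrow> integral\<^sup>L M (\<lambda>w. g (Y w))) L" if g: "continuous_on UNIV g" for g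
 proof (rule tendstoI)
  fix \<epsilon> :: real assume \<epsilon>: "\<epsilon> > 0"
  have "continuous_on {- B..B} g" using g continuous_on_subset by blast
  then obtain q where q: "real_polynomial_function q" "\<And>x. x \<in> {- B..B} \<Longrightarrow> \<bar>g x - q x\<bar> < \<epsilon> / 3"
   using Stone_Weierstrass_real_polynomial_function[of "{- B..B}" g "\<epsilon> / 3"] \<epsilon> by auto
  obtain a n where qs: "q = (\<lambda>x. \<Sum>m\<le>n. a m * x ^ m)"
   using q(1) unfolding real_polynomial_function_iff_sum by blast
  have ip: "integrable M (\<lambda>w. Y w ^ m)" for m using int_prod[of m "\<lambda>_. 0"] by simp
  have "((\<lambda>i. \<Sum>m\<le>n. a m * ((\<Sum>j\<in>G i. F' i j ^ m) / real (N i))) \<longlongrightarrow> (\<Sum>m\<le>n. a m * integral\<^sup>L M (\<lambda>w. Y w ^ m))) L"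
   using step1[of _ "\<lambda>_. 0"] by (intro tendsto_sum tendsto_mult_left) simp
  moreover have "(\<Sum>m\<le>n. a m * ((\<Sum>j\<in>G i. F' i j ^ m) / real (N i))) = \<Lambda> i q" for i
   unfolding \<Lambda>_def qs by (subst sum.swap) (simp add: sum_divide_distrib sum_distrib_left)
  moreover have "(\<Sum>m\<le>n. a m * integral\<^sup>L M (\<lambda>w. Y w ^ m)) = integral\<^sup>L M (\<lambda>w. q (Y w))"
   unfolding qs by (subst Bochner_Integration.integral_sum) (auto intro!: ip)
  ultimately have "((\<lambda>i. \<Lambda> i q) \<longlongrightarrow> integral\<^sup>L M (\<lambda>w. q (Y w))) L" by simp
  hence "eventually (\<lambda>i. dist (\<Lambda> i q) (integral\<^sup>L M (\<lambda>w. q (Y w))) < \<epsilon> / 3) L"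
   using \<epsilon> by (intro tendstoD) auto
  moreover have "eventually (\<lambda>i. \<bar>\<Lambda> i g - \<Lambda> i q\<bar> \<le> \<epsilon> / 3) L"
   using Fb N G
  proof eventually_elim
   case (elim i)
   have "\<bar>\<Lambda> i g - \<Lambda> i q\<bar> = \<bar>\<Sum>j\<in>G i. g (F' i j) - q (F' i j)\<bar> / real (N i)"
    by (simp add: \<Lambda>_def sum_subtractf diff_divide_distrib[symmetric])
   also have "\<bar>\<Sum>j\<in>G i. g (F' i j) - q (F' i j)\<bar> \<le> (\<Sum>j\<in>G i. \<epsilon> / 3)"
   proof (rule order_trans[OF sum_abs], rule sum_mono)
    fix j assume "j \<in> G i"
    hence "F' i j \<in> {- B..B}" using elim(1) by (auto simp: abs_le_iff)
    thus "\<bar>g (F' i j) - q (F' i j)\<bar> \<le> \<epsilon> / 3" using q(2) less_imp_le by blast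
   qed
   also have "\<dots> \<le> real (N i) * (\<epsilon> / 3)"
   proof -
    have "card (G i) \<le> card {1..N i}" by (rule card_mono) (use elim in auto)
    thus ?thesis using \<epsilon> by simp
   qed
   finally show ?case using elim(2) by (simp add: divide_right_mono)
  qed
  moreover have close: "\<bar>integral\<^sup>L M (\<lambda>w. g (Y w)) - integral\<^sup>L M (\<lambda>w. q (Y w))\<bar> \<le> \<epsilon> / 3"
  proof -
   have "compact (g ` {- B..B})" by (rule compact_continuous_image) (use g continuous_on_subset in auto)
   hence "bounded (g ` {- B..B})" by (rule compact_imp_bounded)
   then obtain K where "\<forall>x\<in>{- B..B}. \<bar>g x\<bar> \<le> K" by (auto simp: bounded_iff)
   hence K: "\<bar>g x\<bar> \<le> K" if "x \<in> {- B..B}" for x using that by blast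
   have YB: "Y w \<in> {- B..B}" for w using Yb[of w] by (auto simp: abs_le_iff)
   have ig: "integrable M (\<lambda>w. g (Y w))"
   proof (rule integrable_const_bound[where B = K])
    have "g \<in> borel_measurable borel" using g by (rule borel_measurable_continuous_onI)
    thus "(\<lambda>w. g (Y w)) \<in> borel_measurable M" using Ym by (rule measurable_compose[rotated])
   qed (use K YB in auto)
   have iq: "integrable M (\<lambda>w. q (Y w))" unfolding qs by (intro Bochner_Integration.integrable_sum integrable_mult_right ip)
   have "integral\<^sup>L M (\<lambda>w. g (Y w)) - integral\<^sup>L M (\<lambda>w. q (Y w)) = integral\<^sup>L M (\<lambda>w. g (Y w) - q (Y w))"
    using ig iq by simp
   also have "\<bar>\<dots>\<bar> \<le> integral\<^sup>L M (\<lambda>w. \<bar>g (Y w) - q (Y w)\<bar>)" by (rule integral_abs_bound)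
   also have "\<dots> \<le> integral\<^sup>L M (\<lambda>w. \<epsilon> / 3)"
    using ig iq YB q(2) by (intro integral_mono) (auto intro: less_imp_le)
   finally show ?thesis by (simp add: prob_space)
  qed
  ultimately have "eventually (\<lambda>i. dist (\<Lambda> i q) (integral\<^sup>L M (\<lambda>w. q (Y w))) < \<epsilon> / 3 \<and> \<bar>\<Lambda> i g - \<Lambda> i q\<bar> \<le> \<epsilon> / 3) L"
   by (simp only: eventually_conj_iff)
  thus "eventually (\<lambda>i. dist (\<Lambda> i g) (integral\<^sup>L M (\<lambda>w. g (Y w))) < \<epsilon>) L"
   by eventually_elim (use close in \<open>simp only: dist_real_def, linarith\<close>)
 qed
 have card_G: "((\<lambda>i. real (card (G i)) / real (N i)) \<longlongrightarrow> 1) L"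
  using mom[of "\<lambda>_. 0"] by (simp add: prob_space)
 show ?thesis
  unfolding has_limiting_distribution_def
 proof (intro allI)
  fix a b :: real
  define PP where "PP = measure M {w \<in> space M. a \<le> Y w \<and> Y w \<le> b}"
  define cnt where "cnt i = real (card {j \<in> {1..N i}. a \<le> F i j \<and> F i j \<le> b}) / real (N i)" for i
  \<comment> \<open>Continuous piecewise linear functions of slope \<open>n\<close>:
    \<open>h n\<close> approximates the indicator of the closed interval from above,
    \<open>g n\<close> that of the open interval from below.\<close>
  define h where "h n x = max 0 (min 1 (1 + real n * min (x - a) (b - x)))" for n x
  define g where "g n x = max 0 (min 1 (real n * min (x - a) (b - x)))" for n x
  have hc: "continuous_on UNIV (h n)" and gc: "continuous_on UNIV (g n)" for n
   unfolding h_def g_def by (intro continuous_intros)+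
  have lim_large: "eventually (\<lambda>n. real n * u > 1) sequentially" if "u > 0" for u :: real
  proof -
   obtain n0 where "real n0 > 1 / u" using reals_Archimedean2 by blast
   thus ?thesis using that
    by (intro eventually_sequentiallyI[of n0]) (auto simp: field_simps intro: less_le_trans)
  qed
  have h_lim: "(\<lambda>n. h n x) \<longlonglongrightarrow> indicator {a..b} x" for x
  proof (cases "x \<in> {a..b}")
   case True
   hence "h n x = 1" for n by (auto simp: h_def max_def min_def)
   thus ?thesis using True by simp
  next
   case False
   hence "min (x - a) (b - x) < 0" by auto
   hence "eventually (\<lambda>n. real n * - min (x - a) (b - x) > 1) sequentially" by (intro lim_large) simp
   hence "eventually (\<lambda>n. h n x = indicator {a..b} x) sequentially"
    by eventually_elim (use False in \<open>auto simp: h_def\<close>)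
   thus ?thesis by (rule tendsto_eventually)
  qed
  have g_lim: "(\<lambda>n. g n x) \<longlonglongrightarrow> indicator {a<..<b} x" for x
  proof (cases "x \<in> {a<..<b}")
   case True
   hence "eventually (\<lambda>n. real n * min (x - a) (b - x) > 1) sequentially" by (intro lim_large) auto
   hence "eventually (\<lambda>n. g n x = indicator {a<..<b} x) sequentially"
    by eventually_elim (use True in \<open>auto simp: g_def\<close>)
   thus ?thesis by (rule tendsto_eventually)
  next
   case False
   hence "min (x - a) (b - x) \<le> 0" by auto
   hence "g n x = 0" for n
    using mult_nonneg_nonpos[of "real n" "min (x - a) (b - x)"] by (simp add: g_def)
   thus ?thesis using False by simp
  qed
  have mono_lim: "(\<lambda>n. integral\<^sup>L M (\<lambda>w. u n (Y w))) \<longlonglongrightarrow> measure M (Y -` A \<inter> space M)"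
   if "\<And>x. (\<lambda>n. u n x) \<longlonglongrightarrow> indicator A x" "\<And>n x. u n x \<in> {0..1}" "\<And>n. continuous_on UNIV (u n)" "A \<in> sets borel"
   for u :: "nat \<Rightarrow> real \<Rightarrow> real" and A
  proof -
   have "(\<lambda>n. integral\<^sup>L M (\<lambda>w. u n (Y w))) \<longlonglongrightarrow> integral\<^sup>L M (\<lambda>w. indicator A (Y w))"
   proof (rule integral_dominated_convergence[where w = "\<lambda>_. 1"])
    show "(\<lambda>w. u n (Y w)) \<in> borel_measurable M" for n
     using borel_measurable_continuous_onI[OF that(3)] Ym by (rule measurable_compose[rotated])
    show "(\<lambda>w. indicator A (Y w)) \<in> borel_measurable M" using that(4) Ym by measurable
    show "AE w in M. norm (u n (Y w)) \<le> 1" for n using that(2) by auto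
   qed (use that(1) in auto)
   also have "integral\<^sup>L M (\<lambda>w. indicator A (Y w)) = measure M (Y -` A \<inter> space M)"
   proof -
    have "integral\<^sup>L M (\<lambda>w. indicator A (Y w) :: real) = integral\<^sup>L M (indicator (Y -` A \<inter> space M))"
     by (rule Bochner_Integration.integral_cong) (auto simp: indicator_def)
    thus ?thesis using measurable_sets[OF Ym that(4)] by simp
   qed
   finally show ?thesis .
  qed
  have Eh: "(\<lambda>n. integral\<^sup>L M (\<lambda>w. h n (Y w))) \<longlonglongrightarrow> PP"
   using mono_lim[of h "{a..b}", OF h_lim _ hc] by (simp add: h_def PP_def vimage_def Int_def conj_commute)
  define Q where "Q = measure M {w \<in> space M. a < Y w \<and> Y w < b}"
  have Eg: "(\<lambda>n. integral\<^sup>L M (\<lambda>w. g n (Y w))) \<longlonglongrightarrow> Q"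
   using mono_lim[of g "{a<..<b}", OF g_lim _ gc] by (simp add: g_def Q_def vimage_def Int_def conj_commute)
  \<comment> \<open>\<open>D\<close> flags an endpoint at the possible atom 0, the only case in
    which the open and closed intervals can have different limiting mass. There \<open>g n\<close>
    vanishes at 0, and the mass of \<open>G0\<close> is added by hand.\<close>
  define D where "D = (if a \<le> b \<and> (a = 0 \<or> b = 0) then 1 else 0 :: real)"
  have meas: "{w \<in> space M. Y w = y} \<in> sets M" "{w \<in> space M. a < Y w \<and> Y w < b} \<in> sets M" for y using Ym by measurable
  have PQ: "PP \<le> Q + D * z"
  proof (cases "a \<le> b")
   case True
   define A0 where "A0 y = {w \<in> space M. Y w = y}" for y
   have "PP \<le> measure M ({w \<in> space M. a < Y w \<and> Y w < b} \<union> (A0 a \<union> A0 b))"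
    unfolding PP_def A0_def using meas by (intro finite_measure_mono) auto
   also have "\<dots> \<le> Q + measure M (A0 a \<union> A0 b)"
    unfolding Q_def A0_def using meas by (intro measure_Un_le) auto
   also have "measure M (A0 a \<union> A0 b) \<le> D * z"
   proof (cases "a = b")
    case True
    thus ?thesis using atom[of a] zero(2) by (cases "a = 0") (auto simp: A0_def D_def)
   next
    case False
    have "measure M (A0 a \<union> A0 b) \<le> measure M (A0 a) + measure M (A0 b)"
     unfolding A0_def using meas by (intro measure_Un_le) auto
    also have "\<dots> \<le> D * z"
    proof (cases "a = 0 \<or> b = 0")
     case True
     thus ?thesis using atom[of a] atom[of b] zero(2) False \<open>a \<le> b\<close> by (auto simp: A0_def D_def)
    next
     case False
     thus ?thesis using atom[of a] atom[of b] by (simp add: A0_def D_def)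
    qed
    finally show ?thesis .
   qed
   finally show ?thesis by simp
  next
   case False
   hence "{w \<in> space M. a \<le> Y w \<and> Y w \<le> b} = {}" by auto
   hence "PP = 0" unfolding PP_def by (simp only: measure_empty)
   thus ?thesis using False by (simp add: Q_def D_def)
  qed
  have upper: "eventually (\<lambda>i. cnt i \<le> \<Lambda> i (h n) + (1 - real (card (G i)) / real (N i))) L" for n
   using N G F
  proof eventually_elim
   case (elim i)
   have finG: "finite (G i)" using elim(2) finite_subset by blast
   have "{j \<in> {1..N i}. a \<le> F i j \<and> F i j \<le> b} \<subseteq> {j \<in> G i. a \<le> F' i j \<and> F' i j \<le> b} \<union> ({1..N i} - G i)"
    using elim(3) by (auto simp: F'_def)
   hence "card {j \<in> {1..N i}. a \<le> F i j \<and> F i j \<le> b} \<le> card ({j \<in> G i. a \<le> F' i j \<and> F' i j \<le> b} \<union> ({1..N i} - G i))"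
    using finG by (intro card_mono) auto
   also have "\<dots> \<le> card {j \<in> G i. a \<le> F' i j \<and> F' i j \<le> b} + card ({1..N i} - G i)" by (rule card_Un_le)
   also have "card ({1..N i} - G i) = N i - card (G i)" using elim(2) finG by (simp add: card_Diff_subset)
   finally have 1: "real (card {j \<in> {1..N i}. a \<le> F i j \<and> F i j \<le> b}) \<le> real (card {j \<in> G i. a \<le> F' i j \<and> F' i j \<le> b}) + real (N i - card (G i))"
    by linarith
   have "card (G i) \<le> card {1..N i}" by (rule card_mono) (use elim in auto)
   hence 2: "real (N i - card (G i)) = real (N i) - real (card (G i))" by (simp add: of_nat_diff)
   have "real (card {j \<in> G i. a \<le> F' i j \<and> F' i j \<le> b}) = (\<Sum>j\<in>G i. if a \<le> F' i j \<and> F' i j \<le> b then 1 else 0)"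
    using finG by (simp add: sum.If_cases Int_def)
   also have "\<dots> \<le> (\<Sum>j\<in>G i. h n (F' i j))"
    by (rule sum_mono) (auto simp: h_def max_def min_def)
   finally have "real (card {j \<in> {1..N i}. a \<le> F i j \<and> F i j \<le> b}) \<le> (\<Sum>j\<in>G i. h n (F' i j)) + (real (N i) - real (card (G i)))"
    using 1 2 by linarith
   hence "cnt i \<le> ((\<Sum>j\<in>G i. h n (F' i j)) + (real (N i) - real (card (G i)))) / real (N i)"
    unfolding cnt_def by (rule divide_right_mono) simp
   also have "\<dots> = \<Lambda> i (h n) + (1 - real (card (G i)) / real (N i))"
    using elim(1) by (simp add: \<Lambda>_def add_divide_distrib diff_divide_distrib)
   finally show ?case .
  qed
  have lower: "eventually (\<lambda>i. \<Lambda> i (g n) + D * (real (card (G0 i)) / real (N i)) \<le> cnt i) L" for n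
   using N G F G0
  proof eventually_elim
   case (elim i)
   have finG: "finite (G i)" using elim(2) finite_subset by blast
   have "G i \<inter> {j. j \<in> G0 i} = G0 i" using elim(4) by auto
   hence c0: "(\<Sum>j\<in>G i. if j \<in> G0 i then 1 else 0 :: real) = real (card (G0 i))"
    using finG by (simp add: sum.If_cases)
   have "(\<Sum>j\<in>G i. g n (F' i j)) + D * real (card (G0 i))
    = (\<Sum>j\<in>G i. g n (F' i j) + D * (if j \<in> G0 i then 1 else 0))"
    using c0 by (simp add: sum.distrib sum_distrib_left[symmetric])
   also have "\<dots> \<le> (\<Sum>j\<in>G i. if a \<le> F' i j \<and> F' i j \<le> b then 1 else 0)"
   proof (rule sum_mono)
    fix j
    have out: "g n x = 0" if "\<not> (a < x \<and> x < b)" for x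
    proof -
     have "min (x - a) (b - x) \<le> 0" using that by auto
     thus ?thesis using mult_nonneg_nonpos[of "real n" "min (x - a) (b - x)"] by (simp add: g_def)
    qed
    have le1: "g n x \<le> 1" for x by (simp add: g_def)
    show "g n (F' i j) + D * (if j \<in> G0 i then 1 else 0) \<le> (if a \<le> F' i j \<and> F' i j \<le> b then 1 else 0)"
    proof (cases "j \<in> G0 i \<and> D = 1")
     case True
     hence "F' i j = 0" "a \<le> 0" "0 \<le> b" "g n 0 = 0"
      using out[of 0] elim(4) by (auto simp: F'_def D_def subset_iff split: if_splits)
     thus ?thesis using True by simp
    next
     case False
     hence "D * (if j \<in> G0 i then 1 else 0) = 0" by (auto simp: D_def)
     thus ?thesis using out[of "F' i j"] le1[of "F' i j"] by auto
    qed
   qed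
   also have "\<dots> = real (card {j \<in> G i. a \<le> F' i j \<and> F' i j \<le> b})"
    using finG by (simp add: sum.If_cases Int_def)
   also have "\<dots> \<le> real (card {j \<in> {1..N i}. a \<le> F i j \<and> F i j \<le> b})"
    using elim(2,3) by (intro of_nat_mono card_mono) (auto simp: F'_def)
   finally have "((\<Sum>j\<in>G i. g n (F' i j)) + D * real (card (G0 i))) / real (N i) \<le> cnt i"
    unfolding cnt_def by (rule divide_right_mono) simp
   thus ?case by (simp add: \<Lambda>_def add_divide_distrib)
  qed
  have "(cnt \<longlongrightarrow> PP) L"
  proof (rule order_tendstoI)
   fix y assume "y < PP"
   hence "y - D * z < Q" using PQ by linarith
   then obtain n where n: "y - D * z < integral\<^sup>L M (\<lambda>w. g n (Y w))"
    using order_tendstoD(1)[OF Eg] by (meson eventually_happens trivial_limit_sequentially)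
   have "((\<lambda>i. \<Lambda> i (g n) + D * (real (card (G0 i)) / real (N i))) \<longlongrightarrow> integral\<^sup>L M (\<lambda>w. g n (Y w)) + D * z) L"
    by (intro tendsto_add cont gc tendsto_mult_left zero(1))
   hence "eventually (\<lambda>i. y < \<Lambda> i (g n) + D * (real (card (G0 i)) / real (N i))) L"
    using n by (intro order_tendstoD(1)) auto
   thus "eventually (\<lambda>i. y < cnt i) L" using lower[of n] by eventually_elim linarith
  next
   fix y assume "PP < y"
   then obtain n where n: "integral\<^sup>L M (\<lambda>w. h n (Y w)) < y"
    using order_tendstoD(2)[OF Eh] by (meson eventually_happens trivial_limit_sequentially)
   have "((\<lambda>i. \<Lambda> i (h n) + (1 - real (card (G i)) / real (N i))) \<longlongrightarrow> integral\<^sup>L M (\<lambda>w. h n (Y w)) + (1 - 1)) L"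
    by (intro tendsto_add cont hc tendsto_diff tendsto_const card_G)
   hence "eventually (\<lambda>i. \<Lambda> i (h n) + (1 - real (card (G i)) / real (N i)) < y) L"
    using n by (intro order_tendstoD(2)) auto
   thus "eventually (\<lambda>i. cnt i < y) L" using upper[of n] by eventually_elim linarith
  qed
  thus "((\<lambda>i. real (card {j \<in> {1..N i}. a \<le> F i j \<and> F i j \<le> b}) / real (N i))
    \<longlongrightarrow> measure M {w \<in> space M. a \<le> Y w \<and> Y w \<le> b}) L"
   unfolding cnt_def PP_def .
 qed
qed

context prob_space
begin

context
 fixes S :: "'k set" and Y :: "'a \<Rightarrow> real" and \<theta> :: "'k \<Rightarrow> 'a \<Rightarrow> real" and c :: "'k \<Rightarrow> real"
 assumes S: "finite S" and ind: "indep_vars (\<lambda>_. borel) \<theta> S"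
  and dist: "\<And>\<nu>. \<nu> \<in> S \<Longrightarrow> distr M borel (\<theta> \<nu>) = angle_measure"
  and Y: "Y = (\<lambda>w. \<Sum>\<mu>\<in>S. c \<mu> * (2 * cos (\<theta> \<mu> w)))"
  and c: "\<And>\<nu>. \<nu> \<in> S \<Longrightarrow> c \<nu> \<noteq> 0"
begin

lemma angle_measurable: "\<nu> \<in> S \<Longrightarrow> \<theta> \<nu> \<in> borel_measurable M"
 using ind by (auto simp: indep_vars_def)

lemma angle_prob:
 assumes "\<nu> \<in> S" "{x. Q x} \<in> sets borel"
 shows "prob {w \<in> space M. Q (\<theta> \<nu> w)} = measure angle_measure {x. Q x}"
proof -
 have "measure angle_measure {x. Q x} = measure (distr M borel (\<theta> \<nu>)) {x. Q x}" using dist[OF assms(1)] by simp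
 also have "\<dots> = prob (\<theta> \<nu> -` {x. Q x} \<inter> space M)"
  by (rule measure_distr[OF angle_measurable[OF assms(1)] assms(2)])
 also have "\<theta> \<nu> -` {x. Q x} \<inter> space M = {w \<in> space M. Q (\<theta> \<nu> w)}" by auto
 finally show ?thesis by simp
qed

lemma angles_moment:
 "expectation (\<lambda>w. \<Prod>\<nu>\<in>S. (2 * cos (\<theta> \<nu> w)) ^ \<kappa> \<nu>) = (\<Prod>\<nu>\<in>S. (0 ^ \<kappa> \<nu> + central (\<kappa> \<nu>)) / 2)"
proof -
 have m: "(\<lambda>x :: real. (2 * cos x) ^ n) \<in> borel_measurable borel" for n by measurable
 have "indep_vars (\<lambda>_. borel) (\<lambda>\<nu> w. (2 * cos (\<theta> \<nu> w)) ^ \<kappa> \<nu>) S"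
  by (rule indep_vars_compose2[OF ind]) (rule m)
 moreover have "integrable M (\<lambda>w. (2 * cos (\<theta> \<nu> w)) ^ \<kappa> \<nu>)" if "\<nu> \<in> S" for \<nu>
 proof (rule integrable_const_bound[where B = "2 ^ \<kappa> \<nu>"])
  have "\<bar>(2 * cos x) ^ \<kappa> \<nu>\<bar> \<le> 2 ^ \<kappa> \<nu>" for x :: real
   unfolding power_abs by (intro power_mono) (auto simp: abs_mult)
  thus "AE w in M. norm ((2 * cos (\<theta> \<nu> w)) ^ \<kappa> \<nu>) \<le> 2 ^ \<kappa> \<nu>" by simp
  show "(\<lambda>w. (2 * cos (\<theta> \<nu> w)) ^ \<kappa> \<nu>) \<in> borel_measurable M"
   by (rule measurable_compose[OF angle_measurable[OF that] m])
 qed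
 ultimately have "expectation (\<lambda>w. \<Prod>\<nu>\<in>S. (2 * cos (\<theta> \<nu> w)) ^ \<kappa> \<nu>) = (\<Prod>\<nu>\<in>S. expectation (\<lambda>w. (2 * cos (\<theta> \<nu> w)) ^ \<kappa> \<nu>))"
  using S by (intro indep_vars_lebesgue_integral) auto
 also have "\<dots> = (\<Prod>\<nu>\<in>S. (0 ^ \<kappa> \<nu> + central (\<kappa> \<nu>)) / 2)"
 proof (rule prod.cong[OF refl])
  fix \<nu> assume \<nu>: "\<nu> \<in> S"
  show "expectation (\<lambda>w. (2 * cos (\<theta> \<nu> w)) ^ \<kappa> \<nu>) = (0 ^ \<kappa> \<nu> + central (\<kappa> \<nu>)) / 2"
   using integral_distr[OF angle_measurable[OF \<nu>] m, of "\<kappa> \<nu>"] unfolding dist[OF \<nu>] angle_moment by (rule sym)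
 qed
 finally show ?thesis .
qed

lemma no_atom_part:
 assumes "\<nu> \<in> S"
 shows "prob {w \<in> space M. Y w = y \<and> cos (\<theta> \<nu> w) \<noteq> 0} = 0"
proof -
 have m: "(\<lambda>x :: real. a * (2 * cos x)) \<in> borel_measurable borel" for a by measurable
 have "indep_vars (\<lambda>_. borel) (\<lambda>\<nu> w. c \<nu> * (2 * cos (\<theta> \<nu> w))) S"
  by (rule indep_vars_compose2[OF ind]) (rule m)
 moreover have "prob {w \<in> space M. c \<nu> * (2 * cos (\<theta> \<nu> w)) = x} = 0" if "x \<noteq> 0" for x
 proof -
  have "{x' :: real. c \<nu> * (2 * cos x') = x} \<in> sets borel" by measurable
  hence "prob {w \<in> space M. c \<nu> * (2 * cos (\<theta> \<nu> w)) = x} = measure angle_measure {x'. c \<nu> * (2 * cos x') = x}"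
   by (rule angle_prob[OF assms])
  thus ?thesis using angle_cos_nonzero[OF that, of "c \<nu> * 2"] by (simp add: measure_def mult.assoc)
 qed
 ultimately have "prob {w \<in> space M. (\<Sum>\<mu>\<in>S. c \<mu> * (2 * cos (\<theta> \<mu> w))) = y \<and> c \<nu> * (2 * cos (\<theta> \<nu> w)) \<noteq> 0} = 0"
  by (rule atomless_sum[OF S _ assms])
 thus ?thesis unfolding Y using c[OF assms] by simp
qed

lemma angle_sum_measurable: "Y \<in> borel_measurable M"
 unfolding Y
proof (rule borel_measurable_sum)
 fix \<mu> assume "\<mu> \<in> S"
 have "(\<lambda>x :: real. c \<mu> * (2 * cos x)) \<in> borel_measurable borel" by measurable
 thus "(\<lambda>w. c \<mu> * (2 * cos (\<theta> \<mu> w))) \<in> borel_measurable M"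
  by (rule measurable_compose[OF angle_measurable[OF \<open>\<mu> \<in> S\<close>]])
qed

lemma no_atom_union:
 "prob (\<Union>\<nu>\<in>S. {w \<in> space M. Y w = y \<and> cos (\<theta> \<nu> w) \<noteq> 0}) = 0" (is "prob (\<Union>\<nu>\<in>S. ?B \<nu>) = 0")
  and no_atom_sets: "\<And>\<nu>. \<nu> \<in> S \<Longrightarrow> {w \<in> space M. Y w = y \<and> cos (\<theta> \<nu> w) \<noteq> 0} \<in> events"
proof -
 show B: "?B \<nu> \<in> events" if "\<nu> \<in> S" for \<nu>
  using angle_sum_measurable angle_measurable[OF that] by measurable
 have "prob (\<Union>\<nu>\<in>S. ?B \<nu>) \<le> (\<Sum>\<nu>\<in>S. prob (?B \<nu>))"
  using B S by (intro finite_measure_subadditive_finite) auto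
 thus "prob (\<Union>\<nu>\<in>S. ?B \<nu>) = 0"
  using no_atom_part measure_nonneg[of M "\<Union>\<nu>\<in>S. ?B \<nu>"] by simp
qed

lemma angles_no_atom:
 assumes "y \<noteq> 0"
 shows "prob {w \<in> space M. Y w = y} = 0"
proof -
 have "{w \<in> space M. Y w = y}
  \<subseteq> (\<Union>\<nu>\<in>S. {w \<in> space M. Y w = y \<and> cos (\<theta> \<nu> w) \<noteq> 0})"
 proof (rule subsetI)
  fix w assume w: "w \<in> {w \<in> space M. Y w = y}"
  have "\<exists>\<nu>\<in>S. cos (\<theta> \<nu> w) \<noteq> 0"
  proof (rule ccontr)
   assume "\<not> (\<exists>\<nu>\<in>S. cos (\<theta> \<nu> w) \<noteq> 0)"
   hence "Y w = 0" unfolding Y by (intro sum.neutral) auto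
   thus False using w assms by simp
  qed
  thus "w \<in> (\<Union>\<nu>\<in>S. {w \<in> space M. Y w = y \<and> cos (\<theta> \<nu> w) \<noteq> 0})" using w by blast
 qed
 hence "prob {w \<in> space M. Y w = y} \<le> prob (\<Union>\<nu>\<in>S. {w \<in> space M. Y w = y \<and> cos (\<theta> \<nu> w) \<noteq> 0})"
  using S no_atom_sets by (intro finite_measure_mono sets.finite_UN) auto
 hence "prob {w \<in> space M. Y w = y} \<le> 0" by (simp only: no_atom_union)
 thus ?thesis using measure_nonneg by (metis order_antisym)
qed

text \<open>Up to a null set the sum vanishes only if all the cosines do, and these are independent
  events of probability \<open>1/2\<close>.\<close>

lemma angles_zero: "prob {w \<in> space M. Y w = 0} \<le> 1 / 2 ^ card S"
proof (cases "S = {}")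
 case True
 thus ?thesis by simp
next
 case False
 define Z where "Z = (\<Inter>\<nu>\<in>S. \<theta> \<nu> -` {x. cos x = 0} \<inter> space M)"
 define B where "B = (\<Union>\<nu>\<in>S. {w \<in> space M. Y w = 0 \<and> cos (\<theta> \<nu> w) \<noteq> 0})"
 have m: "{x :: real. cos x = 0} \<in> sets borel" by measurable
 have Zm: "Z \<in> events"
  unfolding Z_def using S False m by (intro sets.finite_INT measurable_sets[OF angle_measurable]) auto
 have Bm: "B \<in> events" unfolding B_def using S no_atom_sets by (intro sets.finite_UN) auto
 have "prob Z = (\<Prod>\<nu>\<in>S. prob (\<theta> \<nu> -` {x. cos x = 0} \<inter> space M))"
  unfolding Z_def by (rule indep_varsD_finite[OF ind False S m])
 also have "\<dots> = (\<Prod>\<nu>\<in>S. 1 / 2)"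
 proof (rule prod.cong[OF refl])
  fix \<nu> assume "\<nu> \<in> S"
  have "\<theta> \<nu> -` {x. cos x = 0} \<inter> space M = {w \<in> space M. cos (\<theta> \<nu> w) = 0}" by auto
  moreover have "measure angle_measure {x. cos x = 0} = 1 / 2"
   unfolding measure_def angle_cos_zero by (simp del: ennreal_half)
  ultimately show "prob (\<theta> \<nu> -` {x. cos x = 0} \<inter> space M) = 1 / 2"
   using angle_prob[OF \<open>\<nu> \<in> S\<close> m] by simp
 qed
 finally have Z: "prob Z = 1 / 2 ^ card S" by (simp add: power_one_over)
 have "{w \<in> space M. Y w = 0} \<subseteq> Z \<union> B"
 proof (rule subsetI)
  fix w assume w: "w \<in> {w \<in> space M. Y w = 0}"
  show "w \<in> Z \<union> B"
  proof (cases "\<forall>\<nu>\<in>S. cos (\<theta> \<nu> w) = 0")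
   case True
   hence "w \<in> Z" using w False by (simp add: Z_def)
   thus ?thesis by blast
  next
   case False
   hence "w \<in> B" using w unfolding B_def by blast
   thus ?thesis by blast
  qed
 qed
 hence "prob {w \<in> space M. Y w = 0} \<le> prob (Z \<union> B)"
  using Zm Bm by (intro finite_measure_mono) auto
 also have "\<dots> \<le> prob Z + prob B" using Zm Bm by (rule measure_Un_le)
 finally show ?thesis using Z no_atom_union[of 0] by (simp add: B_def)
qed

end

end

section \<open>Moments over the Hecke eigenfunctions\<close>

lemma central_bounds: "0 \<le> central k" "central k \<le> 2 ^ k"
proof -
 show "0 \<le> central k" unfolding central_def by (intro sum_nonneg) auto
 have "central k \<le> (\<Sum>a\<le>k. real (k choose a))" unfolding central_def by (intro sum_mono) auto
 also have "\<dots> = real (\<Sum>a\<le>k. k choose a)" by simp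
 also have "\<dots> = 2 ^ k" by (simp only: choose_row_sum) simp
 finally show "central k \<le> 2 ^ k" .
qed

lemma central_0 [simp]: "central 0 = 1"
 by (simp add: central_def)

text \<open>Expanding \<open>2 * Re w = w + cnj w\<close> by the binomial theorem,
  \<open>weyl\<close> kills every exponent pattern except
  \<open>2 * a \<nu> = \<kappa> \<nu>\<close>, for which the monomial is 1.\<close>

lemma fibre_moment:
 fixes w :: "'k \<Rightarrow> nat \<Rightarrow> complex"
 assumes R: "finite R" and w: "\<And>\<nu> j. \<nu> \<in> R \<Longrightarrow> j \<in> J \<Longrightarrow> norm (w \<nu> j) = 1"
  and weyl: "\<And>a. a \<in> PiE R (\<lambda>\<nu>. {..\<kappa> \<nu>}) \<Longrightarrow> \<exists>\<nu>\<in>R. a \<nu> \<noteq> \<kappa> \<nu> - a \<nu> \<Longrightarrow>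
   (\<Sum>j\<in>J. \<Prod>\<nu>\<in>R. w \<nu> j ^ a \<nu> * cnj (w \<nu> j) ^ (\<kappa> \<nu> - a \<nu>)) = 0"
 shows "(\<Sum>j\<in>J. \<Prod>\<nu>\<in>R. (2 * Re (w \<nu> j)) ^ \<kappa> \<nu>) = real (card J) * (\<Prod>\<nu>\<in>R. central (\<kappa> \<nu>))"
proof -
 define W where "W j a = (\<Prod>\<nu>\<in>R. w \<nu> j ^ a \<nu> * cnj (w \<nu> j) ^ (\<kappa> \<nu> - a \<nu>))" for j and a :: "'k \<Rightarrow> nat"
 define B where "B a = (\<Prod>\<nu>\<in>R. of_nat (\<kappa> \<nu> choose a \<nu>) :: complex)" for a :: "'k \<Rightarrow> nat"
 have row: "complex_of_real (\<Prod>\<nu>\<in>R. (2 * Re (w \<nu> j)) ^ \<kappa> \<nu>) = (\<Sum>a\<in>PiE R (\<lambda>\<nu>. {..\<kappa> \<nu>}). B a * W j a)" for j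
 proof -
  have "complex_of_real (2 * Re z) = z + cnj z" for z by (simp add: complex_eq_iff)
  hence "complex_of_real ((2 * Re z) ^ n) = (\<Sum>a\<le>n. of_nat (n choose a) * (z ^ a * cnj z ^ (n - a)))" for z n
   unfolding of_real_power by (simp only: binomial_ring mult.assoc)
  hence "complex_of_real (\<Prod>\<nu>\<in>R. (2 * Re (w \<nu> j)) ^ \<kappa> \<nu>)
   = (\<Prod>\<nu>\<in>R. \<Sum>a\<le>\<kappa> \<nu>. of_nat (\<kappa> \<nu> choose a) * (w \<nu> j ^ a * cnj (w \<nu> j) ^ (\<kappa> \<nu> - a)))"
   by (simp only: of_real_prod)
  also have "\<dots> = (\<Sum>a\<in>PiE R (\<lambda>\<nu>. {..\<kappa> \<nu>}). \<Prod>\<nu>\<in>R. of_nat (\<kappa> \<nu> choose a \<nu>) * (w \<nu> j ^ a \<nu> * cnj (w \<nu> j) ^ (\<kappa> \<nu> - a \<nu>)))"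
   by (rule prod_sum_PiE) (use R in auto)
  finally show ?thesis by (simp only: B_def W_def prod.distrib)
 qed
 have col: "B a * (\<Sum>j\<in>J. W j a) = of_nat (card J) * complex_of_real (\<Prod>\<nu>\<in>R. if 2 * a \<nu> = \<kappa> \<nu> then real (\<kappa> \<nu> choose a \<nu>) else 0)"
  if a: "a \<in> PiE R (\<lambda>\<nu>. {..\<kappa> \<nu>})" for a
 proof (cases "\<forall>\<nu>\<in>R. 2 * a \<nu> = \<kappa> \<nu>")
  case True
  have "W j a = 1" if "j \<in> J" for j
  proof -
   have "w \<nu> j ^ a \<nu> * cnj (w \<nu> j) ^ (\<kappa> \<nu> - a \<nu>) = 1" if "\<nu> \<in> R" for \<nu>
   proof -
    have "\<kappa> \<nu> - a \<nu> = a \<nu>" using True that by fastforce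
    moreover have "w \<nu> j * cnj (w \<nu> j) = 1" using w[OF that \<open>j \<in> J\<close>] by (simp flip: complex_norm_square)
    ultimately show ?thesis by (simp flip: power_mult_distrib)
   qed
   thus ?thesis unfolding W_def by (intro prod.neutral) auto
  qed
  thus ?thesis using True by (simp add: B_def)
 next
  case False
  then obtain \<nu> where \<nu>: "\<nu> \<in> R" "2 * a \<nu> \<noteq> \<kappa> \<nu>" by blast
  have "a \<nu> \<le> \<kappa> \<nu>" using a \<nu>(1) by (auto simp: PiE_iff)
  hence "\<exists>\<nu>\<in>R. a \<nu> \<noteq> \<kappa> \<nu> - a \<nu>" using \<nu> by (intro bexI[of _ \<nu>]) linarith+
  hence "(\<Sum>j\<in>J. W j a) = 0" using weyl[OF a] by (simp add: W_def)
  moreover have "(\<Prod>\<nu>\<in>R. if 2 * a \<nu> = \<kappa> \<nu> then real (\<kappa> \<nu> choose a \<nu>) else 0) = 0"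
   using R \<nu> by (intro prod_zero) auto
  ultimately show ?thesis by simp
 qed
 have "complex_of_real (\<Sum>j\<in>J. \<Prod>\<nu>\<in>R. (2 * Re (w \<nu> j)) ^ \<kappa> \<nu>) = (\<Sum>a\<in>PiE R (\<lambda>\<nu>. {..\<kappa> \<nu>}). B a * (\<Sum>j\<in>J. W j a))"
  unfolding of_real_sum row by (subst sum.swap) (simp only: sum_distrib_left)
 also have "\<dots> = of_nat (card J) * complex_of_real (\<Sum>a\<in>PiE R (\<lambda>\<nu>. {..\<kappa> \<nu>}). \<Prod>\<nu>\<in>R. if 2 * a \<nu> = \<kappa> \<nu> then real (\<kappa> \<nu> choose a \<nu>) else 0)"
 proof -
  have "(\<Sum>a\<in>PiE R (\<lambda>\<nu>. {..\<kappa> \<nu>}). B a * (\<Sum>j\<in>J. W j a)) = (\<Sum>a\<in>PiE R (\<lambda>\<nu>. {..\<kappa> \<nu>}). of_nat (card J)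
    * complex_of_real (\<Prod>\<nu>\<in>R. if 2 * a \<nu> = \<kappa> \<nu> then real (\<kappa> \<nu> choose a \<nu>) else 0))"
   by (rule sum.cong[OF refl], erule col)
  thus ?thesis by (simp only: of_real_sum sum_distrib_left)
 qed
 also have "(\<Sum>a\<in>PiE R (\<lambda>\<nu>. {..\<kappa> \<nu>}). \<Prod>\<nu>\<in>R. if 2 * a \<nu> = \<kappa> \<nu> then real (\<kappa> \<nu> choose a \<nu>) else 0) = (\<Prod>\<nu>\<in>R. central (\<kappa> \<nu>))"
  unfolding central_def by (rule prod_sum_PiE[symmetric]) (use R in auto)
 finally have "complex_of_real (\<Sum>j\<in>J. \<Prod>\<nu>\<in>R. (2 * Re (w \<nu> j)) ^ \<kappa> \<nu>)
  = complex_of_real (real (card J) * (\<Prod>\<nu>\<in>R. central (\<kappa> \<nu>)))" by simp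
 thus ?thesis by (simp only: of_real_eq_iff)
qed

definition Tset :: "int set \<Rightarrow> nat \<Rightarrow> int set" where
 "Tset S p = {t \<in> {0..<int p}. \<not> int p dvd t \<and> (\<forall>\<nu>\<in>S. \<not> int p dvd \<nu> - 4 * t)}"

definition Lp :: "int \<Rightarrow> nat \<Rightarrow> int \<Rightarrow> int \<Rightarrow> int" where
 "Lp D p \<nu> t = Legendre (D * \<nu> * (\<nu> - 4 * t)) (int p)"

text \<open>The data of one prime on which the limit argument rests: \<open>G\<close>,
  \<open>\<tau>\<close> and \<open>w\<close> as in \<open>spectral_data\<close>, the size
  \<open>m\<close> of a fibre, and the factor \<open>\<rho>\<close>, which will be
  \<open>p^l / card norm_one\<close>, between the normalised matrix element and
  \<open>2 * Re w\<close>. The two final bounds force \<open>\<rho>\<close> to 1.\<close>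

definition level_data :: "int \<Rightarrow> int set \<Rightarrow> nat \<Rightarrow> nat \<Rightarrow> (int \<Rightarrow> nat \<Rightarrow> real) \<Rightarrow> nat set \<Rightarrow> (nat \<Rightarrow> int)
  \<Rightarrow> (int \<Rightarrow> nat \<Rightarrow> complex) \<Rightarrow> nat \<Rightarrow> real \<Rightarrow> bool" where
 "level_data D S p N X G \<tau> w m \<rho> \<longleftrightarrow> G \<subseteq> {1..N} \<and> (\<forall>j\<in>G. \<tau> j \<in> Tset S p)
   \<and> (\<forall>t\<in>Tset S p. card {j \<in> G. \<tau> j = t} = m)
   \<and> (\<forall>\<nu>\<in>S. \<forall>j\<in>G. X \<nu> j = (if Lp D p \<nu> (\<tau> j) = 1 then \<rho> * (2 * Re (w \<nu> j)) else 0))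
   \<and> (\<forall>\<nu>\<in>S. \<forall>j\<in>G. Lp D p \<nu> (\<tau> j) = 1 \<longrightarrow> norm (w \<nu> j) = 1)
   \<and> (\<forall>R a b Pl t. R \<subseteq> S \<longrightarrow> relation_poly R a b Pl \<longrightarrow> t \<in> Tset S p \<longrightarrow> (\<forall>\<nu>\<in>R. Lp D p \<nu> t = 1) \<longrightarrow>
     \<not> int p dvd poly Pl t \<longrightarrow> (\<Sum>j | j \<in> G \<and> \<tau> j = t. \<Prod>\<nu>\<in>R. w \<nu> j ^ a \<nu> * cnj (w \<nu> j) ^ b \<nu>) = 0)
   \<and> real m * real p * \<rho> = real N \<and> 1 - 1 / p \<le> \<rho> \<and> \<rho> * (1 - 2 / p) \<le> 1 - 1 / p"

lemmas level_dataD = level_data_def[THEN iffD1, THEN conjunct1]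
 level_data_def[THEN iffD1, THEN conjunct2, THEN conjunct1]
 level_data_def[THEN iffD1, THEN conjunct2, THEN conjunct2, THEN conjunct1]
 level_data_def[THEN iffD1, THEN conjunct2, THEN conjunct2, THEN conjunct2, THEN conjunct1]
 level_data_def[THEN iffD1, THEN conjunct2, THEN conjunct2, THEN conjunct2, THEN conjunct2, THEN conjunct1]
 level_data_def[THEN iffD1, THEN conjunct2, THEN conjunct2, THEN conjunct2, THEN conjunct2, THEN conjunct2, THEN conjunct1]
 level_data_def[THEN iffD1, THEN conjunct2, THEN conjunct2, THEN conjunct2, THEN conjunct2, THEN conjunct2, THEN conjunct2, THEN conjunct1]
 level_data_def[THEN iffD1, THEN conjunct2, THEN conjunct2, THEN conjunct2, THEN conjunct2, THEN conjunct2, THEN conjunct2, THEN conjunct2, THEN conjunct1]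
 level_data_def[THEN iffD1, THEN conjunct2, THEN conjunct2, THEN conjunct2, THEN conjunct2, THEN conjunct2, THEN conjunct2, THEN conjunct2, THEN conjunct2]

lemma finite_Tset [simp]: "finite (Tset S p)"
 by (rule finite_subset[of _ "{0..<int p}"]) (auto simp: Tset_def)

text \<open>Only finitely many exponent patterns occur in a fixed moment, so the product of their
  relation polynomials serves all of them.\<close>

lemma moment_relation:
 fixes R :: "int set"
 assumes R: "finite R" "0 \<notin> R"
 obtains Pl :: "int poly" where "Pl \<noteq> 0"
  "\<forall>a\<in>PiE R (\<lambda>\<nu>. {..\<kappa> \<nu>}). (\<exists>\<nu>\<in>R. a \<nu> \<noteq> \<kappa> \<nu> - a \<nu>) \<longrightarrow>
    (\<exists>q. q dvd Pl \<and> relation_poly R a (\<lambda>\<nu>. \<kappa> \<nu> - a \<nu>) q)"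
proof -
 define I where "I = {a \<in> PiE R (\<lambda>\<nu>. {..\<kappa> \<nu>}). \<exists>\<nu>\<in>R. a \<nu> \<noteq> \<kappa> \<nu> - a \<nu>}"
 have "\<exists>Pl. Pl \<noteq> 0 \<and> relation_poly R a (\<lambda>\<nu>. \<kappa> \<nu> - a \<nu>) Pl" if "a \<in> I" for a
 proof -
  have "\<exists>\<nu>\<in>R. a \<nu> \<noteq> \<kappa> \<nu> - a \<nu>" using that by (simp add: I_def)
  from multiplicative_relation[OF R this] show ?thesis by metis
 qed
 then obtain h where h: "\<And>a. a \<in> I \<Longrightarrow> h a \<noteq> 0 \<and> relation_poly R a (\<lambda>\<nu>. \<kappa> \<nu> - a \<nu>) (h a)" by metis
 have I: "finite I" using R(1) by (simp add: I_def finite_PiE)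
 show ?thesis
 proof (rule that[of "prod h I"])
  show "prod h I \<noteq> 0" using h I by (simp add: prod_zero_iff)
  show "\<forall>a\<in>PiE R (\<lambda>\<nu>. {..\<kappa> \<nu>}). (\<exists>\<nu>\<in>R. a \<nu> \<noteq> \<kappa> \<nu> - a \<nu>) \<longrightarrow>
    (\<exists>q. q dvd prod h I \<and> relation_poly R a (\<lambda>\<nu>. \<kappa> \<nu> - a \<nu>) q)"
  proof (intro ballI impI)
   fix a assume "a \<in> PiE R (\<lambda>\<nu>. {..\<kappa> \<nu>})" "\<exists>\<nu>\<in>R. a \<nu> \<noteq> \<kappa> \<nu> - a \<nu>"
   hence a: "a \<in> I" by (simp add: I_def)
   show "\<exists>q. q dvd prod h I \<and> relation_poly R a (\<lambda>\<nu>. \<kappa> \<nu> - a \<nu>) q"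
    using h[OF a] dvd_prodI[OF I a, of h] by blast
  qed
 qed
qed

text \<open>The sum is split into the fibres of \<open>\<tau>\<close>. Only symbols with
  \<open>\<kappa> \<nu> \<noteq> 0\<close> matter, since the power with exponent 0 is 1 whatever the
  symbol; the fibres over roots of \<open>Pl\<close> modulo \<open>p\<close> are estimated
  trivially.\<close>

lemma level_moment:
 assumes lev: "level_data D S p N X G \<tau> w m \<rho>" and S': "finite S'" "S' \<subseteq> S" and \<rho>: "\<rho> \<ge> 0"
  and R: "R = {\<nu> \<in> S'. \<kappa> \<nu> \<noteq> 0}" and K: "K = sum \<kappa> S'"
  and rel: "\<And>a. a \<in> PiE R (\<lambda>\<nu>. {..\<kappa> \<nu>}) \<Longrightarrow> \<exists>\<nu>\<in>R. a \<nu> \<noteq> \<kappa> \<nu> - a \<nu> \<Longrightarrow>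
    \<exists>q. q dvd Pl \<and> relation_poly R a (\<lambda>\<nu>. \<kappa> \<nu> - a \<nu>) q"
 shows "\<bar>(\<Sum>j\<in>G. \<Prod>\<nu>\<in>S'. X \<nu> j ^ \<kappa> \<nu>)
   - \<rho> ^ K * real m * (\<Prod>\<nu>\<in>R. central (\<kappa> \<nu>)) * card {t \<in> Tset S p. \<forall>\<nu>\<in>R. Lp D p \<nu> t = 1}\<bar>
  \<le> 2 * \<rho> ^ K * real m * 2 ^ K * card {t \<in> {0..<int p}. int p dvd poly Pl t}"
proof -
 define c where "c = (\<Prod>\<nu>\<in>R. central (\<kappa> \<nu>))"
 define J where "J t = {j \<in> G. \<tau> j = t}" for t
 have finG: "finite G" and \<tau>: "\<tau> ` G \<subseteq> Tset S p"
  using level_dataD(1,2)[OF lev] finite_subset by auto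
 have cardJ: "card (J t) = m" if "t \<in> Tset S p" for t using level_dataD(3)[OF lev] that unfolding J_def by blast
 have finR: "finite R" "R \<subseteq> S'" "R \<subseteq> S" using R S' by auto
 have KR: "sum \<kappa> R = K" unfolding K R using S'(1) by (intro sum.mono_neutral_left) auto
 have prodR: "(\<Prod>\<nu>\<in>R. 2 ^ \<kappa> \<nu> :: real) = 2 ^ K" "(\<Prod>\<nu>\<in>R. \<rho> ^ \<kappa> \<nu>) = \<rho> ^ K"
  by (simp_all add: power_sum KR[symmetric])
 have c: "0 \<le> c" "c \<le> 2 ^ K"
  unfolding c_def prodR(1)[symmetric] by (auto intro!: prod_nonneg prod_mono central_bounds)
 define ok where "ok t \<longleftrightarrow> (\<forall>\<nu>\<in>R. Lp D p \<nu> t = 1)" for t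
 define bad where "bad t \<longleftrightarrow> int p dvd poly Pl t" for t
 have weyl: "(\<Sum>j\<in>J t. \<Prod>\<nu>\<in>R. w \<nu> j ^ a \<nu> * cnj (w \<nu> j) ^ (\<kappa> \<nu> - a \<nu>)) = 0"
  if a: "t \<in> Tset S p" "ok t" "\<not> bad t" "a \<in> PiE R (\<lambda>\<nu>. {..\<kappa> \<nu>})" "\<exists>\<nu>\<in>R. a \<nu> \<noteq> \<kappa> \<nu> - a \<nu>" for t a
 proof -
  obtain q where q: "q dvd Pl" "relation_poly R a (\<lambda>\<nu>. \<kappa> \<nu> - a \<nu>) q" using rel[OF a(4,5)] by blast
  have "poly q t dvd poly Pl t" using q(1) by (auto elim!: dvdE)
  hence "\<not> int p dvd poly q t" using a(3) dvd_trans unfolding bad_def by blast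
  thus ?thesis
   using level_dataD(6)[OF lev, rule_format, OF finR(3) q(2) a(1)] a(2) unfolding ok_def J_def by blast
 qed
 define g where "g t = (\<Sum>j\<in>J t. \<Prod>\<nu>\<in>S'. X \<nu> j ^ \<kappa> \<nu>)" for t
 define M where "M = \<rho> ^ K * real m"
 have M: "M \<ge> 0" using \<rho> by (simp add: M_def)
 have est: "\<bar>g t - (if ok t then M * c else 0)\<bar> \<le> (if bad t then 2 * M * 2 ^ K else 0)" if t: "t \<in> Tset S p" for t
 proof (cases "ok t")
  case False
  then obtain \<nu> where \<nu>: "\<nu> \<in> R" "Lp D p \<nu> t \<noteq> 1" by (auto simp: ok_def)
  have "(\<Prod>\<nu>\<in>S'. X \<nu> j ^ \<kappa> \<nu>) = 0" if "j \<in> J t" for j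
  proof (rule prod_zero[OF S'(1)])
   have "X \<nu> j = 0" using level_dataD(4)[OF lev] that \<nu> finR unfolding J_def by auto
   thus "\<exists>\<nu>\<in>S'. X \<nu> j ^ \<kappa> \<nu> = 0" using \<nu>(1) R by auto
  qed
  hence "g t = 0" unfolding g_def by (rule sum.neutral[OF ballI])
  thus ?thesis using False M by simp
 next
  case True
  have X: "X \<nu> j = \<rho> * (2 * Re (w \<nu> j))" and w: "norm (w \<nu> j) = 1" if "\<nu> \<in> R" "j \<in> J t" for \<nu> j
   using level_dataD(4,5)[OF lev] True that finR(3) unfolding J_def ok_def by auto
  have "(\<Prod>\<nu>\<in>S'. X \<nu> j ^ \<kappa> \<nu>) = \<rho> ^ K * (\<Prod>\<nu>\<in>R. (2 * Re (w \<nu> j)) ^ \<kappa> \<nu>)" if "j \<in> J t" for j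
  proof -
   have "(\<Prod>\<nu>\<in>S'. X \<nu> j ^ \<kappa> \<nu>) = (\<Prod>\<nu>\<in>R. X \<nu> j ^ \<kappa> \<nu>)"
    using S'(1) R by (intro prod.mono_neutral_right) auto
   also have "\<dots> = (\<Prod>\<nu>\<in>R. \<rho> ^ \<kappa> \<nu> * (2 * Re (w \<nu> j)) ^ \<kappa> \<nu>)"
    by (rule prod.cong[OF refl]) (simp only: X[OF _ that] power_mult_distrib)
   finally show ?thesis by (simp only: prod.distrib prodR)
  qed
  hence g: "g t = \<rho> ^ K * (\<Sum>j\<in>J t. \<Prod>\<nu>\<in>R. (2 * Re (w \<nu> j)) ^ \<kappa> \<nu>)"
   unfolding g_def sum_distrib_left by (rule sum.cong[OF refl])
  show ?thesis
  proof (cases "bad t")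
   case False
   have "(\<Sum>j\<in>J t. \<Prod>\<nu>\<in>R. (2 * Re (w \<nu> j)) ^ \<kappa> \<nu>) = real (card (J t)) * (\<Prod>\<nu>\<in>R. central (\<kappa> \<nu>))"
    by (rule fibre_moment[OF finR(1) w weyl[OF t True False]])
   thus ?thesis using True False unfolding g cardJ[OF t] by (simp add: M_def c_def)
  next
   case True
   have "\<bar>\<Prod>\<nu>\<in>R. (2 * Re (w \<nu> j)) ^ \<kappa> \<nu>\<bar> \<le> 2 ^ K" if "j \<in> J t" for j
    unfolding abs_prod power_abs prodR(1)[symmetric]
   proof (rule prod_mono, intro conjI power_mono)
    fix \<nu> assume "\<nu> \<in> R"
    thus "\<bar>2 * Re (w \<nu> j)\<bar> \<le> 2" using w[of \<nu> j] that abs_Re_le_cmod[of "w \<nu> j"] by (simp add: abs_mult)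
   qed auto
   hence "\<bar>\<Sum>j\<in>J t. \<Prod>\<nu>\<in>R. (2 * Re (w \<nu> j)) ^ \<kappa> \<nu>\<bar> \<le> (\<Sum>j\<in>J t. 2 ^ K)"
    by (intro order_trans[OF sum_abs] sum_mono)
   hence "\<bar>\<Sum>j\<in>J t. \<Prod>\<nu>\<in>R. (2 * Re (w \<nu> j)) ^ \<kappa> \<nu>\<bar> \<le> real m * 2 ^ K" using cardJ[OF t] by simp
   hence "\<bar>g t\<bar> \<le> \<rho> ^ K * (real m * 2 ^ K)"
    unfolding g abs_mult using \<rho> by (simp add: mult_left_mono)
   moreover have "\<bar>M * c\<bar> \<le> M * 2 ^ K" using M c by (simp add: abs_mult mult_left_mono)
   ultimately show ?thesis using True \<open>ok t\<close> by (simp add: M_def)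
  qed
 qed
 have "(\<Sum>j\<in>G. \<Prod>\<nu>\<in>S'. X \<nu> j ^ \<kappa> \<nu>) = (\<Sum>t\<in>Tset S p. g t)"
  unfolding g_def J_def by (rule sum.group[symmetric]) (use finG \<tau> in auto)
 moreover have "M * c * card {t \<in> Tset S p. ok t} = (\<Sum>t\<in>Tset S p. if ok t then M * c else 0)"
  by (simp add: sum.If_cases Int_def)
 ultimately have "\<bar>(\<Sum>j\<in>G. \<Prod>\<nu>\<in>S'. X \<nu> j ^ \<kappa> \<nu>) - M * c * card {t \<in> Tset S p. ok t}\<bar>
  = \<bar>\<Sum>t\<in>Tset S p. g t - (if ok t then M * c else 0)\<bar>" by (simp only: sum_subtractf)
 also have "\<dots> \<le> (\<Sum>t\<in>Tset S p. if bad t then 2 * M * 2 ^ K else 0)"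
  by (intro order_trans[OF sum_abs] sum_mono est)
 also have "\<dots> \<le> (\<Sum>t\<in>{0..<int p}. if bad t then 2 * M * 2 ^ K else 0)"
  using M by (intro sum_mono2) (auto simp: Tset_def)
 also have "\<dots> = 2 * M * 2 ^ K * card {t \<in> {0..<int p}. bad t}"
  by (simp add: sum.If_cases Int_def)
 finally show ?thesis by (simp add: M_def c_def ok_def bad_def mult_ac)
qed

section \<open>Limits along the primes\<close>

abbreviation (input) primes :: "nat filter" where
 "primes \<equiv> inf at_top (principal {p. prime p})"

lemma eventually_primes: "eventually Q primes \<longleftrightarrow> (\<exists>p0. \<forall>p>p0. prime p \<longrightarrow> Q p)"
 unfolding eventually_inf_principal eventually_at_top_dense by simp

lemma inverse_primes_tendsto: "((\<lambda>p. c / real p) \<longlongrightarrow> 0) primes"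
 by (rule tendsto_mono[OF inf_le1]) (rule lim_const_over_n)

lemma card_Tset_complement:
 assumes "prime p" "odd p" "finite S"
 shows "card ({0..<int p} - Tset S p) \<le> card S + 1"
proof -
 have u: "x = y" if "x \<in> {0..<int p}" "y \<in> {0..<int p}" "int p dvd x - y" for x y
  using that by (simp flip: mod_eq_dvd_iff)
 have fin: "finite {t \<in> {0..<int p}. int p dvd \<nu> - 4 * t}" for \<nu>
  by (rule finite_subset[of _ "{0..<int p}"]) auto
 have one: "card {t \<in> {0..<int p}. int p dvd \<nu> - 4 * t} \<le> 1" for \<nu>
 proof -
  have "x = y" if "x \<in> {0..<int p}" "y \<in> {0..<int p}" "int p dvd \<nu> - 4 * x" "int p dvd \<nu> - 4 * y" for x y
  proof -
   have "int p dvd 4 * (x - y)" using dvd_diff[OF that(4,3)] by (simp add: algebra_simps)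
   moreover have "coprime (int p) 4"
   proof -
    have "coprime (int p) 2" using assms(2) by (simp add: coprime_right_2_iff_odd)
    hence "coprime (int p) (2 ^ 2)" by (simp only: coprime_power_right_iff simp_thms)
    thus ?thesis by simp
   qed
   ultimately have "int p dvd x - y" using coprime_dvd_mult_right_iff by blast
   thus ?thesis using u that by blast
  qed
  thus ?thesis using card_le_Suc0_iff_eq[OF fin] by auto
 qed
 have sub: "{0..<int p} - Tset S p \<subseteq> {0} \<union> (\<Union>\<nu>\<in>S. {t \<in> {0..<int p}. int p dvd \<nu> - 4 * t})"
 proof
  fix t assume t: "t \<in> {0..<int p} - Tset S p"
  have "t = 0" if "int p dvd t" using u[of t 0] t that by auto
  thus "t \<in> {0} \<union> (\<Union>\<nu>\<in>S. {t \<in> {0..<int p}. int p dvd \<nu> - 4 * t})" using t by (auto simp: Tset_def)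
 qed
 have "card ({0..<int p} - Tset S p) \<le> card ({0} \<union> (\<Union>\<nu>\<in>S. {t \<in> {0..<int p}. int p dvd \<nu> - 4 * t}))"
  using assms(3) fin by (intro card_mono sub finite_UnI finite_UN_I) auto
 also have "\<dots> \<le> card {0 :: int} + card (\<Union>\<nu>\<in>S. {t \<in> {0..<int p}. int p dvd \<nu> - 4 * t})" by (rule card_Un_le)
 also have "card (\<Union>\<nu>\<in>S. {t \<in> {0..<int p}. int p dvd \<nu> - 4 * t}) \<le> (\<Sum>\<nu>\<in>S. card {t \<in> {0..<int p}. int p dvd \<nu> - 4 * t})"
  by (rule card_UN_le[OF assms(3)])
 also have "\<dots> \<le> (\<Sum>\<nu>\<in>S. 1)" by (rule sum_mono[OF one])
 finally show ?thesis by simp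
qed

lemma pattern_density:
 fixes S :: "int set" and D s :: int
 assumes S: "finite S" "0 \<notin> S" "D \<noteq> 0" "R \<subseteq> S" "s \<in> {1, - 1}"
 shows "((\<lambda>p. real (card {t \<in> Tset S p. \<forall>\<nu>\<in>R. Lp D p \<nu> t = s}) / real p) \<longlongrightarrow> 1 / 2 ^ card R) primes"
proof -
 define a where "a p = real (card {t \<in> {0..<int p}. \<forall>\<nu>\<in>R. Lp D p \<nu> t = s})" for p
 define b where "b p = real (card {t \<in> Tset S p. \<forall>\<nu>\<in>R. Lp D p \<nu> t = s})" for p
 have R: "finite R" "0 \<notin> R" using S finite_subset by auto
 have "((\<lambda>p. a p / real p) \<longlongrightarrow> 1 / 2 ^ card R) primes"
 proof (rule tendstoI)
  fix \<epsilon> :: real assume "\<epsilon> > 0"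
  hence "\<epsilon> / 2 > 0" by simp
  from Legendre_patterns[OF R S(3,5) this]
  have "\<exists>p0. \<forall>p>p0. prime p \<longrightarrow> \<bar>a p / real p - 1 / 2 ^ card R\<bar> \<le> \<epsilon> / 2"
   unfolding a_def Lp_def .
  then obtain p0 where p0: "\<forall>p>p0. prime p \<longrightarrow> \<bar>a p / real p - 1 / 2 ^ card R\<bar> \<le> \<epsilon> / 2" ..
  show "eventually (\<lambda>p. dist (a p / real p) (1 / 2 ^ card R) < \<epsilon>) primes"
   unfolding eventually_primes dist_real_def
  proof (intro exI[of _ p0] allI impI)
   fix p assume "p > p0" "prime p"
   hence "\<bar>a p / real p - 1 / 2 ^ card R\<bar> \<le> \<epsilon> / 2" using p0 by blast
   thus "\<bar>a p / real p - 1 / 2 ^ card R\<bar> < \<epsilon>" using \<open>\<epsilon> > 0\<close> by linarith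
  qed
 qed
 moreover have "((\<lambda>p. b p / real p - a p / real p) \<longlongrightarrow> 0) primes"
 proof (rule Lim_null_comparison[OF _ inverse_primes_tendsto[of "real (card S + 1)"]])
  show "eventually (\<lambda>p. norm (b p / real p - a p / real p) \<le> real (card S + 1) / real p) primes"
   unfolding eventually_primes
  proof (intro exI[of _ 2] allI impI)
   fix p :: nat assume p: "p > 2" "prime p"
   hence odd: "odd p" using prime_odd_nat by blast
   have sub: "{t \<in> Tset S p. \<forall>\<nu>\<in>R. Lp D p \<nu> t = s} \<subseteq> {t \<in> {0..<int p}. \<forall>\<nu>\<in>R. Lp D p \<nu> t = s}"
    by (auto simp: Tset_def)
   have fin: "finite {t \<in> {0..<int p}. \<forall>\<nu>\<in>R. Lp D p \<nu> t = s}"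
    by (rule finite_subset[of _ "{0..<int p}"]) auto
   have "{t \<in> {0..<int p}. \<forall>\<nu>\<in>R. Lp D p \<nu> t = s} \<subseteq> {t \<in> Tset S p. \<forall>\<nu>\<in>R. Lp D p \<nu> t = s} \<union> ({0..<int p} - Tset S p)"
    by auto
   hence "card {t \<in> {0..<int p}. \<forall>\<nu>\<in>R. Lp D p \<nu> t = s}
    \<le> card ({t \<in> Tset S p. \<forall>\<nu>\<in>R. Lp D p \<nu> t = s} \<union> ({0..<int p} - Tset S p))"
    by (intro card_mono) auto
   also have "\<dots> \<le> card {t \<in> Tset S p. \<forall>\<nu>\<in>R. Lp D p \<nu> t = s} + card ({0..<int p} - Tset S p)" by (rule card_Un_le)
   finally have "a p \<le> b p + real (card S + 1)"
    using card_Tset_complement[OF p(2) odd S(1)] unfolding a_def b_def by linarith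
   moreover have "b p \<le> a p" unfolding a_def b_def by (intro of_nat_mono card_mono fin sub)
   ultimately have "\<bar>b p - a p\<bar> \<le> real (card S + 1)" by linarith
   hence "\<bar>b p - a p\<bar> / real p \<le> real (card S + 1) / real p" by (rule divide_right_mono) simp
   thus "norm (b p / real p - a p / real p) \<le> real (card S + 1) / real p"
    by (simp only: real_norm_def abs_divide diff_divide_distrib[symmetric] abs_of_nat)
  qed
 qed
 ultimately have "((\<lambda>p. a p / real p + (b p / real p - a p / real p)) \<longlongrightarrow> 1 / 2 ^ card R + 0) primes"
  by (rule tendsto_add)
 thus ?thesis by (simp add: b_def)
qed

text \<open>For \<open>p\<close> above the leading coefficient the polynomial stays nonzero modulo
  \<open>p\<close>, so its degree bounds the number of roots uniformly in \<open>p\<close>.\<close>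

lemma roots_mod_primes:
 fixes Pl :: "int poly"
 assumes "Pl \<noteq> 0"
 shows "eventually (\<lambda>p. card {t \<in> {0..<int p}. int p dvd poly Pl t} \<le> degree Pl) primes"
 unfolding eventually_primes
proof (intro exI[of _ "nat \<bar>lead_coeff Pl\<bar>"] allI impI)
 fix p assume p: "p > nat \<bar>lead_coeff Pl\<bar>" "prime p"
 have u: "x = y" if "x \<in> {0..<int p}" "y \<in> {0..<int p}" "int p dvd x - y" for x y
  using that by (simp flip: mod_eq_dvd_iff)
 have "\<not> int p dvd lead_coeff Pl"
 proof
  assume "int p dvd lead_coeff Pl"
  hence "int p \<le> \<bar>lead_coeff Pl\<bar>" using assms by (intro zdvd_imp_le) auto
  thus False using p(1) by linarith
 qed
 hence n: "\<not> [:int p:] dvd Pl" by (auto simp: const_poly_dvd_iff)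
 have fin: "finite {t \<in> {0..<int p}. int p dvd poly Pl t}"
  by (rule finite_subset[of _ "{0..<int p}"]) auto
 have "1 * card {t \<in> {0..<int p}. int p dvd poly Pl t} \<le> degree Pl"
  by (rule card_roots_mod_prime[OF p(2) _ fin _ _ n]) (use p(2) u prime_ge_1_nat in auto)
 thus "card {t \<in> {0..<int p}. int p dvd poly Pl t} \<le> degree Pl" by simp
qed

context
 fixes D :: int and S :: "int set" and N m :: "nat \<Rightarrow> nat" and X :: "nat \<Rightarrow> int \<Rightarrow> nat \<Rightarrow> real"
  and G :: "nat \<Rightarrow> nat set" and \<tau> :: "nat \<Rightarrow> nat \<Rightarrow> int" and w :: "nat \<Rightarrow> int \<Rightarrow> nat \<Rightarrow> complex" and \<rho> :: "nat \<Rightarrow> real"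
 assumes S: "finite S" "0 \<notin> S" "D \<noteq> 0"
  and lev: "eventually (\<lambda>p. N p > 0 \<and> level_data D S p (N p) (X p) (G p) (\<tau> p) (w p) (m p) (\<rho> p)) primes"
begin

lemma \<rho>_bounds:
 assumes "N p > 0" "level_data D S p (N p) (X p) (G p) (\<tau> p) (w p) (m p) (\<rho> p)"
 shows "\<rho> p > 0" "m p > 0" "p > 0"
proof -
 have eq: "real (m p) * real p * \<rho> p = real (N p)" and ge: "1 - 1 / real p \<le> \<rho> p"
  using level_dataD(7,8)[OF assms(2)] by simp_all
 show "m p > 0" "p > 0" using eq assms(1) by (auto intro!: Nat.gr0I)
 have "1 - 1 / real p \<ge> 0" using \<open>p > 0\<close> by (simp add: field_simps)
 moreover have "\<rho> p \<noteq> 0" using eq assms(1) by auto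
 ultimately show "\<rho> p > 0" using ge by linarith
qed

lemma \<rho>_tendsto: "(\<rho> \<longlongrightarrow> 1) primes"
proof (rule tendsto_sandwich)
 show "eventually (\<lambda>p. 1 - 1 / real p \<le> \<rho> p) primes"
  using lev by eventually_elim (use level_dataD(8) in blast)
 have "eventually (\<lambda>p. p > 2) primes" unfolding eventually_primes by blast
 thus "eventually (\<lambda>p. \<rho> p \<le> (1 - 1 / real p) / (1 - 2 / real p)) primes"
  using lev
 proof eventually_elim
  case (elim p)
  hence "1 - 2 / real p > 0" by (simp add: field_simps)
  thus ?case using level_dataD(9)[OF conjunct2[OF elim(2)]] by (simp only: pos_le_divide_eq)
 qed
 have "((\<lambda>p. 1 - 1 / real p) \<longlongrightarrow> 1 - 0) primes"
  by (intro tendsto_diff tendsto_const inverse_primes_tendsto)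
 thus 1: "((\<lambda>p. 1 - 1 / real p) \<longlongrightarrow> 1) primes" by simp
 have "((\<lambda>p. 1 - 2 / real p) \<longlongrightarrow> 1 - 0) primes"
  by (intro tendsto_diff tendsto_const inverse_primes_tendsto)
 hence "((\<lambda>p. (1 - 1 / real p) / (1 - 2 / real p)) \<longlongrightarrow> 1 / (1 - 0)) primes"
  by (intro tendsto_divide 1) auto
 thus "((\<lambda>p. (1 - 1 / real p) / (1 - 2 / real p)) \<longlongrightarrow> 1) primes" by simp
qed

lemma level_moments_tendsto:
 assumes S': "S' \<subseteq> S"
 shows "((\<lambda>p. (\<Sum>j\<in>G p. \<Prod>\<nu>\<in>S'. X p \<nu> j ^ \<kappa> \<nu>) / real (N p)) \<longlongrightarrow> (\<Prod>\<nu>\<in>S'. (0 ^ \<kappa> \<nu> + central (\<kappa> \<nu>)) / 2)) primes"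
proof -
 define R where "R = {\<nu> \<in> S'. \<kappa> \<nu> \<noteq> 0}"
 define K where "K = sum \<kappa> S'"
 define c where "c = (\<Prod>\<nu>\<in>R. central (\<kappa> \<nu>))"
 have fin: "finite S'" "finite R" "0 \<notin> R" "R \<subseteq> S"
  using S S' finite_subset[of S' S] by (auto simp: R_def)
 obtain Pl where Pl: "Pl \<noteq> 0"
  "\<forall>a\<in>PiE R (\<lambda>\<nu>. {..\<kappa> \<nu>}). (\<exists>\<nu>\<in>R. a \<nu> \<noteq> \<kappa> \<nu> - a \<nu>) \<longrightarrow>
    (\<exists>q. q dvd Pl \<and> relation_poly R a (\<lambda>\<nu>. \<kappa> \<nu> - a \<nu>) q)"
  by (rule moment_relation[OF fin(2,3)])
 define T1 where "T1 p = real (card {t \<in> Tset S p. \<forall>\<nu>\<in>R. Lp D p \<nu> t = 1})" for p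
 define B where "B p = real (card {t \<in> {0..<int p}. int p dvd poly Pl t})" for p
 \<comment> \<open>Division by \<open>N = m * p * \<rho>\<close> lowers the power of
   \<open>\<rho>\<close> by one; it is kept as a quotient since \<open>K\<close> may be 0.\<close>
 define main where "main p = \<rho> p ^ K / \<rho> p * c * (T1 p / real p)" for p
 define tot where "tot p = (\<Sum>j\<in>G p. \<Prod>\<nu>\<in>S'. X p \<nu> j ^ \<kappa> \<nu>)" for p
 have pow: "((\<lambda>p. \<rho> p ^ K / \<rho> p) \<longlongrightarrow> 1 ^ K / 1) primes"
  by (intro tendsto_divide tendsto_power \<rho>_tendsto) simp
 have B0: "((\<lambda>p. B p / real p) \<longlongrightarrow> 0) primes"
 proof (rule Lim_null_comparison[OF _ inverse_primes_tendsto[of "real (degree Pl)"]])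
  show "eventually (\<lambda>p. norm (B p / real p) \<le> real (degree Pl) / real p) primes"
   using roots_mod_primes[OF Pl(1)]
   by eventually_elim (simp add: B_def divide_right_mono)
 qed
 have "((\<lambda>p. tot p / real (N p) - main p) \<longlongrightarrow> 0) primes"
 proof (rule Lim_null_comparison)
  show "eventually (\<lambda>p. norm (tot p / real (N p) - main p) \<le> 2 * 2 ^ K * (\<rho> p ^ K / \<rho> p) * (B p / real p)) primes"
   using lev
  proof eventually_elim
   case (elim p)
   note pos = \<rho>_bounds[OF conjunct1[OF elim] conjunct2[OF elim]]
   have N: "real (N p) = real (m p) * real p * \<rho> p" using level_dataD(7)[OF conjunct2[OF elim]] by simp
   have "\<bar>tot p - \<rho> p ^ K * real (m p) * c * T1 p\<bar> \<le> 2 * \<rho> p ^ K * real (m p) * 2 ^ K * B p"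
    unfolding tot_def c_def T1_def B_def
    by (rule level_moment[OF conjunct2[OF elim] fin(1) S' less_imp_le[OF pos(1)] R_def K_def Pl(2)[rule_format]])
   hence "\<bar>tot p - \<rho> p ^ K * real (m p) * c * T1 p\<bar> / real (N p) \<le> 2 * \<rho> p ^ K * real (m p) * 2 ^ K * B p / real (N p)"
    by (rule divide_right_mono) simp
   moreover have "tot p / real (N p) - main p = (tot p - \<rho> p ^ K * real (m p) * c * T1 p) / real (N p)"
    unfolding N main_def using pos by (simp add: field_simps)
   moreover have "2 * \<rho> p ^ K * real (m p) * 2 ^ K * B p / real (N p) = 2 * 2 ^ K * (\<rho> p ^ K / \<rho> p) * (B p / real p)"
    unfolding N using pos by (simp add: field_simps)
   ultimately show ?case by (simp only: real_norm_def abs_divide abs_of_nat)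
  qed
  have "((\<lambda>p. 2 * 2 ^ K * (\<rho> p ^ K / \<rho> p) * (B p / real p)) \<longlongrightarrow> 2 * 2 ^ K * (1 ^ K / 1) * 0) primes"
   by (intro tendsto_mult tendsto_const pow B0)
  thus "((\<lambda>p. 2 * 2 ^ K * (\<rho> p ^ K / \<rho> p) * (B p / real p)) \<longlongrightarrow> 0) primes" by simp
 qed
 moreover have "(main \<longlongrightarrow> 1 ^ K / 1 * c * (1 / 2 ^ card R)) primes"
  unfolding main_def[abs_def] T1_def
  by (intro tendsto_mult tendsto_const pow pattern_density S fin) simp
 ultimately have "((\<lambda>p. tot p / real (N p) - main p + main p) \<longlongrightarrow> 0 + 1 ^ K / 1 * c * (1 / 2 ^ card R)) primes"
  by (rule tendsto_add)
 \<comment> \<open>An exponent 0 contributes \<open>(1 + 1) / 2 = 1\<close>, every other one half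
   its central coefficient.\<close>
 moreover have "0 + 1 ^ K / 1 * c * (1 / 2 ^ card R) = (\<Prod>\<nu>\<in>S'. (0 ^ \<kappa> \<nu> + central (\<kappa> \<nu>)) / 2)"
 proof -
  have "(\<Prod>\<nu>\<in>S'. (0 ^ \<kappa> \<nu> + central (\<kappa> \<nu>)) / 2) = (\<Prod>\<nu>\<in>R. (0 ^ \<kappa> \<nu> + central (\<kappa> \<nu>)) / 2)"
   by (rule prod.mono_neutral_right) (auto simp: R_def fin)
  also have "\<dots> = (\<Prod>\<nu>\<in>R. central (\<kappa> \<nu>) / 2)" by (rule prod.cong) (auto simp: R_def)
  finally show ?thesis by (simp add: c_def prod_dividef)
 qed
 ultimately show ?thesis by (simp add: tot_def)
qed

text \<open>Symbol -1 for all levels makes all the matrix elements vanish; the density of such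
  functions is the probability that all angles equal \<open>\<pi>/2\<close>.\<close>

lemma level_zeros_tendsto:
 assumes S': "S' \<subseteq> S"
 shows "((\<lambda>p. real (card {j \<in> G p. \<forall>\<nu>\<in>S'. Lp D p \<nu> (\<tau> p j) = - 1}) / real (N p)) \<longlongrightarrow> 1 / 2 ^ card S') primes"
proof -
 define T1 where "T1 p = {t \<in> Tset S p. \<forall>\<nu>\<in>S'. Lp D p \<nu> t = - 1}" for p
 have "eventually (\<lambda>p. real (card {j \<in> G p. \<forall>\<nu>\<in>S'. Lp D p \<nu> (\<tau> p j) = - 1}) / real (N p) = 1 / \<rho> p * (real (card (T1 p)) / real p)) primes"
  using lev
 proof eventually_elim
  case (elim p)
  note lv = level_dataD[OF conjunct2[OF elim]] and pos = \<rho>_bounds[OF conjunct1[OF elim] conjunct2[OF elim]]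
  define G0 where "G0 = {j \<in> G p. \<forall>\<nu>\<in>S'. Lp D p \<nu> (\<tau> p j) = - 1}"
  have finG: "finite (G p)" using lv(1) finite_subset by blast
  have "card G0 = (\<Sum>j\<in>G0. 1)" by simp
  also have "\<dots> = (\<Sum>t\<in>T1 p. \<Sum>j | j \<in> G0 \<and> \<tau> p j = t. 1)"
  proof (rule sum.group[symmetric])
   show "finite G0" "finite (T1 p)" using finG by (simp_all add: G0_def T1_def)
   show "\<tau> p ` G0 \<subseteq> T1 p" using lv(2) by (auto simp: G0_def T1_def)
  qed
  also have "\<dots> = (\<Sum>t\<in>T1 p. m p)"
  proof (rule sum.cong[OF refl])
   fix t assume t: "t \<in> T1 p"
   have "{j. j \<in> G0 \<and> \<tau> p j = t} = {j \<in> G p. \<tau> p j = t}" using t by (auto simp: G0_def T1_def)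
   thus "(\<Sum>j | j \<in> G0 \<and> \<tau> p j = t. 1) = m p" using lv(3) t by (simp add: T1_def)
  qed
  finally have "real (card G0) = real (card (T1 p)) * real (m p)" by simp
  moreover have "real (N p) = real (m p) * real p * \<rho> p" using lv(7) by simp
  ultimately show ?case using pos by (simp add: G0_def[symmetric] field_simps)
 qed
 moreover have "((\<lambda>p. 1 / \<rho> p * (real (card (T1 p)) / real p)) \<longlongrightarrow> 1 / 1 * (1 / 2 ^ card S')) primes"
  unfolding T1_def by (intro tendsto_mult tendsto_divide tendsto_const \<rho>_tendsto pattern_density S S') auto
 ultimately show ?thesis by (simp add: tendsto_cong)
qed

end

lemma (in cat_map) level_data_exists:
 assumes onb: "orthonormal_basis_H N \<psi>" and hk: "\<And>j. j \<in> {1..N} \<Longrightarrow> hecke_fun (\<psi> j)"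
  and S: "finite S" "S \<noteq> {}" "\<And>\<nu>. \<nu> \<in> S \<Longrightarrow> Q_form A (r \<nu>) = \<nu> \<and> \<not> int p dvd \<nu>"
  and disc: "\<forall>z. z\<^sup>2 \<noteq> disc A"
 shows "\<exists>G \<tau> w m \<rho>. level_data (disc A) S p N
  (\<lambda>\<nu> j. sqrt N * Re (ip N (twisted_T N (r \<nu>) (\<psi> j)) (\<psi> j))) G \<tau> w m \<rho>"
proof -
 define g where "g = card norm_one"
 define q where "q = real (p ^ (l - 1))"
 define \<rho> where "\<rho> = real (p ^ l) / real g"
 have pl: "real (p ^ l) = real p * q" using l_pos by (simp add: q_def flip: power_Suc)
 have p3: "p \<ge> 3" using prime_p odd_p prime_ge_2_nat[of p] by (cases "p = 2") auto
 have q: "q > 0" using p3 by (simp add: q_def)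
 obtain \<nu>0 where "\<nu>0 \<in> S" using S(2) by blast
 hence good: "good (r \<nu>0)" using S(3) by (simp add: good_def)
 define b where "b = real (card {a \<in> grid (p ^ l). \<not> good a})"
 have le: "p ^ (l - 1) \<le> p ^ l" using p3 by (intro power_increasing) auto
 have "real (g * (p ^ l - p ^ (l - 1)) + card {a \<in> grid (p ^ l). \<not> good a}) = real ((p ^ l)\<^sup>2)"
  using card_norm_one[OF good] unfolding g_def by (rule arg_cong)
 \<comment> \<open>With \<open>c2\<close> and \<open>b \<ge> 0\<close> this point count encloses
   \<open>g\<close>, and hence \<open>\<rho>\<close>, between the bounds that
   \<open>level_data\<close> asks for.\<close>
 hence c1: "real g * (real p * q - q) + b = (real p * q)\<^sup>2"
  using le pl by (simp add: b_def q_def of_nat_diff)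
 have "b \<le> real (2 * p ^ (l - 1) * p ^ l)" unfolding b_def by (rule of_nat_mono) (rule card_bad[OF good])
 hence c2: "b \<le> 2 * q * (real p * q)" using pl by (simp add: q_def)
 have b0: "b \<ge> 0" by (simp add: b_def)
 have up: "real g * (real p - 1) \<le> real p * (real p * q)"
 proof -
  have "q * (real g * (real p - 1)) \<le> q * (real p * (real p * q))" using c1 b0 by (simp add: power2_eq_square algebra_simps)
  thus ?thesis using q by simp
 qed
 have low: "real p * q * (real p - 2) \<le> real g * (real p - 1)"
 proof -
  have "q * (real p * q * (real p - 2)) \<le> q * (real g * (real p - 1))" using c1 c2 by (simp add: power2_eq_square algebra_simps)
  thus ?thesis using q by simp
 qed
 have g: "real g > 0"
 proof -
  have "0 < real p * q * (real p - 2)" using p3 q by simp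
  hence "0 < real g * (real p - 1)" using low by linarith
  thus ?thesis by (simp add: zero_less_mult_iff)
 qed
 have \<rho>: "1 - 1 / real p \<le> \<rho>" "\<rho> * (1 - 2 / real p) \<le> 1 - 1 / real p"
 proof -
  have "(1 - 1 / real p) * real g \<le> real (p ^ l)" using up p3 unfolding pl by (simp add: field_simps)
  thus "1 - 1 / real p \<le> \<rho>" using g by (simp add: \<rho>_def pos_le_divide_eq)
  have "real (p ^ l) * (1 - 2 / real p) = real p * q * (real p - 2) / real p"
   using p3 unfolding pl by (simp add: field_simps)
  also have "\<dots> \<le> real g * (real p - 1) / real p" by (rule divide_right_mono[OF low]) simp
  also have "\<dots> = (1 - 1 / real p) * real g" using p3 by (simp add: field_simps)
  finally have "real (p ^ l) * (1 - 2 / real p) \<le> (1 - 1 / real p) * real g" .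
  thus "\<rho> * (1 - 2 / real p) \<le> 1 - 1 / real p" using g by (simp add: \<rho>_def pos_divide_le_eq)
 qed
 \<comment> \<open>The factor \<open>sqrt (p^e)\<close> cancels the one in the matrix element,
   leaving \<open>\<rho> * (2 * Re w)\<close>.\<close>
 have sqrtN: "sqrt (real N) = real (p ^ l) * sqrt (real (p ^ e))"
 proof -
  have "real N = real (p ^ l) * real (p ^ l) * real (p ^ e)"
   by (simp only: N_def mult_2 power_add of_nat_mult)
  thus ?thesis by (simp add: real_sqrt_mult)
 qed
 obtain G \<tau> w where G: "G \<subseteq> {1..N}" "\<And>j. j \<in> G \<Longrightarrow> \<tau> j \<in> Tset S p"
  "\<And>t. t \<in> Tset S p \<Longrightarrow> card {j \<in> G. \<tau> j = t} = p ^ (l + e - 1) * card norm_one"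
  and V0: "\<And>\<nu> j. \<nu> \<in> S \<Longrightarrow> j \<in> G \<Longrightarrow> Lp (disc A) p \<nu> (\<tau> j) \<noteq> 1 \<Longrightarrow> ip N (twisted_T N (r \<nu>) (\<psi> j)) (\<psi> j) = 0"
  and V1: "\<And>\<nu> j. \<nu> \<in> S \<Longrightarrow> j \<in> G \<Longrightarrow> Lp (disc A) p \<nu> (\<tau> j) = 1 \<Longrightarrow> norm (w \<nu> j) = 1 \<and>
    ip N (twisted_T N (r \<nu>) (\<psi> j)) (\<psi> j) = of_real (2 / (card norm_one * sqrt (real (p ^ e))) * Re (w \<nu> j))"
  and W: "\<And>R a b Pl t. R \<subseteq> S \<Longrightarrow> relation_poly R a b Pl \<Longrightarrow> t \<in> Tset S p \<Longrightarrow> (\<And>\<nu>. \<nu> \<in> R \<Longrightarrow> Lp (disc A) p \<nu> t = 1) \<Longrightarrow>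
    \<not> int p dvd poly Pl t \<Longrightarrow> (\<Sum>j | j \<in> G \<and> \<tau> j = t. \<Prod>\<nu>\<in>R. w \<nu> j ^ a \<nu> * cnj (w \<nu> j) ^ b \<nu>) = 0"
  by (rule spectral_data[where S = S and n = r and T = "Tset S p" and L = "Lp (disc A) p", OF onb hk S disc Tset_def])
   (auto simp: Lp_def fun_eq_iff)
 have X: "sqrt N * Re (ip N (twisted_T N (r \<nu>) (\<psi> j)) (\<psi> j)) = (if Lp (disc A) p \<nu> (\<tau> j) = 1 then \<rho> * (2 * Re (w \<nu> j)) else 0)"
  if "\<nu> \<in> S" "j \<in> G" for \<nu> j
 proof (cases "Lp (disc A) p \<nu> (\<tau> j) = 1")
  case True
  have "sqrt (real (p ^ e)) > 0" using p3 by simp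
  moreover have "Re (ip N (twisted_T N (r \<nu>) (\<psi> j)) (\<psi> j)) = 2 / (real g * sqrt (real (p ^ e))) * Re (w \<nu> j)"
   using V1[OF that True] by (simp only: Re_complex_of_real g_def)
  ultimately show ?thesis using True g unfolding sqrtN \<rho>_def by (simp add: field_simps del: of_nat_power)
 qed (use V0[OF that] in simp)
 have "real (p ^ (l + e - 1) * g) * real p * \<rho> = real N"
 proof -
  have "real (p ^ (l + e - 1)) * real p = real (p ^ (l + e))" using l_pos by (simp flip: power_Suc2)
  hence "real (p ^ (l + e - 1) * g) * real p * \<rho> = real (p ^ (l + e)) * real (p ^ l)"
   using g by (simp add: \<rho>_def field_simps del: of_nat_power)
  also have "\<dots> = real N" by (simp only: N_def mult_2 power_add of_nat_mult) (simp only: mult_ac)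
  finally show ?thesis .
 qed
 hence "level_data (disc A) S p N (\<lambda>\<nu> j. sqrt N * Re (ip N (twisted_T N (r \<nu>) (\<psi> j)) (\<psi> j)))
   G \<tau> w (p ^ (l + e - 1) * g) \<rho>"
  unfolding level_data_def using G(1,2) G(3)[folded g_def] X V1 W \<rho> by (intro conjI allI ballI impI) simp_all
 thus ?thesis by blast
qed

theorem theorem3:
  fixes A :: "int ^ 2 ^ 2" and \<alpha> :: real
    and f :: "real ^ 2 \<Rightarrow> real" and k :: nat
    and U :: "nat \<Rightarrow> int ^ 2 ^ 2 \<Rightarrow> (int \<Rightarrow> complex) \<Rightarrow> (int \<Rightarrow> complex)"
    and \<psi> :: "nat \<Rightarrow> nat \<Rightarrow> int \<Rightarrow> complex"
    and M :: "'w measure" and \<theta> :: "int \<Rightarrow> 'w \<Rightarrow> real"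
  assumes "det A = 1" and "hyperbolic A" and "eigenvalue_of A \<alpha>"
    and "trig_polynomial f" and "k > 1"
    and "\<And>p. prime p \<Longrightarrow> odd p \<Longrightarrow> quantum_propagator (p ^ k) (U (p ^ k))"
    and "\<And>p. prime p \<Longrightarrow> odd p \<Longrightarrow> orthonormal_basis_H (p ^ k) (\<psi> p)"
    and "\<And>p j. prime p \<Longrightarrow> odd p \<Longrightarrow> j \<in> {1..p ^ k} \<Longrightarrow>
           hecke_eigenfunction A \<alpha> (p ^ k) (U (p ^ k)) (\<psi> p j)"
    and "prob_space M"
    and "prob_space.indep_vars M (\<lambda>_. borel) \<theta> {\<nu>. \<nu> \<noteq> 0}"
    and "\<And>\<nu>. \<nu> \<noteq> 0 \<Longrightarrow> distr M borel (\<theta> \<nu>) = angle_measure"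
  shows "has_limiting_distribution
           (inf at_top (principal {p. prime p})) (\<lambda>p. p ^ k) (\<lambda>p j. F_N (p ^ k) f (\<psi> p j))
           M (\<lambda>w. 2 * (\<Sum>\<nu> | \<nu> \<noteq> 0 \<and> twisted_coeff A f \<nu> \<noteq> 0.
                          Re (twisted_coeff A f \<nu>) * cos (\<theta> \<nu> w)))"
proof -
 interpret M: prob_space M by fact
 have disc: "z\<^sup>2 \<noteq> disc A" for z by (rule hyperbolic_disc[OF assms(1,2)])
 have D: "disc A \<noteq> 0" using disc[of 0] by simp
 \<comment> \<open>One further level is adjoined so that \<open>S\<close> is nonempty even for
   constant \<open>f\<close>: the count of points on the conics starts from a vector whose level is
   prime to \<open>p\<close>.\<close>
 define S where "S = Q_form A ` ({n. fourier_coeff f n \<noteq> 0} - {0}) \<union> {Q_form A (axis 1 1)}"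
 define r where "r \<nu> = (SOME n. Q_form A n = \<nu>)" for \<nu>
 define c where "c \<nu> = Re (twisted_coeff A f \<nu>)" for \<nu>
 \<comment> \<open>Only angles that enter with a nonzero coefficient are kept: the mass of the atom
   at 0 is governed by their number.\<close>
 define S' where "S' = {\<nu> \<in> S. c \<nu> \<noteq> 0}"
 have r: "Q_form A (r \<nu>) = \<nu>" if "\<nu> \<in> S" for \<nu>
  unfolding r_def by (rule someI_ex) (use that in \<open>auto simp: S_def\<close>)
 have finS: "finite S" "S \<noteq> {}" using trig_polynomial_fourier(1)[OF assms(4)] by (simp_all add: S_def)
 have S0: "0 \<notin> S"
 proof
  assume "0 \<in> S"
  moreover have "axis 1 1 \<noteq> (0 :: int ^ 2)" by (simp add: axis_def vec_eq_iff)
  ultimately obtain n where "0 = Q_form A n" "n \<noteq> 0" unfolding S_def by blast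
  thus False using Q_form_eq_0[OF disc, of n] by simp
 qed
 have S': "finite S'" "S' \<subseteq> S" using finS by (auto simp: S'_def)
 define X where "X p \<nu> j = sqrt (real (p ^ k)) * Re (ip (p ^ k) (twisted_T (p ^ k) (r \<nu>) (\<psi> p j)) (\<psi> p j))" for p \<nu> j
 have level: "eventually (\<lambda>p. (\<exists>G \<tau> w m \<rho>. level_data (disc A) S p (p ^ k) (X p) G \<tau> w m \<rho>) \<and>
   (\<forall>j\<in>{1..p ^ k}. F_N (p ^ k) f (\<psi> p j) = (\<Sum>\<nu>\<in>S. c \<nu> * X p \<nu> j))) primes"
  unfolding eventually_primes
 proof (intro exI allI impI)
  fix p assume p: "p > Max (insert 2 (insert (nat \<bar>disc A\<bar>) ((\<lambda>\<nu>. nat \<bar>\<nu>\<bar>) ` S)))" "prime p"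
  have gt: "p > 2" "p > nat \<bar>disc A\<bar>" "\<And>\<nu>. \<nu> \<in> S \<Longrightarrow> p > nat \<bar>\<nu>\<bar>"
   using p(1) finS(1) by auto
  have odd: "odd p" using gt(1) p(2) prime_odd_nat by blast
  have ndvd: "\<not> int p dvd x" if "x \<noteq> 0" "p > nat \<bar>x\<bar>" for x
  proof
   assume "int p dvd x"
   hence "int p \<le> \<bar>x\<bar>" using that(1) dvd_imp_le_int[of x "int p"] by simp
   thus False using that(2) by linarith
  qed
  \<comment> \<open>The assumption \<open>k > 1\<close> makes \<open>l\<close> positive.\<close>
  define l e where "l = k div 2" and "e = k mod 2"
  have k: "2 * l + e = k" by (simp add: l_def e_def)
  interpret C: cat_map A p l e "U (p ^ k)"
  proof
   show "prime p" "odd p" "det A = 1" by fact+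
   show "l > 0" using assms(5) by (simp add: l_def)
   show "e \<le> 1" by (simp add: e_def)
   show "\<not> int p dvd disc A" using ndvd[OF D gt(2)] .
   show "quantum_propagator (p ^ (2 * l + e)) (U (p ^ k))" unfolding k by (rule assms(6)[OF p(2) odd])
  qed
  have N: "C.N = p ^ k" by (simp only: C.N_def k)
  have onb: "orthonormal_basis_H C.N (\<psi> p)" unfolding N by (rule assms(7)[OF p(2) odd])
  have hk: "C.hecke_fun (\<psi> p j)" if "j \<in> {1..C.N}" for j
  proof (rule C.hecke_funI[OF assms(2,3)])
   show "hecke_eigenfunction A \<alpha> C.N (U (p ^ k)) (\<psi> p j)"
    using that unfolding N by (intro assms(8)[OF p(2) odd])
   show "ip C.N (\<psi> p j) (\<psi> p j) = 1" using onb that by (simp add: orthonormal_basis_H_def)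
  qed
  have Sp: "Q_form A (r \<nu>) = \<nu> \<and> \<not> int p dvd \<nu>" if "\<nu> \<in> S" for \<nu>
   using r[OF that] ndvd[OF _ gt(3)[OF that]] S0 that by auto
  show "(\<exists>G \<tau> w m \<rho>. level_data (disc A) S p (p ^ k) (X p) G \<tau> w m \<rho>) \<and>
   (\<forall>j\<in>{1..p ^ k}. F_N (p ^ k) f (\<psi> p j) = (\<Sum>\<nu>\<in>S. c \<nu> * X p \<nu> j))"
  proof (intro conjI ballI)
   show "\<exists>G \<tau> w m \<rho>. level_data (disc A) S p (p ^ k) (X p) G \<tau> w m \<rho>"
    using C.level_data_exists[OF onb hk finS Sp] disc unfolding N X_def[abs_def] by blast
   fix j assume j: "j \<in> {1..p ^ k}"
   have "F_N C.N f (\<psi> p j) = sqrt C.N * (\<Sum>\<nu>\<in>S. Re (twisted_coeff A f \<nu>) * Re (ip C.N (twisted_T C.N (r \<nu>) (\<psi> p j)) (\<psi> p j)))"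
    by (rule C.F_N_hecke[OF assms(4) hk disc finS(1) _ Sp]) (use j N in \<open>auto simp: S_def\<close>)
   thus "F_N (p ^ k) f (\<psi> p j) = (\<Sum>\<nu>\<in>S. c \<nu> * X p \<nu> j)"
    unfolding N by (simp add: X_def c_def sum_distrib_left mult_ac)
  qed
 qed
 define ex where "ex p \<longleftrightarrow> (\<exists>G \<tau> w m \<rho>. level_data (disc A) S p (p ^ k) (X p) G \<tau> w m \<rho>)" for p
 have "\<forall>p. \<exists>z. ex p \<longrightarrow> level_data (disc A) S p (p ^ k) (X p) (fst z) (fst (snd z)) (fst (snd (snd z)))
   (fst (snd (snd (snd z)))) (snd (snd (snd (snd z))))"
  unfolding ex_def by simp
 then obtain z where z: "\<forall>p. ex p \<longrightarrow> level_data (disc A) S p (p ^ k) (X p) (fst (z p)) (fst (snd (z p)))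
   (fst (snd (snd (z p)))) (fst (snd (snd (snd (z p))))) (snd (snd (snd (snd (z p)))))"
  by (rule choice[THEN exE])
 define G \<tau> w m \<rho> where "G p = fst (z p)" and "\<tau> p = fst (snd (z p))" and "w p = fst (snd (snd (z p)))"
  and "m p = fst (snd (snd (snd (z p))))" and "\<rho> p = snd (snd (snd (snd (z p))))" for p
 have choice: "ex p \<Longrightarrow> level_data (disc A) S p (p ^ k) (X p) (G p) (\<tau> p) (w p) (m p) (\<rho> p)" for p
  using z unfolding G_def \<tau>_def w_def m_def \<rho>_def by blast
 have pk: "eventually (\<lambda>p. p ^ k > 0) primes"
  unfolding eventually_primes by (intro exI[of _ 0]) simp
 have lev: "eventually (\<lambda>p. p ^ k > 0 \<and> level_data (disc A) S p (p ^ k) (X p) (G p) (\<tau> p) (w p) (m p) (\<rho> p)) primes"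
  using level pk by eventually_elim (use choice ex_def in blast)
 note lim = finS(1) S0 D lev
 \<comment> \<open>The limit of \<open>\<rho>\<close> is 1; the crude bound 2 yields the uniform
   bound 4 for the normalised matrix elements.\<close>
 have "eventually (\<lambda>p. \<rho> p < 2) primes" by (rule order_tendstoD(2)[OF \<rho>_tendsto[OF lim]]) simp
 hence Xb: "eventually (\<lambda>p. \<forall>\<nu>\<in>S'. \<forall>j\<in>G p. \<bar>X p \<nu> j\<bar> \<le> 4) primes"
  using lev
 proof eventually_elim
  case (elim p)
  note lv = level_dataD[OF conjunct2[OF elim(2)]]
  have pos: "\<rho> p > 0" by (rule \<rho>_bounds(1)[OF lim]) (use elim in auto)
  show ?case
  proof (intro ballI)
   fix \<nu> j assume \<nu>: "\<nu> \<in> S'" "j \<in> G p"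
   hence \<nu>S: "\<nu> \<in> S" using S' by blast
   show "\<bar>X p \<nu> j\<bar> \<le> 4"
   proof (cases "Lp (disc A) p \<nu> (\<tau> p j) = 1")
    case True
    hence "\<bar>Re (w p \<nu> j)\<bar> \<le> 1" using lv(5) \<nu>S \<nu>(2) abs_Re_le_cmod[of "w p \<nu> j"] by auto
    hence "\<rho> p * (2 * \<bar>Re (w p \<nu> j)\<bar>) \<le> 2 * 2" using elim(1) pos by (intro mult_mono) auto
    moreover have "X p \<nu> j = \<rho> p * (2 * Re (w p \<nu> j))" using lv(4) \<nu>S \<nu>(2) True by auto
    ultimately show ?thesis using pos by (simp add: abs_mult)
   qed (use lv(4) \<nu>S \<nu>(2) in auto)
  qed
 qed
 have ind: "M.indep_vars (\<lambda>_. borel) \<theta> S'"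
  using assms(10) by (rule M.indep_vars_subset) (use S' S0 in auto)
 have dist: "distr M borel (\<theta> \<nu>) = angle_measure" if "\<nu> \<in> S'" for \<nu>
  by (rule assms(11)) (use that S' S0 in auto)
 have \<theta>m: "(\<lambda>w. 2 * cos (\<theta> \<nu> w)) \<in> borel_measurable M" if "\<nu> \<in> S'" for \<nu>
 proof -
  have "(\<lambda>x :: real. 2 * cos x) \<in> borel_measurable borel" by measurable
  moreover have "\<theta> \<nu> \<in> borel_measurable M" using ind that by (auto simp: M.indep_vars_def)
  ultimately show ?thesis by (rule measurable_compose[rotated])
 qed
 have c0: "c \<nu> \<noteq> 0" if "\<nu> \<in> S'" for \<nu> using that by (simp add: S'_def)
 have Y: "2 * (\<Sum>\<nu> | \<nu> \<noteq> 0 \<and> twisted_coeff A f \<nu> \<noteq> 0. Re (twisted_coeff A f \<nu>) * cos (\<theta> \<nu> w))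
  = (\<Sum>\<nu>\<in>S'. c \<nu> * (2 * cos (\<theta> \<nu> w)))" for w
 proof -
  have sub: "{\<nu>. \<nu> \<noteq> 0 \<and> twisted_coeff A f \<nu> \<noteq> 0} \<subseteq> S"
  proof (rule subsetI)
   fix \<nu> assume "\<nu> \<in> {\<nu>. \<nu> \<noteq> 0 \<and> twisted_coeff A f \<nu> \<noteq> 0}"
   hence \<nu>: "\<nu> \<noteq> 0" "twisted_coeff A f \<nu> \<noteq> 0" by auto
   have "{n. fourier_coeff f n \<noteq> 0 \<and> Q_form A n = \<nu>} \<noteq> {}"
   proof
    assume "{n. fourier_coeff f n \<noteq> 0 \<and> Q_form A n = \<nu>} = {}"
    thus False using \<nu>(2) unfolding twisted_coeff_def by (simp only: sum.empty)
   qed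
   then obtain n where n: "fourier_coeff f n \<noteq> 0" "Q_form A n = \<nu>" by blast
   hence "n \<noteq> 0" using \<nu>(1) by (auto simp: Q_form_def symp_def)
   thus "\<nu> \<in> S" using n by (auto simp: S_def)
  qed
  have "(\<Sum>\<nu>\<in>S'. c \<nu> * (2 * cos (\<theta> \<nu> w))) = (\<Sum>\<nu> | \<nu> \<noteq> 0 \<and> twisted_coeff A f \<nu> \<noteq> 0. c \<nu> * (2 * cos (\<theta> \<nu> w)))"
   using sub finS(1) S0 by (intro sum.mono_neutral_left) (auto simp: S'_def c_def intro: finite_subset)
  thus ?thesis by (simp add: c_def sum_distrib_left mult_ac)
 qed
 have E: "M.expectation (\<lambda>w. \<Prod>\<nu>\<in>S'. (2 * cos (\<theta> \<nu> w)) ^ \<kappa> \<nu>) = (\<Prod>\<nu>\<in>S'. (0 ^ \<kappa> \<nu> + central (\<kappa> \<nu>)) / 2)" for \<kappa>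
  by (rule M.angles_moment[OF S'(1) ind dist refl c0])
 show ?thesis
 proof (rule moments_imp_limiting_distribution[where S = S' and Z = "\<lambda>\<nu> w. 2 * cos (\<theta> \<nu> w)" and C = 4
    and G = G and X = X and c = c and z = "1 / 2 ^ card S'"
    and ?G0.0 = "\<lambda>p. {j \<in> G p. \<forall>\<nu>\<in>S'. Lp (disc A) p \<nu> (\<tau> p j) = - 1}"])
  show "prob_space M" "finite S'" by fact+
  show "(\<lambda>w. 2 * cos (\<theta> \<nu> w)) \<in> borel_measurable M" if "\<nu> \<in> S'" for \<nu> by (rule \<theta>m[OF that])
  show "\<bar>2 * cos (\<theta> \<nu> w)\<bar> \<le> 4" for \<nu> w by (simp add: abs_mult order_trans[OF abs_cos_le_one])
  show "eventually (\<lambda>p. p ^ k > 0) primes" by (rule pk)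
  show "eventually (\<lambda>p. G p \<subseteq> {1..p ^ k}) primes"
   using lev by eventually_elim (use level_dataD(1) in blast)
  show "eventually (\<lambda>p. \<forall>\<nu>\<in>S'. \<forall>j\<in>G p. \<bar>X p \<nu> j\<bar> \<le> 4) primes" by (rule Xb)
  show "((\<lambda>p. (\<Sum>j\<in>G p. \<Prod>\<nu>\<in>S'. X p \<nu> j ^ \<kappa> \<nu>) / real (p ^ k)) \<longlongrightarrow> M.expectation (\<lambda>w. \<Prod>\<nu>\<in>S'. (2 * cos (\<theta> \<nu> w)) ^ \<kappa> \<nu>)) primes" for \<kappa>
   unfolding E by (rule level_moments_tendsto[OF lim S'(2)])
  show "eventually (\<lambda>p. \<forall>j\<in>G p. F_N (p ^ k) f (\<psi> p j) = (\<Sum>\<nu>\<in>S'. c \<nu> * X p \<nu> j)) primes"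
   using level lev
  proof eventually_elim
   case (elim p)
   have "(\<Sum>\<nu>\<in>S. c \<nu> * X p \<nu> j) = (\<Sum>\<nu>\<in>S'. c \<nu> * X p \<nu> j)" for j
    by (rule sum.mono_neutral_right) (use finS in \<open>auto simp: S'_def\<close>)
   thus ?case using elim level_dataD(1)[OF conjunct2[OF elim(2)]] by auto
  qed
  show "(\<lambda>w. 2 * (\<Sum>\<nu> | \<nu> \<noteq> 0 \<and> twisted_coeff A f \<nu> \<noteq> 0. Re (twisted_coeff A f \<nu>) * cos (\<theta> \<nu> w)))
   = (\<lambda>w. \<Sum>\<nu>\<in>S'. c \<nu> * (2 * cos (\<theta> \<nu> w)))" unfolding Y ..
  show "measure M {w \<in> space M. 2 * (\<Sum>\<nu> | \<nu> \<noteq> 0 \<and> twisted_coeff A f \<nu> \<noteq> 0. Re (twisted_coeff A f \<nu>) * cos (\<theta> \<nu> w)) = y} = 0"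
   if "y \<noteq> 0" for y
   unfolding Y by (rule M.angles_no_atom[OF S'(1) ind dist refl c0 that])
  show "measure M {w \<in> space M. 2 * (\<Sum>\<nu> | \<nu> \<noteq> 0 \<and> twisted_coeff A f \<nu> \<noteq> 0. Re (twisted_coeff A f \<nu>) * cos (\<theta> \<nu> w)) = 0} \<le> 1 / 2 ^ card S'"
   unfolding Y by (rule M.angles_zero[OF S'(1) ind dist refl c0])
  show "eventually (\<lambda>p. {j \<in> G p. \<forall>\<nu>\<in>S'. Lp (disc A) p \<nu> (\<tau> p j) = - 1} \<subseteq> {j \<in> G p. \<forall>\<nu>\<in>S'. X p \<nu> j = 0}) primes"
   using lev
  proof eventually_elim
   case (elim p)
   thus ?case using level_dataD(4)[OF conjunct2[OF elim]] S'(2) by auto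
  qed
  show "((\<lambda>p. real (card {j \<in> G p. \<forall>\<nu>\<in>S'. Lp (disc A) p \<nu> (\<tau> p j) = - 1}) / real (p ^ k)) \<longlongrightarrow> 1 / 2 ^ card S') primes"
   by (rule level_zeros_tendsto[OF lim S'(2)])
 qed
qed

end
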